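(* Let $p\in(0,1)$. (i) For $\ell\in\{2,3,\dots\}$ and $\alpha\in(2-\frac1{\ell-1},2-\frac1\ell]$, \[\sup_{x\in\mathbb{R}}(1+|x|)\Big|\mathsf{P}\Big\{\frac{S_n-\mu_1^{\alpha,p}n}{n^{1/\alpha}}\le x\Big\}-\tilde G_{n,\ell-1}^{\alpha,p}(x)\Big|=O\big(n^{-1/\alpha}\big).\] (ii) If either $\ell=2$ and $\alpha\in(1,\frac32)$, or $\ell\in\{3,4,\dots\}$ and $\alpha\in[2-\frac1{\ell-1},2-\frac1\ell)$, and moreover $r^{1/\alpha}\notin\mathbb{N}$, then \[\sup_{x\in\mathbb{R}}(1+|x|)\Big|\mathsf{P}\Big\{\frac{S_n-\mu_1^{\alpha,p}n}{n^{1/\alpha}}\le x\Big\}-\tilde{\tilde G}_{n,\ell-1}^{\alpha,p}(x)\Big|=o\big(n^{-1/\alpha}\big).\] All asymptotics are as $n\to\infty$.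
   Context: Let $p\in(0,1)$, $q=1-p$, $r=1/q$, $\alpha\in(1,2)$. Let $X$ satisfy $\mathsf{P}\{X=r^{k/\alpha}\}=q^{k-1}p$, $k\in\mathbb{N}$; $X_1,X_2,\dots$ i.i.d. copies, $S_n=X_1+\dots+X_n$. For $\beta>0$, $\beta\ne\alpha$, $\mu_\beta^{\alpha,p}=p/(q^{\beta/\alpha}-q)$ (the paper writes the centering as $c_n^{\alpha,p}=\mu_1^{\alpha,p}n$). Let $\gamma_n=n/r^{\lceil\log_r n\rceil}\in(q,1]$. For $\gamma\in(q,1]$, $y_\gamma^{\alpha,p}(t)=\sum_{k\in\mathbb{Z}}(\exp\{\mathrm{i}tr^{k/\alpha}/\gamma^{1/\alpha}\}-1-\mathrm{i}tr^{k/\alpha}/\gamma^{1/\alpha})\frac{p\gamma}{qr^k}$. $G_{\alpha,p,\gamma}$ is the distribution function with characteristic function $e^{y_\gamma^{\alpha,p}}$; for integers $k,j\ge0$, $G^{(k,j)}_{\alpha,p,\gamma}$ is the function of bounded variation with limit $0$ at $-\infty$ and Fourier–Stieltjes transform $(-\mathrm{i}t)^k[y_\gamma^{\alpha,p}(t)]^je^{y_\gamma^{\alpha,p}(t)}$. Define \[\tilde G_{n,\ell-1}^{\alpha,p}=G_{\alpha,p,\gamma_n}+\sum_{j=1}^{\ell-1}\frac{(-1)^j([\mu_1^{\alpha,p}]^2-\mu_2^{\alpha,p})^jG^{(2j,0)}_{\alpha,p,\gamma_n}}{j!\,2^j\,n^{j(2-\alpha)/\alpha}},\qquad \tilde{\tilde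 G}_{n,\ell-1}^{\alpha,p}=\tilde G_{n,\ell-1}^{\alpha,p}+\frac{\mu_1^{\alpha,p}G^{(1,1)}_{\alpha,p,\gamma_n}}{n^{1/\alpha}}.\] *)

theory Defs
  imports "HOL-Probability.Probability"
begin

definition qq :: "real \<Rightarrow> real" where "qq p = 1 - p"
definition rr :: "real \<Rightarrow> real" where "rr p = 1 / (1 - p)"

definition mu :: "real \<Rightarrow> real \<Rightarrow> real \<Rightarrow> real" where
  "mu \<alpha> p \<beta> = p / (qq p powr (\<beta> / \<alpha>) - qq p)"

definition gam :: "real \<Rightarrow> nat \<Rightarrow> real" where
  "gam p n = real n / rr p powr (real_of_int \<lceil>log (rr p) (real n)\<rceil>)"

definition yfun :: "real \<Rightarrow> real \<Rightarrow> real \<Rightarrow> real \<Rightarrow> complex" where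
  "yfun \<alpha> p \<gamma> t = infsum (\<lambda>k::int.
      (exp (\<i> * complex_of_real (t * rr p powr (real_of_int k / \<alpha>) / \<gamma> powr (1 / \<alpha>))) - 1
        - \<i> * complex_of_real (t * rr p powr (real_of_int k / \<alpha>) / \<gamma> powr (1 / \<alpha>)))
      * complex_of_real (p * \<gamma> / (qq p * rr p powr (real_of_int k)))) UNIV"

definition Gdf :: "real \<Rightarrow> real \<Rightarrow> real \<Rightarrow> real \<Rightarrow> real" where
  "Gdf \<alpha> p \<gamma> = (THE F. \<exists>M. real_distribution M \<and>
      (\<forall>t. char M t = exp (yfun \<alpha> p \<gamma> t)) \<and> F = cdf M)"

text \<open>G^{(k,j)}_{alpha,p,gamma}: the (normalized, right-continuous) function of bounded variation
  with limit 0 at -infinity, written as a difference of the distribution functions of two finite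
  Borel measures, whose Fourier--Stieltjes transform (integral of exp(itx) dF(x)) equals
  (-it)^k y(t)^j exp(y(t)).\<close>
definition Gkj :: "nat \<Rightarrow> nat \<Rightarrow> real \<Rightarrow> real \<Rightarrow> real \<Rightarrow> real \<Rightarrow> real" where
  "Gkj k j \<alpha> p \<gamma> = (THE F. \<exists>M1 M2. finite_measure M1 \<and> finite_measure M2 \<and>
      sets M1 = sets borel \<and> sets M2 = sets borel \<and>
      (\<forall>t. char M1 t - char M2 t =
            (- \<i> * complex_of_real t) ^ k * (yfun \<alpha> p \<gamma> t) ^ j * exp (yfun \<alpha> p \<gamma> t)) \<and>
      F = (\<lambda>x. measure M1 {..x} - measure M2 {..x}))"

definition Gtilde :: "real \<Rightarrow> real \<Rightarrow> nat \<Rightarrow> nat \<Rightarrow> real \<Rightarrow> real" where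
  "Gtilde \<alpha> p l n x = Gdf \<alpha> p (gam p n) x +
     (\<Sum>j\<in>{1..l-1}. (-1) ^ j * ((mu \<alpha> p 1)\<^sup>2 - mu \<alpha> p 2) ^ j * Gkj (2*j) 0 \<alpha> p (gam p n) x
        / (fact j * 2 ^ j * real n powr (real j * (2 - \<alpha>) / \<alpha>)))"

definition Gtt :: "real \<Rightarrow> real \<Rightarrow> nat \<Rightarrow> nat \<Rightarrow> real \<Rightarrow> real" where
  "Gtt \<alpha> p l n x = Gtilde \<alpha> p l n x + mu \<alpha> p 1 * Gkj 1 1 \<alpha> p (gam p n) x / real n powr (1 / \<alpha>)"

end

theory Submission imports Defs begin

text \<open>
  The difference between the distribution function of the normalized sum and its approximation is recovered from
  transforms. With a density \<open>g\<close> of the approximation such that \<open>(1 + \<bar>x\<bar>) \<bar>g x\<bar>\<close> is bounded, an Esseen-type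
  inequality with the Fejer kernel bounds both the difference and \<open>x\<close> times the difference by the integral over
  \<open>[-T, T]\<close> of the transform and of its derivative, up to \<open>O(1/T)\<close>.

  The exponent \<open>y\<^sub>\<gamma>\<close> is a bilateral series whose terms with \<open>k \<ge> 1\<close> reproduce the centered characteristic function of
  \<open>X\<close>. The terms with \<open>k \<le> 0\<close> contribute \<open>\<mu>\<^sub>2 s\<^sup>2 / 2 + O(s\<^sup>3)\<close>, so that, with \<open>Y\<close> the exponent for \<open>\<gamma> = 1\<close>,
  \<open>log E exp(i s (X - \<mu>\<^sub>1)) = Y(s) + (\<mu>\<^sub>1\<^sup>2 - \<mu>\<^sub>2) s\<^sup>2 / 2 - i s \<mu>\<^sub>1 Y(s) + O(\<bar>s\<bar>\<^bsup>min(3, 2\<alpha>)\<^esup>)\<close>. At \<open>s = t n\<^bsup>-1/\<alpha>\<^esup>\<close>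
  the \<open>n\<close>-th power gives the two kinds of correction terms, the first of order \<open>n\<^bsup>1 - 2/\<alpha>\<^esup>\<close> and the second of order
  \<open>n\<^bsup>-1/\<alpha>\<^esup>\<close>. For part (i), \<open>T\<close> is a small multiple of \<open>n\<^bsup>1/\<alpha>\<^esup>\<close>. For part (ii) it is an arbitrarily large
  multiple; there the characteristic function is bounded away from 1 in modulus because \<open>r\<^bsup>1/\<alpha>\<^esup>\<close> is not an integer.
\<close>

section \<open>Fourier inversion\<close>

text \<open>The obstacle is regularity. \<open>X\<close> has a mean but no variance, so
  \<open>f\<close> and \<open>Y\<close> are differentiable once and not twice at 0, and the decay of
  the inverse transforms of \<open>(- \<i> * t) ^ k * Y ^ j * exp Y\<close> cannot be read off from
  derivatives of \<open>Y\<close>. Therefore \<open>exp Y\<close> is factored: the exponential of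
  the smooth part \<open>Ym\<close> has an inverse transform decaying faster than any power, and the
  remaining factor is the characteristic function of a compound Poisson law, which acts by
  convolution and preserves first moments. This gives existence for the functions defined by a
  description operator; uniqueness is Levy's theorem after negative parts have been moved to the
  other side. The parameter \<open>gam p n\<close> disappears by semistability: the exponent does
  not change when \<gamma> is multiplied by a power of \<open>r\<close>, hence it equals
  \<open>n * Y (t * n powr (-1/\<alpha>))\<close>. The ranges of \<alpha> come from two errors. The
  power \<open>l\<close> of \<open>n powr (1 - 2/\<alpha>)\<close> is of order
  \<open>n powr (-1/\<alpha>)\<close> or less exactly if \<open>l * (2 - \<alpha>) >= 1\<close>, and
  \<open>n powr (1 - min 3 (2 * \<alpha>) / \<alpha>)\<close> is always smaller because
  \<open>min 3 (2 * \<alpha>) > \<alpha> + 1\<close>.\<close>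

lemma integrable_inverse_square_lborel: "integrable lborel (\<lambda>x::real. 1 / (1 + x^2))"
  using integrable_inverse_1_plus_square by (simp add: set_integrable_def divide_inverse)

lemma integrable_decay:
  fixes \<phi> :: "real \<Rightarrow> 'a::{banach, second_countable_topology}"
  assumes "\<phi> \<in> borel_measurable borel" "\<And>t. norm (\<phi> t) \<le> C / (1 + t^2)"
  shows "integrable lborel \<phi>"
proof (rule Bochner_Integration.integrable_bound)
  show "integrable lborel (\<lambda>x::real. C * (1 / (1 + x^2)))"
    by (intro integrable_mult_right integrable_inverse_square_lborel)
  show "\<phi> \<in> borel_measurable lborel" using assms(1) by simp
  show "AE x in lborel. norm (\<phi> x) \<le> norm (C * (1 / (1 + x\<^sup>2)))"
  proof (rule AE_I2)
    fix x :: real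
    have "norm (\<phi> x) \<le> C / (1 + x^2)" by (rule assms(2))
    also have "\<dots> \<le> \<bar>C / (1 + x^2)\<bar>" by (rule abs_ge_self)
    finally show "norm (\<phi> x) \<le> norm (C * (1 / (1 + x\<^sup>2)))" by simp
  qed
qed

lemma (in pair_sigma_finite) integrable_pair_bound:
  fixes F :: "'a \<times> 'b \<Rightarrow> 'c::{banach, second_countable_topology}"
  assumes [measurable]: "F \<in> borel_measurable (M1 \<Otimes>\<^sub>M M2)"
    and f: "integrable M1 f" and g: "integrable M2 g" and le: "\<And>x y. norm (F (x, y)) \<le> f x * g y"
  shows "integrable (M1 \<Otimes>\<^sub>M M2) F"
proof (rule Fubini_integrable)
  have fx: "integrable M2 (\<lambda>y. F (x, y))" if x: "x \<in> space M1" for x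
    by (rule Bochner_Integration.integrable_bound[OF integrable_mult_right[OF g, of "f x"]])
       (use x in \<open>auto intro!: order_trans[OF le]\<close>)
  show "AE x in M1. integrable M2 (\<lambda>y. F (x, y))" using fx by (rule AE_I2)
  show "integrable M1 (\<lambda>x. LINT y|M2. norm (F (x, y)))"
  proof (rule Bochner_Integration.integrable_bound[OF integrable_mult_left[OF f, of "integral\<^sup>L M2 g"]])
    show "AE x in M1. norm (LINT y|M2. norm (F (x, y))) \<le> norm (f x * integral\<^sup>L M2 g)"
    proof (rule AE_I2)
      fix x assume x: "x \<in> space M1"
      have "(LINT y|M2. norm (F (x, y))) \<le> (LINT y|M2. f x * g y)"
        by (intro integral_mono integrable_norm fx x integrable_mult_right g le)
      moreover have "0 \<le> (LINT y|M2. norm (F (x, y)))" by (intro Bochner_Integration.integral_nonneg) auto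
      ultimately show "norm (LINT y|M2. norm (F (x, y))) \<le> norm (f x * integral\<^sup>L M2 g)" by simp
    qed
  qed simp
qed fact

section \<open>Oscillating exponentials, Gaussians and the inversion formula\<close>

lemma norm_iexp [simp]: "norm (iexp x) = 1"
  by simp

lemma iexp_measurable [measurable]: "f \<in> borel_measurable M \<Longrightarrow> (\<lambda>x. iexp (f x)) \<in> borel_measurable M"
  by (intro borel_measurable_continuous_on[where f = iexp] continuous_intros) auto

lemma integrable_iexp_times_iff:
  assumes "u \<in> borel_measurable M"
  assumes "integrable M g"
  shows "integrable M (\<lambda>t. iexp (u t) * g t)"
  by (rule Bochner_Integration.integrable_bound[OF assms(2)]) (use assms in \<open>auto simp: norm_mult\<close>)

text \<open>The characteristic function of the standard normal law at \<open>u / e\<close>, rescaled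
  by \<open>x = e * t\<close>. It is the regularizing factor in the inversion formula and in the
  positivity argument for densities.\<close>

lemma gauss_fourier:
  fixes e u :: real assumes e: "e > 0"
  shows "integrable lborel (\<lambda>t. exp (-(e * t)\<^sup>2 / 2))"
    and "(\<integral>t. iexp (t * u) * complex_of_real (exp (-(e * t)\<^sup>2 / 2)) \<partial>lborel)
        = complex_of_real (sqrt (2 * pi) / e * exp (-(u / e)\<^sup>2 / 2))"
proof -
  have sn: "std_normal_density t = 1 / sqrt (2*pi) * exp (- t\<^sup>2 / 2)" for t
    by (simp add: std_normal_density_def)
  have i1: "integrable lborel std_normal_density" by (simp add: integrable_normal_density)
  have i2: "integrable lborel (\<lambda>t. exp (-t\<^sup>2 / 2) :: real)"
    using integrable_mult_right[OF i1, of "sqrt (2*pi)"] by (simp add: sn)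
  show "integrable lborel (\<lambda>t. exp (-(e * t)\<^sup>2 / 2))"
    using lborel_integrable_real_affine[OF i2, of e 0] e by simp
  have "char std_normal_distribution (u / e) = complex_of_real (exp (- ((u / e)\<^sup>2) / 2))"
    by (simp add: char_std_normal_distribution)
  also have "char std_normal_distribution (u/e) = 
     (\<integral>x. std_normal_density x *\<^sub>R iexp (u / e * x) \<partial>lborel)"
    unfolding char_def by (subst integral_density) (auto simp: normal_density_nonneg)
  also have "\<dots> = (\<integral>x. (1 / sqrt (2*pi)) *\<^sub>R (iexp (u / e * x) * complex_of_real (exp (- x\<^sup>2 / 2))) \<partial>lborel)"
    by (intro Bochner_Integration.integral_cong) (auto simp only: sn scaleR_conv_of_real of_real_mult mult_ac)
  also have "\<dots> = (1 / sqrt (2*pi)) *\<^sub>R (\<integral>x. (iexp (u / e * x) * complex_of_real (exp (- x\<^sup>2 / 2))) \<partial>lborel)"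
    by (rule integral_scaleR_right)
  also have "(\<integral>x. (iexp (u / e * x) * complex_of_real (exp (- x\<^sup>2 / 2))) \<partial>lborel)
     = e *\<^sub>R (\<integral>x. (iexp (u / e * (e * x)) * complex_of_real (exp (- (e * x)\<^sup>2 / 2))) \<partial>lborel)"
    by (subst lborel_integral_real_affine[of e _ 0]) (use e in auto)
  also have "(\<lambda>x. u / e * (e * x)) = (\<lambda>x. x * u)" using e by auto
  finally show "(\<integral>t. iexp (t * u) * complex_of_real (exp (-(e * t)\<^sup>2 / 2)) \<partial>lborel)
        = complex_of_real (sqrt (2 * pi) / e * exp (-(u / e)\<^sup>2 / 2))"
    using e by (simp add: scaleR_conv_of_real field_simps)
qed

text \<open>Normalized as the inverse of the forward transform
  \<open>\<integral>x. iexp (t * x) * g x\<close>, so that it turns a characteristic function into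
  its density.\<close>

definition invF :: "(real \<Rightarrow> complex) \<Rightarrow> real \<Rightarrow> complex" where
  "invF \<phi> x = (1 / (2*pi)) *\<^sub>R (\<integral>t. iexp (- (t * x)) * \<phi> t \<partial>lborel)"

lemma norm_integral_le:
  fixes f :: "'b \<Rightarrow> 'a::{banach, second_countable_topology}"
  assumes "integrable M g" "\<And>x. norm (f x) \<le> g x"
  shows "norm (integral\<^sup>L M f) \<le> integral\<^sup>L M g"
proof (cases "integrable M f")
  case True
  have "norm (integral\<^sup>L M f) \<le> (\<integral>x. norm (f x) \<partial>M)" by (rule integral_norm_bound)
  also have "\<dots> \<le> integral\<^sup>L M g" by (intro integral_mono) (use True assms in auto)
  finally show ?thesis .
next
  \<comment> \<open>The Bochner integral of a non-integrable function is 0, and the majorant is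
    nonnegative.\<close>
  case False
  have "0 \<le> g x" for x using assms(2)[of x] norm_ge_zero[of "f x"] by linarith
  then have "0 \<le> integral\<^sup>L M g" by (intro Bochner_Integration.integral_nonneg) auto
  then show ?thesis using False by (simp add: not_integrable_integral_eq)
qed

lemma norm_invF_le:
  assumes "integrable lborel g" "\<And>t. norm (\<phi> t) \<le> g t"
  shows "norm (invF \<phi> x) \<le> (1 / (2*pi)) * integral\<^sup>L lborel g"
  unfolding invF_def norm_scaleR
  by (rule order_trans[OF mult_left_mono[OF norm_integral_le[OF assms(1)]]])
     (use assms(2) in \<open>auto simp: norm_mult\<close>)

lemma isCont_invF:
  assumes i: "integrable lborel \<phi>"
  shows "isCont (invF \<phi>) x"
  unfolding continuous_at_sequentially comp_def invF_def
proof safe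
  fix X :: "nat \<Rightarrow> real" assume X: "X \<longlonglongrightarrow> x"
  have m: "\<phi> \<in> borel_measurable borel" using i by auto
  show "(\<lambda>n. (1 / (2*pi)) *\<^sub>R (\<integral>t. iexp (- (t * X n)) * \<phi> t \<partial>lborel)) 
    \<longlonglongrightarrow> (1 / (2*pi)) *\<^sub>R (\<integral>t. iexp (- (t * x)) * \<phi> t \<partial>lborel)"
  proof (rule tendsto_scaleR[OF tendsto_const], rule integral_dominated_convergence[where w = "\<lambda>t. norm (\<phi> t)"])
    show "AE t in lborel. (\<lambda>i. iexp (- (t * X i)) * \<phi> t) \<longlonglongrightarrow> iexp (- (t * x)) * \<phi> t"
      by (intro AE_I2 tendsto_intros X)
  qed (use i m in \<open>auto simp: norm_mult\<close>)
qed

lemma invF_measurable [measurable]: "integrable lborel \<phi> \<Longrightarrow> invF \<phi> \<in> borel_measurable borel"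
  by (intro borel_measurable_continuous_onI continuous_at_imp_continuous_on ballI isCont_invF)

lemma invF_add:
  assumes "integrable lborel \<phi>" "integrable lborel \<psi>"
  shows "invF (\<lambda>t. \<phi> t + \<psi> t) x = invF \<phi> x + invF \<psi> x"
  unfolding invF_def 
proof -
  have 1: "integrable lborel (\<lambda>t. iexp (- (t * x)) * \<phi> t)" "integrable lborel (\<lambda>t. iexp (- (t * x)) * \<psi> t)"
    by (rule integrable_iexp_times_iff, simp, rule assms)+
  show "(1 / (2*pi)) *\<^sub>R (\<integral>t. iexp (- (t * x)) * (\<phi> t + \<psi> t) \<partial>lborel) =
    (1 / (2*pi)) *\<^sub>R (\<integral>t. iexp (- (t * x)) * \<phi> t \<partial>lborel) + (1 / (2*pi)) *\<^sub>R (\<integral>t. iexp (- (t * x)) * \<psi> t \<partial>lborel)"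
    by (simp only: ring_distribs scaleR_right_distrib Bochner_Integration.integral_add[OF 1])
qed

lemma invF_cmult: "invF (\<lambda>t. c * \<phi> t) x = c * invF \<phi> x"
proof -
  have "(\<lambda>t. iexp (- (t * x)) * (c * \<phi> t)) = (\<lambda>t. c * (iexp (- (t * x)) * \<phi> t))" by (simp add: ac_simps)
  then show ?thesis unfolding invF_def by simp
qed

text \<open>Gaussian regularization. With a factor \<open>exp (-(x / (n + 1))\<^sup>2 / 2)\<close>
  the double integral converges absolutely, and interchanging the integrals shows that it averages
  \<open>\<phi>\<close> around \<open>t\<close> against a normal law of standard deviation
  \<open>1 / (n + 1)\<close>. Both forms converge by dominated convergence: one because the inverse
  transform is integrable, the other because \<open>\<phi>\<close> is bounded and
  continuous.\<close>

lemma fourier_inversion: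
  assumes c: "continuous_on UNIV \<phi>" and i: "integrable lborel \<phi>" and B: "\<And>t. norm (\<phi> t) \<le> B"
    and ig: "integrable lborel (invF \<phi>)"
  shows "(\<integral>x. iexp (t * x) * invF \<phi> x \<partial>lborel) = \<phi> t"
proof -
  have m [measurable]: "\<phi> \<in> borel_measurable borel" using i by auto
  have mg [measurable]: "invF \<phi> \<in> borel_measurable borel" using ig by auto
  let ?e = "\<lambda>n::nat. 1 / real (Suc n)"
  let ?I = "\<lambda>n. (\<integral>x. iexp (t * x) * invF \<phi> x * complex_of_real (exp (-(?e n * x)\<^sup>2 / 2)) \<partial>lborel)"
  have L: "?I \<longlonglongrightarrow> (\<integral>x. iexp (t * x) * invF \<phi> x \<partial>lborel)"
  proof (rule integral_dominated_convergence[where w = "\<lambda>t. norm (invF \<phi> t)"])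
    show "AE x in lborel. (\<lambda>n. iexp (t * x) * invF \<phi> x * complex_of_real (exp (-(?e n * x)\<^sup>2 / 2))) \<longlonglongrightarrow> iexp (t * x) * invF \<phi> x"
    proof (rule AE_I2)
      fix x :: real
      have e: "?e \<longlonglongrightarrow> 0" by real_asymp
      have "(\<lambda>n. iexp (t * x) * invF \<phi> x * complex_of_real (exp (-(?e n * x)\<^sup>2 / 2))) \<longlonglongrightarrow>
         iexp (t * x) * invF \<phi> x * complex_of_real (exp (-(0 * x)\<^sup>2 / 2))"
        by (intro tendsto_intros e) auto
      then show "(\<lambda>n. iexp (t * x) * invF \<phi> x * complex_of_real (exp (-(?e n * x)\<^sup>2 / 2))) \<longlonglongrightarrow> iexp (t * x) * invF \<phi> x" by simp
    qed
    fix n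
    show "AE x in lborel. norm (iexp (t * x) * invF \<phi> x * complex_of_real (exp (-(?e n * x)\<^sup>2 / 2))) \<le> norm (invF \<phi> x)"
      by (intro AE_I2) (auto simp: norm_mult mult_left_le)
  qed (use ig in auto)
  have eq: "?I n = (\<integral>z. std_normal_density z *\<^sub>R \<phi> (t + ?e n * z) \<partial>lborel)" for n
  proof -
    let ?d = "?e n"
    have d: "?d > 0" by simp
    have "?I n = (\<integral>x. (\<integral>s. (1 / (2*pi)) *\<^sub>R (iexp (t * x) * (iexp (- (s * x)) * \<phi> s) * complex_of_real (exp (-(?d * x)\<^sup>2 / 2))) \<partial>lborel) \<partial>lborel)"
      unfolding invF_def by simp
    also have "\<dots> = (\<integral>s. (\<integral>x. (1 / (2*pi)) *\<^sub>R (iexp (t * x) * (iexp (- (s * x)) * \<phi> s) * complex_of_real (exp (-(?d * x)\<^sup>2 / 2))) \<partial>lborel) \<partial>lborel)"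
    proof (rule lborel_pair.Fubini_integral[symmetric])
      show "integrable (lborel \<Otimes>\<^sub>M lborel) (\<lambda>(s, x). (1 / (2*pi)) *\<^sub>R (iexp (t * s) * (iexp (- (x * s)) * \<phi> x) * complex_of_real (exp (-(?d * s)\<^sup>2 / 2))))"
        by (rule lborel_pair.integrable_pair_bound[OF _ integrable_mult_right[OF gauss_fourier(1)[OF d], of "1/(2*pi)"] integrable_norm[OF i]])
           (auto simp: norm_mult mult_ac)
    qed
    also have "\<dots> = (\<integral>s. (1 / (sqrt (2*pi) * ?d) * exp (-((t-s) / ?d)\<^sup>2 / 2)) *\<^sub>R \<phi> s \<partial>lborel)"
    proof (rule Bochner_Integration.integral_cong[OF refl])
      fix s :: real
      have "(\<integral>x. (1 / (2*pi)) *\<^sub>R (iexp (t * x) * (iexp (- (s * x)) * \<phi> s) * complex_of_real (exp (-(?d * x)\<^sup>2 / 2))) \<partial>lborel)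
        = (\<integral>x. ((1 / (2*pi)) *\<^sub>R \<phi> s) * (iexp (x * (t-s)) * complex_of_real (exp (-(?d * x)\<^sup>2 / 2))) \<partial>lborel)"
        by (intro Bochner_Integration.integral_cong[OF refl]) (auto simp: exp_add[symmetric] algebra_simps exp_diff exp_minus field_simps)
      also have "\<dots> = ((1 / (2*pi)) *\<^sub>R \<phi> s) * complex_of_real (sqrt (2 * pi) / ?d * exp (-((t-s) / ?d)\<^sup>2 / 2))"
        by (simp only: gauss_fourier(2)[OF d] integral_mult_right_zero)
      also have "\<dots> = (1 / (sqrt (2*pi) * ?d) * exp (-((t-s) / ?d)\<^sup>2 / 2)) *\<^sub>R \<phi> s"
      proof -
        have "2 * pi = sqrt (2*pi) * sqrt (2*pi)" by simp
        moreover have "1 / (m * m) * (m / ?d) = 1 / (m * ?d)" if "m > 0" for m :: real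
          using that by (simp add: field_simps)
        ultimately have "1 / (2*pi) * (sqrt (2*pi) / ?d) = 1 / (sqrt (2*pi) * ?d)"
          using real_sqrt_gt_zero[of "2*pi"] pi_gt_zero by (metis zero_less_mult_iff zero_less_numeral)
        then have "1 / (2*pi) * (sqrt (2*pi) / ?d * exp (-((t-s) / ?d)\<^sup>2 / 2)) = 1 / (sqrt (2*pi) * ?d) * exp (-((t-s) / ?d)\<^sup>2 / 2)"
          by (simp only: mult.assoc[symmetric])
        then show ?thesis by (simp only: scaleR_conv_of_real of_real_mult[symmetric] mult.assoc mult.commute mult.left_commute)
      qed
      finally show "(\<integral>x. (1 / (2*pi)) *\<^sub>R (iexp (t * x) * (iexp (- (s * x)) * \<phi> s) * complex_of_real (exp (-(?d * x)\<^sup>2 / 2))) \<partial>lborel) = (1 / (sqrt (2*pi) * ?d) * exp (-((t-s) / ?d)\<^sup>2 / 2)) *\<^sub>R \<phi> s" .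
    qed
    \<comment> \<open>Substitution \<open>s = t + ?d * z\<close>, which turns the kernel into the
      standard normal density.\<close>
    also have "\<dots> = ?d *\<^sub>R (\<integral>z. (1 / (sqrt (2*pi) * ?d) * exp (-((t-(t + ?d * z)) / ?d)\<^sup>2 / 2)) *\<^sub>R \<phi> (t + ?d * z) \<partial>lborel)"
      by (subst lborel_integral_real_affine[of ?d _ t]) (use d in auto)
    also have "\<dots> = (\<integral>z. ?d *\<^sub>R ((1 / (sqrt (2*pi) * ?d) * exp (-((t-(t + ?d * z)) / ?d)\<^sup>2 / 2)) *\<^sub>R \<phi> (t + ?d * z)) \<partial>lborel)"
      by (rule integral_scaleR_right[symmetric])
    also have "\<dots> = (\<integral>z. std_normal_density z *\<^sub>R \<phi> (t + ?d * z) \<partial>lborel)"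
    proof (rule Bochner_Integration.integral_cong[OF refl])
      fix z :: real
      have "(t - (t + ?d * z)) / ?d = - z" using d by (simp only: diff_add_eq_diff_diff_swap diff_self) (simp add: field_simps)
      then have "((t - (t + ?d * z)) / ?d)\<^sup>2 = z\<^sup>2" by (simp only: power2_minus)
      moreover have "?d * (1 / (sqrt (2*pi) * ?d) * x) = 1 / sqrt (2*pi) * x" for x using d by simp
      ultimately show "?d *\<^sub>R ((1 / (sqrt (2*pi) * ?d) * exp (-((t-(t + ?d * z)) / ?d)\<^sup>2 / 2)) *\<^sub>R \<phi> (t + ?d * z)) = std_normal_density z *\<^sub>R \<phi> (t + ?d * z)"
        by (simp only: scaleR_scaleR std_normal_density_def)
    qed
    finally show ?thesis .
  qed
  have "(\<lambda>n. (\<integral>z. std_normal_density z *\<^sub>R \<phi> (t + ?e n * z) \<partial>lborel)) \<longlonglongrightarrow> (\<integral>z. std_normal_density z *\<^sub>R \<phi> t \<partial>lborel)"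
  proof (rule integral_dominated_convergence[where w = "\<lambda>z. std_normal_density z * B"])
    show "AE z in lborel. (\<lambda>n. std_normal_density z *\<^sub>R \<phi> (t + ?e n * z)) \<longlonglongrightarrow> std_normal_density z *\<^sub>R \<phi> t"
    proof (rule AE_I2)
      fix z :: real
      have e: "(\<lambda>n. t + ?e n * z) \<longlonglongrightarrow> t" by real_asymp
      have "isCont \<phi> t" using c by (simp add: continuous_on_eq_continuous_at)
      from isCont_tendsto_compose[OF this e]
      show "(\<lambda>n. std_normal_density z *\<^sub>R \<phi> (t + ?e n * z)) \<longlonglongrightarrow> std_normal_density z *\<^sub>R \<phi> t"
        by (intro tendsto_intros)
    qed
    fix n
    show "AE z in lborel. norm (std_normal_density z *\<^sub>R \<phi> (t + ?e n * z)) \<le> std_normal_density z * B"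
      by (intro AE_I2) (auto simp: normal_density_nonneg intro!: mult_left_mono B)
  qed (auto simp: integrable_normal_density)
  also have "(\<integral>z. std_normal_density z *\<^sub>R \<phi> t \<partial>lborel) = \<phi> t"
    using integral_normal_density[of 1 0] by simp
  finally show ?thesis using L LIMSEQ_unique unfolding eq by blast
qed

section \<open>Integration by parts under the inverse transform\<close>

lemma lborel_integral_deriv_eq_0:
  fixes F f :: "real \<Rightarrow> complex"
  assumes F: "\<And>x. (F has_vector_derivative f x) (at x)" and c: "continuous_on UNIV f"
    and i: "integrable lborel f" and top: "(F \<longlongrightarrow> 0) at_top" and bot: "(F \<longlongrightarrow> 0) at_bot"
  shows "integral\<^sup>L lborel f = 0"
proof -
  have "(LBINT x=-\<infinity>..\<infinity>. f x) = 0 - 0"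
  proof (rule interval_integral_FTC_integrable[where F = F])
    show "((F \<circ> real_of_ereal) \<longlongrightarrow> 0) (at_right (- \<infinity>))" "((F \<circ> real_of_ereal) \<longlongrightarrow> 0) (at_left \<infinity>)"
      using top bot by (simp_all add: ereal_tendsto_simps)
    show "set_integrable lborel (einterval (- \<infinity>) \<infinity>) f" using i by (simp add: set_integrable_def)
  qed (use F c in \<open>auto simp: continuous_on_eq_continuous_at\<close>)
  then show ?thesis by (simp add: interval_lebesgue_integral_def set_lebesgue_integral_def)
qed

lemma tendsto_decay:
  fixes \<phi> :: "real \<Rightarrow> 'a::real_normed_vector"
  assumes "\<And>t. norm (\<phi> t) \<le> C / (1 + t^2)"
  shows "(\<phi> \<longlongrightarrow> 0) at_top" "(\<phi> \<longlongrightarrow> 0) at_bot"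
proof -
  have "((\<lambda>t. C / (1 + t^2)) \<longlongrightarrow> 0) at_top" "((\<lambda>t::real. C / (1 + t^2)) \<longlongrightarrow> 0) at_bot"
    by real_asymp+
  from this[THEN Lim_null_comparison[rotated], of \<phi>] show "(\<phi> \<longlongrightarrow> 0) at_top" "(\<phi> \<longlongrightarrow> 0) at_bot"
    using assms by (auto intro: always_eventually)
qed

lemma iexp_has_vector_derivative:
  "((\<lambda>t. iexp (- (t * x))) has_vector_derivative - (\<i> * x * iexp (- (t * x)))) (at t)"
proof -
  have "((\<lambda>z. exp (- (\<i> * (z * complex_of_real x)))) has_field_derivative - (\<i> * x * iexp (- (t * x)))) (at (of_real t))"
    by (auto intro!: derivative_eq_intros)
  from has_vector_derivative_real_field[OF this] show ?thesis by simp
qed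

text \<open>The derivative of \<open>iexp (- (t * x)) * \<phi> t\<close> integrates to 0 because the
  boundary values vanish. Each derivative of \<open>\<phi>\<close> with integrable decay thus buys
  one factor \<open>x\<close> of decay for the inverse transform.\<close>

lemma invF_deriv:
  fixes \<phi> \<phi>' :: "real \<Rightarrow> complex"
  assumes d: "\<And>t. (\<phi> has_vector_derivative \<phi>' t) (at t)" and c': "continuous_on UNIV \<phi>'"
    and b: "\<And>t. norm (\<phi> t) \<le> C / (1 + t^2)" and b': "\<And>t. norm (\<phi>' t) \<le> C' / (1 + t^2)"
  shows "invF \<phi>' x = \<i> * x * invF \<phi> x"
proof -
  have c: "continuous_on UNIV \<phi>"
    using has_vector_derivative_continuous[OF d] by (auto simp: continuous_on_eq_continuous_at)
  have [measurable]: "\<phi> \<in> borel_measurable borel" "\<phi>' \<in> borel_measurable borel"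
    using c c' by (auto intro: borel_measurable_continuous_onI)
  have i: "integrable lborel \<phi>" "integrable lborel \<phi>'"
    by (auto intro: integrable_decay b b')
  let ?e = "\<lambda>t::real. iexp (- (t * x))"
  have ie: "integrable lborel (\<lambda>t. ?e t * \<phi> t)" "integrable lborel (\<lambda>t. ?e t * \<phi>' t)"
    by (rule integrable_iexp_times_iff, simp, rule i)+
  have "(\<integral>t. ?e t * \<phi>' t - \<i> * x * (?e t * \<phi> t) \<partial>lborel) = 0"
  proof (rule lborel_integral_deriv_eq_0)
    fix t
    show "((\<lambda>t. ?e t * \<phi> t) has_vector_derivative ?e t * \<phi>' t - \<i> * x * (?e t * \<phi> t)) (at t)"
      using has_vector_derivative_mult[OF iexp_has_vector_derivative[of x t] d[of t]] by (simp add: algebra_simps)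
  next
    have "norm (?e t * \<phi> t) \<le> C / (1 + t^2)" for t using b by (simp add: norm_mult)
    from tendsto_decay[OF this] show "((\<lambda>t. ?e t * \<phi> t) \<longlongrightarrow> 0) at_top" "((\<lambda>t. ?e t * \<phi> t) \<longlongrightarrow> 0) at_bot" .
    show "continuous_on UNIV (\<lambda>t. ?e t * \<phi>' t - \<i> * x * (?e t * \<phi> t))"
      by (intro continuous_intros c c')
    show "complex_integrable lborel (\<lambda>t. ?e t * \<phi>' t - \<i> * x * (?e t * \<phi> t))"
      by (intro Bochner_Integration.integrable_diff integrable_mult_right ie)
  qed
  then have "(\<integral>t. ?e t * \<phi>' t \<partial>lborel) = \<i> * x * (\<integral>t. ?e t * \<phi> t \<partial>lborel)"
    by (subst (asm) Bochner_Integration.integral_diff) (use ie in \<open>auto simp del: of_real_minus\<close>)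
  then show ?thesis unfolding invF_def by (simp add: scaleR_conv_of_real)
qed

text \<open>The class of amplitudes: \<open>k\<close> derivatives exist and grow at most
  polynomially, and the last one is continuous. Recursion over the derivative makes closure under
  sums, products and dilations an induction on \<open>k\<close>, with the Leibniz rule as the
  induction step for products.\<close>

primrec poly_bounded :: "nat \<Rightarrow> (real \<Rightarrow> complex) \<Rightarrow> bool" where
  "poly_bounded 0 u \<longleftrightarrow> continuous_on UNIV u \<and> (\<exists>C n. \<forall>t. norm (u t) \<le> C * (1 + \<bar>t\<bar>) ^ n)"
| "poly_bounded (Suc k) u \<longleftrightarrow> (\<exists>C n. \<forall>t. norm (u t) \<le> C * (1 + \<bar>t\<bar>) ^ n) \<and>
     (\<exists>u'. (\<forall>t. (u has_vector_derivative u' t) (at t)) \<and> poly_bounded k u')"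

lemma poly_boundedD: "poly_bounded k u \<Longrightarrow> \<exists>C n. \<forall>t. norm (u t) \<le> C * (1 + \<bar>t\<bar>) ^ n"
  by (cases k) auto

lemma poly_bounded_Suc: "poly_bounded (Suc k) u \<Longrightarrow> poly_bounded k u"
proof (induction k arbitrary: u)
  case 0
  then show ?case using has_vector_derivative_continuous 
    by (fastforce simp: continuous_on_eq_continuous_at)
next
  case (Suc k)
  then show ?case by (metis poly_bounded.simps(2))
qed

lemma poly_bounded_cont: "poly_bounded k u \<Longrightarrow> continuous_on UNIV u"
  by (induction k) (auto dest: poly_bounded_Suc simp del: poly_bounded.simps(2))

lemma poly_growth_add:
  assumes "\<exists>C n. \<forall>t::real. norm (u t) \<le> C * (1 + \<bar>t\<bar>) ^ n" "\<exists>C n. \<forall>t. norm (v t) \<le> C * (1 + \<bar>t\<bar>) ^ n"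
  shows "\<exists>C n. \<forall>t. norm (u t + v t :: complex) \<le> C * (1 + \<bar>t\<bar>) ^ n"
proof -
  from assms obtain C n D m where u: "norm (u t) \<le> C * (1 + \<bar>t\<bar>) ^ n" and v: "norm (v t) \<le> D * (1 + \<bar>t\<bar>) ^ m" for t by blast
  have "norm (u 0) \<le> C" "norm (v 0) \<le> D" using u[of 0] v[of 0] by auto
  then have CD: "0 \<le> C" "0 \<le> D" using norm_ge_zero order_trans by blast+
  have "norm (u t + v t) \<le> (C + D) * (1 + \<bar>t\<bar>) ^ (n + m)" for t
  proof -
    have "norm (u t + v t) \<le> C * (1 + \<bar>t\<bar>) ^ n + D * (1 + \<bar>t\<bar>) ^ m"
      using norm_triangle_ineq[of "u t" "v t"] u[of t] v[of t] by linarith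
    also have "\<dots> \<le> C * (1 + \<bar>t\<bar>) ^ (n+m) + D * (1 + \<bar>t\<bar>) ^ (n+m)"
      by (intro add_mono mult_left_mono power_increasing CD) auto
    finally show ?thesis by (simp add: ring_distribs)
  qed
  then show ?thesis by blast
qed

lemma poly_growth_mult:
  assumes "\<exists>C n. \<forall>t::real. norm (u t) \<le> C * (1 + \<bar>t\<bar>) ^ n" "\<exists>C n. \<forall>t. norm (v t) \<le> C * (1 + \<bar>t\<bar>) ^ n"
  shows "\<exists>C n. \<forall>t. norm (u t * v t :: complex) \<le> C * (1 + \<bar>t\<bar>) ^ n"
proof -
  from assms obtain C n D m where u: "norm (u t) \<le> C * (1 + \<bar>t\<bar>) ^ n" and v: "norm (v t) \<le> D * (1 + \<bar>t\<bar>) ^ m" for t by blast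
  have "norm (u 0) \<le> C" using u[of 0] by auto
  then have C: "0 \<le> C" using norm_ge_zero order_trans by blast
  have "norm (u t * v t) \<le> (C * D) * (1 + \<bar>t\<bar>) ^ (n + m)" for t
  proof -
    have "norm (u t * v t) \<le> (C * (1 + \<bar>t\<bar>) ^ n) * (D * (1 + \<bar>t\<bar>) ^ m)"
      unfolding norm_mult by (intro mult_mono u v) (use C in auto)
    then show ?thesis by (simp add: power_add mult_ac)
  qed
  then show ?thesis by blast
qed

lemma poly_bounded_add: "poly_bounded k u \<Longrightarrow> poly_bounded k v \<Longrightarrow> poly_bounded k (\<lambda>t. u t + v t)"
proof (induction k arbitrary: u v)
  case 0
  then show ?case by (auto intro!: continuous_intros poly_growth_add)
next
  case (Suc k)
  from Suc.prems obtain u' v' where "\<And>t. (u has_vector_derivative u' t) (at t)" "poly_bounded k u'"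
     "\<And>t. (v has_vector_derivative v' t) (at t)" "poly_bounded k v'" by auto
  then show ?case using Suc.prems[THEN poly_boundedD] Suc.IH[of u' v']
    by (auto intro!: poly_growth_add has_vector_derivative_add exI[of _ "\<lambda>t. u' t + v' t"])
qed

lemma poly_bounded_mult: "poly_bounded k u \<Longrightarrow> poly_bounded k v \<Longrightarrow> poly_bounded k (\<lambda>t. u t * v t)"
proof (induction k arbitrary: u v)
  case 0
  then show ?case by (auto intro!: continuous_intros poly_growth_mult)
next
  case (Suc k)
  from Suc.prems obtain u' v' where *: "\<And>t. (u has_vector_derivative u' t) (at t)" "poly_bounded k u'"
     "\<And>t. (v has_vector_derivative v' t) (at t)" "poly_bounded k v'" by auto
  have "poly_bounded k (\<lambda>t. u t * v' t + u' t * v t)"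
    by (intro poly_bounded_add Suc.IH * Suc.prems[THEN poly_bounded_Suc])
  then show ?case using Suc.prems[THEN poly_boundedD] *
    by (auto intro!: poly_growth_mult has_vector_derivative_mult exI[of _ "\<lambda>t. u t * v' t + u' t * v t"])
qed

lemma poly_bounded_const: "poly_bounded k (\<lambda>t. c)"
proof (induction k arbitrary: c)
  case 0
  show ?case by (auto intro!: exI[of _ "norm c"] exI[of _ "0::nat"])
next
  case (Suc k)
  show ?case unfolding poly_bounded.simps
  proof (intro conjI exI allI)
    show "norm c \<le> norm c * (1 + \<bar>t\<bar>) ^ 0" for t by simp
    show "((\<lambda>t::real. c) has_vector_derivative 0) (at t)" for t by (rule has_vector_derivative_const)
    show "poly_bounded k (\<lambda>t. 0)" by (rule Suc)
  qed
qed

lemma poly_bounded_ident: "poly_bounded k complex_of_real"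
proof (cases k)
  case 0
  then show ?thesis by (auto intro!: exI[of _ 1] continuous_intros)
next
  case (Suc l)
  have "(complex_of_real has_vector_derivative 1) (at t)" for t
    by (auto intro!: derivative_eq_intros simp: has_vector_derivative_def scaleR_conv_of_real)
  then show ?thesis using poly_bounded_const[of l 1] Suc
    by (auto intro!: exI[of _ "1::real"] exI[of _ "1::nat"] exI[of _ "\<lambda>_. 1::complex"])
qed

lemma poly_bounded_power: "poly_bounded k u \<Longrightarrow> poly_bounded k (\<lambda>t. u t ^ n)"
  by (induction n) (auto intro: poly_bounded_const poly_bounded_mult)

lemma poly_growth_dilate:
  assumes "\<exists>C n. \<forall>t::real. norm (u t) \<le> C * (1 + \<bar>t\<bar>) ^ n"
  shows "\<exists>C n. \<forall>t. norm (u (c * t) :: complex) \<le> C * (1 + \<bar>t\<bar>) ^ n"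
proof -
  from assms obtain C n where u: "norm (u t) \<le> C * (1 + \<bar>t\<bar>) ^ n" for t by auto
  have "norm (u 0) \<le> C" using u[of 0] by auto
  then have C: "0 \<le> C" using norm_ge_zero order_trans by blast
  have "norm (u (c * t)) \<le> C * (1 + \<bar>c\<bar>) ^ n * (1 + \<bar>t\<bar>) ^ n" for t
  proof -
    have "norm (u (c * t)) \<le> C * (1 + \<bar>c * t\<bar>) ^ n" by (rule u)
    also have "\<dots> \<le> C * ((1 + \<bar>c\<bar>) * (1 + \<bar>t\<bar>)) ^ n"
      by (intro mult_left_mono power_mono C) (auto simp: algebra_simps abs_mult)
    finally show ?thesis by (simp add: power_mult_distrib mult_ac)
  qed
  then show ?thesis by blast
qed

lemma poly_bounded_dilate: "poly_bounded k u \<Longrightarrow> poly_bounded k (\<lambda>t. u (c * t))"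
proof (induction k arbitrary: u)
  case 0
  then have "continuous_on UNIV u" by simp
  then have "continuous_on UNIV (\<lambda>t. u (c * t))"
    by (rule continuous_on_compose2) (auto intro!: continuous_intros)
  then show ?case using 0 poly_growth_dilate[of u c] by simp
next
  case (Suc k)
  from Suc.prems obtain u' where *: "\<And>t. (u has_vector_derivative u' t) (at t)" "poly_bounded k u'" by auto
  have "((\<lambda>t. u (c * t)) has_vector_derivative c *\<^sub>R u' (c * t)) (at t)" for t
  proof -
    have "((\<lambda>t. c * t) has_vector_derivative c) (at t)"
      by (auto simp: has_vector_derivative_def intro!: derivative_eq_intros)
    from vector_diff_chain_at[OF this *(1)] show ?thesis by (simp add: comp_def)
  qed
  moreover have "poly_bounded k (\<lambda>t. c *\<^sub>R u' (c * t))"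
    unfolding scaleR_conv_of_real by (intro poly_bounded_mult poly_bounded_const Suc.IH *)
  ultimately show ?case using poly_growth_dilate[OF poly_boundedD[OF Suc.prems]]
    unfolding poly_bounded.simps by (intro conjI exI[of _ "\<lambda>t. c *\<^sub>R u' (c * t)"]) auto
qed

section \<open>Amplitudes times decaying exponentials\<close>

lemma power_over_fact_le_exp:
  fixes x :: real assumes "x \<ge> 0" shows "x ^ n / fact n \<le> exp x"
proof -
  have "(\<Sum>k\<in>{n}. x ^ k /\<^sub>R fact k) \<le> exp x"
    unfolding exp_def by (rule sum_le_suminf[OF summable_exp_generic]) (use assms in auto)
  then show ?thesis by (simp add: divide_inverse mult.commute)
qed

lemma poly_exp_decay:
  assumes w: "\<And>t. Re (w t) \<le> b - c * \<bar>t\<bar>" and c: "c > 0"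
    and u: "\<exists>C n. \<forall>t::real. norm (u t :: complex) \<le> C * (1 + \<bar>t\<bar>) ^ n"
  shows "\<exists>C. \<forall>t. norm (u t * exp (w t)) \<le> C / (1 + t^2)"
proof -
  from u obtain C n where u: "norm (u t) \<le> C * (1 + \<bar>t\<bar>) ^ n" for t by auto
  have "norm (u 0) \<le> C" using u[of 0] by auto
  then have C: "0 \<le> C" using norm_ge_zero order_trans by blast
  \<comment> \<open>From a single term of the exponential series at
    \<open>c * (1 + \<bar>t\<bar>)\<close>. The exponent \<open>n + 2\<close> has two powers to
    spare, which pay for the denominator \<open>1 + t^2\<close>.\<close>
  define K where "K = fact (n+2) / c ^ (n+2) * exp c"
  have K: "(1 + \<bar>t\<bar>) ^ (n+2) * exp (- c * \<bar>t\<bar>) \<le> K" for t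
  proof -
    have "(c * (1 + \<bar>t\<bar>)) ^ (n+2) / fact (n+2) \<le> exp (c * (1 + \<bar>t\<bar>))"
      by (rule power_over_fact_le_exp) (use c in auto)
    moreover have "c ^ (n+2) > 0" "(fact (n+2) :: real) > 0" using c by auto
    moreover have "exp (c * (1 + \<bar>t\<bar>)) = exp c * exp (c * \<bar>t\<bar>)" by (simp add: exp_add ring_distribs)
    moreover have "x \<le> f / e * y" if "e * x / f \<le> y" "e > 0" "f > 0" for x y e f :: real
      using that by (simp add: field_simps)
    note this[of "c ^ (n+2)" "(1 + \<bar>t\<bar>) ^ (n+2)" "fact (n+2)" "exp (c * (1 + \<bar>t\<bar>))"]
    ultimately have "(1 + \<bar>t\<bar>) ^ (n+2) \<le> fact (n+2) / c ^ (n+2) * (exp c * exp (c * \<bar>t\<bar>))"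
      by (simp only: power_mult_distrib)
    then have "(1 + \<bar>t\<bar>) ^ (n+2) * exp (- c * \<bar>t\<bar>) \<le> fact (n+2) / c ^ (n+2) * (exp c * exp (c * \<bar>t\<bar>)) * exp (- c * \<bar>t\<bar>)"
      by (intro mult_right_mono) auto
    moreover have "exp (c * \<bar>t\<bar>) * exp (- c * \<bar>t\<bar>) = 1" by (simp flip: exp_add)
    ultimately show ?thesis unfolding K_def by (metis mult.assoc mult.right_neutral)
  qed
  have "norm (u t * exp (w t)) \<le> C * exp b * K / (1 + t^2)" for t
  proof -
    have "norm (u t * exp (w t)) \<le> (C * (1 + \<bar>t\<bar>) ^ n) * exp (b - c * \<bar>t\<bar>)"
      unfolding norm_mult norm_exp_eq_Re using u w by (intro mult_mono) (auto simp: C)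
    then have "norm (u t * exp (w t)) * (1 + t^2) \<le> (C * (1 + \<bar>t\<bar>) ^ n) * exp (b - c * \<bar>t\<bar>) * (1 + \<bar>t\<bar>)^2"
      by (intro mult_mono) (auto simp: C power2_eq_square algebra_simps)
    also have "\<dots> = C * exp b * ((1 + \<bar>t\<bar>) ^ (n+2) * exp (- c * \<bar>t\<bar>))"
      by (simp add: power_add exp_diff exp_minus divide_inverse power2_eq_square mult_ac)
    also have "\<dots> \<le> C * exp b * K" by (intro mult_left_mono K) (auto simp: C)
    finally show ?thesis by (simp add: pos_le_divide_eq add_pos_nonneg)
  qed
  then show ?thesis by blast
qed

text \<open>Differentiating \<open>u * exp w\<close> gives \<open>(u' + u * w') * exp w\<close>,
  which has the same form with an amplitude that is one derivative poorer, while the inverse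
  transform is multiplied by \<open>\<i> * x\<close>. Induction on the number of available
  derivatives gives every power of \<open>\<bar>x\<bar>\<close>.\<close>

lemma bounded_invF_poly_exp:
  assumes w: "\<And>t. (w has_vector_derivative w' t) (at t)" and w': "\<And>k. poly_bounded k w'"
    and re: "\<And>t. Re (w t) \<le> b - c * \<bar>t\<bar>" and c: "c > 0"
    and u: "poly_bounded k u"
  shows "\<exists>C. \<forall>x. \<bar>x\<bar> ^ k * norm (invF (\<lambda>t. u t * exp (w t)) x) \<le> C"
  using u
proof (induction k arbitrary: u)
  case 0
  obtain C where C: "norm (u t * exp (w t)) \<le> C / (1 + t^2)" for t
    using poly_exp_decay[OF re c poly_boundedD[OF 0]] by blast
  have "integrable lborel (\<lambda>t::real. C * (1 / (1 + t^2)))"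
    by (intro integrable_mult_right integrable_inverse_square_lborel)
  then have "integrable lborel (\<lambda>t::real. C / (1 + t^2))" by simp
  from norm_invF_le[OF this C] show ?case by auto
next
  case (Suc k)
  from Suc.prems obtain u' where u': "\<And>t. (u has_vector_derivative u' t) (at t)" "poly_bounded k u'" by auto
  define v where "v t = u' t + u t * w' t" for t
  have v: "poly_bounded k v" unfolding v_def
    by (intro poly_bounded_add poly_bounded_mult u' w' poly_bounded_Suc[OF Suc.prems])
  obtain C where C: "norm (u t * exp (w t)) \<le> C / (1 + t^2)" for t
    using poly_exp_decay[OF re c poly_boundedD[OF Suc.prems]] by blast
  obtain D where D: "norm (v t * exp (w t)) \<le> D / (1 + t^2)" for t
    using poly_exp_decay[OF re c poly_boundedD[OF v]] by blast
  have cw: "continuous_on UNIV w"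
    using has_vector_derivative_continuous[OF w] by (auto simp: continuous_on_eq_continuous_at)
  have ew: "((\<lambda>t. exp (w t)) has_vector_derivative w' t * exp (w t)) (at t)" for t
    using field_vector_diff_chain_at[OF w[of t] DERIV_exp] by (simp add: comp_def)
  have d: "((\<lambda>t. u t * exp (w t)) has_vector_derivative v t * exp (w t)) (at t)" for t
    using has_vector_derivative_mult[OF u'(1) ew, of t] by (simp add: v_def algebra_simps)
  have cd: "continuous_on UNIV (\<lambda>t. v t * exp (w t))"
    by (intro continuous_intros cw poly_bounded_cont[OF v])
  have eq: "invF (\<lambda>t. v t * exp (w t)) x = \<i> * x * invF (\<lambda>t. u t * exp (w t)) x" for x
    by (rule invF_deriv[OF d cd C D])
  obtain E where "\<forall>x. \<bar>x\<bar> ^ k * norm (invF (\<lambda>t. v t * exp (w t)) x) \<le> E" using Suc.IH[OF v] by blast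
  then show ?case by (auto simp: eq norm_mult mult_ac)
qed

text \<open>Transforms whose inverse is a complex density with a first absolute moment. The first
  moment is needed because distribution functions, and not only densities, are to be compared; the
  class is preserved by sums, scalar factors and characteristic functions of laws with a
  mean.\<close>

definition fourier_good :: "(real \<Rightarrow> complex) \<Rightarrow> bool" where
  "fourier_good \<phi> \<longleftrightarrow> integrable lborel \<phi> \<and> integrable lborel (invF \<phi>) \<and>
     integrable lborel (\<lambda>x. x * invF \<phi> x) \<and> (\<forall>t. (\<integral>x. iexp (t * x) * invF \<phi> x \<partial>lborel) = \<phi> t)"

lemma fourier_good_add:
  assumes "fourier_good \<phi>" "fourier_good \<psi>"
  shows "fourier_good (\<lambda>t. \<phi> t + \<psi> t)"
proof -
  have i: "integrable lborel \<phi>" "integrable lborel \<psi>" "integrable lborel (invF \<phi>)" "integrable lborel (invF \<psi>)"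
    and ix: "integrable lborel (\<lambda>x. x * invF \<phi> x)" "integrable lborel (\<lambda>x. x * invF \<psi> x)"
    using assms by (auto simp: fourier_good_def)
  have eq: "invF (\<lambda>t. \<phi> t + \<psi> t) = (\<lambda>x. invF \<phi> x + invF \<psi> x)" using invF_add[OF i(1,2)] by auto
  have 1: "integrable lborel (\<lambda>x. iexp (t * x) * invF \<phi> x)" "integrable lborel (\<lambda>x. iexp (t * x) * invF \<psi> x)" for t
    by (rule integrable_iexp_times_iff, simp, rule i)+
  show ?thesis unfolding fourier_good_def eq ring_distribs
  proof (intro conjI allI)
    fix t
    show "(\<integral>x. iexp (t * x) * invF \<phi> x + iexp (t * x) * invF \<psi> x \<partial>lborel) = \<phi> t + \<psi> t"
      by (subst Bochner_Integration.integral_add[OF 1]) (use assms in \<open>simp add: fourier_good_def\<close>)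
  qed (intro Bochner_Integration.integrable_add i ix)+
qed

lemma fourier_good_cmult:
  assumes "fourier_good \<phi>"
  shows "fourier_good (\<lambda>t. c * \<phi> t)"
proof -
  have eq: "invF (\<lambda>t. c * \<phi> t) = (\<lambda>x. c * invF \<phi> x)" using invF_cmult by auto
  have eq2: "(\<lambda>x. x * (c * invF \<phi> x)) = (\<lambda>x. c * (x * invF \<phi> x))"
      "(\<lambda>x. iexp (t * x) * (c * invF \<phi> x)) = (\<lambda>x. c * (iexp (t * x) * invF \<phi> x))" for t
    by (simp_all only: mult.left_commute)
  show ?thesis using assms unfolding fourier_good_def eq eq2 by simp
qed

text \<open>The cube is the first integer power that leaves \<open>x * g x\<close> with decay like
  \<open>1 / x^2\<close>.\<close>

lemma integrable_cubic_decay: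
  fixes g :: "real \<Rightarrow> complex"
  assumes [measurable]: "g \<in> borel_measurable borel" and g0: "\<And>x. norm (g x) \<le> A" and g3: "\<And>x. \<bar>x\<bar> ^ 3 * norm (g x) \<le> B"
  shows "integrable lborel g" "integrable lborel (\<lambda>x. x * g x)"
proof -
  have A: "A \<ge> 0" using g0[of 0] norm_ge_zero order_trans by blast
  have B: "B \<ge> 0" using g3[of 0] by simp
  have AB: "(1 + \<bar>x\<bar>) * norm (g x) \<le> (4 * A + 4 * B) / (1 + x^2)" for x
  proof -
    \<comment> \<open>If \<open>\<bar>x\<bar> > 1\<close>, each of the four monomials of the product
      is at most \<open>\<bar>x\<bar> ^ 3\<close>; otherwise the product is at most 4.\<close>
    have "(1 + \<bar>x\<bar>) * (1 + x^2) \<le> 4 + 4 * \<bar>x\<bar> ^ 3"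
    proof (cases "\<bar>x\<bar> \<le> 1")
      case True
      then have "x^2 \<le> 1" by (simp add: abs_square_le_1)
      then have "(1 + \<bar>x\<bar>) * (1 + x^2) \<le> 2 * 2" using True by (intro mult_mono) auto
      moreover have "0 \<le> 4 * \<bar>x\<bar> ^ 3" by simp
      ultimately show ?thesis by linarith
    next
      case False
      define y where "y = \<bar>x\<bar>"
      have y: "y > 1" "x^2 = y^2" using False by (auto simp: y_def)
      have "y * 1 \<le> y * y^2" "1 * y^2 \<le> y * y^2" using y by (auto intro!: mult_left_mono mult_right_mono)
      moreover have "(1 + y) * (1 + y^2) = 1 + y + y^2 + y * y^2" "4 + 4 * y ^ 3 = 4 + 4 * (y * y^2)" by (simp_all add: algebra_simps power3_eq_cube power2_eq_square)
      moreover have "y * y^2 \<ge> 0" using y by simp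
      ultimately have "(1 + y) * (1 + y^2) \<le> 4 + 4 * y ^ 3" by linarith
      then show ?thesis using y unfolding y_def[symmetric] by simp
    qed
    then have "((1 + \<bar>x\<bar>) * (1 + x^2)) * norm (g x) \<le> (4 + 4 * \<bar>x\<bar> ^ 3) * norm (g x)" by (intro mult_right_mono) auto
    also have "\<dots> \<le> 4 * A + 4 * B" using g0[of x] g3[of x] by (simp add: algebra_simps)
    finally show ?thesis by (simp add: pos_le_divide_eq add_pos_nonneg mult_ac)
  qed
  show "integrable lborel g"
  proof (rule integrable_decay)
    fix x show "norm (g x) \<le> (4 * A + 4 * B) / (1 + x^2)"
      using order_trans[OF mult_right_mono[of 1 "1 + \<bar>x\<bar>" "norm (g x)"] AB[of x]] by simp
  qed simp
  show "integrable lborel (\<lambda>x. x * g x)"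
  proof (rule integrable_decay)
    fix x show "norm (x * g x) \<le> (4 * A + 4 * B) / (1 + x^2)"
      using order_trans[OF mult_right_mono[of "\<bar>x\<bar>" "1 + \<bar>x\<bar>" "norm (g x)"] AB[of x]] by (simp add: norm_mult)
  qed simp
qed

text \<open>The powers 0 and 3 of the preceding decay bounds make the inverse transform and its
  first moment integrable, and then the inversion formula applies.\<close>

lemma fourier_good_poly_exp:
  assumes w: "\<And>t. (w has_vector_derivative w' t) (at t)" and w': "\<And>k. poly_bounded k w'"
    and re: "\<And>t. Re (w t) \<le> b - c * \<bar>t\<bar>" and c: "c > 0"
    and u: "\<And>k. poly_bounded k u"
  shows "fourier_good (\<lambda>t. u t * exp (w t))"
proof -
  have cw: "continuous_on UNIV w"
    using has_vector_derivative_continuous[OF w] by (auto simp: continuous_on_eq_continuous_at)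
  have cont: "continuous_on UNIV (\<lambda>t. u t * exp (w t))"
    by (intro continuous_intros cw poly_bounded_cont[OF u])
  obtain C where C: "norm (u t * exp (w t)) \<le> C / (1 + t^2)" for t
    using poly_exp_decay[OF re c poly_boundedD[OF u]] by blast
  have i: "integrable lborel (\<lambda>t. u t * exp (w t))"
    by (rule integrable_decay[OF borel_measurable_continuous_onI[OF cont] C])
  obtain A where A: "\<bar>x\<bar> ^ 0 * norm (invF (\<lambda>t. u t * exp (w t)) x) \<le> A" for x
    using bounded_invF_poly_exp[OF w w' re c u] by blast
  obtain B where B: "\<bar>x\<bar> ^ 3 * norm (invF (\<lambda>t. u t * exp (w t)) x) \<le> B" for x
    using bounded_invF_poly_exp[OF w w' re c u] by blast
  have A': "norm (invF (\<lambda>t. u t * exp (w t)) x) \<le> A" for x using A[of x] by simp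
  have ig: "integrable lborel (invF (\<lambda>t. u t * exp (w t)))" "integrable lborel (\<lambda>x. x * invF (\<lambda>t. u t * exp (w t)) x)"
    using integrable_cubic_decay[OF invF_measurable[OF i] A' B] .
  have C0: "0 \<le> C" using order_trans[OF norm_ge_zero C[of 0]] by simp
  have bd: "norm (u t * exp (w t)) \<le> C" for t
  proof -
    have "C / (1 + t^2) \<le> C / 1" by (intro divide_left_mono C0) (auto simp: add_pos_nonneg)
    then show ?thesis using C[of t] by simp
  qed
  have "\<forall>t. (\<integral>x. iexp (t * x) * invF (\<lambda>t. u t * exp (w t)) x \<partial>lborel) = u t * exp (w t)"
    by (intro allI fourier_inversion[OF cont i bd ig(1)])
  with i ig show ?thesis unfolding fourier_good_def by blast
qed

text \<open>Multiplication by a characteristic function is convolution of the inverse transform with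
  the law \<open>P\<close>: the new density at \<open>x\<close> is the mean of
  \<open>invF \<phi> (x - z)\<close>. Its first moment is finite because
  \<open>\<bar>x\<bar> \<le> \<bar>x - z\<bar> + \<bar>z\<bar>\<close> and \<open>P\<close> has a
  mean. No smoothness of the factor enters.\<close>

lemma fourier_good_mult_pmf:
  fixes P :: "real pmf"
  assumes good: "fourier_good \<phi>" and iP: "integrable (measure_pmf P) (\<lambda>z. z)"
    and ch: "\<And>t. ch t = (\<integral>z. iexp (t * z) \<partial>measure_pmf P)"
  shows "fourier_good (\<lambda>t. \<phi> t * ch t)"
proof -
  have i: "integrable lborel \<phi>" and ig: "integrable lborel (invF \<phi>)"
    and ixg: "integrable lborel (\<lambda>x. x * invF \<phi> x)" and inv: "\<And>t. (\<integral>x. iexp (t * x) * invF \<phi> x \<partial>lborel) = \<phi> t"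
    using good by (auto simp: fourier_good_def)
  have [measurable]: "\<phi> \<in> borel_measurable borel" "invF \<phi> \<in> borel_measurable borel" using i ig by auto
  interpret pair_sigma_finite lborel "measure_pmf P" ..
  have sndm [measurable]: "snd \<in> borel_measurable (borel \<Otimes>\<^sub>M measure_pmf P)"
    by (rule measurable_compose[OF measurable_snd]) simp
  have chm [measurable]: "ch \<in> borel_measurable borel"
  proof -
    have "(\<lambda>t. (\<integral>z. iexp (t * z) \<partial>measure_pmf P)) \<in> borel_measurable borel"
      by (rule measure_pmf.borel_measurable_lebesgue_integral) (simp add: split_beta)
    moreover have "ch = (\<lambda>t. (\<integral>z. iexp (t * z) \<partial>measure_pmf P))" using ch by auto
    ultimately show ?thesis by simp
  qed
  have ch1: "norm (ch t) \<le> 1" for t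
    unfolding ch using norm_integral_le[of "measure_pmf P" "\<lambda>_. 1::real" "\<lambda>z. iexp (t * z)"] by simp
  have ich: "integrable lborel (\<lambda>t. \<phi> t * ch t)"
    by (rule Bochner_Integration.integrable_bound[OF i]) (auto simp: norm_mult intro!: mult_left_le ch1)
  define g where "g x = (\<integral>z. invF \<phi> (x - z) \<partial>measure_pmf P)" for x
  have g: "invF (\<lambda>t. \<phi> t * ch t) = g"
  proof
    fix x
    have "(\<integral>t. iexp (- (t * x)) * (\<phi> t * ch t) \<partial>lborel) = (\<integral>t. (\<integral>z. iexp (- (t * x)) * \<phi> t * iexp (t * z) \<partial>measure_pmf P) \<partial>lborel)"
      unfolding ch by (simp add: mult.assoc)
    also have "\<dots> = (\<integral>z. (\<integral>t. iexp (- (t * x)) * \<phi> t * iexp (t * z) \<partial>lborel) \<partial>measure_pmf P)"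
      by (rule Fubini_integral[symmetric], rule integrable_pair_bound[OF _ integrable_norm[OF i], of _ "\<lambda>_. 1"])
         (auto simp: norm_mult split_beta)
    also have "(\<lambda>z. (\<integral>t. iexp (- (t * x)) * \<phi> t * iexp (t * z) \<partial>lborel)) = (\<lambda>z. (\<integral>t. iexp (- (t * (x - z))) * \<phi> t \<partial>lborel))"
      by (intro ext Bochner_Integration.integral_cong refl) (simp add: algebra_simps exp_add[symmetric] exp_diff exp_minus field_simps)
    finally show "invF (\<lambda>t. \<phi> t * ch t) x = g x" unfolding g_def invF_def by simp
  qed
  interpret Q: pair_sigma_finite "measure_pmf P" lborel ..
  have fstm [measurable]: "fst \<in> borel_measurable (measure_pmf P \<Otimes>\<^sub>M borel)"
    by (rule measurable_compose[OF measurable_fst]) simp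
  have shift: "integrable lborel (\<lambda>x. invF \<phi> (x - z))" "integrable lborel (\<lambda>x. complex_of_real (x - z) * invF \<phi> (x - z))" for z
    using lborel_integrable_real_affine[OF ig, of 1 "- z"] lborel_integrable_real_affine[OF ixg, of 1 "- z"]
    by (simp_all del: of_real_diff)
  have shift_x: "integrable lborel (\<lambda>x. x * invF \<phi> (x - z))" for z
  proof -
    have "integrable lborel (\<lambda>x. (x - z) * invF \<phi> (x - z) + z * invF \<phi> (x - z))"
      by (intro Bochner_Integration.integrable_add integrable_mult_right shift)
    then show ?thesis by (simp add: ring_distribs)
  qed
  have translate: "(\<integral>x. f (x - z) \<partial>lborel) = (\<integral>x. f x \<partial>lborel)" for f :: "real \<Rightarrow> 'z::{banach,second_countable_topology}" and z
    using lborel_integral_real_affine[of 1 f "- z"] by simp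
  have I1: "integrable (measure_pmf P \<Otimes>\<^sub>M lborel) (\<lambda>(z, x). iexp (t * x) * invF \<phi> (x - z))" for t
  proof (rule Q.Fubini_integrable)
    show "integrable (measure_pmf P) (\<lambda>z. \<integral>x. norm (case (z, x) of (z, x) \<Rightarrow> iexp (t * x) * invF \<phi> (x - z)) \<partial>lborel)"
      by (simp add: norm_mult translate[of "\<lambda>x. norm (invF \<phi> x)"])
    show "AE z in measure_pmf P. complex_integrable lborel (\<lambda>x. case (z, x) of (z, x) \<Rightarrow> iexp (t * x) * invF \<phi> (x - z))"
      unfolding prod.case by (rule AE_I2, rule integrable_iexp_times_iff, simp, rule shift)
  qed (simp add: split_beta)
  have I2: "integrable (measure_pmf P \<Otimes>\<^sub>M lborel) (\<lambda>(z, x). x * invF \<phi> (x - z))"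
  proof (rule Q.Fubini_integrable)
    let ?A = "\<integral>x. norm (x * invF \<phi> x) \<partial>lborel" and ?B = "\<integral>x. norm (invF \<phi> x) \<partial>lborel"
    show "integrable (measure_pmf P) (\<lambda>z. \<integral>x. norm (case (z, x) of (z, x) \<Rightarrow> x * invF \<phi> (x - z)) \<partial>lborel)"
    proof (rule Bochner_Integration.integrable_bound)
      show "integrable (measure_pmf P) (\<lambda>z. ?A + \<bar>z\<bar> * ?B)"
        by (intro Bochner_Integration.integrable_add integrable_mult_left integrable_abs iP) simp
      have "(\<integral>x. norm (x * invF \<phi> (x - z)) \<partial>lborel) \<le> ?A + \<bar>z\<bar> * ?B" for z
      proof -
        have "(\<integral>x. norm (x * invF \<phi> (x - z)) \<partial>lborel) \<le> (\<integral>x. norm (complex_of_real (x - z) * invF \<phi> (x - z)) + \<bar>z\<bar> * norm (invF \<phi> (x - z)) \<partial>lborel)"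
        proof (intro integral_mono integrable_norm shift_x Bochner_Integration.integrable_add integrable_mult_right shift)
          fix x
          have "\<bar>x\<bar> * norm (invF \<phi> (x - z)) \<le> (\<bar>x - z\<bar> + \<bar>z\<bar>) * norm (invF \<phi> (x - z))" by (intro mult_right_mono) auto
          moreover have "norm (complex_of_real (x - z)) = \<bar>x - z\<bar>" by (simp only: norm_of_real)
          ultimately show "norm (x * invF \<phi> (x - z)) \<le> norm (complex_of_real (x - z) * invF \<phi> (x - z)) + \<bar>z\<bar> * norm (invF \<phi> (x - z))"
            unfolding norm_mult by (simp add: ring_distribs(2) del: of_real_diff)
        qed
        also have "\<dots> = ?A + \<bar>z\<bar> * ?B"
          using integrable_norm[OF shift(1)[of z]] integrable_norm[OF shift(2)[of z]]
          by (subst Bochner_Integration.integral_add) 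
             (auto simp: translate[of "\<lambda>x. norm (invF \<phi> x)"] translate[of "\<lambda>x. norm (x * invF \<phi> x)"] simp del: of_real_diff)
        finally show ?thesis .
      qed
      moreover have "0 \<le> (\<integral>x. norm (x * invF \<phi> (x - z)) \<partial>lborel)" for z by (intro Bochner_Integration.integral_nonneg) simp
      ultimately show "AE z in measure_pmf P. norm (\<integral>x. norm (case (z, x) of (z, x) \<Rightarrow> x * invF \<phi> (x - z)) \<partial>lborel) \<le> norm (?A + \<bar>z\<bar> * ?B)"
        by (intro AE_I2) (simp only: prod.case real_norm_def, simp only: abs_of_nonneg, rule order_trans[OF _ abs_ge_self], assumption | simp)
    qed simp
    show "AE z in measure_pmf P. complex_integrable lborel (\<lambda>x. case (z, x) of (z, x) \<Rightarrow> x * invF \<phi> (x - z))"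
      using shift_x by simp
  qed (simp add: split_beta)
  show ?thesis unfolding fourier_good_def g
  proof (intro conjI allI ich)
    show "integrable lborel g" using Q.integrable_snd[OF I1[of 0]] unfolding g_def by simp
    show "integrable lborel (\<lambda>x. x * g x)" using Q.integrable_snd[OF I2] unfolding g_def by simp
    fix t
    have "(\<integral>x. iexp (t * x) * g x \<partial>lborel) = (\<integral>x. (\<integral>z. iexp (t * x) * invF \<phi> (x - z) \<partial>measure_pmf P) \<partial>lborel)"
      unfolding g_def by simp
    also have "\<dots> = (\<integral>z. (\<integral>x. iexp (t * x) * invF \<phi> (x - z) \<partial>lborel) \<partial>measure_pmf P)"
      by (rule Q.Fubini_integral[OF I1])
    also have "\<dots> = (\<integral>z. \<phi> t * iexp (t * z) \<partial>measure_pmf P)"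
    proof (intro Bochner_Integration.integral_cong refl)
      fix z
      have "(\<integral>x. iexp (t * x) * invF \<phi> (x - z) \<partial>lborel) = (\<integral>x. iexp (t * z) * (iexp (t * (x - z)) * invF \<phi> (x - z)) \<partial>lborel)"
        by (intro Bochner_Integration.integral_cong refl) (simp add: algebra_simps exp_add[symmetric] exp_diff exp_minus field_simps)
      also have "\<dots> = iexp (t * z) * (\<integral>x. iexp (t * x) * invF \<phi> x \<partial>lborel)"
        using translate[of "\<lambda>x. iexp (t * x) * invF \<phi> x" z] by simp
      finally show "(\<integral>x. iexp (t * x) * invF \<phi> (x - z) \<partial>lborel) = \<phi> t * iexp (t * z)" using inv by simp
    qed
    also have "\<dots> = \<phi> t * ch t" unfolding ch by simp
    finally show "(\<integral>x. iexp (t * x) * g x \<partial>lborel) = \<phi> t * ch t" .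
  qed
qed

text \<open>For the characteristic function of a law, the inverse transform with a Gaussian factor
  is a positive mixture of Gaussian densities. This survives the limit of the laws, since the
  Gaussian dominates, and then the removal of the Gaussian, since \<open>\<phi>\<close> is
  integrable.\<close>

lemma invF_nonneg:
  fixes P :: "nat \<Rightarrow> real pmf"
  assumes i: "integrable lborel \<phi>" and lim: "\<And>t. (\<lambda>n. (\<integral>z. iexp (t * z) \<partial>measure_pmf (P n))) \<longlonglongrightarrow> \<phi> t"
  shows "Re (invF \<phi> x) \<ge> 0"
proof -
  have [measurable]: "\<phi> \<in> borel_measurable borel" using i by auto
  let ?g = "\<lambda>e t. complex_of_real (exp (-(e * t)\<^sup>2 / 2))"
  have pos: "Re (\<integral>t. iexp (- (t * x)) * \<phi> t * ?g e t \<partial>lborel) \<ge> 0" if e: "e > 0" for e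
  proof -
    let ?ch = "\<lambda>n t. (\<integral>z. iexp (t * z) \<partial>measure_pmf (P n))"
    have ch1: "norm (?ch n t) \<le> 1" for n t
      using norm_integral_le[of "measure_pmf (P n)" "\<lambda>_. 1::real" "\<lambda>z. iexp (t * z)"] by simp
    have sndm [measurable]: "snd \<in> borel_measurable (borel \<Otimes>\<^sub>M measure_pmf (P n))" for n
      by (rule measurable_compose[OF measurable_snd]) simp
    have chm [measurable]: "?ch n \<in> borel_measurable borel" for n
      by (rule measure_pmf.borel_measurable_lebesgue_integral) (simp add: split_beta)
    have "(\<lambda>n. \<integral>t. iexp (- (t * x)) * ?ch n t * ?g e t \<partial>lborel) \<longlonglongrightarrow> (\<integral>t. iexp (- (t * x)) * \<phi> t * ?g e t \<partial>lborel)"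
    proof (rule integral_dominated_convergence[where w = "\<lambda>t. exp (-(e * t)\<^sup>2 / 2)"])
      show "AE t in lborel. (\<lambda>n. iexp (- (t * x)) * ?ch n t * ?g e t) \<longlonglongrightarrow> iexp (- (t * x)) * \<phi> t * ?g e t"
        by (intro AE_I2 tendsto_intros lim)
      show "AE t in lborel. norm (iexp (- (t * x)) * ?ch n t * ?g e t) \<le> exp (-(e * t)\<^sup>2 / 2)" for n
        by (intro AE_I2) (use ch1 in \<open>auto simp: norm_mult mult_left_le_one_le\<close>)
    qed (use gauss_fourier(1)[OF e] in \<open>auto\<close>)
    moreover have "Re (\<integral>t. iexp (- (t * x)) * ?ch n t * ?g e t \<partial>lborel) \<ge> 0" for n
    proof -
      interpret pair_sigma_finite lborel "measure_pmf (P n)" ..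
      have "(\<integral>t. iexp (- (t * x)) * ?ch n t * ?g e t \<partial>lborel) = (\<integral>t. (\<integral>z. iexp (- (t * x)) * iexp (t * z) * ?g e t \<partial>measure_pmf (P n)) \<partial>lborel)"
        by simp
      also have "\<dots> = (\<integral>z. (\<integral>t. iexp (- (t * x)) * iexp (t * z) * ?g e t \<partial>lborel) \<partial>measure_pmf (P n))"
        by (rule Fubini_integral[symmetric], rule integrable_pair_bound[OF _ gauss_fourier(1)[OF e], of _ "\<lambda>_. 1"])
           (auto simp: norm_mult split_beta)
      also have "\<dots> = (\<integral>z. complex_of_real (sqrt (2 * pi) / e * exp (-((z - x) / e)\<^sup>2 / 2)) \<partial>measure_pmf (P n))"
      proof (intro Bochner_Integration.integral_cong refl)
        fix z
        have "(\<integral>t. iexp (- (t * x)) * iexp (t * z) * ?g e t \<partial>lborel) = (\<integral>t. iexp (t * (z - x)) * ?g e t \<partial>lborel)"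
          by (intro Bochner_Integration.integral_cong refl) (simp add: algebra_simps exp_add[symmetric] exp_diff exp_minus field_simps)
        then show "(\<integral>t. iexp (- (t * x)) * iexp (t * z) * ?g e t \<partial>lborel) = complex_of_real (sqrt (2 * pi) / e * exp (-((z - x) / e)\<^sup>2 / 2))"
          using gauss_fourier(2)[OF e, of "z - x"] by simp
      qed
      finally show ?thesis using e by simp
    qed
    ultimately show ?thesis
      by (intro LIMSEQ_le_const[OF tendsto_Re]) auto
  qed
  have "(\<lambda>n. \<integral>t. iexp (- (t * x)) * \<phi> t * ?g (1 / real (Suc n)) t \<partial>lborel) \<longlonglongrightarrow> (\<integral>t. iexp (- (t * x)) * \<phi> t \<partial>lborel)"
  proof (rule integral_dominated_convergence[where w = "\<lambda>t. norm (\<phi> t)"])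
    show "AE t in lborel. (\<lambda>n. iexp (- (t * x)) * \<phi> t * ?g (1 / real (Suc n)) t) \<longlonglongrightarrow> iexp (- (t * x)) * \<phi> t"
    proof (rule AE_I2)
      fix t :: real
      have e: "(\<lambda>n. 1 / real (Suc n)) \<longlonglongrightarrow> 0" by real_asymp
      have "(\<lambda>n. iexp (- (t * x)) * \<phi> t * ?g (1 / real (Suc n)) t) \<longlonglongrightarrow> iexp (- (t * x)) * \<phi> t * ?g 0 t"
        by (intro tendsto_intros e) auto
      then show "(\<lambda>n. iexp (- (t * x)) * \<phi> t * ?g (1 / real (Suc n)) t) \<longlonglongrightarrow> iexp (- (t * x)) * \<phi> t" by simp
    qed
    show "AE t in lborel. norm (iexp (- (t * x)) * \<phi> t * ?g (1 / real (Suc n)) t) \<le> norm (\<phi> t)" for n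
      by (intro AE_I2) (auto simp: norm_mult mult_left_le)
  qed (use i in auto)
  then have "Re (\<integral>t. iexp (- (t * x)) * \<phi> t \<partial>lborel) \<ge> 0"
  proof (rule LIMSEQ_le_const[OF tendsto_Re], intro exI allI impI)
    show "0 \<le> Re (\<integral>t. iexp (- (t * x)) * \<phi> t * ?g (1 / real (Suc n)) t \<partial>lborel)" for n by (rule pos) simp
  qed
  then show ?thesis unfolding invF_def by simp
qed

section \<open>A weighted smoothing inequality\<close>

text \<open>The unit step at \<open>z\<close> minus the unit step at 0. The subtraction makes it
  integrable in \<open>y\<close>, with norm \<open>\<bar>z\<bar>\<close>; in a difference of two
  functions of total mass 1 the step at 0 cancels.\<close>

definition stepdiff :: "real \<Rightarrow> real \<Rightarrow> real" where
  "stepdiff z y = (if z \<le> y then 1 else 0) - (if 0 \<le> y then 1 else 0)"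

lemma stepdiff_measurable [measurable]:
  "(\<lambda>p. stepdiff (fst p) (snd p)) \<in> borel_measurable (borel \<Otimes>\<^sub>M borel)"
  unfolding stepdiff_def by measurable

lemma stepdiff_measurable1 [measurable]: "stepdiff z \<in> borel_measurable borel"
  unfolding stepdiff_def by measurable

lemma stepdiff_fourier:
  shows "integrable lborel (stepdiff z)" "(\<integral>y. \<bar>stepdiff z y\<bar> \<partial>lborel) = \<bar>z\<bar>"
    "- (\<i> * t) * (\<integral>y. iexp (t * y) * stepdiff z y \<partial>lborel) = iexp (t * z) - 1"
proof -
  let ?I = "if z \<le> 0 then {z..0} else {0..z}" and ?s = "if z \<le> 0 then 1 else - 1 :: real"
  \<comment> \<open>Up to the end points the function is \<open>1\<close> on the segment from
    \<open>z\<close> to 0 if \<open>z\<close> is negative, and \<open>- 1\<close> on the segment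
    from 0 to \<open>z\<close> if it is positive.\<close>
  have ae: "AE y in lborel. stepdiff z y = ?s * indicator ?I y"
  proof -
    have "AE y in lborel. y \<noteq> 0 \<and> y \<noteq> z" using AE_lborel_singleton[of 0] AE_lborel_singleton[of z] by auto
    then show ?thesis by (rule AE_mp) (auto simp: stepdiff_def indicator_def)
  qed
  have i: "integrable lborel (\<lambda>y. ?s * indicator ?I y)"
    by (intro integrable_mult_right) (auto simp: emeasure_lborel_Icc_eq)
  show "integrable lborel (stepdiff z)"
    using i by (subst integrable_cong_AE[OF _ _ ae]) auto
  have "(\<integral>y. \<bar>stepdiff z y\<bar> \<partial>lborel) = (\<integral>y. indicator ?I y \<partial>lborel)"
    using ae by (intro integral_cong_AE) (auto split: if_splits simp: abs_mult)
  then show "(\<integral>y. \<bar>stepdiff z y\<bar> \<partial>lborel) = \<bar>z\<bar>" by (auto split: if_splits)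
  have FTC: "(\<integral>y. indicator {a..b} y *\<^sub>R (\<i> * t * iexp (t * y)) \<partial>lborel) = iexp (t * b) - iexp (t * a)" if "a \<le> b" for a b
  proof (rule integral_FTC_Icc[OF that])
    fix x
    have "((\<lambda>z. exp (\<i> * (complex_of_real t * z))) has_field_derivative \<i> * t * iexp (t * x)) (at (of_real x))"
      by (auto intro!: derivative_eq_intros)
    from has_vector_derivative_real_field[OF this] 
    show "((\<lambda>x. iexp (t * x)) has_vector_derivative \<i> * t * iexp (t * x)) (at x within {a..b})" by simp
  qed (intro continuous_intros)
  have "- (\<i> * t) * (\<integral>y. iexp (t * y) * stepdiff z y \<partial>lborel) = (\<integral>y. - (\<i> * t) * (iexp (t * y) * stepdiff z y) \<partial>lborel)"
    by simp
  also have "\<dots> = (\<integral>y. - ?s *\<^sub>R (indicator ?I y *\<^sub>R (\<i> * t * iexp (t * y))) \<partial>lborel)"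
  proof (rule integral_cong_AE)
    show "AE y in lborel. - (\<i> * t) * (iexp (t * y) * stepdiff z y) = - ?s *\<^sub>R (indicator ?I y *\<^sub>R (\<i> * t * iexp (t * y)))"
      using ae by (rule AE_mp) (auto intro!: AE_I2 simp: scaleR_conv_of_real indicator_def)
  qed auto
  also have "\<dots> = - ?s *\<^sub>R (\<integral>y. indicator ?I y *\<^sub>R (\<i> * t * iexp (t * y)) \<partial>lborel)"
    by (rule integral_scaleR_right)
  also have "\<dots> = iexp (t * z) - 1"
    using FTC[of z 0] FTC[of 0 z] by auto
  finally show "- (\<i> * t) * (\<integral>y. iexp (t * y) * stepdiff z y \<partial>lborel) = iexp (t * z) - 1" .
qed

text \<open>Integrating \<open>iexp (t * y)\<close> against a distribution function divides the
  transform by \<open>- \<i> * t\<close>. The measure \<open>N\<close> is left general so that one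
  statement serves both a law with \<open>g = 1\<close> and Lebesgue measure with a density
  \<open>g\<close>. Since the norm of the step difference is \<open>\<bar>z\<bar>\<close>, a first
  moment is exactly what Fubini requires.\<close>

lemma primitive_fourier:
  fixes g :: "real \<Rightarrow> real" and N :: "real measure"
  assumes N: "sigma_finite_measure N" "sets N = sets borel"
    and g: "integrable N g" and xg: "integrable N (\<lambda>x. x * g x)"
  defines "E \<equiv> \<lambda>y. \<integral>z. stepdiff z y * g z \<partial>N"
  shows "integrable lborel E" 
    "- (\<i> * t) * (\<integral>y. iexp (t * y) * E y \<partial>lborel) = (\<integral>z. (iexp (t * z) - 1) * g z \<partial>N)"
proof -
  interpret N: sigma_finite_measure N by fact
  interpret pair_sigma_finite N lborel ..
  note N(2)[measurable_cong]
  have [measurable]: "g \<in> borel_measurable borel"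
    using borel_measurable_integrable[OF g] N(2) by (simp cong: measurable_cong_sets)
  have F: "integrable (N \<Otimes>\<^sub>M lborel) (\<lambda>(z, y). iexp (t * y) * (stepdiff z y * g z))" for t
  proof (rule Fubini_integrable)
    have "(\<lambda>z. \<integral>y. norm (case (z, y) of (z, y) \<Rightarrow> iexp (t * y) * (stepdiff z y * g z)) \<partial>lborel) = (\<lambda>z. \<bar>z * g z\<bar>)"
      by (auto simp: norm_mult abs_mult stepdiff_fourier)
    then show "integrable N (\<lambda>z. \<integral>y. norm (case (z, y) of (z, y) \<Rightarrow> iexp (t * y) * (stepdiff z y * g z)) \<partial>lborel)"
      using integrable_abs[OF xg] by simp
    show "AE z in N. integrable lborel (\<lambda>y. case (z, y) of (z, y) \<Rightarrow> iexp (t * y) * complex_of_real (stepdiff z y * g z))"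
      unfolding prod.case by (rule AE_I2, rule integrable_iexp_times_iff, simp, intro integrable_of_real integrable_mult_left stepdiff_fourier)
  qed (simp add: split_beta)
  have F0: "integrable (N \<Otimes>\<^sub>M lborel) (\<lambda>(z, y). stepdiff z y * g z)"
    using integrable_Re[OF F[of 0]] by (simp add: split_beta')
  show "integrable lborel E" unfolding E_def using integrable_snd[OF F0] .
  have "(\<integral>y. iexp (t * y) * E y \<partial>lborel) = (\<integral>y. (\<integral>z. iexp (t * y) * (stepdiff z y * g z) \<partial>N) \<partial>lborel)"
    unfolding E_def by (simp flip: integral_complex_of_real)
  also have "\<dots> = (\<integral>z. (\<integral>y. iexp (t * y) * (stepdiff z y * g z) \<partial>lborel) \<partial>N)"
    by (rule Fubini_integral[OF F])
  also have "\<dots> = (\<integral>z. g z * (\<integral>y. iexp (t * y) * stepdiff z y \<partial>lborel) \<partial>N)"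
    by (intro Bochner_Integration.integral_cong refl) (simp flip: integral_mult_right_zero add: mult_ac)
  finally have "- (\<i> * t) * (\<integral>y. iexp (t * y) * E y \<partial>lborel) = (\<integral>z. g z * (- (\<i> * t) * (\<integral>y. iexp (t * y) * stepdiff z y \<partial>lborel)) \<partial>N)"
    by (simp flip: integral_mult_right_zero add: mult_ac)
  then show "- (\<i> * t) * (\<integral>y. iexp (t * y) * E y \<partial>lborel) = (\<integral>z. (iexp (t * z) - 1) * g z \<partial>N)"
    unfolding stepdiff_fourier by (simp add: mult.commute)
qed

section \<open>The Fejer kernel, the square of \<open>sin (u / 2) / (u / 2)\<close>, continuous at
  0\<close>

definition fejer :: "real \<Rightarrow> real" where
  "fejer u = (if u = 0 then 1 else 2 * (1 - cos u) / u\<^sup>2)"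

lemma fejer_even: "fejer (- u) = fejer u"
  by (simp add: fejer_def)

lemma fejer_nonneg: "fejer u \<ge> 0"
  by (simp add: fejer_def)

lemma fejer_decay: "norm (fejer u) \<le> 8 / (1 + u\<^sup>2)"
proof (cases "u = 0")
  case False
  have u: "u^2 > 0" using False by simp
  have 1: "1 - cos u \<le> u^2 / 2" using cos_ge_minus_one[of u] cos_double_sin[of "u/2"] abs_sin_x_le_abs_x[of "u/2"]
    using power_mono[of "\<bar>sin (u/2)\<bar>" "\<bar>u/2\<bar>" 2] by (simp add: power_divide)
  have "2 * (1 - cos u) * (1 + u^2) \<le> 8 * u^2"
  proof (cases "u^2 \<le> 1")
    case True
    then have "2 * (1 - cos u) * (1 + u^2) \<le> u^2 * 2" using 1 by (intro mult_mono) auto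
    then show ?thesis using u by linarith
  next
    case False
    have "2 * (1 - cos u) \<le> 4" using cos_ge_minus_one[of u] by argo
    from mult_right_mono[OF this, of "1 + u^2"] have "2 * (1 - cos u) * (1 + u^2) \<le> 4 * (1 + u^2)" using u by linarith
    also have "\<dots> \<le> 8 * u^2" using False by simp
    finally show ?thesis .
  qed
  then show ?thesis using False u by (simp add: fejer_def field_simps add_pos_pos)
qed (simp add: fejer_def)

lemma fejer_measurable [measurable]: "fejer \<in> borel_measurable borel"
  unfolding fejer_def by measurable

lemma fejer_integrable: "integrable lborel fejer"
  by (rule integrable_decay[OF _ fejer_decay]) simp

text \<open>Left unevaluated (it is \<open>2 * pi\<close>): only its positivity matters for the
  smoothing inequality.\<close>

definition fejer_mass :: real where "fejer_mass = integral\<^sup>L lborel fejer"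

lemma fejer_mass_pos: "fejer_mass > 0"
proof -
  have "fejer_mass \<noteq> 0"
  proof
    assume "fejer_mass = 0"
    then have "AE u in lborel. fejer u = 0" unfolding fejer_mass_def
      by (subst (asm) integral_nonneg_eq_0_iff_AE[OF fejer_integrable]) (auto simp: fejer_nonneg)
    then have "AE u in lborel. u \<notin> {0<..<1::real}"
    proof (rule AE_mp, intro AE_I2 impI notI)
      fix u :: real assume "fejer u = 0" and u: "u \<in> {0<..<1}"
      then have "cos u = cos 0" by (auto simp: fejer_def split: if_splits)
      moreover have "cos u < cos 0" using u pi_gt3 by (intro cos_monotone_0_pi) auto
      ultimately show False by simp
    qed
    then have "emeasure lborel {0<..<1::real} = 0" by (subst (asm) AE_iff_measurable[of "{0<..<1}"]) auto
    then show False by simp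
  qed
  moreover have "fejer_mass \<ge> 0" unfolding fejer_mass_def by (intro Bochner_Integration.integral_nonneg fejer_nonneg)
  ultimately show ?thesis by simp
qed

lemma fejer_radius: "\<exists>a>0. (\<integral>u. fejer u * indicator (- {-a..a}) u \<partial>lborel) \<le> fejer_mass / 4"
proof -
  have "(\<lambda>n. \<integral>u. fejer u * indicator (- {- real n..real n}) u \<partial>lborel) \<longlonglongrightarrow> (\<integral>u. 0 \<partial>(lborel :: real measure))"
  proof (rule integral_dominated_convergence[where w = fejer and s = "\<lambda>n u. fejer u * indicator (- {- real n..real n}) u"])
    show "AE u in lborel. (\<lambda>n. fejer u * indicator (- {- real n..real n}) u) \<longlonglongrightarrow> 0"
    proof (rule AE_I2)
      fix u :: real
      obtain N :: nat where N: "\<bar>u\<bar> \<le> real N" using real_arch_simple by blast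
      have "\<forall>\<^sub>F n in sequentially. fejer u * indicator (- {- real n..real n}) u = 0"
        using eventually_ge_at_top[of N] by eventually_elim (use N in \<open>auto simp: indicator_def\<close>)
      then show "(\<lambda>n. fejer u * indicator (- {- real n..real n}) u) \<longlonglongrightarrow> 0"
        by (rule tendsto_eventually)
    qed
  qed (auto simp: fejer_integrable fejer_nonneg indicator_def)
  then have "\<forall>\<^sub>F n in sequentially. (\<integral>u. fejer u * indicator (- {- real n..real n}) u \<partial>lborel) < fejer_mass / 4"
    by (intro order_tendstoD(2)) (use fejer_mass_pos in auto)
  then obtain n where n: "n \<ge> 1" "(\<integral>u. fejer u * indicator (- {- real n..real n}) u \<partial>lborel) < fejer_mass / 4"
    by (metis (mono_tags, lifting) eventually_at_top_linorder nle_le)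
  then show ?thesis by (intro exI[of _ "real n"]) auto
qed

text \<open>A radius holding three quarters of the mass. The remaining quarter is small enough to
  make the self-improving estimate in \<open>smoothing_peak\<close> a contraction.\<close>

definition fejer_rad :: real where
  "fejer_rad = (SOME a. a > 0 \<and> (\<integral>u. fejer u * indicator (- {-a..a}) u \<partial>lborel) \<le> fejer_mass / 4)"

lemma fejer_rad: "fejer_rad > 0" "(\<integral>u. fejer u * indicator (- {-fejer_rad..fejer_rad}) u \<partial>lborel) \<le> fejer_mass / 4"
  using someI_ex[OF fejer_radius] unfolding fejer_rad_def by auto

text \<open>Near a point where \<open>U\<close> is almost extremal, \<open>U\<close> stays extremal up to \<open>L\<close> on a one-sided
  interval, which carries at least three quarters of the Fejer mass once the kernel is centred there; the remaining
  quarter is absorbed by the supremum.\<close>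
lemma smoothing_peak:
  fixes U :: "real \<Rightarrow> real"
  assumes T: "T > 0" and [measurable]: "U \<in> borel_measurable borel" and bdd: "\<And>x. \<bar>U x\<bar> \<le> Nb" and L: "L \<ge> 0"
    and b: "\<And>x. \<bar>\<integral>v. U (x - v / T) * fejer v \<partial>lborel\<bar> \<le> \<beta>"
    and peak: "\<And>x. \<bar>U x\<bar> \<le> L \<or> (\<exists>s\<in>{1,-1}. \<exists>\<tau>\<in>{1,-1}. \<forall>d\<in>{0..2 * fejer_rad / T}. s * U (x + \<tau> * d) \<ge> \<bar>U x\<bar> - L)"
  shows "\<bar>U x\<bar> \<le> 2 * L + 2 * \<beta> / fejer_mass"
proof -
  let ?a = fejer_rad and ?m = fejer_mass
  have beta: "\<beta> \<ge> 0" using b[of 0] by linarith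
  \<comment> \<open>Any bound \<open>N\<close> for \<open>U\<close> improves to a bound containing
    only \<open>N / 3\<close>; applied to the supremum this closes the estimate.\<close>
  have step: "\<bar>U x\<bar> \<le> L + 4 / 3 * \<beta> / ?m + N / 3" if N: "\<And>x. \<bar>U x\<bar> \<le> N" for N x
  proof (cases "\<bar>U x\<bar> \<le> L")
    case True
    moreover have "0 \<le> 4/3 * \<beta> / ?m" "0 \<le> N" using beta fejer_mass_pos N[of 0] by auto
    ultimately show ?thesis by linarith
  next
    case False
    with peak[of x] obtain s \<tau> where s: "s \<in> {1,-1}" and \<tau>: "\<tau> \<in> {1,-1}" and d: "\<And>d. d \<in> {0..2 * ?a / T} \<Longrightarrow> s * U (x + \<tau> * d) \<ge> \<bar>U x\<bar> - L" by blast
    define D where "D = \<bar>U x\<bar> - L"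
    have D: "D > 0" using False by (simp add: D_def)
    \<comment> \<open>The midpoint of the interval on which \<open>U\<close> stays extremal: the
      part of the kernel with \<open>\<bar>v\<bar>\<close> at most the radius samples exactly this
      interval.\<close>
    define c where "c = x + \<tau> * ?a / T"
    have iU: "integrable lborel (\<lambda>v. U (c - v / T) * fejer v)"
    proof (rule Bochner_Integration.integrable_bound[OF integrable_mult_right[OF fejer_integrable, of N]])
      show "AE v in lborel. norm (U (c - v / T) * fejer v) \<le> norm (N * fejer v)"
        using N by (auto simp: abs_mult fejer_nonneg intro!: mult_right_mono order_trans[OF N abs_ge_self])
    qed simp
    let ?o = "\<lambda>v. fejer v * indicator (- {-?a..?a}) v"
    have io: "integrable lborel ?o" 
      by (rule Bochner_Integration.integrable_bound[OF fejer_integrable]) (auto simp: indicator_def)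
    \<comment> \<open>Inside the radius the integrand is at least \<open>D * fejer v\<close>,
      outside at least \<open>- N * fejer v\<close>.\<close>
    have "(\<integral>v. D * fejer v - (D + N) * ?o v \<partial>lborel) \<le> (\<integral>v. s * (U (c - v / T) * fejer v) \<partial>lborel)"
    proof (intro integral_mono Bochner_Integration.integrable_diff integrable_mult_right fejer_integrable io iU)
      fix v
      show "D * fejer v - (D + N) * ?o v \<le> s * (U (c - v / T) * fejer v)"
      proof (cases "v \<in> {-?a..?a}")
        case True
        define d' where "d' = (?a - \<tau> * v) / T"
        have "c - v / T = x + \<tau> * d'" using \<tau> T unfolding c_def d'_def by (auto simp: field_simps)
        moreover have "0 \<le> ?a - \<tau> * v" "?a - \<tau> * v \<le> 2 * ?a" using \<tau> True by auto
        then have "d' \<in> {0..2 * ?a / T}" using T unfolding d'_def by (auto intro!: divide_right_mono)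
        ultimately have "D \<le> s * U (c - v / T)" using d[of d'] by (simp add: D_def)
        from mult_right_mono[OF this fejer_nonneg[of v]] show ?thesis using True by (simp add: mult.assoc)
      next
        case False
        have "- N \<le> s * U (c - v / T)" using s N[of "c - v / T"] by auto
        from mult_right_mono[OF this fejer_nonneg[of v]] show ?thesis using False by (simp add: algebra_simps)
      qed
    qed
    also have "\<dots> \<le> \<bar>\<integral>v. U (c - v / T) * fejer v \<partial>lborel\<bar>" using s by auto
    also have "\<dots> \<le> \<beta>" by (rule b)
    finally have "D * ?m - (D + N) * integral\<^sup>L lborel ?o \<le> \<beta>"
      using fejer_integrable io by (simp add: fejer_mass_def)
    moreover have "(D + N) * integral\<^sup>L lborel ?o \<le> (D + N) * (?m / 4)"
      by (intro mult_left_mono fejer_rad) (use D N[of 0] in auto)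
    ultimately have "D * ?m - (D + N) * (?m / 4) \<le> \<beta>" by linarith
    moreover have "(D + N) * (?m / 4) = D * ?m / 4 + N * ?m / 4" by (simp add: field_simps)
    ultimately have "D * ?m * 3 \<le> 4 * \<beta> + N * ?m" by linarith
    then have "D \<le> 4 / 3 * \<beta> / ?m + N / 3" using fejer_mass_pos by (simp add: field_simps)
    then show ?thesis by (simp add: D_def)
  qed
  \<comment> \<open>The a priori bound \<open>Nb\<close> enters only here, to make the supremum
    finite so that \<open>M / 3\<close> can be subtracted.\<close>
  define M where "M = (SUP x. \<bar>U x\<bar>)"
  have bd: "bdd_above (range (\<lambda>x. \<bar>U x\<bar>))" using bdd by (auto intro!: bdd_aboveI)
  have UM: "\<bar>U x\<bar> \<le> M" for x unfolding M_def by (rule cSUP_upper[OF _ bd]) simp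
  have "M \<le> L + 4 / 3 * \<beta> / ?m + M / 3" unfolding M_def[of] 
    by (rule cSUP_least) (use step[OF UM] in \<open>auto simp: M_def\<close>)
  then have "M \<le> 3/2 * L + 2 * \<beta> / ?m" by (simp add: field_simps)
  then show ?thesis using UM[of x] L by linarith
qed

text \<open>The transform of the triangle function, computed from explicit antiderivatives on the
  two halves of the interval.\<close>

lemma fejer_kernel:
  fixes T u :: real assumes T: "T > 0"
  shows "(\<integral>t. indicator {-T..T} t *\<^sub>R (complex_of_real (1 - \<bar>t\<bar> / T) * iexp (t * u)) \<partial>lborel) = complex_of_real (T * fejer (T * u))"
proof -
  let ?f = "\<lambda>t. complex_of_real (1 - \<bar>t\<bar> / T) * iexp (t * u)"
  have eq: "(\<integral>t. indicator {-T..T} t *\<^sub>R ?f t \<partial>lborel) = integral {-T..T} ?f"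
  proof -
    have "set_integrable lborel {-T..T} ?f"
      by (intro borel_integrable_compact[unfolded set_integrable_def[symmetric]] continuous_intros) (use T in auto)
    from set_borel_integral_eq_integral(2)[OF this] show ?thesis by (simp add: set_lebesgue_integral_def)
  qed
  have "\<exists>I J. (?f has_integral I) {-T..0} \<and> (?f has_integral J) {0..T} \<and> I + J = complex_of_real (T * fejer (T * u))"
  proof (cases "u = 0")
    case True
    have 1: "((\<lambda>z. z + z\<^sup>2 / (2 * complex_of_real T)) has_field_derivative 1 + complex_of_real t / T) (at (of_real t))" for t
      using T by (auto intro!: derivative_eq_intros)
    have 2: "((\<lambda>z. z - z\<^sup>2 / (2 * complex_of_real T)) has_field_derivative 1 - complex_of_real t / T) (at (of_real t))" for t
      using T by (auto intro!: derivative_eq_intros)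
    have "((\<lambda>t. 1 + complex_of_real t / T) has_integral (of_real 0 + (of_real 0)\<^sup>2 / (2 * of_real T)) - (of_real (-T) + (of_real (-T))\<^sup>2 / (2 * of_real T))) {-T..0}"
      by (rule fundamental_theorem_of_calculus) (use T has_vector_derivative_real_field[OF 1] in \<open>auto intro: has_vector_derivative_at_within\<close>)
    then have I: "(?f has_integral complex_of_real (T / 2)) {-T..0}"
      using T by (subst has_integral_cong[where g = "\<lambda>t. 1 + complex_of_real t / T"]) (auto simp: True field_simps power2_eq_square)
    have "((\<lambda>t. 1 - complex_of_real t / T) has_integral (of_real T - (of_real T)\<^sup>2 / (2 * of_real T)) - (of_real 0 - (of_real 0)\<^sup>2 / (2 * of_real T))) {0..T}"
      by (rule fundamental_theorem_of_calculus) (use T has_vector_derivative_real_field[OF 2] in \<open>auto intro: has_vector_derivative_at_within\<close>)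
    then have J: "(?f has_integral complex_of_real (T / 2)) {0..T}"
      using T by (subst has_integral_cong[where g = "\<lambda>t. 1 - complex_of_real t / T"]) (auto simp: True field_simps power2_eq_square)
    show ?thesis by (rule exI, rule exI, intro conjI, rule I, rule J) (simp add: True fejer_def flip: of_real_add)
  next
    case False
    define e where "e z = exp (\<i> * complex_of_real u * z)" for z
    have ee: "e (complex_of_real t) = iexp (t * u)" for t by (simp add: e_def mult_ac)
    have de: "(e has_field_derivative \<i> * u * e z) (at z)" for z
      unfolding e_def by (auto intro!: derivative_eq_intros)
    \<comment> \<open>Antiderivative of \<open>(1 + s * z / T) * e z\<close>, from one integration
      by parts; \<open>s = 1\<close> belongs to the left half and \<open>s = - 1\<close> to the
      right half of the triangle.\<close>
    define A where "A s z = (1 + s * z / complex_of_real T) * e z / (\<i> * u) + s * e z / (T * u\<^sup>2)" for s z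
    have dA: "(A s has_field_derivative (1 + s * z / T) * e z) (at z)" for s z
      unfolding A_def using T False by (auto intro!: derivative_eq_intros de simp: field_simps power2_eq_square)
    have dAr: "((\<lambda>t. A s (complex_of_real t)) has_vector_derivative (1 + s * complex_of_real t / T) * e (complex_of_real t)) (at t within S)" for s t S
      by (rule has_vector_derivative_real_field, rule has_field_derivative_at_within, rule dA)
    have "((\<lambda>t. (1 + 1 * complex_of_real t / T) * e (complex_of_real t)) has_integral A 1 (complex_of_real 0) - A 1 (complex_of_real (- T))) {-T..0}"
      by (rule fundamental_theorem_of_calculus) (use T in \<open>auto intro: dAr[of 1, simplified] dAr[of "-1", simplified]\<close>)
    then have I: "(?f has_integral A 1 (complex_of_real 0) - A 1 (complex_of_real (- T))) {-T..0}"
      by (subst has_integral_cong[where g = "\<lambda>t. (1 + 1 * complex_of_real t / T) * e (complex_of_real t)"]) (auto simp: ee)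
    have "((\<lambda>t. (1 + (-1) * complex_of_real t / T) * e (complex_of_real t)) has_integral A (-1) (complex_of_real T) - A (-1) (complex_of_real 0)) {0..T}"
      by (rule fundamental_theorem_of_calculus) (use T in \<open>auto intro: dAr[of 1, simplified] dAr[of "-1", simplified]\<close>)
    then have J: "(?f has_integral A (-1) (complex_of_real T) - A (-1) (complex_of_real 0)) {0..T}"
      by (subst has_integral_cong[where g = "\<lambda>t. (1 + (-1) * complex_of_real t / T) * e (complex_of_real t)"]) (auto simp: ee)
    have E: "e 0 = 1" "e (complex_of_real T) + e (- complex_of_real T) = complex_of_real (2 * cos (T * u))"
      using cos_exp_eq[of "complex_of_real (T * u)"] by (simp_all add: e_def mult_ac flip: cos_of_real)
    have "A 1 (complex_of_real 0) - A 1 (complex_of_real (- T)) + (A (-1) (complex_of_real T) - A (-1) (complex_of_real 0))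
       = (2 - (e (complex_of_real T) + e (- complex_of_real T))) / (T * u\<^sup>2)"
      using T False unfolding A_def by (simp add: E(1) field_simps)
    also have "\<dots> = complex_of_real (T * fejer (T * u))"
      unfolding E using T False by (simp add: fejer_def field_simps power2_eq_square)
    finally show ?thesis using I J by blast
  qed
  then obtain I J where "(?f has_integral I) {-T..0}" "(?f has_integral J) {0..T}" "I + J = complex_of_real (T * fejer (T * u))" by blast
  with has_integral_combine[of "-T" 0 T ?f I J] T have "(?f has_integral complex_of_real (T * fejer (T * u))) {-T..T}" by simp
  then show ?thesis unfolding eq by (rule integral_unique)
qed

text \<open>The sum of the constants in the bounds for \<open>\<bar>H x\<bar>\<close> and
  \<open>\<bar>x * H x\<bar>\<close> once the integral of \<open>B\<close> and \<open>K / T\<close>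
  have both been replaced by their sum.\<close>

definition "smooth_const = (1 + 4 * fejer_rad) * (4 * fejer_rad + 2 / fejer_mass) + 4 * fejer_rad * (1 + 2 * fejer_rad) + 2 / fejer_mass"

lemma smooth_const_nonneg: "smooth_const \<ge> 0"
  unfolding smooth_const_def using fejer_rad(1) fejer_mass_pos by (intro add_nonneg_nonneg mult_nonneg_nonneg) auto

text \<open>\<open>B\<close> bounds both the transform of the difference of the two distribution functions, \<open>\<i> * h t / t\<close>, and its
  derivative; the latter gives the factor \<open>\<bar>x\<bar>\<close> in the weighted bound.\<close>
locale smoothing_setup =
  fixes P :: "real measure" and g :: "real \<Rightarrow> real" and h h' :: "real \<Rightarrow> complex" and B :: "real \<Rightarrow> real" and T K :: real
  assumes P: "real_distribution P" and Pid: "integrable P (\<lambda>x. x)"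
    and g: "integrable lborel g" and xg: "integrable lborel (\<lambda>x. x * g x)" and g1: "integral\<^sup>L lborel g = 1"
    and gK: "\<And>x. (1 + \<bar>x\<bar>) * \<bar>g x\<bar> \<le> K"
    and h: "\<And>t. h t = char P t - (\<integral>x. iexp (t * x) * g x \<partial>lborel)"
    and T: "T \<ge> 1"
    and h': "\<And>t. t \<noteq> 0 \<Longrightarrow> \<bar>t\<bar> < T \<Longrightarrow> (h has_vector_derivative h' t) (at t)"
    and B: "B integrable_on {-T..T}"
    and hB: "\<And>t. \<bar>t\<bar> \<le> T \<Longrightarrow> norm (h t / t) \<le> B t"
    and h'B: "\<And>t. \<bar>t\<bar> \<le> T \<Longrightarrow> norm (h' t / t - h t / t\<^sup>2) \<le> B t"
    and h0: "h 0 = 0"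
begin

section \<open>The difference of the two distribution functions and its transform\<close>

definition "G x = (\<integral>z. indicator {..x} z * g z \<partial>lborel)"
definition "H x = cdf P x - G x"
definition "Hf t = (\<integral>y. iexp (t * y) * H y \<partial>lborel)"

sublocale P: real_distribution P by (rule P)

text \<open>Both sides have total mass 1, so the same unit step can be subtracted from each. Each of
  the two terms is then integrable in \<open>y\<close> by its first moment.\<close>

lemma H_eq: "H y = (\<integral>z. stepdiff z y \<partial>P) - (\<integral>z. stepdiff z y * g z \<partial>lborel)"
proof -
  let ?c = "if 0 \<le> y then 1 else 0 :: real"
  have "(\<integral>z. stepdiff z y \<partial>P) = (\<integral>z. indicator {..y} z - ?c \<partial>P)"
    by (intro Bochner_Integration.integral_cong) (auto simp: stepdiff_def)
  also have "\<dots> = cdf P y - ?c"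
    by (subst Bochner_Integration.integral_diff) (auto simp: cdf_def P.prob_space[simplified] intro!: P.integrable_const_bound[where B = 1])
  finally have 1: "(\<integral>z. stepdiff z y \<partial>P) = cdf P y - ?c" .
  have ig: "integrable lborel (\<lambda>z. indicator {..y} z * g z)"
    using integrable_mult_indicator[OF _ g, of "{..y}"] by simp
  have "(\<integral>z. stepdiff z y * g z \<partial>lborel) = (\<integral>z. indicator {..y} z * g z - ?c * g z \<partial>lborel)"
    by (intro Bochner_Integration.integral_cong) (auto simp: stepdiff_def)
  also have "\<dots> = G y - ?c"
    unfolding G_def by (subst Bochner_Integration.integral_diff[OF ig]) (use g in \<open>auto simp: g1\<close>)
  finally show ?thesis unfolding H_def 1 by simp
qed

lemma H_integrable: "integrable lborel H"
  and Hf_eq: "- (\<i> * t) * Hf t = h t"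
proof -
  let ?E1 = "\<lambda>y. \<integral>z. stepdiff z y * 1 \<partial>P" and ?E2 = "\<lambda>y. \<integral>z. stepdiff z y * g z \<partial>lborel"
  have P1: "integrable P (\<lambda>z. z * (1::real))" "integrable P (\<lambda>z. 1::real)" using Pid by auto
  note A1 = primitive_fourier[OF P.sigma_finite_measure_axioms P.events_eq_borel P1(2,1)]
  note A2 = primitive_fourier[OF lborel.sigma_finite_measure_axioms sets_lborel g xg]
  have Heq: "H = (\<lambda>y. ?E1 y - ?E2 y)" using H_eq by auto
  show iH: "integrable lborel H" unfolding Heq using A1(1) A2(1) by (rule Bochner_Integration.integrable_diff)
  have 1: "integrable lborel (\<lambda>y. iexp (t * y) * ?E1 y)" "integrable lborel (\<lambda>y. iexp (t * y) * ?E2 y)"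
    by (rule integrable_iexp_times_iff, simp, intro integrable_of_real A1(1) A2(1))+
  have "Hf t = (\<integral>y. iexp (t * y) * ?E1 y - iexp (t * y) * ?E2 y \<partial>lborel)"
    unfolding Hf_def Heq of_real_diff ring_distribs ..
  also have "\<dots> = (\<integral>y. iexp (t * y) * ?E1 y \<partial>lborel) - (\<integral>y. iexp (t * y) * ?E2 y \<partial>lborel)"
    by (rule Bochner_Integration.integral_diff[OF 1])
  finally have "- (\<i> * t) * Hf t = - (\<i> * t) * (\<integral>y. iexp (t * y) * ?E1 y \<partial>lborel) - - (\<i> * t) * (\<integral>y. iexp (t * y) * ?E2 y \<partial>lborel)"
    by (simp only: ring_distribs)
  also have "\<dots> = (\<integral>z. (iexp (t * z) - 1) * complex_of_real 1 \<partial>P) - (\<integral>z. (iexp (t * z) - 1) * g z \<partial>lborel)"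
    by (simp only: A1(2) A2(2))
  also have "(\<integral>z. (iexp (t * z) - 1) * complex_of_real 1 \<partial>P) = char P t - 1"
    unfolding char_def using P.integrable_iexp[of "\<lambda>z. t * z"] by (simp add: P.prob_space[simplified])
  also have "(\<integral>z. (iexp (t * z) - 1) * g z \<partial>lborel) = (\<integral>z. iexp (t * z) * g z - complex_of_real (g z) \<partial>lborel)"
    by (simp only: ring_distribs mult_1)
  also have "\<dots> = (\<integral>z. iexp (t * z) * g z \<partial>lborel) - 1"
  proof (subst Bochner_Integration.integral_diff)
    show "complex_integrable lborel (\<lambda>z. iexp (t * z) * g z)" by (rule integrable_iexp_times_iff, simp, intro integrable_of_real g)
  qed (use g g1 in auto)
  finally show "- (\<i> * t) * Hf t = h t" unfolding h by simp
qed

lemma H_measurable [measurable]: "H \<in> borel_measurable borel"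
  using H_integrable by auto

lemma Hf_cont: "isCont Hf t"
  unfolding continuous_at_sequentially comp_def Hf_def
proof safe
  fix X :: "nat \<Rightarrow> real" assume X: "X \<longlonglongrightarrow> t"
  show "(\<lambda>n. \<integral>y. iexp (X n * y) * H y \<partial>lborel) \<longlonglongrightarrow> (\<integral>y. iexp (t * y) * H y \<partial>lborel)"
  proof (rule integral_dominated_convergence[where w = "\<lambda>y. \<bar>H y\<bar>"])
    show "AE y in lborel. (\<lambda>i. iexp (X i * y) * H y) \<longlonglongrightarrow> iexp (t * y) * H y"
      by (intro AE_I2 tendsto_intros X)
  qed (use H_integrable in \<open>auto simp: norm_mult\<close>)
qed

lemma Hf_quot: "t \<noteq> 0 \<Longrightarrow> Hf t = \<i> * (h t / t)"
  using Hf_eq[of t] by (simp add: field_simps flip: Hf_eq)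

section \<open>The triangular weight whose transform is the Fejer kernel centred at
  \<open>x\<close>\<close>

definition "w x t = complex_of_real (1 - \<bar>t\<bar> / T) * iexp (- (t * x))"
definition "w' x t = - (\<i> * x) * w x t - complex_of_real (sgn t / T) * iexp (- (t * x))"

lemma w_measurable [measurable]: "w x \<in> borel_measurable borel" "w' x \<in> borel_measurable borel"
  unfolding w_def w'_def by measurable

lemma w_le: "\<bar>t\<bar> \<le> T \<Longrightarrow> norm (w x t) \<le> 1"
proof -
  assume "\<bar>t\<bar> \<le> T"
  then have "\<bar>1 - \<bar>t\<bar> / T\<bar> \<le> 1" using T by (simp add: field_simps)
  then show ?thesis unfolding w_def norm_mult norm_of_real norm_iexp by simp
qed

lemma w_deriv: "t \<noteq> 0 \<Longrightarrow> (w x has_vector_derivative w' x t) (at t)"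
proof -
  assume t: "t \<noteq> 0"
  have "((\<lambda>t. \<bar>t\<bar>) has_real_derivative sgn t) (at t)"
  proof (cases "t > 0")
    case True
    have "((\<lambda>t. t) has_real_derivative sgn t) (at t)" using True by (auto intro!: derivative_eq_intros)
    then show ?thesis by (rule has_field_derivative_transform_within_open[of _ _ _ "{0<..}"]) (use True in auto)
  next
    case False
    have "((\<lambda>t. - t) has_real_derivative sgn t) (at t)" using False t by (auto intro!: derivative_eq_intros)
    then show ?thesis by (rule has_field_derivative_transform_within_open[of _ _ _ "{..<0}"]) (use False t in auto)
  qed
  then have "((\<lambda>t. 1 - \<bar>t\<bar> / T) has_real_derivative - (sgn t / T)) (at t)"
    using T by (auto intro!: derivative_eq_intros)
  then have "((\<lambda>t. complex_of_real (1 - \<bar>t\<bar> / T)) has_vector_derivative complex_of_real (- (sgn t / T))) (at t)"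
    by (simp add: has_real_derivative_iff_has_vector_derivative has_vector_derivative_of_real del: of_real_diff of_real_minus of_real_divide)
  from has_vector_derivative_mult[OF this iexp_has_vector_derivative[of x t]]
  show ?thesis unfolding w_def[abs_def] w'_def by (simp add: algebra_simps)
qed

lemma w_cont: "continuous_on S (w x)"
  unfolding w_def using T by (intro continuous_intros) auto

lemma w_ends: "w x T = 0" "w x (- T) = 0"
  using T by (auto simp: w_def)

lemma kernel_shift: "(\<integral>t. indicator {-T..T} t *\<^sub>R (w x t * iexp (t * y)) \<partial>lborel) = complex_of_real (T * fejer (T * (x - y)))"
proof -
  have "T * (x - y) = - (T * (y - x))" by (simp add: algebra_simps)
  then have "T * fejer (T * (x - y)) = T * fejer (T * (y - x))" by (simp only: fejer_even)
  moreover have "w x t * iexp (t * y) = complex_of_real (1 - \<bar>t\<bar> / T) * iexp (t * (y - x))" for t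
    unfolding w_def by (simp add: algebra_simps exp_diff exp_minus field_simps)
  ultimately show ?thesis using fejer_kernel[of T "y - x"] T by simp
qed

text \<open>A Parseval identity: the pairing of \<open>H\<close> with a kernel whose transform is
  supported in \<open>[-T, T]\<close> depends only on \<open>Hf\<close> in that interval.\<close>

lemma Fubini_HT:
  assumes [measurable]: "u \<in> borel_measurable borel" and u: "\<And>t. \<bar>t\<bar> \<le> T \<Longrightarrow> norm (u t) \<le> c"
  shows "(\<integral>y. H y * (\<integral>t. indicator {-T..T} t *\<^sub>R (u t * iexp (t * y)) \<partial>lborel) \<partial>lborel) =
    (\<integral>t. indicator {-T..T} t *\<^sub>R (u t * Hf t) \<partial>lborel)"
proof -
  have "(\<integral>y. H y * (\<integral>t. indicator {-T..T} t *\<^sub>R (u t * iexp (t * y)) \<partial>lborel) \<partial>lborel) =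
    (\<integral>y. (\<integral>t. H y * (indicator {-T..T} t *\<^sub>R (u t * iexp (t * y))) \<partial>lborel) \<partial>lborel)"
    by (simp only: integral_mult_right_zero)
  also have "\<dots> = (\<integral>t. (\<integral>y. H y * (indicator {-T..T} t *\<^sub>R (u t * iexp (t * y))) \<partial>lborel) \<partial>lborel)"
  proof (rule lborel_pair.Fubini_integral[symmetric], rule lborel_pair.integrable_pair_bound)
    show "integrable lborel (\<lambda>y. \<bar>H y\<bar>)" using H_integrable by auto
    show "integrable lborel (\<lambda>t. c * indicator {-T..T} t)" by (intro integrable_mult_right) (auto simp: emeasure_lborel_Icc_eq)
    show "norm (case (y, t) of (y, t) \<Rightarrow> complex_of_real (H y) * (indicator {-T..T} t *\<^sub>R (u t * iexp (t * y)))) \<le> \<bar>H y\<bar> * (c * indicator {-T..T} t)" for y t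
      using u[of t] by (auto simp: norm_mult indicator_def intro!: mult_left_mono)
  qed simp
  also have "\<dots> = (\<integral>t. indicator {-T..T} t *\<^sub>R (u t * Hf t) \<partial>lborel)"
    unfolding Hf_def by (intro Bochner_Integration.integral_cong refl) (auto simp: indicator_def mult_ac simp flip: integral_mult_right_zero)
  finally show ?thesis .
qed

text \<open>Passes from the Lebesgue integral to the gauge integral, in which the fundamental
  theorem with an exceptional point and the majorant \<open>B\<close> are formulated.\<close>

lemma set_integral_HK:
  assumes "f \<in> borel_measurable borel" "\<And>t. \<bar>t\<bar> \<le> T \<Longrightarrow> norm (f t) \<le> (c :: real)"
  shows "((f :: real \<Rightarrow> complex) has_integral (\<integral>t. indicator {-T..T} t *\<^sub>R f t \<partial>lborel)) {-T..T}"
proof -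
  have "set_integrable lborel {-T..T} f"
    unfolding set_integrable_def
  proof (rule Bochner_Integration.integrable_bound)
    show "integrable lborel (\<lambda>t. c * indicator {-T..T} t :: real)" by (intro integrable_mult_right) (auto simp: emeasure_lborel_Icc_eq)
  qed (use assms in \<open>auto simp: indicator_def intro!: order_trans[OF assms(2) abs_ge_self]\<close>)
  from set_borel_integral_eq_integral[OF this] show ?thesis
    by (simp add: set_lebesgue_integral_def has_integral_iff)
qed

text \<open>The weight vanishes at both ends of the interval, so integration by parts leaves no
  boundary terms; its kink at 0 is one exceptional point.\<close>

lemma has_integral_w_deriv:
  assumes "\<And>t. t \<noteq> 0 \<Longrightarrow> \<bar>t\<bar> < T \<Longrightarrow> (F has_vector_derivative F' t) (at t)" "continuous_on {-T..T} F"
  shows "((\<lambda>t. w' x t * F t + w x t * F' t) has_integral 0) {-T..T}"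
proof -
  have "((\<lambda>t. w' x t * F t + w x t * F' t) has_integral (w x T * F T - w x (-T) * F (-T))) {-T..T}"
  proof (rule fundamental_theorem_of_calculus_interior_strong[of "{0}"])
    fix t assume "t \<in> {-T<..<T} - {0}"
    then show "((\<lambda>t. w x t * F t) has_vector_derivative w' x t * F t + w x t * F' t) (at t)"
      using has_vector_derivative_mult[OF w_deriv[of t x] assms(1)[of t]] by (auto simp: add.commute)
  qed (use T assms(2) in \<open>auto intro!: continuous_intros w_cont\<close>)
  then show ?thesis by (simp add: w_ends)
qed

lemma w'_le: "\<bar>t\<bar> \<le> T \<Longrightarrow> norm (w' x t) \<le> \<bar>x\<bar> + 1"
proof -
  assume t: "\<bar>t\<bar> \<le> T"
  have "norm (w' x t) \<le> norm (\<i> * x * w x t) + norm (complex_of_real (sgn t / T) * iexp (- (t * x)))"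
    unfolding w'_def using norm_triangle_ineq4[of "- (\<i> * x) * w x t"] by (metis mult_minus_left norm_minus_cancel)
  also have "\<dots> \<le> \<bar>x\<bar> * 1 + 1 * 1"
    unfolding norm_mult norm_iexp using w_le[OF t, of x] T
    by (intro add_mono mult_mono) (auto simp: norm_divide sgn_if)
  finally show ?thesis by simp
qed

text \<open>Since \<open>y * iexp (t * y)\<close> is \<open>- \<i>\<close> times a derivative in
  \<open>t\<close>, the factor \<open>y\<close> moves onto the weight by parts.\<close>

lemma kernel_parts:
  "complex_of_real y * (\<integral>t. indicator {-T..T} t *\<^sub>R (w x t * iexp (t * y)) \<partial>lborel) = \<i> * (\<integral>t. indicator {-T..T} t *\<^sub>R (w' x t * iexp (t * y)) \<partial>lborel)"
proof -
  have d: "((\<lambda>t. iexp (t * y)) has_vector_derivative \<i> * y * iexp (t * y)) (at t)" for t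
    using iexp_has_vector_derivative[of "- y" t] by simp
  have 0: "((\<lambda>t. w' x t * iexp (t * y) + w x t * (\<i> * y * iexp (t * y))) has_integral 0) {-T..T}"
    by (rule has_integral_w_deriv[OF d]) (intro continuous_intros)
  have 1: "((\<lambda>t. w' x t * iexp (t * y)) has_integral (\<integral>t. indicator {-T..T} t *\<^sub>R (w' x t * iexp (t * y)) \<partial>lborel)) {-T..T}"
    by (rule set_integral_HK[where c = "\<bar>x\<bar> + 1"]) (use w'_le in \<open>auto simp: norm_mult\<close>)
  have 2: "((\<lambda>t. w x t * iexp (t * y)) has_integral (\<integral>t. indicator {-T..T} t *\<^sub>R (w x t * iexp (t * y)) \<partial>lborel)) {-T..T}"
    by (rule set_integral_HK[where c = 1]) (use w_le in \<open>auto simp: norm_mult\<close>)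
  have "((\<lambda>t. w' x t * iexp (t * y) + \<i> * y * (w x t * iexp (t * y))) has_integral 
     (\<integral>t. indicator {-T..T} t *\<^sub>R (w' x t * iexp (t * y)) \<partial>lborel) + \<i> * y * (\<integral>t. indicator {-T..T} t *\<^sub>R (w x t * iexp (t * y)) \<partial>lborel)) {-T..T}"
    by (intro has_integral_add 1 has_integral_mult_right 2)
  moreover have "(\<lambda>t. w' x t * iexp (t * y) + \<i> * y * (w x t * iexp (t * y))) = (\<lambda>t. w' x t * iexp (t * y) + w x t * (\<i> * y * iexp (t * y)))"
    by (auto simp: mult_ac)
  ultimately have "(\<integral>t. indicator {-T..T} t *\<^sub>R (w' x t * iexp (t * y)) \<partial>lborel) + \<i> * y * (\<integral>t. indicator {-T..T} t *\<^sub>R (w x t * iexp (t * y)) \<partial>lborel) = 0"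
    using has_integral_unique[OF 0] by simp
  then have "\<i> * ((\<integral>t. indicator {-T..T} t *\<^sub>R (w' x t * iexp (t * y)) \<partial>lborel) + \<i> * y * (\<integral>t. indicator {-T..T} t *\<^sub>R (w x t * iexp (t * y)) \<partial>lborel)) = 0"
    by simp
  then show ?thesis by (simp only: ring_distribs mult.assoc[symmetric] i_squared) simp
qed

lemma rescale:
  "(\<integral>v. f (x - v / T) * fejer v \<partial>lborel) = (\<integral>y. f y * (T * fejer (T * (x - y))) \<partial>lborel)"
proof -
  have "(\<integral>v. f (x - v / T) * fejer v \<partial>lborel) = T * (\<integral>y. f (x - (T * x + - T * y) / T) * fejer (T * x + - T * y) \<partial>lborel)"
    using lborel_integral_real_affine[of "- T" "\<lambda>v. f (x - v / T) * fejer v" "T * x"] T by simp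
  also have "\<dots> = (\<integral>y. f y * (T * fejer (T * (x - y))) \<partial>lborel)"
    using T by (simp add: field_simps diff_divide_distrib flip: integral_mult_right_zero)
  finally show ?thesis .
qed

lemma plain_bound: "\<bar>\<integral>v. H (x - v / T) * fejer v \<partial>lborel\<bar> \<le> integral {-T..T} B"
proof -
  have "complex_of_real (\<integral>v. H (x - v / T) * fejer v \<partial>lborel) = (\<integral>y. H y * (\<integral>t. indicator {-T..T} t *\<^sub>R (w x t * iexp (t * y)) \<partial>lborel) \<partial>lborel)"
    unfolding rescale kernel_shift by (simp flip: integral_complex_of_real)
  also have "\<dots> = (\<integral>t. indicator {-T..T} t *\<^sub>R (w x t * Hf t) \<partial>lborel)"
    by (rule Fubini_HT[where c = 1]) (use w_le in auto)
  finally have eq: "complex_of_real (\<integral>v. H (x - v / T) * fejer v \<partial>lborel) = (\<integral>t. indicator {-T..T} t *\<^sub>R (w x t * Hf t) \<partial>lborel)" .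
  have Hfm: "Hf \<in> borel_measurable borel"
    by (intro borel_measurable_continuous_onI continuous_at_imp_continuous_on ballI Hf_cont)
  have Hfb: "norm (Hf t) \<le> (\<integral>y. \<bar>H y\<bar> \<partial>lborel)" for t
    unfolding Hf_def by (rule norm_integral_le) (use H_integrable in \<open>auto simp: norm_mult\<close>)
  have "((\<lambda>t. w x t * Hf t) has_integral (\<integral>t. indicator {-T..T} t *\<^sub>R (w x t * Hf t) \<partial>lborel)) {-T..T}"
  proof (rule set_integral_HK[where c = "1 * (\<integral>y. \<bar>H y\<bar> \<partial>lborel)"])
    show "norm (w x t * Hf t) \<le> 1 * (\<integral>y. \<bar>H y\<bar> \<partial>lborel)" if "\<bar>t\<bar> \<le> T" for t
      unfolding norm_mult by (intro mult_mono Hfb w_le that) auto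
  qed (use Hfm in simp)
  \<comment> \<open>The quotient \<open>h t / t\<close> has the default value 0 at
    \<open>t = 0\<close> and need not agree with \<open>Hf\<close> there; one point does not change
    the integral.\<close>
  then have *: "((\<lambda>t. w x t * (\<i> * (h t / t))) has_integral (\<integral>t. indicator {-T..T} t *\<^sub>R (w x t * Hf t) \<partial>lborel)) {-T..T}"
    by (rule has_integral_spike_finite[of "{0}", rotated 2]) (auto simp: Hf_quot)
  have "norm (integral {-T..T} (\<lambda>t. w x t * (\<i> * (h t / t)))) \<le> integral {-T..T} B"
  proof (rule integral_norm_bound_integral[OF _ B])
    fix t assume "t \<in> {-T..T}"
    then have t: "\<bar>t\<bar> \<le> T" by auto
    have "norm (w x t) * norm (h t / t) \<le> 1 * B t" by (intro mult_mono w_le t hB) auto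
    then show "norm (w x t * (\<i> * (h t / t))) \<le> B t" unfolding norm_mult norm_ii by simp
  qed (use * in blast)
  then show ?thesis unfolding integral_unique[OF *] eq[symmetric] norm_of_real .
qed

text \<open>Two integrations by parts. The first trades the factor \<open>y\<close> at the kernel
  for the derivative of the weight, the second trades that derivative for the one of
  \<open>Hf\<close>. In total the factor \<open>y\<close> turns into a derivative of the transform,
  which \<open>B\<close> dominates.\<close>

lemma weighted_bound: "\<bar>\<integral>v. ((x - v / T) * H (x - v / T)) * fejer v \<partial>lborel\<bar> \<le> integral {-T..T} B"
proof -
  have "complex_of_real (\<integral>v. ((x - v / T) * H (x - v / T)) * fejer v \<partial>lborel) = (\<integral>y. H y * (complex_of_real y * (\<integral>t. indicator {-T..T} t *\<^sub>R (w x t * iexp (t * y)) \<partial>lborel)) \<partial>lborel)"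
    unfolding rescale[of "\<lambda>y. y * H y"] kernel_shift by (simp add: mult_ac flip: integral_complex_of_real)
  also have "\<dots> = (\<integral>y. \<i> * (H y * (\<integral>t. indicator {-T..T} t *\<^sub>R (w' x t * iexp (t * y)) \<partial>lborel)) \<partial>lborel)"
    unfolding kernel_parts by (simp only: mult_ac)
  also have "\<dots> = \<i> * (\<integral>t. indicator {-T..T} t *\<^sub>R (w' x t * Hf t) \<partial>lborel)"
    unfolding integral_mult_right_zero by (subst Fubini_HT[where c = "\<bar>x\<bar> + 1"]) (use w'_le in auto)
  finally have eq: "complex_of_real (\<integral>v. ((x - v / T) * H (x - v / T)) * fejer v \<partial>lborel) = \<i> * (\<integral>t. indicator {-T..T} t *\<^sub>R (w' x t * Hf t) \<partial>lborel)" .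
  let ?J = "\<integral>t. indicator {-T..T} t *\<^sub>R (w' x t * Hf t) \<partial>lborel"
  have Hfm: "Hf \<in> borel_measurable borel"
    by (intro borel_measurable_continuous_onI continuous_at_imp_continuous_on ballI Hf_cont)
  have Hfb: "norm (Hf t) \<le> (\<integral>y. \<bar>H y\<bar> \<partial>lborel)" for t
    unfolding Hf_def by (rule norm_integral_le) (use H_integrable in \<open>auto simp: norm_mult\<close>)
  have J: "((\<lambda>t. w' x t * Hf t) has_integral ?J) {-T..T}"
  proof (rule set_integral_HK[where c = "(\<bar>x\<bar> + 1) * (\<integral>y. \<bar>H y\<bar> \<partial>lborel)"])
    show "norm (w' x t * Hf t) \<le> (\<bar>x\<bar> + 1) * (\<integral>y. \<bar>H y\<bar> \<partial>lborel)" if "\<bar>t\<bar> \<le> T" for t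
      unfolding norm_mult by (intro mult_mono Hfb w'_le that) auto
  qed (use Hfm in simp)
  \<comment> \<open>The derivative of \<open>\<i> * h t / t\<close>, hence of \<open>Hf\<close> away
    from 0.\<close>
  define D where "D t = \<i> * (h' t / t - h t / t\<^sup>2)" for t
  have Hfd: "(Hf has_vector_derivative D t) (at t)" if t: "t \<noteq> 0" "\<bar>t\<bar> < T" for t
  proof -
    have "((\<lambda>z. 1 / z) has_field_derivative - (1 / (complex_of_real t)\<^sup>2)) (at (of_real t))"
      using t by (auto intro!: derivative_eq_intros simp: power2_eq_square)
    from has_vector_derivative_real_field[OF this]
    have "((\<lambda>s. 1 / complex_of_real s) has_vector_derivative - (1 / (complex_of_real t)\<^sup>2)) (at t)" .
    from has_vector_derivative_mult[OF h'[OF t] this]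
    have "((\<lambda>s. \<i> * (h s * (1 / complex_of_real s))) has_vector_derivative \<i> * (h t * - (1 / (complex_of_real t)\<^sup>2) + h' t * (1 / complex_of_real t))) (at t)"
      by (rule has_vector_derivative_mult_right)
    then have "((\<lambda>s. \<i> * (h s / complex_of_real s)) has_vector_derivative D t) (at t)"
      unfolding D_def by (simp add: algebra_simps)
    then show ?thesis
      by (rule has_vector_derivative_transform_within_open[of _ _ _ "- {0}"]) (use t in \<open>auto simp: Hf_quot\<close>)
  qed
  have "((\<lambda>t. w' x t * Hf t + w x t * D t) has_integral 0) {-T..T}"
    by (rule has_integral_w_deriv[OF Hfd]) (auto intro!: continuous_at_imp_continuous_on Hf_cont)
  from has_integral_diff[OF this J] have *: "((\<lambda>t. w x t * D t) has_integral - ?J) {-T..T}" by simp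
  have "norm (integral {-T..T} (\<lambda>t. w x t * D t)) \<le> integral {-T..T} B"
  proof (rule integral_norm_bound_integral[OF _ B])
    fix t assume "t \<in> {-T..T}"
    then have t: "\<bar>t\<bar> \<le> T" by auto
    have "norm (w x t) * norm (h' t / t - h t / t\<^sup>2) \<le> 1 * B t" by (intro mult_mono w_le t h'B) auto
    then show "norm (w x t * D t) \<le> B t" by (simp add: norm_mult D_def)
  qed (use * in blast)
  then have "norm (\<i> * ?J) \<le> integral {-T..T} B" using integral_unique[OF *] by (simp add: norm_mult)
  then show ?thesis unfolding eq[symmetric] norm_of_real .
qed

section \<open>From smoothed bounds to pointwise bounds\<close>

lemma H_bdd: "\<bar>H x\<bar> \<le> 1 + (\<integral>z. \<bar>g z\<bar> \<partial>lborel)" "\<bar>x * H x\<bar> \<le> (\<integral>z. \<bar>z\<bar> \<partial>P) + (\<integral>z. \<bar>z * g z\<bar> \<partial>lborel)"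
proof -
  have s1: "\<bar>stepdiff z x\<bar> \<le> 1" and sx: "\<bar>x\<bar> * \<bar>stepdiff z x\<bar> \<le> \<bar>z\<bar>" for z by (auto simp: stepdiff_def)
  have "\<bar>\<integral>z. stepdiff z x \<partial>P\<bar> \<le> (\<integral>z. 1 \<partial>P)"
    using norm_integral_le[of P "\<lambda>z. 1" "\<lambda>z. stepdiff z x"] s1 by simp
  moreover have "\<bar>\<integral>z. stepdiff z x * g z \<partial>lborel\<bar> \<le> (\<integral>z. \<bar>g z\<bar> \<partial>lborel)"
    using norm_integral_le[of lborel "\<lambda>z. \<bar>g z\<bar>" "\<lambda>z. stepdiff z x * g z"] g s1
    by (simp add: abs_mult mult_left_le_one_le)
  ultimately show "\<bar>H x\<bar> \<le> 1 + (\<integral>z. \<bar>g z\<bar> \<partial>lborel)"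
    unfolding H_eq by (simp add: P.prob_space[simplified])
  have "\<bar>\<integral>z. x * stepdiff z x \<partial>P\<bar> \<le> (\<integral>z. \<bar>z\<bar> \<partial>P)"
    using norm_integral_le[of P "\<lambda>z. \<bar>z\<bar>" "\<lambda>z. x * stepdiff z x"] Pid sx by (simp add: abs_mult)
  moreover have "\<bar>\<integral>z. x * (stepdiff z x * g z) \<partial>lborel\<bar> \<le> (\<integral>z. \<bar>z * g z\<bar> \<partial>lborel)"
  proof -
    have "norm (x * (stepdiff z x * g z)) \<le> \<bar>z * g z\<bar>" for z
      using mult_right_mono[OF sx[of z], of "\<bar>g z\<bar>"] by (simp add: abs_mult mult.assoc)
    from norm_integral_le[of lborel "\<lambda>z. \<bar>z * g z\<bar>" "\<lambda>z. x * (stepdiff z x * g z)", OF _ this] show ?thesis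
      using integrable_abs[OF xg] by simp
  qed
  ultimately show "\<bar>x * H x\<bar> \<le> (\<integral>z. \<bar>z\<bar> \<partial>P) + (\<integral>z. \<bar>z * g z\<bar> \<partial>lborel)"
    unfolding H_eq right_diff_distrib by simp
qed

text \<open>The weight \<open>m\<close> keeps the decay of the density on the interval;
  \<open>m = 1\<close> serves the plain bound, and values growing with the distance to 0 serve the
  weighted one.\<close>

lemma G_diff:
  assumes xy: "x \<le> y" and m: "0 \<le> m" "\<And>z. x \<le> z \<Longrightarrow> z \<le> y \<Longrightarrow> m \<le> 1 + \<bar>z\<bar>"
  shows "m * \<bar>G y - G x\<bar> \<le> K * (y - x)"
proof -
  have i: "integrable lborel (\<lambda>z. indicator {..a} z * g z)" for a
    using integrable_mult_indicator[OF _ g, of "{..a}"] by simp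
  have "m * (G y - G x) = (\<integral>z. m * (indicator {..y} z * g z - indicator {..x} z * g z) \<partial>lborel)"
    unfolding G_def using i by simp
  also have "norm \<dots> \<le> (\<integral>z. K * indicator {x..y} z \<partial>lborel)"
  proof (rule norm_integral_le)
    fix z
    show "norm (m * (indicator {..y} z * g z - indicator {..x} z * g z)) \<le> K * indicator {x..y} z"
    proof (cases "x < z \<and> z \<le> y")
      case True
      then have "m * \<bar>g z\<bar> \<le> (1 + \<bar>z\<bar>) * \<bar>g z\<bar>" by (intro mult_right_mono m) auto
      then show ?thesis using gK[of z] True m by (simp add: abs_mult)
    next
      case False
      have "K \<ge> 0" using gK[of 0] by (meson abs_ge_zero mult_nonneg_nonneg order_trans add_nonneg_nonneg zero_le_one)
      moreover have "indicator {..y} z * g z - indicator {..x} z * g z = 0" using False xy by (auto simp: indicator_def)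
      ultimately show ?thesis by (simp only: mult_zero_right norm_zero) (simp add: indicator_def)
    qed
  qed (intro integrable_mult_right, auto simp: emeasure_lborel_Icc_eq)
  also have "\<dots> = K * (y - x)" using xy by simp
  finally show ?thesis using m by (simp add: abs_mult)
qed

text \<open>A distribution function is monotone, so \<open>H\<close> can fall to the right, or rise
  to the left, only as fast as \<open>G\<close> allows. This one-sided persistence takes the place
  of continuity of \<open>P\<close>, which is discrete in the application.\<close>

lemma H_mono_right: "d \<ge> 0 \<Longrightarrow> H (x + d) \<ge> H x - (G (x + d) - G x)"
  unfolding H_def using P.cdf_nondecreasing[of x "x + d"] by simp

lemma H_mono_left: "d \<ge> 0 \<Longrightarrow> H (x - d) \<le> H x + (G x - G (x - d))"
  unfolding H_def using P.cdf_nondecreasing[of "x - d" x] by simp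

lemma K_nonneg: "K \<ge> 0"
  using order_trans[OF _ gK[of 0]] by simp

abbreviation "\<beta> \<equiv> integral {-T..T} B"
abbreviation "rad \<equiv> 2 * fejer_rad / T"
abbreviation "B1 \<equiv> 2 * (K * rad) + 2 * \<beta> / fejer_mass"

lemma rad: "rad \<ge> 0" "rad \<le> 2 * fejer_rad"
  using T fejer_rad(1) by (auto simp: field_simps)

text \<open>A positive value persists to the right and a negative one to the left, which is the
  hypothesis on near-extremal points in \<open>smoothing_peak\<close>.\<close>

lemma H_le: "\<bar>H x\<bar> \<le> B1"
proof (rule smoothing_peak[OF _ H_measurable H_bdd(1) _ plain_bound])
  fix x
  have KR: "K * d \<le> K * rad" if "d \<in> {0..rad}" for d using that K_nonneg by (intro mult_left_mono) auto
  have "\<exists>s\<in>{1,-1}. \<exists>\<tau>\<in>{1,-1}. \<forall>d\<in>{0..rad}. s * H (x + \<tau> * d) \<ge> \<bar>H x\<bar> - K * rad"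
  proof (cases "H x \<ge> 0")
    case True
    have "1 * H (x + 1 * d) \<ge> \<bar>H x\<bar> - K * rad" if d: "d \<in> {0..rad}" for d
      using H_mono_right[of d x] G_diff[of x "x+d" 1] KR[OF d] d True by auto
    then show ?thesis by blast
  next
    case False
    have "(-1) * H (x + (-1) * d) \<ge> \<bar>H x\<bar> - K * rad" if d: "d \<in> {0..rad}" for d
      using H_mono_left[of d x] G_diff[of "x-d" x 1] KR[OF d] d False by auto
    then show ?thesis by blast
  qed
  then show "\<bar>H x\<bar> \<le> K * rad \<or> (\<exists>s\<in>{1,-1}. \<exists>\<tau>\<in>{1,-1}. \<forall>d\<in>{0..rad}. s * H (x + \<tau> * d) \<ge> \<bar>H x\<bar> - K * rad)" by blast
qed (use T rad K_nonneg in auto)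

text \<open>For \<open>\<bar>x\<bar>\<close> up to \<open>rad\<close> the bound on \<open>H\<close>
  suffices. Beyond it the sign of \<open>H\<close> dictates the direction of persistence and the
  sign of \<open>x\<close> tells whether this leads outward or inward. Outward (\<open>far\<close>)
  the factor \<open>\<bar>x\<bar>\<close> only helps; inward (\<open>near\<close>) it shrinks by
  \<open>d\<close>, which costs \<open>d * \<bar>H x\<bar>\<close> and is paid by the bound on
  \<open>H\<close> already proved.\<close>

lemma xH_le: "\<bar>x * H x\<bar> \<le> 2 * ((1 + 2 * fejer_rad) * (K * rad) + B1 * rad) + 2 * \<beta> / fejer_mass"
proof (rule smoothing_peak[where U = "\<lambda>x. x * H x" and Nb = "(\<integral>z. \<bar>z\<bar> \<partial>P) + (\<integral>z. \<bar>z * g z\<bar> \<partial>lborel)"])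
  let ?L = "(1 + 2 * fejer_rad) * (K * rad) + B1 * rad"
  have B1: "B1 \<ge> 0" using H_le[of 0] by linarith
  have a0: "fejer_rad > 0" by (rule fejer_rad)
  have Kr: "0 \<le> K * rad" by (intro mult_nonneg_nonneg K_nonneg rad)
  have L1: "(1 + 2 * fejer_rad) * (K * rad) \<ge> 0" by (intro mult_nonneg_nonneg Kr) (use a0 in auto)
  show "0 \<le> ?L" by (intro add_nonneg_nonneg L1 mult_nonneg_nonneg B1 rad)
  show "\<bar>\<integral>v. (x - v / T) * H (x - v / T) * fejer v \<partial>lborel\<bar> \<le> \<beta>" for x by (rule weighted_bound)
  fix x
  show "\<bar>x * H x\<bar> \<le> ?L \<or> (\<exists>s\<in>{1,-1}. \<exists>\<tau>\<in>{1,-1}. \<forall>d\<in>{0..rad}. s * ((x + \<tau> * d) * H (x + \<tau> * d)) \<ge> \<bar>x * H x\<bar> - ?L)"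
  proof (cases "\<bar>x\<bar> \<le> rad")
    case True
    have "\<bar>x * H x\<bar> \<le> rad * B1" unfolding abs_mult by (intro mult_mono True H_le rad) auto
    then show ?thesis using L1 by (simp add: mult.commute)
  next
    case x: False
    have KR: "K * d \<le> K * rad" if "d \<in> {0..rad}" for d using that K_nonneg by (intro mult_left_mono) auto
    have far: "(\<bar>x\<bar> + d) * \<bar>G u - G v\<bar> \<le> (1 + 2 * fejer_rad) * (K * rad)"
      if d: "d \<in> {0..rad}" and le: "(1 + \<bar>x\<bar>) * \<bar>G u - G v\<bar> \<le> K * d" for d u v
    proof -
      have "(\<bar>x\<bar> + d) \<le> (1 + d) * (1 + \<bar>x\<bar>)" using d by (auto simp: algebra_simps)
      then have "(\<bar>x\<bar> + d) * \<bar>G u - G v\<bar> \<le> (1 + d) * ((1 + \<bar>x\<bar>) * \<bar>G u - G v\<bar>)"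
        using mult_right_mono[of "\<bar>x\<bar> + d" "(1 + d) * (1 + \<bar>x\<bar>)" "\<bar>G u - G v\<bar>"] by (simp add: mult.assoc)
      also have "\<dots> \<le> (1 + 2 * fejer_rad) * (K * rad)"
        by (rule mult_mono[OF _ order_trans[OF le KR[OF d]]]) (use d rad in auto)
      finally show ?thesis .
    qed
    have near: "y * \<bar>G u - G v\<bar> \<le> (1 + 2 * fejer_rad) * (K * rad)"
      if d: "d \<in> {0..rad}" and le: "(1 + y) * \<bar>G u - G v\<bar> \<le> K * d" for d u v y
    proof -
      have "y * \<bar>G u - G v\<bar> \<le> (1 + y) * \<bar>G u - G v\<bar>" by (intro mult_right_mono) auto
      also have "\<dots> \<le> 1 * (K * rad)" using le KR[OF d] by simp
      also have "\<dots> \<le> (1 + 2 * fejer_rad) * (K * rad)" using a0 Kr by (intro mult_right_mono) auto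
      finally show ?thesis .
    qed
    have dB: "d * \<bar>H x\<bar> \<le> B1 * rad" if "d \<in> {0..rad}" for d
      using mult_mono[of "\<bar>H x\<bar>" B1 d rad] that H_le[of x] B1 by (simp add: mult.commute)
    have B1r: "0 \<le> B1 * rad" by (intro mult_nonneg_nonneg B1 rad)
    consider (a) "x > 0" "H x \<ge> 0" | (b) "x > 0" "H x < 0" | (c) "x < 0" "H x < 0" | (d) "x < 0" "H x \<ge> 0"
      using x rad(1) by linarith
    then have "\<exists>s\<in>{1,-1}. \<exists>\<tau>\<in>{1,-1}. \<forall>d\<in>{0..rad}. s * ((x + \<tau> * d) * H (x + \<tau> * d)) \<ge> \<bar>x * H x\<bar> - ?L"
    proof cases
      case a
      have "1 * ((x + 1 * d) * H (x + 1 * d)) \<ge> \<bar>x * H x\<bar> - ?L" if d: "d \<in> {0..rad}" for d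
      proof -
        have "(1 + \<bar>x\<bar>) * \<bar>G (x + d) - G x\<bar> \<le> K * d" using G_diff[of x "x + d" "1 + \<bar>x\<bar>"] d a by auto
        note f = far[OF d this]
        have "(x + d) * (H x - \<bar>G (x + d) - G x\<bar>) \<le> (x + d) * H (x + d)"
          using H_mono_right[of d x] d a by (intro mult_left_mono) auto
        moreover have "x * H x \<le> (x + d) * H x" using a d by (intro mult_right_mono) auto
        ultimately show ?thesis using f a B1r by (simp add: right_diff_distrib)
      qed
      then show ?thesis by blast
    next
      case b
      have "(-1) * ((x + (-1) * d) * H (x + (-1) * d)) \<ge> \<bar>x * H x\<bar> - ?L" if d: "d \<in> {0..rad}" for d
      proof -
        have y: "x - d \<ge> 0" using d x b by auto
        have "(1 + (x - d)) * \<bar>G x - G (x - d)\<bar> \<le> K * d" using G_diff[of "x - d" x "1 + (x - d)"] d y by auto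
        note f = near[OF d this]
        have "(x - d) * H (x - d) \<le> (x - d) * (H x + \<bar>G x - G (x - d)\<bar>)"
          using H_mono_left[of d x] d y by (intro mult_left_mono) auto
        moreover have "(x - d) * H x = x * H x + d * \<bar>H x\<bar>" using b by (simp add: algebra_simps)
        moreover have "\<bar>x * H x\<bar> = - (x * H x)" using b by (simp add: abs_mult)
        ultimately show ?thesis using f dB[OF d] by (simp add: ring_distribs(1))
      qed
      then show ?thesis by blast
    next
      case c
      have "1 * ((x + (-1) * d) * H (x + (-1) * d)) \<ge> \<bar>x * H x\<bar> - ?L" if d: "d \<in> {0..rad}" for d
      proof -
        have "(1 + \<bar>x\<bar>) * \<bar>G x - G (x - d)\<bar> \<le> K * d" using G_diff[of "x - d" x "1 + \<bar>x\<bar>"] d c by auto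
        note f = far[OF d this]
        have "(d - x) * H (x - d) \<le> (d - x) * (H x + \<bar>G x - G (x - d)\<bar>)"
          using H_mono_left[of d x] d c by (intro mult_left_mono) auto
        moreover have "(d - x) * H x \<le> (- x) * H x" using c d by (intro mult_right_mono_neg) auto
        moreover have "\<bar>x * H x\<bar> = x * H x" using c by (simp add: abs_mult)
        moreover have "\<bar>x\<bar> + d = d - x" using c by simp
        moreover have "(x - d) * H (x - d) = - ((d - x) * H (x - d))" by (simp add: algebra_simps)
        ultimately show ?thesis using f B1r by (simp add: ring_distribs(1))
      qed
      then show ?thesis by blast
    next
      case d
      have "(-1) * ((x + 1 * d) * H (x + 1 * d)) \<ge> \<bar>x * H x\<bar> - ?L" if d': "d \<in> {0..rad}" for d
      proof -
        have y: "- x - d \<ge> 0" using d' x d by auto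
        have "(1 + (- x - d)) * \<bar>G (x + d) - G x\<bar> \<le> K * d" using G_diff[of x "x + d" "1 + (- x - d)"] d' y by auto
        note f = near[OF d' this]
        have "(- x - d) * (H x - \<bar>G (x + d) - G x\<bar>) \<le> (- x - d) * H (x + d)"
          using H_mono_right[of d x] d' y by (intro mult_left_mono) auto
        moreover have "(- x - d) * H x = - (x * H x) - d * \<bar>H x\<bar>" using d by (simp add: algebra_simps)
        moreover have "\<bar>x * H x\<bar> = - (x * H x)" using d by (simp add: abs_mult)
        moreover have "(x + d) * H (x + d) = - ((- x - d) * H (x + d))" by (simp add: algebra_simps)
        ultimately show ?thesis using f dB[OF d'] by (simp add: right_diff_distrib)
      qed
      then show ?thesis by blast
    qed
    then show ?thesis by blast
  qed
qed (use T H_bdd(2) in auto)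

theorem smoothing_bound:
  "(1 + \<bar>x\<bar>) * \<bar>H x\<bar> \<le> smooth_const * (\<beta> + K / T)"
proof -
  let ?a = fejer_rad and ?m = fejer_mass
  define r where "r = \<beta> + K / T"
  have a0: "?a > 0" and m0: "?m > 0" by (rule fejer_rad fejer_mass_pos)+
  have \<beta>: "\<beta> \<ge> 0" using plain_bound[of 0] by linarith
  have KT: "K / T \<ge> 0" using K_nonneg T by simp
  have r: "\<beta> \<le> r" "K / T \<le> r" "r \<ge> 0" using \<beta> KT by (auto simp: r_def)
  have Kr: "K * rad \<le> 2 * ?a * r"
    using mult_left_mono[OF r(2), of "2 * ?a"] a0 by (simp add: mult_ac)
  have bm: "2 * \<beta> / ?m \<le> 2 / ?m * r"
    using mult_left_mono[OF r(1), of "2 / ?m"] m0 by simp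
  have B1: "B1 \<le> (4 * ?a + 2 / ?m) * r" using Kr bm by (simp add: distrib_right)
  have B1r: "B1 * rad \<le> (2 * ?a) * ((4 * ?a + 2 / ?m) * r)"
    using mult_mono[OF B1 rad(2)] B1 H_le[of 0] rad a0 m0 r(3) by (simp add: mult_ac) 
  have "(1 + \<bar>x\<bar>) * \<bar>H x\<bar> = \<bar>H x\<bar> + \<bar>x * H x\<bar>" by (simp add: ring_distribs abs_mult)
  also have "\<dots> \<le> B1 + (2 * ((1 + 2 * ?a) * (K * rad) + B1 * rad) + 2 * \<beta> / ?m)"
    by (intro add_mono H_le xH_le)
  also have "\<dots> \<le> (4 * ?a + 2 / ?m) * r + (2 * ((1 + 2 * ?a) * (2 * ?a * r) + (2 * ?a) * ((4 * ?a + 2 / ?m) * r)) + 2 / ?m * r)"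
    by (intro add_mono mult_left_mono B1 B1r Kr bm) (use a0 in auto)
  also have "\<dots> = smooth_const * r" unfolding smooth_const_def by (simp add: algebra_simps add_divide_distrib)
  finally show ?thesis unfolding r_def .
qed

end

section \<open>The semistable exponent\<close>

text \<open>Termwise differentiation by the Weierstrass test on balls. The majorant may depend on
  the radius \<open>R\<close>, because the differentiated terms of \<open>Ym\<close> are only
  bounded linearly in \<open>t\<close>.\<close>

lemma series_has_vector_derivative:
  fixes u u' :: "nat \<Rightarrow> real \<Rightarrow> complex"
  assumes d: "\<And>n t. (u n has_vector_derivative u' n t) (at t)"
    and M: "\<And>R. R > 0 \<Longrightarrow> summable (M R)" "\<And>R n t. \<bar>t\<bar> < R \<Longrightarrow> norm (u' n t) \<le> M R n"
    and s0: "summable (\<lambda>n. u n 0)"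
  shows "summable (\<lambda>n. u n t)" "((\<lambda>t. \<Sum>n. u n t) has_vector_derivative (\<Sum>n. u' n t)) (at t)"
    "(\<And>n t. isCont (u' n) t) \<Longrightarrow> isCont (\<lambda>t. \<Sum>n. u' n t) t"
proof -
  define R where "R = \<bar>t\<bar> + 1"
  let ?S = "ball 0 R :: real set"
  have tS: "t \<in> ?S" "R > 0" by (auto simp: R_def)
  have ul: "uniform_limit ?S (\<lambda>n x. \<Sum>i<n. u' i x) (\<lambda>x. \<Sum>i. u' i x) sequentially"
    by (rule Weierstrass_m_test[OF M(2) M(1)]) (use tS in auto)
  have "\<exists>g. \<forall>x\<in>?S. (\<lambda>n. u n x) sums g x \<and> (g has_derivative (\<lambda>h. h *\<^sub>R (\<Sum>i. u' i x))) (at x within ?S)"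
  proof (rule has_derivative_series[where x = 0])
    show "(u n has_derivative (\<lambda>h. h *\<^sub>R u' n x)) (at x within ?S)" for n x
      using d[of n x] by (auto simp: has_vector_derivative_def intro: has_derivative_at_withinI)
    show "(\<lambda>n. u n 0) sums (\<Sum>n. u n 0)" using s0 by (rule summable_sums)
    fix e :: real assume "e > 0"
    from ul[unfolded uniform_limit_iff, rule_format, OF this]
    show "\<forall>\<^sub>F n in sequentially. \<forall>x\<in>?S. \<forall>h. norm ((\<Sum>i<n. h *\<^sub>R u' i x) - h *\<^sub>R (\<Sum>i. u' i x)) \<le> e * norm h"
    proof eventually_elim
      case (elim n)
      show ?case
      proof (intro ballI allI)
        fix x h assume "x \<in> ?S"
        with elim have "norm ((\<Sum>i<n. u' i x) - (\<Sum>i. u' i x)) \<le> e" by (auto simp: dist_norm intro: less_imp_le)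
        then have "\<bar>h\<bar> * norm ((\<Sum>i<n. u' i x) - (\<Sum>i. u' i x)) \<le> \<bar>h\<bar> * e" by (rule mult_left_mono) auto
        then show "norm ((\<Sum>i<n. h *\<^sub>R u' i x) - h *\<^sub>R (\<Sum>i. u' i x)) \<le> e * norm h"
          by (simp add: mult.commute flip: scaleR_sum_right scaleR_right_diff_distrib)
      qed
    qed
  qed (use tS in auto)
  then obtain g where g: "\<And>x. x \<in> ?S \<Longrightarrow> (\<lambda>n. u n x) sums g x"
    and g': "\<And>x. x \<in> ?S \<Longrightarrow> (g has_vector_derivative (\<Sum>i. u' i x)) (at x within ?S)"
    unfolding has_vector_derivative_def by blast
  show "summable (\<lambda>n. u n t)" using g[OF tS(1)] by (rule sums_summable)
  have "(g has_vector_derivative (\<Sum>i. u' i t)) (at t)"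
    using g'[OF tS(1)] tS(1) by (simp add: at_within_open[of t ?S])
  then show "((\<lambda>t. \<Sum>n. u n t) has_vector_derivative (\<Sum>n. u' n t)) (at t)"
    by (rule has_vector_derivative_transform_within_open[of _ _ _ ?S]) (use tS g in \<open>auto simp: sums_iff\<close>)
  show "isCont (\<lambda>t. \<Sum>n. u' n t) t" if "\<And>n t. isCont (u' n) t"
  proof -
    have "continuous_on ?S (\<lambda>t. \<Sum>n. u' n t)"
      by (rule uniform_limit_theorem[OF always_eventually ul])
         (use that in \<open>auto intro!: continuous_on_sum continuous_at_imp_continuous_on\<close>)
    then show ?thesis using tS(1) by (simp add: continuous_on_eq_continuous_at)
  qed
qed

locale stp =
  fixes p \<alpha> :: real
  assumes p: "0 < p" "p < 1" and \<alpha>: "1 < \<alpha>" "\<alpha> < 2"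
begin

section \<open>Constants of the law and the geometric series behind them\<close>

definition "q = 1 - p"
definition "r = 1 / (1 - p)"
definition "rho = r powr (1 / \<alpha>)"
definition "kap = 1 / rho"
definition "mu1 = mu \<alpha> p 1"
definition "mu2 = mu \<alpha> p 2"

lemma q: "0 < q" "q < 1" "qq p = q" using p by (auto simp: q_def qq_def)
lemma r: "r > 1" "r > 0" "r = 1 / q" "rr p = r" using p by (auto simp: r_def q_def rr_def)
lemma rho: "rho > 1" "rho > 0" using r \<alpha> by (auto simp: rho_def)
lemma kap: "kap > 0" "kap < 1" "rho * kap = 1" using rho by (auto simp: kap_def)

lemma rho_powr: "rho powr \<alpha> = r" using \<alpha> r by (simp add: rho_def powr_powr)
lemma kap_powr: "kap = q powr (1 / \<alpha>)"
proof -
  have "q = 1 / r" using r q by simp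
  then show ?thesis using r by (simp add: kap_def rho_def powr_divide)
qed

text \<open>This is the place of \<alpha> > 1: the ratio of the series for the mean of
  \<open>X\<close> is below 1.\<close>

lemma rho_q: "rho * q < 1" "0 < rho * q"
proof -
  have "r powr (1 / \<alpha>) < r powr 1" using \<alpha> r by (intro powr_less_mono) auto
  then have "rho < 1 / q" using r by (simp add: rho_def)
  then show "rho * q < 1" using q by (simp add: field_simps)
qed (use rho q in simp)

lemma kap_q: "q < kap"
  using rho_q rho by (simp add: kap_def field_simps)

text \<open>The ratio of the series of second moments of the small jumps; it is below 1 because
  \<alpha> < 2.\<close>

definition "\<theta> = r * kap\<^sup>2"
lemma \<theta>: "0 < \<theta>" "\<theta> < 1"
proof -
  have "r powr 1 < r powr (2 / \<alpha>)" using \<alpha> r by (intro powr_less_mono) auto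
  also have "\<dots> = rho powr 2" by (simp add: rho_def powr_powr)
  finally have "r < rho\<^sup>2" using rho r by (simp add: powr_numeral)
  then show "\<theta> < 1" using rho by (simp add: \<theta>_def kap_def field_simps)
qed (use r kap in \<open>simp add: \<theta>_def\<close>)

lemma kap2_q: "kap\<^sup>2 < q" using \<theta> q r(3) by (simp add: \<theta>_def field_simps)

lemma mu1: "mu1 = p / (kap - q)" "mu1 > 0"
proof -
  show *: "mu1 = p / (kap - q)" by (simp add: mu1_def mu_def q kap_powr)
  show "mu1 > 0" unfolding * using p kap_q by simp
qed

lemma mu2: "mu2 = p / (kap\<^sup>2 - q)" "mu2 < 0"
proof -
  have "q powr (2 / \<alpha>) = kap\<^sup>2" using q by (simp add: kap_powr power2_eq_square flip: powr_add)
  then show *: "mu2 = p / (kap\<^sup>2 - q)" by (simp add: mu2_def mu_def q)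
  show "mu2 < 0" unfolding * using p kap2_q by (simp add: divide_pos_neg)
qed

text \<open>Weights of the two halves of the bilateral series. \<open>Wf k\<close> belongs to the
  exponent \<open>k + 1\<close> and is the probability of the value \<open>rho ^ Suc k\<close>;
  \<open>Wm k\<close> belongs to the exponent \<open>- k\<close>, that is, to the jump
  \<open>kap ^ k\<close>.\<close>

definition "Wf k = p * q ^ k"
definition "Wm k = p / q * r ^ k"

lemma Wf: "Wf k > 0" "Wf sums 1" and Wm: "Wm k > 0" 
proof -
  show "Wf k > 0" "Wm k > 0" using p q r by (auto simp: Wf_def Wm_def)
  have "(\<lambda>k. p * q ^ k) sums (p * (1 / (1 - q)))" using q by (intro sums_mult geometric_sums) auto
  then show "Wf sums 1" using p by (simp add: q_def Wf_def[abs_def])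
qed

lemma rho_Wf: "(\<lambda>k. rho ^ Suc k * Wf k) sums mu1"
proof -
  have "(\<lambda>k. p * rho * (rho * q) ^ k) sums (p * rho * (1 / (1 - rho * q)))"
    using rho_q by (intro sums_mult geometric_sums) auto
  moreover have "p * rho * (rho * q) ^ k = rho ^ Suc k * Wf k" for k by (simp add: Wf_def power_mult_distrib)
  moreover have "p * rho * (1 / (1 - rho * q)) = mu1" unfolding mu1 using rho rho_q kap_q by (simp add: kap_def field_simps)
  ultimately show ?thesis by simp
qed

text \<open>The closed form \<open>mu2\<close> would be the second moment of \<open>X\<close> if its
  geometric series converged. As the two halves of a bilateral geometric series formally cancel, it
  is minus the second moment of the small jumps, hence negative. This identity brings
  \<open>mu2\<close> into the expansion.\<close>

lemma kap_Wm: "(\<lambda>k. (kap ^ k)\<^sup>2 * Wm k) sums - mu2"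
proof -
  have "(\<lambda>k. p / q * \<theta> ^ k) sums (p / q * (1 / (1 - \<theta>)))"
    using \<theta> by (intro sums_mult geometric_sums) auto
  moreover have "p / q * \<theta> ^ k = (kap ^ k)\<^sup>2 * Wm k" for k by (simp add: Wm_def \<theta>_def power_mult_distrib power2_eq_square)
  moreover have "p / q * (1 / (1 - \<theta>)) = - mu2" unfolding mu2 \<theta>_def r(3) using q kap2_q by (simp add: field_simps)
  ultimately show ?thesis by simp
qed

lemma kap_Wm_summable: "m \<ge> 2 \<Longrightarrow> summable (\<lambda>k. (kap ^ k) ^ m * Wm k)"
proof (rule summable_comparison_test'[OF sums_summable[OF kap_Wm], of 0])
  fix k assume "m \<ge> 2"
  then have "(kap ^ k) ^ m \<le> (kap ^ k)\<^sup>2" using kap by (intro power_decreasing power_le_one) auto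
  then show "norm ((kap ^ k) ^ m * Wm k) \<le> (kap ^ k)\<^sup>2 * Wm k" using kap Wm[of k] by (simp add: mult_right_mono)
qed

text \<open>\<open>f\<close> is the characteristic function of \<open>X\<close>. The exponent is \<open>Y\<close> up to scaling: \<open>y\<^sub>\<gamma>(t) = \<gamma> Y(t \<gamma>\<^bsup>-1/\<alpha>\<^esup>)\<close>;
  the terms with \<open>k \<ge> 1\<close> sum to \<open>f s - 1 - \<i> s \<mu>\<^sub>1\<close> and those with \<open>k \<le> 0\<close> to \<open>Ym s\<close>, so that the centered
  characteristic function is an explicit perturbation of \<open>exp (Y s)\<close>.\<close>
definition "f s = (\<Sum>k. iexp (s * rho ^ Suc k) * Wf k)"
definition "f' s = (\<Sum>k. \<i> * rho ^ Suc k * iexp (s * rho ^ Suc k) * Wf k)"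
definition "Ym s = (\<Sum>k. (iexp (s * kap ^ k) - 1 - \<i> * (s * kap ^ k)) * Wm k)"
definition "Ym1 s = (\<Sum>k. \<i> * kap ^ k * (iexp (s * kap ^ k) - 1) * Wm k)"
text \<open>For \<open>m >= 2\<close> the \<open>m\<close>-th derivative of \<open>Ym\<close>.
  Moments of the small jumps of every order from 2 on are finite, so \<open>Ym\<close> is smooth, in
  contrast to \<open>f\<close>.\<close>

definition "Yd m s = (\<Sum>k. (\<i> * kap ^ k) ^ m * iexp (s * kap ^ k) * Wm k)"
definition "Y s = f s - 1 - \<i> * s * mu1 + Ym s"
definition "Y' s = f' s - \<i> * mu1 + Ym1 s"

lemma iexp_deriv: "((\<lambda>s. iexp (s * a)) has_vector_derivative \<i> * a * iexp (s * a)) (at s)"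
  using iexp_has_vector_derivative[of "- a" s] by simp

lemma norm_f_term: "norm (iexp (s * a) * complex_of_real w) = \<bar>w\<bar>" by (simp add: norm_mult)

lemma f_summable: "summable (\<lambda>k. norm (iexp (s * rho ^ Suc k) * Wf k))"
  unfolding norm_f_term using sums_summable[OF Wf(2)] Wf(1) by (simp add: less_imp_le)

lemma f_deriv: "(f has_vector_derivative f' s) (at s)" and f'_cont: "isCont f' s"
proof -
  note S = series_has_vector_derivative[where u = "\<lambda>k s. iexp (s * rho ^ Suc k) * Wf k" and u' = "\<lambda>k s. \<i> * rho ^ Suc k * iexp (s * rho ^ Suc k) * Wf k" and M = "\<lambda>R k. rho ^ Suc k * Wf k"]
  have 1: "((\<lambda>s. iexp (s * rho ^ Suc k) * Wf k) has_vector_derivative \<i> * rho ^ Suc k * iexp (s * rho ^ Suc k) * Wf k) (at s)" for k s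
    using has_vector_derivative_mult_left[OF iexp_deriv[of "rho ^ Suc k" s]] by (simp only: of_real_power)
  have 2: "norm (\<i> * rho ^ Suc k * iexp (s * rho ^ Suc k) * Wf k) \<le> rho ^ Suc k * Wf k" for k s
    unfolding norm_mult norm_iexp using rho Wf(1)[of k] by (simp add: norm_mult norm_power)
  show "(f has_vector_derivative f' s) (at s)" unfolding f_def[abs_def] f'_def
    by (rule S(2)[OF 1 sums_summable[OF rho_Wf] 2 summable_norm_cancel[OF f_summable]])
  have 3: "isCont (\<lambda>s. \<i> * rho ^ Suc k * iexp (s * rho ^ Suc k) * Wf k) s" for k s
    by (intro continuous_intros)
  show "isCont f' s" unfolding f'_def[abs_def]
    by (rule S(3)[OF 1 sums_summable[OF rho_Wf] 2 summable_norm_cancel[OF f_summable] 3])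
qed

lemma f_0: "f 0 = 1" and f'_0: "f' 0 = \<i> * mu1"
proof -
  have "(\<lambda>k. complex_of_real (Wf k)) sums complex_of_real 1" by (rule sums_of_real[OF Wf(2)])
  then show "f 0 = 1" unfolding f_def by (simp add: sums_iff)
  have "(\<lambda>k. \<i> * complex_of_real (rho ^ Suc k * Wf k)) sums (\<i> * complex_of_real mu1)" by (intro sums_mult sums_of_real rho_Wf)
  then show "f' 0 = \<i> * mu1" unfolding f'_def by (simp add: sums_iff mult.assoc)
qed

lemma norm_f: "norm (f s) \<le> 1" and norm_f': "norm (f' s) \<le> mu1"
proof -
  have "norm (f s) \<le> (\<Sum>k. norm (iexp (s * rho ^ Suc k) * Wf k))" unfolding f_def by (rule summable_norm[OF f_summable])
  also have "\<dots> = 1" unfolding norm_f_term using Wf by (simp add: sums_iff less_imp_le)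
  finally show "norm (f s) \<le> 1" .
  have eq: "norm (\<i> * rho ^ Suc k * iexp (s * rho ^ Suc k) * Wf k) = rho ^ Suc k * Wf k" for k
    unfolding norm_mult norm_iexp using rho Wf(1)[of k] by (simp add: norm_mult norm_power)
  have "norm (f' s) \<le> (\<Sum>k. norm (\<i> * rho ^ Suc k * iexp (s * rho ^ Suc k) * Wf k))" unfolding f'_def
    by (rule summable_norm) (unfold eq, rule sums_summable[OF rho_Wf])
  also have "\<dots> = mu1" unfolding eq using rho_Wf by (simp add: sums_iff)
  finally show "norm (f' s) \<le> mu1" .
qed

lemma iexp_1: "norm (iexp x - 1) \<le> \<bar>x\<bar>" and iexp_2: "norm (iexp x - 1 - \<i> * x) \<le> x\<^sup>2 / 2"
  using iexp_approx1[of x 0] iexp_approx1[of x 1] by (simp_all add: power2_eq_square algebra_simps)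

lemma Ym_term_le: "norm ((iexp (s * kap ^ k) - 1 - \<i> * (s * kap ^ k)) * Wm k) \<le> s\<^sup>2 / 2 * ((kap ^ k)\<^sup>2 * Wm k)"
  using mult_right_mono[OF iexp_2[of "s * kap ^ k"], of "Wm k"] Wm[of k] by (simp add: norm_mult power_mult_distrib)

lemma Ym1_term_le: "norm (\<i> * kap ^ k * (iexp (s * kap ^ k) - 1) * Wm k) \<le> \<bar>s\<bar> * ((kap ^ k)\<^sup>2 * Wm k)"
proof -
  have "kap ^ k * norm (iexp (s * kap ^ k) - 1) * Wm k \<le> kap ^ k * \<bar>s * kap ^ k\<bar> * Wm k"
    using iexp_1[of "s * kap ^ k"] kap Wm[of k] by (intro mult_right_mono mult_left_mono) auto
  then show ?thesis using kap Wm[of k] by (simp add: norm_mult norm_power abs_mult power2_eq_square mult_ac)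
qed

lemma Yd_term_le: "norm ((\<i> * kap ^ k) ^ m * iexp (s * kap ^ k) * Wm k) = (kap ^ k) ^ m * Wm k"
  unfolding norm_mult norm_iexp norm_power using kap Wm[of k] by (simp add: norm_power)

lemma Ym_summable: "summable (\<lambda>k. norm ((iexp (s * kap ^ k) - 1 - \<i> * (s * kap ^ k)) * Wm k))"
  by (rule summable_comparison_test'[OF summable_mult[OF sums_summable[OF kap_Wm], of "s\<^sup>2/2"], of 0])
     (use Ym_term_le in simp)

lemma Ym1_summable: "summable (\<lambda>k. norm (\<i> * kap ^ k * (iexp (s * kap ^ k) - 1) * Wm k))"
  by (rule summable_comparison_test'[OF summable_mult[OF sums_summable[OF kap_Wm], of "\<bar>s\<bar>"], of 0])
     (use Ym1_term_le in simp)

lemma Ym_deriv: "(Ym has_vector_derivative Ym1 s) (at s)"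
proof -
  have 1: "((\<lambda>s. (iexp (s * kap ^ k) - 1 - \<i> * (s * kap ^ k)) * Wm k) has_vector_derivative \<i> * kap ^ k * (iexp (s * kap ^ k) - 1) * Wm k) (at s)" for k s
  proof -
    have "((\<lambda>s. complex_of_real (s * kap ^ k)) has_vector_derivative kap ^ k) (at s)"
      by (auto intro!: derivative_eq_intros simp: has_vector_derivative_def scaleR_conv_of_real)
    then have "((\<lambda>s. \<i> * complex_of_real (s * kap ^ k)) has_vector_derivative \<i> * kap ^ k) (at s)"
      by (rule has_vector_derivative_mult_right)
    from has_vector_derivative_mult_left[OF has_vector_derivative_diff[OF has_vector_derivative_diff[OF iexp_deriv[of "kap ^ k" s] has_vector_derivative_const] this], of 1 "Wm k"]
    show ?thesis by (simp add: algebra_simps)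
  qed
  have 2: "norm (\<i> * kap ^ k * (iexp (s * kap ^ k) - 1) * Wm k) \<le> R * ((kap ^ k)\<^sup>2 * Wm k)" if "\<bar>s\<bar> < R" for R k s
  proof -
    have "\<bar>s\<bar> * ((kap ^ k)\<^sup>2 * Wm k) \<le> R * ((kap ^ k)\<^sup>2 * Wm k)" using that Wm[of k] by (intro mult_right_mono) auto
    then show ?thesis using Ym1_term_le[of k s] by linarith
  qed
  show ?thesis unfolding Ym_def[abs_def] Ym1_def
    by (rule series_has_vector_derivative(2)[OF 1 summable_mult[OF sums_summable[OF kap_Wm]] 2 summable_norm_cancel[OF Ym_summable]])
qed

lemma Ym1_deriv: "(Ym1 has_vector_derivative Yd 2 s) (at s)"
proof -
  have 1: "((\<lambda>s. \<i> * kap ^ k * (iexp (s * kap ^ k) - 1) * Wm k) has_vector_derivative (\<i> * kap ^ k) ^ 2 * iexp (s * kap ^ k) * Wm k) (at s)" for k s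
    using has_vector_derivative_mult_left[OF has_vector_derivative_mult_right[OF has_vector_derivative_diff[OF iexp_deriv[of "kap ^ k" s] has_vector_derivative_const[of 1]], of "\<i> * kap ^ k"], of "Wm k"]
    by (simp add: power2_eq_square mult_ac)
  show ?thesis unfolding Ym1_def[abs_def] Yd_def
    by (rule series_has_vector_derivative(2)[OF 1 kap_Wm_summable[of 2] _ summable_norm_cancel[OF Ym1_summable]]) (simp_all only: Yd_term_le order_refl)
qed

lemma Yd_deriv: "m \<ge> 2 \<Longrightarrow> (Yd m has_vector_derivative Yd (Suc m) s) (at s)"
proof -
  assume m: "m \<ge> 2"
  have 1: "((\<lambda>s. (\<i> * kap ^ k) ^ m * iexp (s * kap ^ k) * Wm k) has_vector_derivative (\<i> * kap ^ k) ^ Suc m * iexp (s * kap ^ k) * Wm k) (at s)" for k s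
    using has_vector_derivative_mult_left[OF has_vector_derivative_mult_right[OF iexp_deriv[of "kap ^ k" s]], of "Wm k" "(\<i> * kap ^ k) ^ m"]
    by (simp add: mult_ac)
  have 2: "summable (\<lambda>k. (\<i> * kap ^ k) ^ m * iexp (0 * kap ^ k) * Wm k)"
    by (rule summable_norm_cancel) (simp only: Yd_term_le kap_Wm_summable[OF m])
  show ?thesis unfolding Yd_def[abs_def]
    by (rule series_has_vector_derivative(2)[OF 1 kap_Wm_summable[of "Suc m"] _ 2]) (use m in \<open>simp_all only: Yd_term_le order_refl le_SucI\<close>)
qed

lemma norm_Yd: "m \<ge> 2 \<Longrightarrow> norm (Yd m s) \<le> (\<Sum>k. (kap ^ k) ^ m * Wm k)"
  unfolding Yd_def by (rule order_trans[OF summable_norm]) (simp_all only: Yd_term_le kap_Wm_summable order_refl)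

lemma norm_Ym1: "norm (Ym1 s) \<le> \<bar>s\<bar> * - mu2" and norm_Ym: "norm (Ym s) \<le> s\<^sup>2 / 2 * - mu2"
proof -
  have "norm (Ym1 s) \<le> (\<Sum>k. norm (\<i> * kap ^ k * (iexp (s * kap ^ k) - 1) * Wm k))"
    unfolding Ym1_def by (rule summable_norm[OF Ym1_summable])
  also have "\<dots> \<le> (\<Sum>k. \<bar>s\<bar> * ((kap ^ k)\<^sup>2 * Wm k))"
    by (intro suminf_le Ym1_term_le Ym1_summable summable_mult sums_summable[OF kap_Wm])
  also have "\<dots> = \<bar>s\<bar> * - mu2" using sums_mult[OF kap_Wm, of "\<bar>s\<bar>"] by (simp add: sums_iff)
  finally show "norm (Ym1 s) \<le> \<bar>s\<bar> * - mu2" .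
  have "norm (Ym s) \<le> (\<Sum>k. norm ((iexp (s * kap ^ k) - 1 - \<i> * (s * kap ^ k)) * Wm k))"
    unfolding Ym_def by (rule summable_norm[OF Ym_summable])
  also have "\<dots> \<le> (\<Sum>k. s\<^sup>2 / 2 * ((kap ^ k)\<^sup>2 * Wm k))"
    by (intro suminf_le Ym_term_le Ym_summable summable_mult sums_summable[OF kap_Wm])
  also have "\<dots> = s\<^sup>2 / 2 * - mu2" using sums_mult[OF kap_Wm, of "s\<^sup>2 / 2"] by (simp add: sums_iff)
  finally show "norm (Ym s) \<le> s\<^sup>2 / 2 * - mu2" .
qed

text \<open>The linear coefficient is minus the second moment of the small jumps, that is
  \<open>mu2\<close>. Its series is subtracted term by term, and the second-order bound for
  \<open>iexp\<close> leaves a third moment.\<close>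

lemma Ym1_taylor: "norm (Ym1 s - mu2 * s) \<le> s\<^sup>2 / 2 * (\<Sum>k. (kap ^ k) ^ 3 * Wm k)"
proof -
  have "(\<lambda>k. complex_of_real (s * ((kap ^ k)\<^sup>2 * Wm k))) sums complex_of_real (s * - mu2)"
    by (intro sums_of_real sums_mult kap_Wm)
  with summable_sums[OF summable_norm_cancel[OF Ym1_summable[of s]]]
  have "(\<lambda>k. \<i> * kap ^ k * (iexp (s * kap ^ k) - 1) * Wm k + complex_of_real (s * ((kap ^ k)\<^sup>2 * Wm k))) sums (Ym1 s + complex_of_real (s * - mu2))"
    unfolding Ym1_def by (rule sums_add)
  moreover have "\<i> * kap ^ k * (iexp (s * kap ^ k) - 1) * Wm k + complex_of_real (s * ((kap ^ k)\<^sup>2 * Wm k))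
    = \<i> * kap ^ k * (iexp (s * kap ^ k) - 1 - \<i> * complex_of_real (s * kap ^ k)) * Wm k" for k
    by (simp add: algebra_simps power2_eq_square)
  ultimately have S: "(\<lambda>k. \<i> * kap ^ k * (iexp (s * kap ^ k) - 1 - \<i> * complex_of_real (s * kap ^ k)) * Wm k) sums (Ym1 s - mu2 * s)"
    by (simp add: mult.commute)
  have le: "norm (\<i> * kap ^ k * (iexp (s * kap ^ k) - 1 - \<i> * complex_of_real (s * kap ^ k)) * Wm k) \<le> s\<^sup>2 / 2 * ((kap ^ k) ^ 3 * Wm k)" for k
  proof -
    have "kap ^ k * norm (iexp (s * kap ^ k) - 1 - \<i> * complex_of_real (s * kap ^ k)) * Wm k \<le> kap ^ k * ((s * kap ^ k)\<^sup>2 / 2) * Wm k"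
      using iexp_2 kap Wm[of k] by (intro mult_right_mono mult_left_mono) (auto simp del: of_real_mult of_real_power)
    then show ?thesis using kap Wm[of k] unfolding norm_mult norm_of_real by (simp add: norm_power power_mult_distrib power2_eq_square power3_eq_cube mult_ac)
  qed
  have sn: "summable (\<lambda>k. norm (\<i> * kap ^ k * (iexp (s * kap ^ k) - 1 - \<i> * complex_of_real (s * kap ^ k)) * Wm k))"
    by (rule summable_comparison_test'[OF summable_mult[OF kap_Wm_summable[of 3], of "s\<^sup>2/2"], of 0]) (use le in simp_all)
  have "norm (Ym1 s - mu2 * s) \<le> (\<Sum>k. norm (\<i> * kap ^ k * (iexp (s * kap ^ k) - 1 - \<i> * complex_of_real (s * kap ^ k)) * Wm k))"
    using summable_norm[OF sn] S by (simp add: sums_iff)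
  also have "\<dots> \<le> (\<Sum>k. s\<^sup>2 / 2 * ((kap ^ k) ^ 3 * Wm k))"
    by (intro suminf_le le sn summable_mult kap_Wm_summable) simp
  also have "\<dots> = s\<^sup>2 / 2 * (\<Sum>k. (kap ^ k) ^ 3 * Wm k)" by (intro suminf_mult kap_Wm_summable) simp
  finally show ?thesis .
qed

lemma poly_bounded_Yd: "m \<ge> 2 \<Longrightarrow> poly_bounded k (Yd m)"
proof (induction k arbitrary: m)
  case 0
  have "continuous_on UNIV (Yd m)" using has_vector_derivative_continuous[OF Yd_deriv[OF 0]]
    by (auto simp: continuous_on_eq_continuous_at)
  then show ?case using norm_Yd[OF 0] by (auto intro!: exI[of _ "\<Sum>k. (kap ^ k) ^ m * Wm k"] exI[of _ "0::nat"])
next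
  case (Suc k)
  have "\<exists>C n. \<forall>t. norm (Yd m t) \<le> C * (1 + \<bar>t\<bar>) ^ n"
    using norm_Yd[OF Suc.prems] by (auto intro!: exI[of _ "\<Sum>k. (kap ^ k) ^ m * Wm k"] exI[of _ "0::nat"])
  then show ?case using Yd_deriv[OF Suc.prems] Suc.IH[of "Suc m"] Suc.prems by auto
qed

lemma poly_bounded_Ym1: "poly_bounded k Ym1"
proof -
  have "norm (Ym1 t) \<le> (- mu2) * (1 + \<bar>t\<bar>) ^ 1" for t
    using norm_Ym1[of t] mu2(2) by (simp add: algebra_simps)
  then have "poly_bounded (Suc k) Ym1" unfolding poly_bounded.simps using Ym1_deriv poly_bounded_Yd[of 2 k] by blast
  then show ?thesis by (rule poly_bounded_Suc)
qed

lemma poly_bounded_Ym: "poly_bounded k Ym"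
proof -
  have "norm (Ym t) \<le> (- mu2) * (1 + \<bar>t\<bar>) ^ 2" for t
  proof -
    have "t\<^sup>2 / 2 * - mu2 \<le> (1 + \<bar>t\<bar>)\<^sup>2 * - mu2" using mu2(2)
      by (intro mult_right_mono) (auto simp: power2_eq_square algebra_simps)
    then show ?thesis using norm_Ym[of t] by (simp add: mult.commute)
  qed
  then have "poly_bounded (Suc k) Ym" unfolding poly_bounded.simps using Ym_deriv poly_bounded_Ym1[of k] by blast
  then show ?thesis by (rule poly_bounded_Suc)
qed

lemma Y_deriv: "(Y has_vector_derivative Y' s) (at s)"
proof -
  have "((\<lambda>s. \<i> * complex_of_real s * mu1) has_vector_derivative \<i> * 1 * mu1) (at s)"
    by (intro has_vector_derivative_mult_left has_vector_derivative_mult_right)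
       (auto intro!: derivative_eq_intros simp: has_vector_derivative_def scaleR_conv_of_real)
  from has_vector_derivative_add[OF has_vector_derivative_diff[OF has_vector_derivative_diff[OF f_deriv has_vector_derivative_const] this] Ym_deriv]
  show ?thesis unfolding Y_def[abs_def] Y'_def by simp
qed

lemma Y'_cont: "isCont Y' s"
  unfolding Y'_def[abs_def] using f'_cont has_vector_derivative_continuous[OF Ym1_deriv[of s]]
  by (intro continuous_intros)

lemma Y_0: "Y 0 = 0" "Y' 0 = 0"
  using norm_Ym[of 0] norm_Ym1[of 0] by (auto simp: Y_def Y'_def f_0 f'_0)

section \<open>Scaling invariance of the exponent and global bounds\<close>

lemma kap_pow: "kap ^ k = r powr (- real k / \<alpha>)" and rho_pow: "rho ^ k = r powr (real k / \<alpha>)"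
proof -
  show *: "rho ^ k = r powr (real k / \<alpha>)" for k
    using r by (simp add: rho_def powr_powr flip: powr_realpow)
  show "kap ^ k = r powr (- real k / \<alpha>)"
    using *[of k] by (simp add: kap_def power_divide powr_minus_divide)
qed

definition "yterm \<gamma> t k = (exp (\<i> * complex_of_real (t * r powr (real_of_int k / \<alpha>) / \<gamma> powr (1 / \<alpha>))) - 1
        - \<i> * complex_of_real (t * r powr (real_of_int k / \<alpha>) / \<gamma> powr (1 / \<alpha>)))
      * complex_of_real (p * \<gamma> / (q * r powr (real_of_int k)))"

lemma yfun_eq: "yfun \<alpha> p \<gamma> t = infsum (yterm \<gamma> t) UNIV"
  unfolding yfun_def yterm_def[abs_def] r q ..

text \<open>Semistability: multiplying \<gamma> by a power of \<open>r\<close> only shifts the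
  summation index. Since \<open>gam p n\<close> is \<open>n\<close> divided by a power of
  \<open>r\<close>, it may be replaced by \<open>n\<close> itself, and no case distinction on the
  position of \<open>n\<close> between powers of \<open>r\<close> remains.\<close>

lemma yfun_shift: 
  assumes "\<gamma> > 0" shows "yfun \<alpha> p (\<gamma> * r powr (real_of_int m)) t = yfun \<alpha> p \<gamma> t"
proof -
  have "yterm (\<gamma> * r powr (real_of_int m)) t k = yterm \<gamma> t (k - m)" for k
  proof -
    have 1: "t * r powr (real_of_int k / \<alpha>) / (\<gamma> * r powr (real_of_int m)) powr (1 / \<alpha>) = t * r powr (real_of_int (k - m) / \<alpha>) / \<gamma> powr (1 / \<alpha>)"
      using assms r by (simp add: powr_mult powr_powr diff_divide_distrib powr_diff)
    have 2: "p * (\<gamma> * r powr (real_of_int m)) / (q * r powr (real_of_int k)) = p * \<gamma> / (q * r powr (real_of_int (k - m)))"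
      using r by (simp add: powr_diff)
    show ?thesis unfolding yterm_def 1 2 ..
  qed
  then have "yfun \<alpha> p (\<gamma> * r powr (real_of_int m)) t = infsum (\<lambda>k. yterm \<gamma> t (k - m)) UNIV"
    unfolding yfun_eq by (intro infsum_cong) simp
  also have "\<dots> = infsum (yterm \<gamma> t) UNIV"
    by (rule infsum_reindex_bij_betw) (rule bij_betwI[where g = "\<lambda>k. k + m"], auto)
  finally show ?thesis unfolding yfun_eq .
qed

text \<open>The bilateral sum is split at the exponents \<open>>= 1\<close> and \<open><= 0\<close>.
  Both halves are absolutely summable, which identifies the unordered sum with two ordinary
  series.\<close>

lemma yfun_Y: assumes g: "\<gamma> > 0" shows "yfun \<alpha> p \<gamma> t = \<gamma> * Y (t * \<gamma> powr (- 1 / \<alpha>))"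
proof -
  define s where "s = t * \<gamma> powr (- 1 / \<alpha>)"
  have s: "t * x / \<gamma> powr (1 / \<alpha>) = s * x" for x
    unfolding s_def by (simp add: powr_minus_divide)
  have pos: "yterm \<gamma> t (int (Suc n)) = \<gamma> * (iexp (s * rho ^ Suc n) * Wf n - Wf n - \<i> * s * complex_of_real (rho ^ Suc n * Wf n))" for n
  proof -
    have "r powr (real_of_int (int (Suc n)) / \<alpha>) = rho ^ Suc n" unfolding rho_pow by simp
    moreover have "p * \<gamma> / (q * r powr (real_of_int (int (Suc n)))) = \<gamma> * Wf n"
    proof -
      have "r powr (real_of_int (int (Suc n))) = r ^ Suc n" using r by (simp add: powr_realpow del: of_nat_Suc power_Suc)
      then show ?thesis using q unfolding r(3) Wf_def by (simp add: field_simps)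
    qed
    ultimately show ?thesis unfolding yterm_def s by (simp add: algebra_simps)
  qed
  have neg: "yterm \<gamma> t (- int n) = \<gamma> * ((iexp (s * kap ^ n) - 1 - \<i> * (s * kap ^ n)) * Wm n)" for n
  proof -
    have "r powr (real_of_int (- int n) / \<alpha>) = kap ^ n" unfolding kap_pow by simp
    moreover have "p * \<gamma> / (q * r powr (real_of_int (- int n))) = \<gamma> * Wm n"
      using r(1,2) by (simp add: powr_minus powr_realpow Wm_def field_simps)
    ultimately show ?thesis unfolding yterm_def s by simp
  qed
  have h1: "((\<lambda>n. yterm \<gamma> t (int (Suc n))) has_sum \<gamma> * (f s - 1 - \<i> * s * mu1)) UNIV"
  proof (rule norm_summable_imp_has_sum)
    have S1: "(\<lambda>n. complex_of_real (Wf n)) sums complex_of_real 1" by (rule sums_of_real[OF Wf(2)])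
    have S2: "(\<lambda>n. complex_of_real (rho ^ Suc n * Wf n)) sums complex_of_real mu1" by (rule sums_of_real[OF rho_Wf])
    show "(\<lambda>n. yterm \<gamma> t (int (Suc n))) sums (\<gamma> * (f s - 1 - \<i> * s * mu1))"
      unfolding pos by (intro sums_mult sums_diff S1[unfolded of_real_1] S2) (unfold f_def, rule summable_sums[OF summable_norm_cancel[OF f_summable]])
    have B: "norm (yterm \<gamma> t (int (Suc n))) \<le> \<gamma> * (2 * Wf n + \<bar>s\<bar> * (rho ^ Suc n * Wf n))" for n
    proof -
      have "norm (iexp (s * rho ^ Suc n) * Wf n - Wf n - \<i> * s * complex_of_real (rho ^ Suc n * Wf n)) \<le>
        norm (iexp (s * rho ^ Suc n) * Wf n) + norm (complex_of_real (Wf n)) + norm (\<i> * s * complex_of_real (rho ^ Suc n * Wf n))"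
        by (rule order_trans[OF norm_triangle_ineq4]) (intro add_right_mono norm_triangle_ineq4)
      also have "\<dots> = 2 * Wf n + \<bar>s\<bar> * (rho ^ Suc n * Wf n)"
        unfolding norm_f_term using Wf(1)[of n] rho by (simp add: norm_mult norm_power abs_mult)
      finally show ?thesis unfolding pos using g by (simp add: norm_mult del: power_Suc)
    qed
    show "summable (\<lambda>n. norm (yterm \<gamma> t (int (Suc n))))"
      by (rule summable_comparison_test'[OF summable_mult[OF summable_add[OF summable_mult[OF sums_summable[OF Wf(2)], of 2] summable_mult[OF sums_summable[OF rho_Wf], of "\<bar>s\<bar>"]], of \<gamma>], of 0])
         (use B in simp)
  qed
  have h2: "((\<lambda>n. yterm \<gamma> t (- int n)) has_sum \<gamma> * Ym s) UNIV"
  proof (rule norm_summable_imp_has_sum)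
    show "(\<lambda>n. yterm \<gamma> t (- int n)) sums (\<gamma> * Ym s)"
      unfolding neg by (intro sums_mult) (unfold Ym_def, rule summable_sums[OF summable_norm_cancel[OF Ym_summable]])
    show "summable (\<lambda>n. norm (yterm \<gamma> t (- int n)))"
      unfolding neg norm_mult[of "complex_of_real \<gamma>"] by (intro summable_mult Ym_summable)
  qed
  have "(yterm \<gamma> t has_sum \<gamma> * (f s - 1 - \<i> * s * mu1)) (range (\<lambda>n. int (Suc n)))"
    using h1 by (subst has_sum_reindex) (auto simp: inj_def comp_def)
  moreover have "(yterm \<gamma> t has_sum \<gamma> * Ym s) (range (\<lambda>n. - int n))"
    using h2 by (subst has_sum_reindex) (auto simp: inj_def comp_def)
  ultimately have "(yterm \<gamma> t has_sum \<gamma> * (f s - 1 - \<i> * s * mu1) + \<gamma> * Ym s) (range (\<lambda>n. int (Suc n)) \<union> range (\<lambda>n. - int n))"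
    by (rule has_sum_Un_disjoint) auto
  moreover have "range (\<lambda>n. int (Suc n)) \<union> range (\<lambda>n. - int n) = UNIV"
  proof -
    have "k \<in> range (\<lambda>n. int (Suc n)) \<union> range (\<lambda>n. - int n)" for k
    proof (cases "k \<ge> 1")
      case True
      then have "k = int (Suc (nat (k - 1)))" by simp
      then show ?thesis by blast
    next
      case False
      then have "k = - int (nat (- k))" by simp
      then show ?thesis by blast
    qed
    then show ?thesis by blast
  qed
  ultimately have "infsum (yterm \<gamma> t) UNIV = \<gamma> * (f s - 1 - \<i> * s * mu1) + \<gamma> * Ym s" by (simp add: infsumI)
  then show ?thesis unfolding yfun_eq s_def[symmetric] Y_def by (simp add: algebra_simps)
qed

lemma yfun_gam: assumes "n \<ge> 1" shows "yfun \<alpha> p (gam p n) t = yfun \<alpha> p (real n) t" "gam p n > 0"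
proof -
  let ?m = "\<lceil>log r (real n)\<rceil>"
  have g: "gam p n = real n / r powr (real_of_int ?m)" by (simp add: gam_def r)
  then show pos: "gam p n > 0" using assms r by simp
  have "real n = gam p n * r powr (real_of_int ?m)" unfolding g using r by simp
  then show "yfun \<alpha> p (gam p n) t = yfun \<alpha> p (real n) t" using yfun_shift[OF pos, of ?m t] by simp
qed

text \<open>The shift invariance at \<gamma> = 1 read as a functional equation of \<open>Y\<close>.
  It reduces global estimates to the annulus between 1 and \<open>rho\<close>.\<close>

lemma Y_scale: "Y t = r powr (real_of_int m) * Y (t * rho powr - real_of_int m)"
proof -
  have e: "(r powr real_of_int m) powr (- 1 / \<alpha>) = rho powr - real_of_int m"
    unfolding rho_def powr_powr by simp
  have "Y t = yfun \<alpha> p 1 t" using yfun_Y[of 1 t] by simp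
  also have "\<dots> = yfun \<alpha> p (1 * r powr (real_of_int m)) t" using yfun_shift[of 1 m t] by simp
  also have "\<dots> = r powr (real_of_int m) * Y (t * (r powr real_of_int m) powr (- 1 / \<alpha>))"
    using yfun_Y[of "r powr real_of_int m" t] r by simp
  finally show ?thesis unfolding e .
qed

lemma Y'_scale: "Y' t = r powr (real_of_int m) * rho powr (- real_of_int m) * Y' (t * rho powr - real_of_int m)"
proof -
  let ?c = "rho powr - real_of_int m"
  have "((\<lambda>t. t * ?c) has_vector_derivative ?c) (at t)"
    by (auto intro!: derivative_eq_intros simp: has_vector_derivative_def)
  from vector_diff_chain_at[OF this Y_deriv]
  have "((\<lambda>t. Y (t * ?c)) has_vector_derivative ?c *\<^sub>R Y' (t * ?c)) (at t)" by (simp add: comp_def)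
  from has_vector_derivative_mult_right[OF this, of "complex_of_real (r powr (real_of_int m))"]
  have "(Y has_vector_derivative r powr (real_of_int m) * (?c *\<^sub>R Y' (t * ?c))) (at t)"
    unfolding Y_scale[of _ m, symmetric] .
  from vector_derivative_unique_at[OF Y_deriv this] show ?thesis
    by (simp add: scaleR_conv_of_real mult.assoc)
qed

text \<open>With \<open>m\<close> the integer part of the logarithm of \<open>\<bar>t\<bar>\<close>
  to the base \<open>rho\<close>, the scaling factors of \<open>Y\<close> and \<open>Y'\<close> are
  comparable to powers of \<open>\<bar>t\<bar>\<close> because
  \<open>rho powr \<alpha> = r\<close>.\<close>

lemma scale_repr:
  assumes "t \<noteq> 0"
  obtains m :: int and u where "u = t * rho powr - real_of_int m" "1 \<le> \<bar>u\<bar>" "\<bar>u\<bar> \<le> rho" 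
    "r powr (real_of_int m) \<le> \<bar>t\<bar> powr \<alpha>" "\<bar>t\<bar> powr \<alpha> \<le> r * r powr (real_of_int m)"
    "r powr (real_of_int m) * rho powr (- real_of_int m) \<le> \<bar>t\<bar> powr (\<alpha> - 1)"
proof -
  define m where "m = \<lfloor>log rho \<bar>t\<bar>\<rfloor>"
  have m: "rho powr (real_of_int m) \<le> \<bar>t\<bar>" "\<bar>t\<bar> \<le> rho powr (real_of_int m + 1)"
  proof -
    have "real_of_int m \<le> log rho \<bar>t\<bar>" "log rho \<bar>t\<bar> \<le> real_of_int m + 1" unfolding m_def by linarith+
    then show "rho powr (real_of_int m) \<le> \<bar>t\<bar>" "\<bar>t\<bar> \<le> rho powr (real_of_int m + 1)"
      using assms rho by (simp_all add: le_log_iff log_le_iff)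
  qed
  have rm: "r powr x = (rho powr x) powr \<alpha>" for x using rho_powr by (metis powr_powr mult.commute)
  show ?thesis
  proof (rule that[of "t * rho powr - real_of_int m" m])
    show "1 \<le> \<bar>t * rho powr - real_of_int m\<bar>" "\<bar>t * rho powr - real_of_int m\<bar> \<le> rho"
      using m rho by (simp_all add: abs_mult powr_minus powr_add field_simps)
    show "r powr (real_of_int m) \<le> \<bar>t\<bar> powr \<alpha>" unfolding rm using m \<alpha> by (intro powr_mono2) auto
    have "\<bar>t\<bar> powr \<alpha> \<le> (rho powr (real_of_int m + 1)) powr \<alpha>" using m \<alpha> by (intro powr_mono2) auto
    also have "\<dots> = r * r powr (real_of_int m)" unfolding rm[symmetric] using r by (simp add: powr_add)
    finally show "\<bar>t\<bar> powr \<alpha> \<le> r * r powr (real_of_int m)" .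
    have "r powr (real_of_int m) * rho powr (- real_of_int m) = (rho powr (real_of_int m)) powr (\<alpha> - 1)"
      unfolding rm powr_powr using rho by (simp add: algebra_simps flip: powr_add)
    also have "\<dots> \<le> \<bar>t\<bar> powr (\<alpha> - 1)" using m \<alpha> by (intro powr_mono2) auto
    finally show "r powr (real_of_int m) * rho powr (- real_of_int m) \<le> \<bar>t\<bar> powr (\<alpha> - 1)" .
  qed simp
qed

text \<open>The sum of the elementary bounds for \<open>Y\<close> and for \<open>Y'\<close> on
  \<open>\<bar>u\<bar> \<le> rho\<close>.\<close>

definition "CY = 2 + rho * mu1 + rho\<^sup>2 * - mu2 + 2 * mu1 + rho * - mu2"

lemma CY: "CY > 0" unfolding CY_def using mu1(2) mu2(2) rho by (intro add_pos_pos mult_pos_pos) auto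

lemma norm_Y: "norm (Y t) \<le> CY * \<bar>t\<bar> powr \<alpha>" and norm_Y': "norm (Y' t) \<le> CY * \<bar>t\<bar> powr (\<alpha> - 1)"
proof -
  have b: "norm (Y u) \<le> CY" "norm (Y' u) \<le> CY" if u: "\<bar>u\<bar> \<le> rho" for u
  proof -
    have m0: "0 \<le> - mu2" "0 \<le> mu1" using mu1 mu2 by auto
    have "norm (Y u) \<le> norm (f u) + 1 + \<bar>u\<bar> * mu1 + norm (Ym u)"
      unfolding Y_def using norm_triangle_ineq[of "f u - 1 - \<i> * u * mu1" "Ym u"] norm_triangle_ineq4[of "f u - 1" "\<i> * u * mu1"] norm_triangle_ineq4[of "f u" 1] m0
      by (simp add: norm_mult)
    also have "\<dots> \<le> 1 + 1 + rho * mu1 + rho\<^sup>2 * - mu2"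
    proof (intro add_mono norm_f mult_right_mono u m0 order_trans[OF norm_Ym])
      have "u\<^sup>2 \<le> rho\<^sup>2" using u rho by (simp add: abs_le_square_iff[symmetric])
      moreover have "u\<^sup>2 / 2 \<le> u\<^sup>2" by simp
      ultimately show "u\<^sup>2 / 2 \<le> rho\<^sup>2" by linarith
    qed auto
    finally show "norm (Y u) \<le> CY" using m0 mult_nonneg_nonneg[of rho "- mu2"] rho unfolding CY_def by linarith
    have "norm (Y' u) \<le> norm (f' u) + mu1 + norm (Ym1 u)"
      unfolding Y'_def using norm_triangle_ineq[of "f' u - \<i> * mu1" "Ym1 u"] norm_triangle_ineq4[of "f' u" "\<i> * mu1"] m0
      by (simp add: norm_mult)
    also have "\<dots> \<le> mu1 + mu1 + rho * - mu2"
      by (intro add_mono norm_f' order_refl order_trans[OF norm_Ym1] mult_right_mono u m0)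
    finally show "norm (Y' u) \<le> CY" using m0 mult_nonneg_nonneg[of "rho\<^sup>2" "- mu2"] mult_nonneg_nonneg[of rho mu1] rho unfolding CY_def by (simp add: add_nonneg_nonneg) (smt (verit) mult_nonneg_nonneg)
  qed
  show "norm (Y t) \<le> CY * \<bar>t\<bar> powr \<alpha>"
  proof (cases "t = 0")
    case False
    then obtain m :: int and u where u: "u = t * rho powr - real_of_int m" "\<bar>u\<bar> \<le> rho" and le: "r powr (real_of_int m) \<le> \<bar>t\<bar> powr \<alpha>"
      by (rule scale_repr)
    have "norm (Y t) = r powr (real_of_int m) * norm (Y u)"
      unfolding Y_scale[of t m] u(1)[symmetric] by (simp add: norm_mult)
    also have "\<dots> \<le> \<bar>t\<bar> powr \<alpha> * CY" by (intro mult_mono le b u) auto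
    finally show ?thesis by (simp add: mult.commute)
  qed (simp add: Y_0)
  show "norm (Y' t) \<le> CY * \<bar>t\<bar> powr (\<alpha> - 1)"
  proof (cases "t = 0")
    case False
    then obtain m :: int and u where u: "u = t * rho powr - real_of_int m" "\<bar>u\<bar> \<le> rho" and le: "r powr (real_of_int m) * rho powr (- real_of_int m) \<le> \<bar>t\<bar> powr (\<alpha> - 1)"
      by (rule scale_repr)
    have "norm (Y' t) = (r powr (real_of_int m) * rho powr (- real_of_int m)) * norm (Y' u)"
      unfolding Y'_scale[of t m] u(1)[symmetric] by (simp add: norm_mult)
    also have "\<dots> \<le> \<bar>t\<bar> powr (\<alpha> - 1) * CY" by (intro mult_mono le b u) auto
    finally show ?thesis by (simp add: mult.commute)
  qed (simp add: Y_0)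
qed

section \<open>The real part of the exponent\<close>

lemma Re_iexp_term: "Re ((iexp x - 1 - \<i> * complex_of_real x) * complex_of_real w) = - (1 - cos x) * w"
  by (simp add: Re_exp)

text \<open>The third-order remainder is at most \<open>x\<^sup>2 / 6\<close> on this range, which
  leaves \<open>x\<^sup>2 / 3\<close> of the quadratic term.\<close>

lemma cos_le: fixes x :: real assumes "\<bar>x\<bar> \<le> 1" shows "1 - cos x \<ge> x\<^sup>2 / 4"
proof -
  have "\<bar>Re (iexp x - (\<Sum>k\<le>2. (\<i> * x) ^ k / fact k))\<bar> \<le> \<bar>x\<bar> ^ Suc 2 / fact (Suc 2)"
    by (rule order_trans[OF abs_Re_le_cmod iexp_approx1])
  moreover have "Re (iexp x - (\<Sum>k\<le>2. (\<i> * x) ^ k / fact k)) = cos x - 1 + x\<^sup>2 / 2"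
    by (simp add: numeral_2_eq_2 Re_exp power2_eq_square)
  moreover have "\<bar>x\<bar> ^ Suc 2 = \<bar>x\<bar> * x\<^sup>2" by (simp only: power_Suc power2_abs)
  moreover have "\<bar>x\<bar> * x\<^sup>2 \<le> 1 * x\<^sup>2" using assms by (intro mult_right_mono) auto
  ultimately have "\<bar>cos x - 1 + x\<^sup>2 / 2\<bar> \<le> x\<^sup>2 / 6" by (simp add: fact_numeral)
  then show ?thesis using zero_le_power2[of x] by linarith
qed

text \<open>The contribution of the single jump \<open>kap\<close> to \<open>Ym\<close> on the
  annulus; division by \<open>r\<close> accounts for passing from the power of \<open>r\<close> to
  \<open>\<bar>t\<bar> powr \<alpha>\<close>.\<close>

definition "cY = kap\<^sup>2 / 4 * Wm 1 / r"
lemma cY: "cY > 0" unfolding cY_def using kap Wm[of 1] r by simp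

text \<open>All terms have nonpositive real part. On the annulus the one with \<open>k = 1\<close>
  is kept, for which the argument of the cosine is at most \<open>rho * kap = 1\<close>; scaling
  extends the bound to all \<open>t\<close>.\<close>

lemma Re_Y: "Re (Y t) \<le> - cY * \<bar>t\<bar> powr \<alpha>"
proof (cases "t = 0")
  case False
  have b: "Re (Y u) \<le> - (cY * r)" if u: "1 \<le> \<bar>u\<bar>" "\<bar>u\<bar> \<le> rho" for u
  proof -
    have "Re (f u) \<le> 1" using norm_f[of u] complex_Re_le_cmod[of "f u"] by linarith
    moreover have "Re (Ym u) \<le> - (cY * r)"
    proof -
      let ?a = "\<lambda>k. (1 - cos (u * kap ^ k)) * Wm k"
      have "(\<lambda>k. Re ((iexp (u * kap ^ k) - 1 - \<i> * (u * kap ^ k)) * Wm k)) sums Re (Ym u)"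
        unfolding Ym_def by (intro sums_Re summable_sums summable_norm_cancel[OF Ym_summable])
      from sums_minus[OF this] have S: "?a sums - Re (Ym u)" unfolding Re_iexp_term by (simp only: mult_minus_left minus_minus)
      have "(\<Sum>k\<in>{1}. ?a k) \<le> - Re (Ym u)"
        unfolding sums_unique[OF S] by (rule sum_le_suminf[OF sums_summable[OF S]]) (auto simp: Wm less_imp_le)
      moreover have "1 - cos (u * kap) \<ge> (u * kap)\<^sup>2 / 4"
      proof (rule cos_le)
        have "\<bar>u\<bar> * kap \<le> rho * kap" using u kap by (intro mult_right_mono) auto
        then show "\<bar>u * kap\<bar> \<le> 1" using kap by (simp add: abs_mult)
      qed
      moreover have "kap\<^sup>2 / 4 \<le> (u * kap)\<^sup>2 / 4"
      proof -
        have "1 \<le> u\<^sup>2" using u by (simp add: one_le_power abs_le_square_iff[of 1 u, simplified])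
        then show ?thesis using kap by (simp add: power_mult_distrib)
      qed
      ultimately have le: "(1 - cos (u * kap)) * Wm 1 \<le> - Re (Ym u)" "kap\<^sup>2 / 4 \<le> 1 - cos (u * kap)"
        by simp_all
      from order_trans[OF mult_right_mono[OF le(2), of "Wm 1"] le(1)]
      have "kap\<^sup>2 / 4 * Wm 1 \<le> - Re (Ym u)" using Wm[of 1] by simp
      then show ?thesis using r by (simp add: cY_def)
    qed
    ultimately show ?thesis unfolding Y_def by simp
  qed
  from False obtain m :: int and u where u: "u = t * rho powr - real_of_int m" "1 \<le> \<bar>u\<bar>" "\<bar>u\<bar> \<le> rho" and le: "\<bar>t\<bar> powr \<alpha> \<le> r * r powr (real_of_int m)"
    by (rule scale_repr)
  have "Re (Y t) = r powr (real_of_int m) * Re (Y u)"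
    unfolding Y_scale[of t m] u(1)[symmetric] by simp
  also have "\<dots> \<le> r powr (real_of_int m) * (- (cY * r))" by (intro mult_left_mono b u) auto
  also have "\<dots> = - cY * (r * r powr (real_of_int m))" by simp
  also have "\<dots> \<le> - cY * (\<bar>t\<bar> powr \<alpha>)" using cY by (intro mult_left_mono_neg le) auto
  finally show ?thesis .
qed (simp add: Y_0)

text \<open>\<open>Ym\<close> and \<open>Y\<close> differ by \<open>f - 1\<close> and an imaginary
  term, so their real parts differ boundedly. The linear form of the bound is the one required for
  amplitudes times exponentials.\<close>

lemma Re_Ym: "Re (Ym t) \<le> 2 + cY - cY * \<bar>t\<bar>"
proof -
  have "\<bar>t\<bar> - 1 \<le> \<bar>t\<bar> powr \<alpha>"
  proof (cases "\<bar>t\<bar> \<ge> 1")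
    case True
    then have "\<bar>t\<bar> powr 1 \<le> \<bar>t\<bar> powr \<alpha>" using \<alpha> by (intro powr_mono) auto
    then show ?thesis using True by simp
  qed (use powr_ge_zero[of "\<bar>t\<bar>" \<alpha>] in linarith)
  then have "cY * (\<bar>t\<bar> - 1) \<le> cY * \<bar>t\<bar> powr \<alpha>" using cY by (intro mult_left_mono) auto
  moreover have "Re (Ym t) = Re (Y t) - Re (f t) + 1" unfolding Y_def by simp
  moreover have "\<bar>Re (f t)\<bar> \<le> 1" using norm_f[of t] abs_Re_le_cmod[of "f t"] by linarith
  ultimately show ?thesis using Re_Y[of t] by (simp add: right_diff_distrib)
qed

end

section \<open>Signed densities and compound Poisson laws\<close>

text \<open>An identity between differences of finite measures becomes an identity between sums of
  nonnegative measures, to which uniqueness of characteristic functions applies.\<close>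

definition sum_measure :: "real measure \<Rightarrow> real measure \<Rightarrow> real measure" where
  "sum_measure M N = measure_of UNIV (sets borel) (\<lambda>A. emeasure M A + emeasure N A)"

lemma sum_measure:
  assumes M: "sets M = sets borel" and N: "sets N = sets borel"
  shows "sets (sum_measure M N) = sets borel" "space (sum_measure M N) = UNIV"
    "A \<in> sets borel \<Longrightarrow> emeasure (sum_measure M N) A = emeasure M A + emeasure N A"
proof -
  have sa: "sigma_algebra UNIV (sets (borel :: real measure))"
    using sets.sigma_algebra_axioms[of "borel :: real measure"] by simp
  show s: "sets (sum_measure M N) = sets borel"
    unfolding sum_measure_def using sa by (simp add: sigma_algebra.sigma_sets_eq)
  show "space (sum_measure M N) = UNIV" unfolding sum_measure_def by (simp add: space_measure_of_conv)
  assume A: "A \<in> sets borel"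
  show "emeasure (sum_measure M N) A = emeasure M A + emeasure N A"
  proof (rule emeasure_measure_of[OF sum_measure_def])
    show "countably_additive (sets (sum_measure M N)) (\<lambda>A. emeasure M A + emeasure N A)"
      unfolding countably_additive_def
    proof (intro allI impI)
      fix F :: "nat \<Rightarrow> real set" assume F: "range F \<subseteq> sets (sum_measure M N)" "disjoint_family F"
      have "(\<Sum>i. emeasure M (F i) + emeasure N (F i)) = (\<Sum>i. emeasure M (F i)) + (\<Sum>i. emeasure N (F i))"
        by (intro suminf_add[symmetric]) auto
      also have "\<dots> = emeasure M (\<Union>i. F i) + emeasure N (\<Union>i. F i)"
        using F M N s by (simp add: suminf_emeasure)
      finally show "(\<Sum>i. emeasure M (F i) + emeasure N (F i)) = emeasure M (\<Union>i. F i) + emeasure N (\<Union>i. F i)" .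
    qed
  qed (use A s in \<open>auto simp: positive_def\<close>)
qed

lemma nn_integral_sum_measure:
  assumes M: "sets M = sets borel" and N: "sets N = sets borel" and f: "f \<in> borel_measurable borel"
  shows "(\<integral>\<^sup>+x. f x \<partial>sum_measure M N) = (\<integral>\<^sup>+x. f x \<partial>M) + (\<integral>\<^sup>+x. f x \<partial>N)"
proof -
  note S = sum_measure[OF M N]
  have ms: "(borel_measurable (sum_measure M N) :: (real \<Rightarrow> ennreal) set) = borel_measurable borel" "(borel_measurable M :: (real \<Rightarrow> ennreal) set) = borel_measurable borel" "(borel_measurable N :: (real \<Rightarrow> ennreal) set) = borel_measurable borel"
    by (intro measurable_cong_sets S M N refl)+
  show ?thesis using f
  proof (induction rule: borel_measurable_induct)
    case (cong f g)
    then have "f = g" by auto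
    then show ?case using cong by simp
  next
    case (set A)
    then show ?case using S M N by simp
  next
    case (mult u c)
    then show ?case by (simp add: nn_integral_cmult ms distrib_left)
  next
    case (add u v)
    then show ?case by (simp add: nn_integral_add ms add_ac)
  next
    case (seq U)
    have K: "(\<integral>\<^sup>+x. (SUP i. U i x) \<partial>K) = (SUP i. \<integral>\<^sup>+x. U i x \<partial>K)" if "(borel_measurable K :: (real \<Rightarrow> ennreal) set) = borel_measurable borel" for K :: "real measure"
      by (rule nn_integral_monotone_convergence_SUP) (rule \<open>incseq U\<close>, unfold that, rule \<open>\<And>i. U i \<in> borel_measurable borel\<close>)
    have "(\<integral>\<^sup>+x. (SUP i. U i x) \<partial>sum_measure M N) = (SUP i. (\<integral>\<^sup>+x. U i x \<partial>M) + (\<integral>\<^sup>+x. U i x \<partial>N))"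
      unfolding K[OF ms(1)] by (simp only: seq.IH)
    also have "\<dots> = (SUP i. \<integral>\<^sup>+x. U i x \<partial>M) + (SUP i. \<integral>\<^sup>+x. U i x \<partial>N)"
      using \<open>incseq U\<close> by (intro ennreal_SUP_add) (auto simp: incseq_def le_fun_def intro!: nn_integral_mono)
    finally have "(\<integral>\<^sup>+x. (SUP i. U i x) \<partial>sum_measure M N) = (\<integral>\<^sup>+x. (SUP i. U i x) \<partial>M) + (\<integral>\<^sup>+x. (SUP i. U i x) \<partial>N)"
      unfolding K[OF ms(2)] K[OF ms(3)] .
    then show ?case unfolding SUP_apply .
  qed
qed

lemma integral_sum_measure:
  fixes g :: "real \<Rightarrow> real"
  assumes "finite_measure M" "finite_measure N" and M: "sets M = sets borel" and N: "sets N = sets borel"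
    and g: "g \<in> borel_measurable borel" "\<And>x. 0 \<le> g x" "\<And>x. g x \<le> B"
  shows "(\<integral>x. g x \<partial>sum_measure M N) = (\<integral>x. g x \<partial>M) + (\<integral>x. g x \<partial>N)"
proof -
  interpret M: finite_measure M by fact
  interpret N: finite_measure N by fact
  note S = sum_measure[OF M N]
  have ms: "g \<in> borel_measurable (sum_measure M N)" "g \<in> borel_measurable M" "g \<in> borel_measurable N"
    using g(1) by (simp_all cong: measurable_cong_sets add: S M N)
  have i: "integrable M g" "integrable N g"
    using g(2,3) by (auto intro!: M.integrable_const_bound[where B = B] N.integrable_const_bound[where B = B] ms)
  have "(\<integral>\<^sup>+x. g x \<partial>sum_measure M N) = (\<integral>\<^sup>+x. g x \<partial>M) + (\<integral>\<^sup>+x. g x \<partial>N)"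
    using g(1) by (intro nn_integral_sum_measure M N) simp
  also have "\<dots> = ennreal ((\<integral>x. g x \<partial>M) + (\<integral>x. g x \<partial>N))"
    using i g(2) by (simp add: nn_integral_eq_integral)
  finally have e: "(\<integral>\<^sup>+x. g x \<partial>sum_measure M N) = ennreal ((\<integral>x. g x \<partial>M) + (\<integral>x. g x \<partial>N))" .
  have "(\<integral>x. g x \<partial>sum_measure M N) = enn2real (\<integral>\<^sup>+x. g x \<partial>sum_measure M N)"
    by (rule integral_eq_nn_integral) (use g(2) ms in auto)
  also have "\<dots> = (\<integral>x. g x \<partial>M) + (\<integral>x. g x \<partial>N)"
    unfolding e by (rule enn2real_ennreal) (intro add_nonneg_nonneg Bochner_Integration.integral_nonneg g)
  finally show ?thesis .
qed

text \<open>The shifts \<open>1 + cos\<close> and \<open>1 + sin\<close> are bounded and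
  nonnegative, so additivity of the nonnegative integral carries over to characteristic
  functions.\<close>

lemma integral_iexp_split:
  assumes "finite_measure M" "sets M = sets borel"
  shows "(\<integral>x. iexp (t * x) \<partial>M) = complex_of_real (\<integral>x. 1 + cos (t * x) \<partial>M) + \<i> * complex_of_real (\<integral>x. 1 + sin (t * x) \<partial>M) - (1 + \<i>) * complex_of_real (measure M UNIV)"
proof -
  interpret finite_measure M by fact
  note assms(2)[measurable_cong]
  have sp: "space M = UNIV" using sets_eq_imp_space_eq[OF assms(2)] by simp
  have i: "integrable M (\<lambda>x. cos (t * x))" "integrable M (\<lambda>x. sin (t * x))"
    by (auto intro!: integrable_const_bound[where B = 1])
  have "(\<integral>x. iexp (t * x) \<partial>M) = (\<integral>x. complex_of_real (cos (t * x)) + \<i> * complex_of_real (sin (t * x)) \<partial>M)"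
    by (intro Bochner_Integration.integral_cong refl) (simp only: exp_Euler cos_of_real sin_of_real)
  also have "\<dots> = complex_of_real (\<integral>x. cos (t * x) \<partial>M) + \<i> * complex_of_real (\<integral>x. sin (t * x) \<partial>M)"
    using i by (subst Bochner_Integration.integral_add) auto
  finally show ?thesis using i by (simp add: sp algebra_simps)
qed

lemma sum_measure_finite: 
  assumes "finite_measure M" "finite_measure N" "sets M = sets borel" "sets N = sets borel"
  shows "finite_measure (sum_measure M N)" 
    "A \<in> sets borel \<Longrightarrow> measure (sum_measure M N) A = measure M A + measure N A"
    "char (sum_measure M N) t = char M t + char N t"
proof -
  interpret M: finite_measure M by fact
  interpret N: finite_measure N by fact
  note S = sum_measure[OF assms(3,4)]
  have e: "emeasure (sum_measure M N) A = ennreal (measure M A + measure N A)" if "A \<in> sets borel" for A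
    using S(3)[OF that] by (simp add: M.emeasure_eq_measure N.emeasure_eq_measure)
  show fin: "finite_measure (sum_measure M N)" by (rule finite_measureI) (simp add: S e)
  show m: "measure (sum_measure M N) A = measure M A + measure N A" if "A \<in> sets borel" for A
    by (rule measure_eq_emeasure_eq_ennreal[OF _ e[OF that]]) simp
  have "(\<integral>x. 1 + cos (t * x) \<partial>sum_measure M N) = (\<integral>x. 1 + cos (t * x) \<partial>M) + (\<integral>x. 1 + cos (t * x) \<partial>N)"
  proof (rule integral_sum_measure[where B = 2])
    fix x show "0 \<le> 1 + cos (t * x)" "1 + cos (t * x) \<le> 2" using cos_ge_minus_one[of "t * x"] cos_le_one[of "t * x"] by linarith+
  qed (use assms in auto)
  moreover have "(\<integral>x. 1 + sin (t * x) \<partial>sum_measure M N) = (\<integral>x. 1 + sin (t * x) \<partial>M) + (\<integral>x. 1 + sin (t * x) \<partial>N)"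
  proof (rule integral_sum_measure[where B = 2])
    fix x show "0 \<le> 1 + sin (t * x)" "1 + sin (t * x) \<le> 2" using sin_ge_minus_one[of "t * x"] sin_le_one[of "t * x"] by linarith+
  qed (use assms in auto)
  ultimately show "char (sum_measure M N) t = char M t + char N t"
    unfolding char_def integral_iexp_split[OF fin S(1)] integral_iexp_split[OF assms(1,3)] integral_iexp_split[OF assms(2,4)]
    by (simp add: m algebra_simps)
qed

lemma char_finite_0: "finite_measure M \<Longrightarrow> sets M = sets borel \<Longrightarrow> char M 0 = complex_of_real (measure M UNIV)"
  using sets_eq_imp_space_eq[of M borel] by (simp add: char_def scaleR_conv_of_real)

text \<open>The value at 0 is the total mass, hence both masses agree. Mass 0 is trivial; otherwise
  both measures are normalized and Levy's theorem for laws is used.\<close>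

lemma finite_Levy_uniqueness:
  assumes M: "finite_measure M" "sets M = sets borel" and N: "finite_measure N" "sets N = sets borel"
    and eq: "\<And>t. char M t = char N t"
  shows "M = N"
proof -
  interpret M: finite_measure M by fact
  interpret N: finite_measure N by fact
  have spM: "space M = UNIV" "space N = UNIV" using sets_eq_imp_space_eq[OF M(2)] sets_eq_imp_space_eq[OF N(2)] by auto
  define c where "c = measure M UNIV"
  have c: "measure N UNIV = c"
    using eq[of 0] unfolding char_finite_0[OF M] char_finite_0[OF N] c_def by simp
  show ?thesis
  proof (cases "c = 0")
    case True
    have "emeasure K A = 0" if "finite_measure K" "sets K = sets borel" "measure K UNIV = 0" for K A
    proof -
      interpret K: finite_measure K by fact
      have "emeasure K A \<le> emeasure K (space K)" by (rule emeasure_space)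
      also have "\<dots> = 0" using that sets_eq_imp_space_eq[OF that(2)] by (simp add: K.emeasure_eq_measure)
      finally show ?thesis by simp
    qed
    from this[OF M] this[OF N] show ?thesis using M N c True by (intro measure_eqI) (simp_all add: c_def)
  next
    case False
    then have c0: "c > 0" unfolding c_def using zero_less_measure_iff by blast
    define D where "D K = density K (\<lambda>_. ennreal (1 / c))" for K :: "real measure"
    have D: "real_distribution (D K)" "char (D K) t = (1 / c) *\<^sub>R char K t" "A \<in> sets borel \<Longrightarrow> emeasure (D K) A = ennreal (1/c) * emeasure K A"
      if K: "finite_measure K" "sets K = sets borel" "measure K UNIV = c" for K t A
    proof -
      interpret K: finite_measure K by fact
      have spK: "space K = UNIV" using sets_eq_imp_space_eq[OF K(2)] by simp
      show e: "emeasure (D K) A = ennreal (1/c) * emeasure K A" if "A \<in> sets borel" for A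
        unfolding D_def using that K by (subst emeasure_density) (auto simp: nn_integral_cmult)
      have "emeasure (D K) UNIV = 1"
        using c0 K by (subst e) (auto simp: K.emeasure_eq_measure simp flip: ennreal_mult)
      then show "real_distribution (D K)"
        by (intro real_distribution.intro prob_spaceI real_distribution_axioms.intro) (auto simp: D_def K spK)
      have "(\<lambda>x. iexp (t * x)) \<in> borel_measurable K" by (simp cong: measurable_cong_sets add: K)
      then show "char (D K) t = (1 / c) *\<^sub>R char K t"
        unfolding char_def D_def using c0 by (subst integral_density) auto
    qed
    have "D M = D N"
      by (rule Levy_uniqueness) (use D[OF M c_def[symmetric]] D[OF N c] eq in auto)
    show ?thesis
    proof (rule measure_eqI)
      fix A assume "A \<in> sets M"
      then have A: "A \<in> sets borel" using M by simp
      have "ennreal (1/c) * emeasure M A = ennreal (1/c) * emeasure N A"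
        using D(3)[OF M c_def[symmetric] A] D(3)[OF N c A] \<open>D M = D N\<close> by simp
      then show "emeasure M A = emeasure N A" using c0 by (simp add: ennreal_mult_cancel_left)
    qed (use M N in simp)
  qed
qed

text \<open>Rearranged as equality of the characteristic functions of \<open>M1 + N2\<close> and
  \<open>N1 + M2\<close>.\<close>

lemma signed_cdf_unique:
  assumes M1: "finite_measure M1" "sets M1 = sets borel" and M2: "finite_measure M2" "sets M2 = sets borel"
    and N1: "finite_measure N1" "sets N1 = sets borel" and N2: "finite_measure N2" "sets N2 = sets borel"
    and eq: "\<And>t. char M1 t - char M2 t = char N1 t - char N2 t"
  shows "measure M1 {..x} - measure M2 {..x} = measure N1 {..x} - measure N2 {..x}"
proof -
  have "sum_measure M1 N2 = sum_measure N1 M2"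
  proof (rule finite_Levy_uniqueness)
    show "char (sum_measure M1 N2) t = char (sum_measure N1 M2) t" for t
    proof -
      have "char M1 t = char N1 t - char N2 t + char M2 t" using eq[of t] by (metis diff_add_cancel)
      then show ?thesis by (simp add: sum_measure_finite assms)
    qed
  qed (simp_all add: sum_measure_finite sum_measure assms)
  then have "measure (sum_measure M1 N2) {..x} = measure (sum_measure N1 M2) {..x}" by simp
  then show ?thesis by (simp add: sum_measure_finite assms)
qed

section \<open>Distribution functions determined by their transforms\<close>

definition fourier_density :: "(real \<Rightarrow> real) \<Rightarrow> (real \<Rightarrow> complex) \<Rightarrow> bool" where
  "fourier_density g \<phi> \<longleftrightarrow> integrable lborel g \<and> integrable lborel (\<lambda>x. x * g x) \<and>
    (\<forall>t. (\<integral>x. iexp (t * x) * g x \<partial>lborel) = \<phi> t)"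

text \<open>By Hermitian symmetry of \<open>\<phi>\<close>, the substitution of \<open>- t\<close>
  for \<open>t\<close> shows that the inverse transform equals its conjugate.\<close>

lemma invF_real:
  assumes h: "\<And>t. \<phi> (- t) = cnj (\<phi> t)"
  shows "invF \<phi> x = complex_of_real (Re (invF \<phi> x))"
proof -
  have "cnj (\<integral>t. iexp (- (t * x)) * \<phi> t \<partial>lborel) = (\<integral>t. cnj (iexp (- (t * x)) * \<phi> t) \<partial>lborel)" by (rule integral_bounded_linear'[OF bounded_linear_cnj bounded_linear_cnj, symmetric]) simp
  also have "\<dots> = (\<integral>t. iexp (- ((- t) * x)) * \<phi> (- t) \<partial>lborel)"
    by (intro Bochner_Integration.integral_cong refl) (simp add: h exp_cnj)
  also have "\<dots> = (\<integral>t. iexp (- (t * x)) * \<phi> t \<partial>lborel)"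
    using lborel_integral_real_affine[of "-1" "\<lambda>t. iexp (- (t * x)) * \<phi> t" 0] by simp
  finally have "cnj (invF \<phi> x) = invF \<phi> x" unfolding invF_def by simp
  then show ?thesis by (metis Reals_cnj_iff of_real_Re)
qed

lemma fourier_density_invF:
  assumes "fourier_good \<phi>" "\<And>t. \<phi> (- t) = cnj (\<phi> t)"
  shows "fourier_density (\<lambda>x. Re (invF \<phi> x)) \<phi>"
proof -
  have e: "complex_of_real (Re (invF \<phi> x)) = invF \<phi> x" for x by (rule invF_real[of \<phi> x, OF assms(2), symmetric])
  have i: "integrable lborel (invF \<phi>)" "integrable lborel (\<lambda>x. x * invF \<phi> x)" using assms(1) by (auto simp: fourier_good_def)
  have "(\<lambda>x. Re (x * invF \<phi> x)) = (\<lambda>x. x * Re (invF \<phi> x))" by simp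
  then show ?thesis unfolding fourier_density_def e using assms(1) integrable_Re[OF i(1)] integrable_Re[OF i(2)]
    by (auto simp: fourier_good_def)
qed

text \<open>The positive and the negative part of \<open>g\<close> provide the pair of finite
  measures that \<open>Gkj\<close> asks for.\<close>

lemma density_pos_neg:
  fixes g :: "real \<Rightarrow> real"
  assumes g: "integrable lborel g"
  defines "N1 \<equiv> density lborel (\<lambda>x. ennreal (max 0 (g x)))" and "N2 \<equiv> density lborel (\<lambda>x. ennreal (max 0 (- g x)))"
  shows "finite_measure N1" "sets N1 = sets borel" "finite_measure N2" "sets N2 = sets borel"
    "char N1 t - char N2 t = (\<integral>x. iexp (t * x) * g x \<partial>lborel)"
    "measure N1 {..x} - measure N2 {..x} = (\<integral>z. indicator {..x} z * g z \<partial>lborel)"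
proof -
  have gm [measurable]: "g \<in> borel_measurable borel" using g by auto
  have ip: "integrable lborel (\<lambda>x. max 0 (g x))" "integrable lborel (\<lambda>x. max 0 (- g x))"
    using g by (auto intro!: integrable_max)
  have fin: "finite_measure (density lborel (\<lambda>x. ennreal (h x)))" 
    and meas: "measure (density lborel (\<lambda>x. ennreal (h x))) {..x} = (\<integral>z. indicator {..x} z * h z \<partial>lborel)"
    if h: "integrable lborel h" "\<And>x. h x \<ge> 0" for h :: "real \<Rightarrow> real"
  proof -
    have [measurable]: "h \<in> borel_measurable borel" using h by auto
    have "emeasure (density lborel (\<lambda>x. ennreal (h x))) UNIV = ennreal (integral\<^sup>L lborel h)"
      using h by (subst emeasure_density) (auto simp: nn_integral_eq_integral)
    then show "finite_measure (density lborel (\<lambda>x. ennreal (h x)))" by (intro finite_measureI) simp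
    have "emeasure (density lborel (\<lambda>x. ennreal (h x))) {..x} = (\<integral>\<^sup>+z. ennreal (indicator {..x} z * h z) \<partial>lborel)"
      by (subst emeasure_density) (auto intro!: nn_integral_cong simp: indicator_def)
    also have "\<dots> = ennreal (\<integral>z. indicator {..x} z * h z \<partial>lborel)"
      using h integrable_mult_indicator[OF _ h(1), of "{..x}"] by (intro nn_integral_eq_integral) auto
    finally show "measure (density lborel (\<lambda>x. ennreal (h x))) {..x} = (\<integral>z. indicator {..x} z * h z \<partial>lborel)"
      unfolding measure_def using h by simp
  qed
  show "finite_measure N1" "finite_measure N2" unfolding N1_def N2_def by (rule fin[OF ip(1) max.cobounded1], rule fin[OF ip(2) max.cobounded1])
  show "sets N1 = sets borel" "sets N2 = sets borel" unfolding N1_def N2_def by auto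
  have dec: "max 0 (g z) - max 0 (- g z) = g z" for z by auto
  have "char N1 t - char N2 t = (\<integral>x. max 0 (g x) *\<^sub>R iexp (t * x) \<partial>lborel) - (\<integral>x. max 0 (- g x) *\<^sub>R iexp (t * x) \<partial>lborel)"
  proof -
    have "char (density lborel (\<lambda>x. ennreal (h x))) t = (\<integral>x. h x *\<^sub>R iexp (t * x) \<partial>lborel)"
      if "h \<in> borel_measurable borel" "\<And>x. h x \<ge> 0" for h
      unfolding char_def using that by (subst integral_density) auto
    from this[of "\<lambda>x. max 0 (g x)"] this[of "\<lambda>x. max 0 (- g x)"] show ?thesis
      unfolding N1_def N2_def by (simp only: max.cobounded1 borel_measurable_max borel_measurable_const gm borel_measurable_uminus)
  qed
  also have "\<dots> = (\<integral>x. iexp (t * x) * max 0 (g x) \<partial>lborel) - (\<integral>x. iexp (t * x) * max 0 (- g x) \<partial>lborel)"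
    by (simp only: scaleR_conv_of_real mult.commute)
  also have "\<dots> = (\<integral>x. iexp (t * x) * max 0 (g x) - iexp (t * x) * max 0 (- g x) \<partial>lborel)"
    by (intro Bochner_Integration.integral_diff[symmetric] integrable_iexp_times_iff integrable_of_real ip) auto
  also have "\<dots> = (\<integral>x. iexp (t * x) * g x \<partial>lborel)"
    by (simp only: right_diff_distrib[symmetric] of_real_diff[symmetric] dec)
  finally show "char N1 t - char N2 t = (\<integral>x. iexp (t * x) * g x \<partial>lborel)" .
  have "measure N1 {..x} - measure N2 {..x} = (\<integral>z. indicator {..x} z * max 0 (g z) \<partial>lborel) - (\<integral>z. indicator {..x} z * max 0 (- g z) \<partial>lborel)"
    unfolding N1_def N2_def by (simp only: meas[OF ip(1) max.cobounded1] meas[OF ip(2) max.cobounded1])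
  also have "\<dots> = (\<integral>z. indicator {..x} z * max 0 (g z) - indicator {..x} z * max 0 (- g z) \<partial>lborel)"
    using integrable_mult_indicator[OF _ ip(1), of "{..x}"] integrable_mult_indicator[OF _ ip(2), of "{..x}"]
    by (intro Bochner_Integration.integral_diff[symmetric]) auto
  also have "\<dots> = (\<integral>z. indicator {..x} z * g z \<partial>lborel)"
    by (simp only: right_diff_distrib[symmetric] dec)
  finally show "measure N1 {..x} - measure N2 {..x} = (\<integral>z. indicator {..x} z * g z \<partial>lborel)" .
qed

text \<open>The description in \<open>Gkj\<close> is meaningful: a density with the right transform
  gives existence, and \<open>signed_cdf_unique\<close> shows that the choice of the two measures
  does not matter.\<close>

lemma Gkj_eq:
  assumes "fourier_density g (\<lambda>t. (- \<i> * complex_of_real t) ^ k * (yfun \<alpha> p \<gamma> t) ^ j * exp (yfun \<alpha> p \<gamma> t))"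
  shows "Gkj k j \<alpha> p \<gamma> = (\<lambda>x. \<integral>z. indicator {..x} z * g z \<partial>lborel)"
proof -
  have g: "integrable lborel g" and ch: "\<And>t. (\<integral>x. iexp (t * x) * g x \<partial>lborel) = (- \<i> * complex_of_real t) ^ k * (yfun \<alpha> p \<gamma> t) ^ j * exp (yfun \<alpha> p \<gamma> t)"
    using assms by (auto simp: fourier_density_def)
  note D = density_pos_neg[OF g]
  let ?N1 = "density lborel (\<lambda>x. ennreal (max 0 (g x)))" and ?N2 = "density lborel (\<lambda>x. ennreal (max 0 (- g x)))"
  show ?thesis unfolding Gkj_def
  proof (rule the_equality)
    show "\<exists>M1 M2. finite_measure M1 \<and> finite_measure M2 \<and> sets M1 = sets borel \<and> sets M2 = sets borel \<and>
      (\<forall>t. char M1 t - char M2 t = (- \<i> * complex_of_real t) ^ k * (yfun \<alpha> p \<gamma> t) ^ j * exp (yfun \<alpha> p \<gamma> t)) \<and>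
      (\<lambda>x. \<integral>z. indicator {..x} z * g z \<partial>lborel) = (\<lambda>x. measure M1 {..x} - measure M2 {..x})"
      using D(1-4) by (intro exI[of _ ?N1] exI[of _ ?N2] conjI allI ext) (simp_all only: D ch)
    fix F assume "\<exists>M1 M2. finite_measure M1 \<and> finite_measure M2 \<and> sets M1 = sets borel \<and> sets M2 = sets borel \<and>
      (\<forall>t. char M1 t - char M2 t = (- \<i> * complex_of_real t) ^ k * (yfun \<alpha> p \<gamma> t) ^ j * exp (yfun \<alpha> p \<gamma> t)) \<and>
      F = (\<lambda>x. measure M1 {..x} - measure M2 {..x})"
    then obtain M1 M2 where M: "finite_measure M1" "sets M1 = sets borel" "finite_measure M2" "sets M2 = sets borel"
      and c: "\<And>t. char M1 t - char M2 t = (- \<i> * complex_of_real t) ^ k * (yfun \<alpha> p \<gamma> t) ^ j * exp (yfun \<alpha> p \<gamma> t)"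
      and F: "F = (\<lambda>x. measure M1 {..x} - measure M2 {..x})" by blast
    show "F = (\<lambda>x. \<integral>z. indicator {..x} z * g z \<partial>lborel)"
      unfolding F D(6)[symmetric] by (intro ext signed_cdf_unique M D(1-4)) (simp only: D(5) c ch)
  qed
qed

text \<open>Here the witness must be a probability law, which requires a nonnegative density; the
  total mass is the transform at 0.\<close>

lemma Gdf_eq:
  assumes "fourier_density g (\<lambda>t. exp (yfun \<alpha> p \<gamma> t))" and nonneg: "\<And>x. g x \<ge> 0" and y0: "yfun \<alpha> p \<gamma> 0 = 0"
  shows "Gdf \<alpha> p \<gamma> = (\<lambda>x. \<integral>z. indicator {..x} z * g z \<partial>lborel)"
proof -
  have g: "integrable lborel g" and ch: "\<And>t. (\<integral>x. iexp (t * x) * g x \<partial>lborel) = exp (yfun \<alpha> p \<gamma> t)"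
    using assms by (auto simp: fourier_density_def)
  note D = density_pos_neg[OF g]
  let ?N = "density lborel (\<lambda>x. ennreal (max 0 (g x)))" and ?N2 = "density lborel (\<lambda>x. ennreal (max 0 (- g x)))"
  have N2: "?N2 = null_measure lborel"
  proof -
    have "ennreal (max 0 (- g x)) = 0" for x using nonneg[of x] by (simp add: max_absorb1)
    then have "(\<lambda>x. ennreal (max 0 (- g x))) = (\<lambda>x. 0)" by (rule ext)
    then show ?thesis by (simp only: null_measure_eq_density)
  qed
  have c: "char ?N t = exp (yfun \<alpha> p \<gamma> t)" for t
  proof -
    have "char ?N2 t = 0" unfolding N2 char_def by simp
    then show ?thesis using D(5)[of t] unfolding ch by (simp only: diff_zero)
  qed
  have m: "cdf ?N = (\<lambda>x. \<integral>z. indicator {..x} z * g z \<partial>lborel)"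
  proof
    fix x
    have "measure ?N2 {..x} = 0" unfolding N2 by simp
    then show "cdf ?N x = (\<integral>z. indicator {..x} z * g z \<partial>lborel)" using D(6)[of x] unfolding cdf_def by (simp only: diff_zero)
  qed
  have "measure ?N UNIV = 1" using c[of 0] char_finite_0[OF D(1,2)] by (simp add: y0)
  then have RD: "real_distribution ?N"
    using finite_measure.emeasure_eq_measure[OF D(1)]
    by (intro real_distribution.intro prob_spaceI real_distribution_axioms.intro) auto
  show ?thesis unfolding Gdf_def
  proof (rule the_equality)
    show "\<exists>M. real_distribution M \<and> (\<forall>t. char M t = exp (yfun \<alpha> p \<gamma> t)) \<and> (\<lambda>x. \<integral>z. indicator {..x} z * g z \<partial>lborel) = cdf M"
      using RD c m by metis
    fix F assume "\<exists>M. real_distribution M \<and> (\<forall>t. char M t = exp (yfun \<alpha> p \<gamma> t)) \<and> F = cdf M"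
    then obtain M where M: "real_distribution M" "\<And>t. char M t = exp (yfun \<alpha> p \<gamma> t)" "F = cdf M" by blast
    have "char M = char ?N" by (rule ext) (simp only: M c)
    then have "M = ?N" by (rule Levy_uniqueness[OF M(1) RD])
    then show "F = (\<lambda>x. \<integral>z. indicator {..x} z * g z \<partial>lborel)" by (simp only: M(3) m)
  qed
qed

section \<open>Characteristic functions of discrete laws\<close>

lemma pmf_nat_sums:
  fixes g :: "nat \<Rightarrow> complex"
  assumes "summable (\<lambda>n. pmf P n * norm (g n))"
  shows "(\<lambda>n. pmf P n *\<^sub>R g n) sums (\<integral>n. g n \<partial>measure_pmf P)"
proof -
  have "integrable (count_space UNIV) (\<lambda>n. pmf P n *\<^sub>R g n)"
    using assms by (simp add: integrable_count_space_nat_iff)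
  from sums_integral_count_space_nat[OF this] show ?thesis
    unfolding measure_pmf_eq_density by (subst integral_density) (auto simp: pmf_nonneg)
qed

definition chp :: "real pmf \<Rightarrow> real \<Rightarrow> complex" where "chp P t = (\<integral>z. iexp (t * z) \<partial>measure_pmf P)"

text \<open>Passes through the nonnegative integral, where binding is an iterated integral. It is
  applied to \<open>1 + cos\<close> and \<open>1 + sin\<close>.\<close>

lemma expectation_bind_pmf_bounded:
  fixes g :: "real \<Rightarrow> real"
  assumes g: "\<And>x. 0 \<le> g x" "\<And>x. g x \<le> B"
  shows "(\<integral>x. g x \<partial>bind_pmf A K) = (\<integral>a. (\<integral>x. g x \<partial>K a) \<partial>measure_pmf A)"
proof -
  have i: "integrable (measure_pmf P) g" for P :: "real pmf"
    using g by (intro measure_pmf.integrable_const_bound[where B = B]) auto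
  have n: "(\<integral>x. g x \<partial>measure_pmf P) \<ge> 0" for P using g by (intro Bochner_Integration.integral_nonneg)
  have B: "(\<integral>x. g x \<partial>measure_pmf P) \<le> B" for P
    using integral_mono[OF i, of P "\<lambda>_. B"] g by simp
  have i2: "integrable (measure_pmf A) (\<lambda>a. \<integral>x. g x \<partial>K a)"
    using n B by (intro measure_pmf.integrable_const_bound[where B = B]) auto
  have "ennreal (\<integral>x. g x \<partial>bind_pmf A K) = (\<integral>\<^sup>+x. ennreal (g x) \<partial>bind_pmf A K)"
    using g by (intro nn_integral_eq_integral[symmetric] i) auto
  also have "\<dots> = (\<integral>\<^sup>+a. (\<integral>\<^sup>+x. ennreal (g x) \<partial>K a) \<partial>measure_pmf A)" by simp
  also have "\<dots> = (\<integral>\<^sup>+a. ennreal (\<integral>x. g x \<partial>K a) \<partial>measure_pmf A)"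
    using g by (intro nn_integral_cong nn_integral_eq_integral i) auto
  also have "\<dots> = ennreal (\<integral>a. (\<integral>x. g x \<partial>K a) \<partial>measure_pmf A)"
    using n by (intro nn_integral_eq_integral i2) auto
  finally show ?thesis using n by (subst (asm) ennreal_inj) (auto intro!: Bochner_Integration.integral_nonneg)
qed

lemma chp_split: "chp P t = complex_of_real (\<integral>x. 1 + cos (t * x) \<partial>measure_pmf P) + \<i> * complex_of_real (\<integral>x. 1 + sin (t * x) \<partial>measure_pmf P) - (1 + \<i>)"
proof -
  have i: "integrable (measure_pmf P) (\<lambda>x. cos (t * x))" "integrable (measure_pmf P) (\<lambda>x. sin (t * x))"
    by (auto intro!: measure_pmf.integrable_const_bound[where B = 1])
  have "chp P t = (\<integral>x. complex_of_real (cos (t * x)) + \<i> * complex_of_real (sin (t * x)) \<partial>measure_pmf P)"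
    unfolding chp_def by (intro Bochner_Integration.integral_cong refl) (simp only: exp_Euler cos_of_real sin_of_real)
  also have "\<dots> = complex_of_real (\<integral>x. cos (t * x) \<partial>measure_pmf P) + \<i> * complex_of_real (\<integral>x. sin (t * x) \<partial>measure_pmf P)"
    using i by (subst Bochner_Integration.integral_add) auto
  finally show ?thesis using i by (simp add: algebra_simps)
qed

lemma chp_bind: "chp (bind_pmf A K) t = (\<integral>a. chp (K a) t \<partial>measure_pmf A)"
proof -
  let ?c = "\<lambda>P. \<integral>x. 1 + cos (t * x) \<partial>measure_pmf P" and ?s = "\<lambda>P. \<integral>x. 1 + sin (t * x) \<partial>measure_pmf P"
  have b: "0 \<le> 1 + cos (t * x)" "1 + cos (t * x) \<le> 2" "0 \<le> 1 + sin (t * x)" "1 + sin (t * x) \<le> 2" for x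
    using cos_ge_minus_one[of "t * x"] cos_le_one[of "t * x"] sin_ge_minus_one[of "t * x"] sin_le_one[of "t * x"] by linarith+
  have bi: "0 \<le> (\<integral>x. g x \<partial>measure_pmf P)" "(\<integral>x. g x \<partial>measure_pmf P) \<le> 2" 
    if "\<And>x. 0 \<le> g x" "\<And>x. g x \<le> 2" for P :: "real pmf" and g :: "real \<Rightarrow> real"
  proof -
    show "0 \<le> (\<integral>x. g x \<partial>measure_pmf P)" using that by (intro Bochner_Integration.integral_nonneg)
    have "integrable (measure_pmf P) g" using that by (intro measure_pmf.integrable_const_bound[where B = 2]) auto
    from integral_mono[OF this, of "\<lambda>_. 2"] that show "(\<integral>x. g x \<partial>measure_pmf P) \<le> 2" by simp
  qed
  have i: "integrable (measure_pmf A) (\<lambda>a. ?c (K a))" "integrable (measure_pmf A) (\<lambda>a. ?s (K a))"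
    using bi b by (auto intro!: measure_pmf.integrable_const_bound[where B = 2])
  have "(\<integral>a. chp (K a) t \<partial>measure_pmf A) = (\<integral>a. complex_of_real (?c (K a)) + \<i> * complex_of_real (?s (K a)) - (1 + \<i>) \<partial>measure_pmf A)"
    unfolding chp_split ..
  also have "\<dots> = complex_of_real (\<integral>a. ?c (K a) \<partial>measure_pmf A) + \<i> * complex_of_real (\<integral>a. ?s (K a) \<partial>measure_pmf A) - (1 + \<i>)"
    using i by (simp add: measure_pmf.prob_space[simplified])
  also have "\<dots> = chp (bind_pmf A K) t"
    unfolding chp_split[of "bind_pmf A K"] using b by (simp add: expectation_bind_pmf_bounded[where B = 2])
  finally show ?thesis by simp
qed

lemma chp_map: "chp (map_pmf (\<lambda>y. b + y) P) t = iexp (t * b) * chp P t"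
  unfolding chp_def by (simp add: ring_distribs exp_add)

lemma integrable_pmf_nn:
  "integrable (measure_pmf P) (\<lambda>z. z) \<longleftrightarrow> (\<integral>\<^sup>+z. ennreal \<bar>z\<bar> \<partial>measure_pmf P) < \<infinity>"
  by (simp add: integrable_iff_bounded)

section \<open>The law of \<open>X\<close>, compound Poisson laws and positivity of the limit
  density\<close>

context stp begin

text \<open>The geometric law counts from 0, whereas the exponents of \<open>rho\<close> start at
  1.\<close>

definition Xpmf :: "real pmf" where "Xpmf = map_pmf (\<lambda>k. rho ^ Suc k) (geometric_pmf p)"

lemma chp_X: "(\<integral>x. iexp (s * x) \<partial>measure_pmf Xpmf) = f s"
proof -
  have pm: "pmf (geometric_pmf p) k = Wf k" for k using p by (simp add: Wf_def q_def)
  have "summable (\<lambda>n. pmf (geometric_pmf p) n * norm (iexp (s * rho ^ Suc n)))"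
    using sums_summable[OF Wf(2)] by (simp only: norm_iexp pm mult_1_right)
  from pmf_nat_sums[OF this] have "f s = (\<integral>n. iexp (s * rho ^ Suc n) \<partial>measure_pmf (geometric_pmf p))"
    unfolding f_def pm by (simp add: sums_iff scaleR_conv_of_real mult.commute)
  then show ?thesis unfolding Xpmf_def by (simp del: power_Suc)
qed

lemma Xpmf_mean: "(\<integral>\<^sup>+x. ennreal \<bar>x\<bar> \<partial>measure_pmf Xpmf) = ennreal mu1"
proof -
  have pm: "pmf (geometric_pmf p) k = Wf k" for k using p by (simp add: Wf_def q_def)
  have "(\<integral>\<^sup>+x. ennreal \<bar>x\<bar> \<partial>measure_pmf Xpmf) = (\<integral>\<^sup>+n. ennreal (rho ^ Suc n * Wf n) \<partial>count_space UNIV)"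
  proof -
    have "(\<integral>\<^sup>+x. ennreal \<bar>x\<bar> \<partial>measure_pmf Xpmf) = (\<integral>\<^sup>+n. ennreal \<bar>rho ^ Suc n\<bar> \<partial>measure_pmf (geometric_pmf p))"
      unfolding Xpmf_def by simp
    also have "\<dots> = (\<integral>\<^sup>+n. ennreal (rho ^ Suc n * Wf n) \<partial>count_space UNIV)"
      unfolding nn_integral_measure_pmf pm using rho Wf(1)
      by (intro nn_integral_cong) (simp add: mult.commute less_imp_le abs_mult flip: ennreal_mult)
    finally show ?thesis .
  qed
  also have "\<dots> = (\<Sum>n. ennreal (rho ^ Suc n * Wf n))" by (rule nn_integral_count_space_nat)
  also have "\<dots> = ennreal mu1"
    using rho Wf(1) by (intro suminf_ennreal_eq rho_Wf) (simp add: less_imp_le)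
  finally show ?thesis .
qed

definition addX :: "real \<Rightarrow> real pmf \<Rightarrow> real pmf" where
  "addX c P = bind_pmf Xpmf (\<lambda>x. map_pmf (\<lambda>y. c * x + y) P)"

lemma chp_addX: "chp (addX c P) t = f (c * t) * chp P t"
  unfolding addX_def chp_bind chp_map using chp_X[of "c * t"] by (simp add: mult_ac)

lemma mean_addX: "c \<ge> 0 \<Longrightarrow> (\<integral>\<^sup>+z. ennreal \<bar>z\<bar> \<partial>measure_pmf (addX c P)) \<le> ennreal (c * mu1) + (\<integral>\<^sup>+z. ennreal \<bar>z\<bar> \<partial>measure_pmf P)"
proof -
  assume c: "c \<ge> 0"
  have "(\<integral>\<^sup>+z. ennreal \<bar>z\<bar> \<partial>measure_pmf (addX c P)) = (\<integral>\<^sup>+x. (\<integral>\<^sup>+y. ennreal \<bar>c * x + y\<bar> \<partial>measure_pmf P) \<partial>measure_pmf Xpmf)"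
    unfolding addX_def by simp
  also have "\<dots> \<le> (\<integral>\<^sup>+x. (\<integral>\<^sup>+y. ennreal c * ennreal \<bar>x\<bar> + ennreal \<bar>y\<bar> \<partial>measure_pmf P) \<partial>measure_pmf Xpmf)"
  proof (intro nn_integral_mono)
    fix x y :: real
    have "\<bar>c * x + y\<bar> \<le> c * \<bar>x\<bar> + \<bar>y\<bar>" using abs_triangle_ineq[of "c * x" y] c by (simp add: abs_mult)
    then show "ennreal \<bar>c * x + y\<bar> \<le> ennreal c * ennreal \<bar>x\<bar> + ennreal \<bar>y\<bar>"
      using c by (simp add: ennreal_leI flip: ennreal_mult ennreal_plus)
  qed
  also have "\<dots> = ennreal (c * mu1) + (\<integral>\<^sup>+z. ennreal \<bar>z\<bar> \<partial>measure_pmf P)"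
  proof -
    have "ennreal (c * mu1) = ennreal c * ennreal mu1" using c mu1(2) by (simp add: ennreal_mult)
    then show ?thesis by (simp add: nn_integral_add nn_integral_cmult Xpmf_mean measure_pmf.emeasure_space_1[simplified])
  qed
  finally show ?thesis .
qed

primrec sumX :: "real \<Rightarrow> nat \<Rightarrow> real pmf" where
  "sumX c 0 = return_pmf 0"
| "sumX c (Suc n) = addX c (sumX c n)"

lemma chp_sumX: "chp (sumX c n) t = f (c * t) ^ n"
  by (induction n) (simp_all add: chp_addX, simp add: chp_def)

lemma mean_sumX: "c \<ge> 0 \<Longrightarrow> (\<integral>\<^sup>+z. ennreal \<bar>z\<bar> \<partial>measure_pmf (sumX c n)) \<le> ennreal (c * mu1) * of_nat n"
proof (induction n)
  case (Suc n)
  have "(\<integral>\<^sup>+z. ennreal \<bar>z\<bar> \<partial>measure_pmf (sumX c (Suc n))) \<le> ennreal (c * mu1) + (\<integral>\<^sup>+z. ennreal \<bar>z\<bar> \<partial>measure_pmf (sumX c n))"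
    using mean_addX[OF Suc.prems] by simp
  also have "\<dots> \<le> ennreal (c * mu1) + ennreal (c * mu1) * of_nat n" by (intro add_left_mono Suc)
  finally show ?case by (simp add: distrib_left)
qed simp

text \<open>A Poisson number of jumps \<open>c * X\<close> with mean number \<open>L\<close>,
  centered by its mean. Its exponent is \<open>L\<close> times the part of \<open>Y (c * t)\<close>
  that comes from the exponents \<open>k >= 1\<close>.\<close>

definition compound :: "real \<Rightarrow> real \<Rightarrow> real pmf" where
  "compound L c = bind_pmf (poisson_pmf L) (\<lambda>n. map_pmf (\<lambda>y. - (L * c * mu1) + y) (sumX c n))"

lemma chp_compound:
  assumes L: "L > 0" shows "chp (compound L c) t = exp (L * (f (c * t) - 1 - \<i> * (c * t) * mu1))"
proof -
  have pm: "pmf (poisson_pmf L) n = L ^ n / fact n * exp (- L)" for n using L by simp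
  have "chp (compound L c) t = (\<integral>n. iexp (t * - (L * c * mu1)) * f (c * t) ^ n \<partial>measure_pmf (poisson_pmf L))"
    unfolding compound_def chp_bind chp_map chp_sumX ..
  also have "\<dots> = iexp (t * - (L * c * mu1)) * (\<integral>n. f (c * t) ^ n \<partial>measure_pmf (poisson_pmf L))" by simp
  also have "(\<integral>n. f (c * t) ^ n \<partial>measure_pmf (poisson_pmf L)) = exp (- L) * exp (L * f (c * t))"
  proof -
    have "summable (\<lambda>n. exp (- L) * (norm (f (c * t)) * L) ^ n /\<^sub>R fact n)"
      using summable_mult[OF summable_exp_generic[of "norm (f (c * t)) * L"], of "exp (- L)"] by (simp add: mult_ac)
    then have "summable (\<lambda>n. pmf (poisson_pmf L) n * norm (f (c * t) ^ n))"
      unfolding pm by (simp add: norm_power power_mult_distrib divide_inverse mult_ac)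
    from pmf_nat_sums[OF this] have S: "(\<lambda>n. pmf (poisson_pmf L) n *\<^sub>R f (c * t) ^ n) sums (\<integral>n. f (c * t) ^ n \<partial>measure_pmf (poisson_pmf L))" .
    have "(\<lambda>n. exp (- L) *\<^sub>R ((L * f (c * t)) ^ n /\<^sub>R fact n)) sums (exp (- L) *\<^sub>R exp (L * f (c * t)))"
      by (intro sums_scaleR_right exp_converges)
    moreover have "exp (- L) *\<^sub>R ((L * f (c * t)) ^ n /\<^sub>R fact n) = pmf (poisson_pmf L) n *\<^sub>R f (c * t) ^ n" for n
      unfolding pm by (simp add: power_mult_distrib divide_inverse scaleR_conv_of_real mult_ac)
    ultimately show ?thesis using S sums_unique2 by (fastforce simp: scaleR_conv_of_real)
  qed
  finally have "chp (compound L c) t = iexp (t * - (L * c * mu1)) * (exp (- complex_of_real L) * exp (L * f (c * t)))"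
    using exp_of_real[of "- L", where ?'a = complex] by simp
  then show ?thesis by (simp add: exp_add[symmetric] algebra_simps)
qed

text \<open>The absolute mean is at most the centering plus \<open>c * mu1\<close> times the mean of
  the Poisson number of summands.\<close>

lemma compound_integrable:
  assumes L: "L > 0" and c: "c \<ge> 0" shows "integrable (measure_pmf (compound L c)) (\<lambda>z. z)"
proof -
  let ?b = "L * c * mu1"
  have b: "?b \<ge> 0" using L c mu1(2) by simp
  have "(\<integral>\<^sup>+z. ennreal \<bar>z\<bar> \<partial>measure_pmf (compound L c)) = (\<integral>\<^sup>+n. (\<integral>\<^sup>+y. ennreal \<bar>- ?b + y\<bar> \<partial>measure_pmf (sumX c n)) \<partial>measure_pmf (poisson_pmf L))"
    unfolding compound_def by simp
  also have "\<dots> \<le> (\<integral>\<^sup>+n. (\<integral>\<^sup>+y. ennreal ?b + ennreal \<bar>y\<bar> \<partial>measure_pmf (sumX c n)) \<partial>measure_pmf (poisson_pmf L))"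
  proof (intro nn_integral_mono)
    fix y
    have "\<bar>- ?b + y\<bar> \<le> ?b + \<bar>y\<bar>" using b by linarith
    then show "ennreal \<bar>- ?b + y\<bar> \<le> ennreal ?b + ennreal \<bar>y\<bar>"
      using b by (simp add: ennreal_leI flip: ennreal_plus)
  qed
  also have "\<dots> \<le> (\<integral>\<^sup>+n. ennreal ?b + ennreal (c * mu1) * of_nat n \<partial>measure_pmf (poisson_pmf L))"
    by (intro nn_integral_mono) (simp add: nn_integral_add measure_pmf.emeasure_space_1[simplified] mean_sumX[OF c])
  also have "\<dots> = ennreal ?b + ennreal (c * mu1) * (\<integral>\<^sup>+n. of_nat n \<partial>measure_pmf (poisson_pmf L))"
    by (simp add: nn_integral_add nn_integral_cmult measure_pmf.emeasure_space_1[simplified])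
  also have "\<dots> < \<infinity>"
  proof -
    have pm: "pmf (poisson_pmf L) n = L ^ n / fact n * exp (- L)" for n using L by simp
    have "summable (\<lambda>n. (L * exp (- L)) * (L ^ n /\<^sub>R fact n))" by (intro summable_mult summable_exp_generic)
    moreover have "(L * exp (- L)) * (L ^ n /\<^sub>R fact n) = pmf (poisson_pmf L) (Suc n) * real (Suc n)" for n
    proof -
      have "inverse (fact n) = real (Suc n) * inverse (fact (Suc n))" by (simp add: divide_simps)
      then show ?thesis unfolding pm by (simp add: divide_inverse mult_ac del: fact_Suc of_nat_Suc)
    qed
    ultimately have "summable (\<lambda>n. pmf (poisson_pmf L) (Suc n) * real (Suc n))" by (simp only:)
    then have sm: "summable (\<lambda>n. pmf (poisson_pmf L) n * real n)" by (subst (asm) summable_Suc_iff)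
    have "(\<integral>\<^sup>+n. of_nat n \<partial>measure_pmf (poisson_pmf L)) = (\<Sum>n. ennreal (pmf (poisson_pmf L) n * real n))"
      unfolding nn_integral_measure_pmf nn_integral_count_space_nat
      by (intro suminf_cong) (simp add: ennreal_mult pmf_nonneg ennreal_of_nat_eq_real_of_nat del: pmf_poisson)
    also have "\<dots> < \<infinity>" using sm by (simp add: suminf_ennreal2 del: pmf_poisson)
    finally show ?thesis by (simp add: ennreal_mult_less_top ennreal_add_less_top)
  qed
  finally show ?thesis unfolding integrable_pmf_nn .
qed

lemma addX_integrable:
  assumes "c \<ge> 0" "integrable (measure_pmf P) (\<lambda>z. z)"
  shows "integrable (measure_pmf (addX c P)) (\<lambda>z. z)"
proof -
  have "ennreal (c * mu1) + (\<integral>\<^sup>+z. ennreal \<bar>z\<bar> \<partial>measure_pmf P) < \<infinity>"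
    using assms(2) unfolding integrable_pmf_nn by (simp add: ennreal_add_less_top)
  then show ?thesis unfolding integrable_pmf_nn using mean_addX[OF assms(1), of P] by (rule order.strict_trans1[rotated])
qed

text \<open>\<open>f\<close> is not smooth, so factors \<open>Y\<close> cannot be treated by differentiation. Each factor \<open>f (c * t)\<close> is
  instead absorbed into the law \<open>P\<close> by convolution with \<open>c X\<close>, and what is left of \<open>Y\<close> is smooth.\<close>
lemma fourier_good_jumps:
  fixes lam c :: real
  assumes lam: "lam > 0" and c: "c > 0"
    and u: "\<And>k. poly_bounded k u" and P: "integrable (measure_pmf P) (\<lambda>z. z)"
  shows "fourier_good (\<lambda>t. u t * (lam * Y (c * t)) ^ j * exp (lam * Ym (c * t)) * chp P t)"
  using u P
proof (induction j arbitrary: u P)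
  case 0
  have w: "((\<lambda>t. lam * Ym (c * t)) has_vector_derivative lam * (c *\<^sub>R Ym1 (c * t))) (at t)" for t
  proof -
    have "((\<lambda>t. c * t) has_vector_derivative c) (at t)"
      by (auto simp: has_vector_derivative_def intro!: derivative_eq_intros)
    from vector_diff_chain_at[OF this Ym_deriv] 
    have "((\<lambda>t. Ym (c * t)) has_vector_derivative c *\<^sub>R Ym1 (c * t)) (at t)" by (simp add: comp_def)
    then show ?thesis by (rule has_vector_derivative_mult_right)
  qed
  have w': "poly_bounded k (\<lambda>t. lam * (c *\<^sub>R Ym1 (c * t)))" for k
    unfolding scaleR_conv_of_real by (intro poly_bounded_mult poly_bounded_const poly_bounded_dilate poly_bounded_Ym1)
  have re: "Re (lam * Ym (c * t)) \<le> lam * (2 + cY) - (lam * cY * c) * \<bar>t\<bar>" for t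
    using mult_left_mono[OF Re_Ym[of "c * t"], of lam] lam c by (simp add: abs_mult algebra_simps)
  have "fourier_good (\<lambda>t. u t * exp (lam * Ym (c * t)))"
    by (rule fourier_good_poly_exp[OF w w' re _ 0(1)]) (use lam cY c in auto)
  from fourier_good_mult_pmf[OF this 0(2) chp_def] show ?case by simp
next
  case (Suc j)
  \<comment> \<open>All of \<open>lam * Y (c * t)\<close> except \<open>lam * f (c * t)\<close>: a
    smooth function of polynomial growth, which joins the amplitude. The missing summand raises the
    law \<open>P\<close> to \<open>addX c P\<close>, so each factor \<open>Y\<close> splits into two
    instances of the induction hypothesis.\<close>
  let ?v = "\<lambda>t. u t * (lam * Ym (c * t) + (- lam + - (\<i> * (lam * c * mu1)) * complex_of_real t))"
  have v: "poly_bounded k ?v" for k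
    by (intro poly_bounded_mult poly_bounded_add poly_bounded_const poly_bounded_dilate poly_bounded_Ym poly_bounded_ident Suc.prems)
  have v2: "poly_bounded k (\<lambda>t. lam * u t)" for k
    by (intro poly_bounded_mult poly_bounded_const Suc.prems)
  note A = Suc.IH[OF v Suc.prems(2)]
  note B = Suc.IH[OF v2 addX_integrable[OF less_imp_le[OF c] Suc.prems(2)]]
  have eq: "u t * (lam * Y (c * t)) ^ Suc j * exp (lam * Ym (c * t)) * chp P t =
    ?v t * (lam * Y (c * t)) ^ j * exp (lam * Ym (c * t)) * chp P t +
    lam * u t * (lam * Y (c * t)) ^ j * exp (lam * Ym (c * t)) * chp (addX c P) t" for t
  proof -
    have "lam * Y (c * t) = lam * Ym (c * t) + (- lam + - (\<i> * (lam * c * mu1)) * complex_of_real t) + lam * f (c * t)"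
      unfolding Y_def by (simp add: algebra_simps)
    then show ?thesis unfolding chp_addX power_Suc by (simp only: algebra_simps)
  qed
  show ?case unfolding eq using fourier_good_add[OF A B] .
qed

lemma Y_cnj: "Y (- s) = cnj (Y s)"
proof -
  have f: "f (- s) = cnj (f s)"
  proof -
    have "(\<lambda>k. cnj (iexp (s * rho ^ Suc k) * Wf k)) sums cnj (f s)"
      unfolding sums_cnj f_def by (rule summable_sums[OF summable_norm_cancel[OF f_summable]])
    then show ?thesis unfolding f_def by (simp add: sums_iff exp_cnj)
  qed
  have "(\<lambda>k. cnj ((iexp (s * kap ^ k) - 1 - \<i> * (s * kap ^ k)) * Wm k)) sums cnj (Ym s)"
    unfolding sums_cnj Ym_def by (rule summable_sums[OF summable_norm_cancel[OF Ym_summable]])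
  then have "Ym (- s) = cnj (Ym s)" unfolding Ym_def by (simp add: sums_iff exp_cnj)
  then show ?thesis by (simp add: Y_def f)
qed

definition gY :: "real \<Rightarrow> real \<Rightarrow> nat \<Rightarrow> nat \<Rightarrow> real \<Rightarrow> real" where
  "gY lam c k j x = Re (invF (\<lambda>t. (- \<i> * complex_of_real t) ^ k * (lam * Y (c * t)) ^ j * exp (lam * Y (c * t))) x)"

text \<open>\<open>exp (lam * Y (c * t))\<close> is a limit of characteristic functions of compound
  Poisson laws. By the functional equation \<open>Y (c * t)\<close> can be read at the scale
  \<open>kap ^ n\<close> with weight \<open>r ^ n\<close>; dropping \<open>Ym\<close> there leaves a
  compound Poisson exponent, and the dropped part is of order
  \<open>(r * kap\<^sup>2) ^ n = \<theta> ^ n\<close>.\<close>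

lemma gY_nonneg:
  fixes lam c :: real
  assumes lam: "lam > 0" and c: "c > 0"
  shows "gY lam c 0 0 x \<ge> 0"
proof -
  let ?P = "\<lambda>n. compound (lam * r ^ n) (c * kap ^ n)"
  have "(\<lambda>n. chp (?P n) t) \<longlonglongrightarrow> exp (lam * Y (c * t))" for t
  proof -
    have e: "chp (?P n) t = exp (lam * Y (c * t) - lam * r ^ n * Ym (c * t * kap ^ n))" for n
    proof -
      have "rho powr - real_of_int (int n) = kap ^ n"
        using rho by (simp add: powr_minus powr_realpow kap_def power_divide inverse_eq_divide)
      moreover have "r powr real_of_int (int n) = r ^ n" using r by (simp add: powr_realpow)
      ultimately have Ye: "Y (c * t) = r ^ n * Y (c * t * kap ^ n)" using Y_scale[of "c * t" "int n"] by simp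
      have ct: "c * kap ^ n * t = c * t * kap ^ n" by simp
      have "complex_of_real (lam * r ^ n) * (f (c * t * kap ^ n) - 1 - \<i> * (complex_of_real (c * kap ^ n) * complex_of_real t) * mu1) = lam * Y (c * t) - lam * r ^ n * Ym (c * t * kap ^ n)"
        unfolding Ye unfolding Y_def by (simp add: algebra_simps)
      then show ?thesis using chp_compound[of "lam * r ^ n" "c * kap ^ n" t] lam r(2) unfolding ct by simp
    qed
    have "(\<lambda>n. lam * r ^ n * Ym (c * t * kap ^ n)) \<longlonglongrightarrow> 0"
    proof (rule Lim_null_comparison)
      show "\<forall>\<^sub>F n in sequentially. norm (lam * r ^ n * Ym (c * t * kap ^ n)) \<le> lam * (c * t)\<^sup>2 / 2 * - mu2 * \<theta> ^ n"
      proof (intro always_eventually allI)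
        fix n
        have "norm (lam * r ^ n * Ym (c * t * kap ^ n)) = lam * r ^ n * norm (Ym (c * t * kap ^ n))"
          using lam r(2) by (simp add: norm_mult norm_power)
        also have "\<dots> \<le> lam * r ^ n * ((c * t * kap ^ n)\<^sup>2 / 2 * - mu2)"
          by (intro mult_left_mono norm_Ym) (use lam r in auto)
        also have "\<dots> = lam * (c * t)\<^sup>2 / 2 * - mu2 * \<theta> ^ n"
          unfolding \<theta>_def by (simp add: power_mult_distrib power2_eq_square)
        finally show "norm (lam * r ^ n * Ym (c * t * kap ^ n)) \<le> lam * (c * t)\<^sup>2 / 2 * - mu2 * \<theta> ^ n" .
      qed
      show "(\<lambda>n. lam * (c * t)\<^sup>2 / 2 * - mu2 * \<theta> ^ n) \<longlonglongrightarrow> 0"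
        using \<theta> by (intro tendsto_mult_right_zero LIMSEQ_power_zero) auto
    qed
    from tendsto_exp[OF tendsto_diff[OF tendsto_const this]] show ?thesis unfolding e by simp
  qed
  moreover have "integrable lborel (\<lambda>t. exp (lam * Y (c * t)))"
  proof -
    have "fourier_good (\<lambda>t. 1 * (lam * Y (c * t)) ^ 0 * exp (lam * Ym (c * t)) * chp (compound lam c) t)"
      by (rule fourier_good_jumps[OF lam c poly_bounded_const compound_integrable[OF lam less_imp_le[OF c]]])
    moreover have "exp (lam * Ym (c * t)) * chp (compound lam c) t = exp (lam * Y (c * t))" for t
      unfolding chp_compound[OF lam] Y_def by (simp add: algebra_simps flip: exp_add)
    ultimately show ?thesis unfolding fourier_good_def by simp
  qed
  ultimately show ?thesis unfolding gY_def using invF_nonneg[of "\<lambda>t. exp (lam * Y (c * t))" ?P x] 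
    unfolding chp_def by simp
qed

end

section \<open>Expansion of the characteristic function\<close>

text \<open>The index counts terms, so \<open>expT (Suc L)\<close> contains the powers up to
  \<open>L\<close>, and differentiation lowers the index by one.\<close>

definition expT :: "nat \<Rightarrow> complex \<Rightarrow> complex" where "expT k z = (\<Sum>j<k. z ^ j / fact j)"

lemma exp_minus_expT: "norm (exp z - expT k z) \<le> exp (norm z) * norm z ^ k"
proof (cases k)
  case 0
  then show ?thesis by (simp add: expT_def complex_Re_le_cmod)
next
  case (Suc n)
  have "norm (exp z - (\<Sum>j\<le>n. z ^ j / fact j)) \<le> exp \<bar>Re z\<bar> * (norm z ^ Suc n) / fact n"
    by (rule Taylor_exp)
  also have "\<dots> \<le> exp (norm z) * norm z ^ Suc n / 1"
    by (intro divide_mono mult_right_mono) (auto simp: abs_Re_le_cmod fact_ge_1)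
  finally show ?thesis unfolding expT_def Suc lessThan_Suc_atMost by simp
qed

lemma expT_1: "expT (Suc 0) z = 1" and expT_2: "expT 2 z = 1 + z"
  by (simp_all add: expT_def numeral_2_eq_2)

lemma expT_deriv:
  assumes "(v has_vector_derivative v') (at t)"
  shows "((\<lambda>t. expT (Suc L) (v t)) has_vector_derivative expT L (v t) * v') (at t)"
proof -
  have "((\<lambda>z. expT (Suc L) z) has_field_derivative expT L z) (at z)" for z
  proof (induction L)
    case (Suc L)
    have e: "expT (Suc (Suc L)) = (\<lambda>z. expT (Suc L) z + z ^ Suc L / fact (Suc L))" "expT (Suc L) z = expT L z + z ^ L / fact L"
      by (auto simp: expT_def)
    have "((\<lambda>z::complex. z ^ Suc L / fact (Suc L)) has_field_derivative (of_nat (Suc L) * z ^ L / fact (Suc L))) (at z)"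
      by (auto intro!: derivative_eq_intros simp del: power_Suc fact_Suc)
    also have "of_nat (Suc L) * z ^ L / fact (Suc L) = z ^ L / fact L" by (simp add: divide_simps del: of_nat_Suc)
    finally show ?case unfolding e by (rule DERIV_add[OF Suc])
  qed (simp add: expT_def)
  from field_vector_diff_chain_at[OF assms this] show ?thesis by (simp add: comp_def mult.commute)
qed

lemma norm_add4: "norm (a + b + c + d :: 'a :: real_normed_vector) \<le> norm a + norm b + norm c + norm d"
  using norm_triangle_ineq[of a b] norm_triangle_ineq[of "a + b" c] norm_triangle_ineq[of "a + b + c" d] by linarith

lemma norm_add6: "norm (a + b + c + d + e + f :: 'a :: real_normed_vector) \<le> norm a + norm b + norm c + norm d + norm e + norm f"
  using norm_add4[of a b c d] norm_triangle_ineq[of "a + b + c + d" e] norm_triangle_ineq[of "a + b + c + d + e" f] by linarith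

text \<open>\<open>v1\<close> and \<open>v2\<close> are two corrections to an exponent, of sizes
  \<open>\<delta>\<close> and \<open>d\<close>. The error \<open>\<epsilon>\<close> collects the
  first omitted power of \<open>v1\<close>, the square of \<open>v2\<close>, the mixed term and,
  unless \<open>\<theta> = 1\<close>, the term \<open>v2\<close> itself. The factors
  \<open>t\<^sup>2\<close> and \<open>t\<close> are kept because both estimates are later divided by
  \<open>t\<close> or its square.\<close>

lemma remainder_bounds:
  fixes L :: nat and v1 v1' v2 v2' :: complex and t K \<delta> d \<theta> :: real
  assumes K: "K \<ge> 1" and \<delta>: "0 \<le> \<delta>" "\<delta> \<le> 1" and d: "0 \<le> d" "d \<le> 1" and \<theta>: "0 \<le> \<theta>" "\<theta> \<le> 1"
    and t: "t \<ge> 0"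
  defines "P \<equiv> 1 + t"
  assumes v1: "norm v1 \<le> K * \<delta> * t\<^sup>2" "norm v1' \<le> K * \<delta> * t"
    and v2: "norm v2 \<le> K * d * t\<^sup>2 * P" "norm v2' \<le> K * d * t * P"
  defines "G \<equiv> exp (norm v1 + norm v2)" and "\<epsilon> \<equiv> \<delta> ^ Suc L + d\<^sup>2 + \<delta> * d + (1 - \<theta>) * d"
    and "N \<equiv> K ^ Suc L + 2 * K ^ 3"
  shows "norm (exp (v1 + v2) - expT (Suc L) v1 - \<theta> * v2) \<le> N * \<epsilon> * G * (t\<^sup>2 * P ^ (2 * L + 6))"
    and "norm (exp (v1 + v2) * (v1' + v2') - expT L v1 * v1' - \<theta> * v2') \<le> N * \<epsilon> * G * (t * P ^ (2 * L + 6))"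
proof -
  have P: "P \<ge> 1" "t \<le> P" using t by (auto simp: P_def)
  have G: "exp (norm v1) * exp (norm v2) = G" "exp (norm v1) \<le> G" "exp (norm v2) \<le> G" by (auto simp: G_def exp_add)
  have G3: "G \<ge> 1" by (simp add: G_def)
  let ?Q = "P ^ (2 * L + 6)"
  \<comment> \<open>The exponent \<open>2 * L + 6\<close> covers every pair that occurs:
    \<open>2 * L\<close> comes from the power of \<open>v1\<close>, and 6 from \<open>v1'\<close>
    times the square of \<open>v2\<close>.\<close>
  have Pk: "t ^ i * P ^ j \<le> ?Q" if "i + j \<le> 2 * L + 6" for i j
  proof -
    have "t ^ i * P ^ j \<le> P ^ i * P ^ j" using P t by (intro mult_right_mono power_mono) auto
    also have "\<dots> \<le> ?Q" unfolding power_add[symmetric] using P that by (intro power_increasing) auto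
    finally show ?thesis .
  qed
  have St: "c * (X * (t ^ i * P ^ j)) \<le> c' * (X * ?Q)" if "c \<le> c'" "0 \<le> c'" "0 \<le> X" "i + j \<le> 2 * L + 6" for c c' X i j
  proof (rule mult_mono[OF that(1) mult_left_mono[OF Pk[OF that(4)] that(3)] that(2)])
    show "0 \<le> X * (t ^ i * P ^ j)" using that P t by simp
  qed
  have K2: "1 \<le> K ^ 2" "K ^ 2 \<le> K ^ 3" "K \<le> K ^ 3" using K power_increasing[of 2 3 K] power_increasing[of 1 3 K] by (auto simp: one_le_power)
  have p2L: "(t\<^sup>2) ^ L = t ^ (2 * L)" by (simp only: power_mult)
  have Q0: "?Q \<ge> 0" using P by simp
  let ?t2 = "t\<^sup>2 * ?Q" and ?t1 = "t * ?Q"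
  have nn: "0 \<le> ?t2" "0 \<le> ?t1" using Q0 t by auto
  have vK: "0 \<le> K * \<delta> * t\<^sup>2" "0 \<le> K * \<delta> * t" "0 \<le> K * d * t\<^sup>2 * P" "0 \<le> K * d * t * P" using K \<delta> d P t by auto
  have m1: "norm v1 ^ Suc L \<le> K ^ Suc L * \<delta> ^ Suc L * ?t2"
  proof -
    have "norm v1 ^ Suc L \<le> (K * \<delta> * t\<^sup>2) ^ Suc L" by (intro power_mono v1) auto
    also have "\<dots> = K ^ Suc L * \<delta> ^ Suc L * (t\<^sup>2 * (t ^ (2 * L) * P ^ 0))"
      by (simp only: power_mult_distrib power_Suc p2L power_0 mult_1_right mult_ac)
    also have "\<dots> \<le> K ^ Suc L * \<delta> ^ Suc L * ?t2" by (rule St) (use K \<delta> t in auto)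
    finally show ?thesis .
  qed
  have m1': "norm v1 ^ L * norm v1' \<le> K ^ Suc L * \<delta> ^ Suc L * ?t1"
  proof -
    have "norm v1 ^ L * norm v1' \<le> (K * \<delta> * t\<^sup>2) ^ L * (K * \<delta> * t)" using vK by (intro mult_mono power_mono v1) auto
    also have "\<dots> = K ^ Suc L * \<delta> ^ Suc L * (t * (t ^ (2 * L) * P ^ 0))"
      by (simp only: power_mult_distrib power_Suc p2L power_0 mult_1_right mult_ac)
    also have "\<dots> \<le> K ^ Suc L * \<delta> ^ Suc L * ?t1" by (rule St) (use K \<delta> t in auto)
    finally show ?thesis .
  qed
  have m2: "norm v2 ^ 2 \<le> K ^ 3 * d\<^sup>2 * ?t2"
  proof -
    have "norm v2 ^ 2 \<le> (K * d * t\<^sup>2 * P) ^ 2" by (intro power_mono v2) auto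
    also have "\<dots> = K ^ 2 * d\<^sup>2 * (t\<^sup>2 * (t ^ 2 * P ^ 2))" by (simp add: power_mult_distrib power2_eq_square mult_ac)
    also have "\<dots> \<le> K ^ 3 * d\<^sup>2 * ?t2" by (rule St) (use K t in \<open>auto intro!: mult_right_mono K2\<close>)
    finally show ?thesis .
  qed
  have m2': "norm v2 * norm v2' \<le> K ^ 3 * d\<^sup>2 * ?t1"
  proof -
    have "norm v2 * norm v2' \<le> (K * d * t\<^sup>2 * P) * (K * d * t * P)" using vK by (intro mult_mono v2) auto
    also have "\<dots> = K ^ 2 * d\<^sup>2 * (t * (t ^ 2 * P ^ 2))" by (simp add: power2_eq_square mult_ac)
    also have "\<dots> \<le> K ^ 3 * d\<^sup>2 * ?t1" by (rule St) (use K t in \<open>auto intro!: mult_right_mono K2\<close>)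
    finally show ?thesis .
  qed
  have m3: "norm v1' * norm v2 ^ 2 \<le> K ^ 3 * d\<^sup>2 * ?t1"
  proof -
    have "norm v1' * norm v2 ^ 2 \<le> (K * \<delta> * t) * (K * d * t\<^sup>2 * P) ^ 2" using vK by (intro mult_mono power_mono v1 v2) auto
    also have "\<dots> = \<delta> * (K ^ 3 * d\<^sup>2 * (t * (t ^ 4 * P ^ 2)))" by (simp add: power_mult_distrib power2_eq_square power3_eq_cube power4_eq_xxxx mult_ac)
    also have "\<dots> \<le> 1 * (K ^ 3 * d\<^sup>2 * ?t1)"
      by (rule mult_mono[OF \<delta>(2) St]) (use K P t in auto)
    finally show ?thesis by simp
  qed
  have m4: "norm v1 * norm v2 \<le> K ^ 3 * (\<delta> * d) * ?t2"
  proof -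
    have "norm v1 * norm v2 \<le> (K * \<delta> * t\<^sup>2) * (K * d * t\<^sup>2 * P)" using vK by (intro mult_mono v1 v2) auto
    also have "\<dots> = K ^ 2 * (\<delta> * d) * (t\<^sup>2 * (t ^ 2 * P ^ 1))" by (simp add: power2_eq_square mult_ac)
    also have "\<dots> \<le> K ^ 3 * (\<delta> * d) * ?t2" by (rule St) (use K \<delta> d t in \<open>auto intro!: mult_right_mono K2\<close>)
    finally show ?thesis .
  qed
  have m4': "norm v1' * norm v2 \<le> K ^ 3 * (\<delta> * d) * ?t1" "norm v1 * norm v2' \<le> K ^ 3 * (\<delta> * d) * ?t1"
  proof -
    have le: "K ^ 2 * (\<delta> * d) * (t * (t ^ 2 * P ^ 1)) \<le> K ^ 3 * (\<delta> * d) * ?t1" by (rule St) (use K \<delta> d t in \<open>auto intro!: mult_right_mono K2\<close>)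
    have "norm v1' * norm v2 \<le> (K * \<delta> * t) * (K * d * t\<^sup>2 * P)" using vK by (intro mult_mono v1 v2) auto
    also have "\<dots> = K ^ 2 * (\<delta> * d) * (t * (t ^ 2 * P ^ 1))" by (simp add: power2_eq_square mult_ac)
    finally show "norm v1' * norm v2 \<le> K ^ 3 * (\<delta> * d) * ?t1" using le by linarith
    have "norm v1 * norm v2' \<le> (K * \<delta> * t\<^sup>2) * (K * d * t * P)" using vK by (intro mult_mono v1 v2) auto
    also have "\<dots> = K ^ 2 * (\<delta> * d) * (t * (t ^ 2 * P ^ 1))" by (simp add: power2_eq_square mult_ac)
    finally show "norm v1 * norm v2' \<le> K ^ 3 * (\<delta> * d) * ?t1" using le by linarith
  qed
  have m5: "norm v2 \<le> K ^ 3 * d * ?t2" "norm v2' \<le> K ^ 3 * d * ?t1"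
  proof -
    have "K * d * t\<^sup>2 * P = K * d * (t\<^sup>2 * (t ^ 0 * P ^ 1))" "K * d * t * P = K * d * (t * (t ^ 0 * P ^ 1))" by auto
    moreover have "K * d * (t\<^sup>2 * (t ^ 0 * P ^ 1)) \<le> K ^ 3 * d * ?t2" "K * d * (t * (t ^ 0 * P ^ 1)) \<le> K ^ 3 * d * ?t1"
      by (rule St; use K d t in \<open>auto intro!: mult_right_mono K2\<close>)+
    ultimately show "norm v2 \<le> K ^ 3 * d * ?t2" "norm v2' \<le> K ^ 3 * d * ?t1" using v2 by linarith+
  qed
  have comb: "K ^ Suc L * \<delta> ^ Suc L * X + 2 * (K ^ 3 * d\<^sup>2 * X) + 2 * (K ^ 3 * (\<delta> * d) * X) + (1 - \<theta>) * (K ^ 3 * d * X) \<le> N * \<epsilon> * X" if X: "X \<ge> 0" for X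
  proof -
    have k: "0 \<le> K ^ Suc L" "0 \<le> K ^ 3" using K by auto
    have e: "0 \<le> \<delta> ^ Suc L" "0 \<le> d\<^sup>2" "0 \<le> \<delta> * d" "0 \<le> (1 - \<theta>) * d" using \<delta> d \<theta> by auto
    have "K ^ Suc L * \<delta> ^ Suc L + 2 * K ^ 3 * d\<^sup>2 + 2 * K ^ 3 * (\<delta> * d) + K ^ 3 * ((1 - \<theta>) * d) \<le> N * \<epsilon>"
    proof -
      have "a * e1 + 2 * b * e2 + 2 * b * e3 + b * e4 \<le> (a + 2 * b) * (e1 + e2 + e3 + e4)"
        if "0 \<le> a" "0 \<le> b" "0 \<le> e1" "0 \<le> e2" "0 \<le> e3" "0 \<le> e4" for a b e1 e2 e3 e4 :: real
      proof -
        have "(a + 2 * b) * (e1 + e2 + e3 + e4) = a * e1 + 2 * b * e2 + 2 * b * e3 + b * e4 + (a * e2 + a * e3 + a * e4 + 2 * b * e1 + b * e4)"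
          by (simp add: algebra_simps)
        moreover have "0 \<le> a * e2 + a * e3 + a * e4 + 2 * b * e1 + b * e4" using that by (intro add_nonneg_nonneg mult_nonneg_nonneg) auto
        ultimately show ?thesis by linarith
      qed
      from this[OF k e] show ?thesis unfolding N_def \<epsilon>_def .
    qed
    from mult_right_mono[OF this X] show ?thesis by (simp add: algebra_simps)
  qed
  have x1: "norm (exp v1 - expT k v1) \<le> exp (norm v1) * norm v1 ^ k" for k by (rule exp_minus_expT)
  have x2: "norm (exp v2 - 1 - v2) \<le> exp (norm v2) * norm v2 ^ 2" using exp_minus_expT[of v2 2] by (simp add: expT_2 diff_diff_eq)
  have x3: "norm (exp v2 - 1) \<le> exp (norm v2) * norm v2" using exp_minus_expT[of v2 "Suc 0"] by (simp add: expT_1)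
  have x4: "norm (exp v1 - 1) \<le> exp (norm v1) * norm v1" using exp_minus_expT[of v1 "Suc 0"] by (simp add: expT_1)
  have x5: "norm (exp v1) \<le> exp (norm v1)" by (rule norm_exp)
  have GG: "a * b \<le> G * x" if "a \<le> exp (norm v1)" "b \<le> exp (norm v2) * x" "0 \<le> b" "0 \<le> x" for a b x
  proof -
    have "a * b \<le> exp (norm v1) * (exp (norm v2) * x)" using that by (intro mult_mono) auto
    then show ?thesis by (simp add: mult.assoc[symmetric] G)
  qed
  have nth: "norm (complex_of_real (1 - \<theta>)) = 1 - \<theta>"
    unfolding norm_of_real using \<theta> by simp
  have G1: "a \<le> G * x" if "a \<le> exp (norm v1) * x" "0 \<le> x" for a x
    using that mult_right_mono[OF G(2), of x] by linarith
  \<comment> \<open>The four summands correspond in order to the four summands of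
    \<open>\<epsilon>\<close>.\<close>
  have "exp (v1 + v2) - expT (Suc L) v1 - \<theta> * v2 = (exp v1 - expT (Suc L) v1) + exp v1 * (exp v2 - 1 - v2) + (exp v1 - 1) * v2 + (1 - \<theta>) * v2"
    by (simp add: exp_add algebra_simps)
  also have "norm \<dots> \<le> norm (exp v1 - expT (Suc L) v1) + norm (exp v1) * norm (exp v2 - 1 - v2) + norm (exp v1 - 1) * norm v2 + (1 - \<theta>) * norm v2"
    by (rule order_trans[OF norm_add4]) (simp only: norm_mult nth order_refl)
  also have "\<dots> \<le> G * norm v1 ^ Suc L + G * norm v2 ^ 2 + G * (norm v1 * norm v2) + G * ((1 - \<theta>) * norm v2)"
  proof (intro add_mono)
    show "norm (exp v1 - expT (Suc L) v1) \<le> G * norm v1 ^ Suc L" by (rule G1[OF x1]) simp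
    show "norm (exp v1) * norm (exp v2 - 1 - v2) \<le> G * norm v2 ^ 2" by (rule GG[OF x5 x2]) auto
    have "norm (exp v1 - 1) * norm v2 \<le> exp (norm v1) * (norm v1 * norm v2)" using mult_right_mono[OF x4, of "norm v2"] by (simp add: mult.assoc)
    then show "norm (exp v1 - 1) * norm v2 \<le> G * (norm v1 * norm v2)" by (rule G1) simp
    show "(1 - \<theta>) * norm v2 \<le> G * ((1 - \<theta>) * norm v2)" using mult_right_mono[OF G3, of "(1 - \<theta>) * norm v2"] \<theta> by simp
  qed
  also have "\<dots> = G * (norm v1 ^ Suc L + norm v2 ^ 2 + norm v1 * norm v2 + (1 - \<theta>) * norm v2)" by (simp only: ring_distribs)
  also have "\<dots> \<le> G * (K ^ Suc L * \<delta> ^ Suc L * ?t2 + 2 * (K ^ 3 * d\<^sup>2 * ?t2) + 2 * (K ^ 3 * (\<delta> * d) * ?t2) + (1 - \<theta>) * (K ^ 3 * d * ?t2))"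
  proof (intro mult_left_mono add_mono m1)
    have "0 \<le> K ^ 3 * d\<^sup>2 * ?t2" "0 \<le> K ^ 3 * (\<delta> * d) * ?t2" using K \<delta> d nn by auto
    then show "norm v2 ^ 2 \<le> 2 * (K ^ 3 * d\<^sup>2 * ?t2)" "norm v1 * norm v2 \<le> 2 * (K ^ 3 * (\<delta> * d) * ?t2)" using m2 m4 by linarith+
  qed (use m5 \<theta> G3 in auto)
  also have "\<dots> \<le> G * (N * \<epsilon> * ?t2)" using G3 by (intro mult_left_mono comb nn) auto
  finally show "norm (exp (v1 + v2) - expT (Suc L) v1 - \<theta> * v2) \<le> N * \<epsilon> * G * (t\<^sup>2 * P ^ (2 * L + 6))" by (simp only: mult_ac)
  \<comment> \<open>The previous splitting differentiated by the product rule.\<close>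
  have "exp (v1 + v2) * (v1' + v2') - expT L v1 * v1' - \<theta> * v2' = (exp v1 - expT L v1) * v1' + v1' * (exp v1 * (exp v2 - 1 - v2)) + exp v1 * (exp v2 - 1) * v2' + exp v1 * (v1' * v2) + (exp v1 - 1) * v2' + (1 - \<theta>) * v2'"
    by (simp add: exp_add algebra_simps)
  also have "norm \<dots> \<le> norm (exp v1 - expT L v1) * norm v1' + norm v1' * (norm (exp v1) * norm (exp v2 - 1 - v2)) + norm (exp v1) * norm (exp v2 - 1) * norm v2' + norm (exp v1) * (norm v1' * norm v2) + norm (exp v1 - 1) * norm v2' + (1 - \<theta>) * norm v2'"
    by (rule order_trans[OF norm_add6]) (simp only: norm_mult nth order_refl mult.assoc)
  also have "\<dots> \<le> G * (norm v1 ^ L * norm v1') + G * (norm v1' * norm v2 ^ 2) + G * (norm v2 * norm v2') + G * (norm v1' * norm v2) + G * (norm v1 * norm v2') + G * ((1 - \<theta>) * norm v2')"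
  proof (intro add_mono)
    have "norm (exp v1 - expT L v1) * norm v1' \<le> exp (norm v1) * (norm v1 ^ L * norm v1')" using mult_right_mono[OF x1[of L], of "norm v1'"] by (simp add: mult.assoc)
    then show "norm (exp v1 - expT L v1) * norm v1' \<le> G * (norm v1 ^ L * norm v1')" by (rule G1) simp
    have "norm (exp v1) * norm (exp v2 - 1 - v2) \<le> G * norm v2 ^ 2" by (rule GG[OF x5 x2]) auto
    from mult_left_mono[OF this, of "norm v1'"] show "norm v1' * (norm (exp v1) * norm (exp v2 - 1 - v2)) \<le> G * (norm v1' * norm v2 ^ 2)" by (simp add: mult_ac)
    have "norm (exp v1) * norm (exp v2 - 1) \<le> G * norm v2" by (rule GG[OF x5 x3]) auto
    from mult_right_mono[OF this, of "norm v2'"] show "norm (exp v1) * norm (exp v2 - 1) * norm v2' \<le> G * (norm v2 * norm v2')" by (simp add: mult_ac)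
    show "norm (exp v1) * (norm v1' * norm v2) \<le> G * (norm v1' * norm v2)" by (rule mult_right_mono[OF order_trans[OF x5 G(2)]]) simp
    have "norm (exp v1 - 1) * norm v2' \<le> exp (norm v1) * (norm v1 * norm v2')" using mult_right_mono[OF x4, of "norm v2'"] by (simp add: mult.assoc)
    then show "norm (exp v1 - 1) * norm v2' \<le> G * (norm v1 * norm v2')" by (rule G1) simp
    show "(1 - \<theta>) * norm v2' \<le> G * ((1 - \<theta>) * norm v2')" using mult_right_mono[OF G3, of "(1 - \<theta>) * norm v2'"] \<theta> by simp
  qed
  also have "\<dots> = G * (norm v1 ^ L * norm v1' + (norm v1' * norm v2 ^ 2 + norm v2 * norm v2') + (norm v1' * norm v2 + norm v1 * norm v2') + (1 - \<theta>) * norm v2')" by (simp only: ring_distribs add.assoc)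
  also have "\<dots> \<le> G * (K ^ Suc L * \<delta> ^ Suc L * ?t1 + 2 * (K ^ 3 * d\<^sup>2 * ?t1) + 2 * (K ^ 3 * (\<delta> * d) * ?t1) + (1 - \<theta>) * (K ^ 3 * d * ?t1))"
  proof (intro mult_left_mono add_mono m1')
    show "norm v1' * norm v2 ^ 2 + norm v2 * norm v2' \<le> 2 * (K ^ 3 * d\<^sup>2 * ?t1)" "norm v1' * norm v2 + norm v1 * norm v2' \<le> 2 * (K ^ 3 * (\<delta> * d) * ?t1)"
      using m2' m3 m4' by linarith+
  qed (use m5 \<theta> G3 in auto)
  also have "\<dots> \<le> G * (N * \<epsilon> * ?t1)" using G3 by (intro mult_left_mono comb nn) auto
  finally show "norm (exp (v1 + v2) * (v1' + v2') - expT L v1 * v1' - \<theta> * v2') \<le> N * \<epsilon> * G * (t * P ^ (2 * L + 6))" by (simp only: mult_ac)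
qed

text \<open>Telescoping of the difference of two powers, one factor exchanged at a time.\<close>

lemma power_diff_le:
  fixes z w :: complex
  assumes "norm z \<le> R" "norm w \<le> R"
  shows "norm (z ^ Suc m - w ^ Suc m) \<le> real (Suc m) * norm (z - w) * R ^ m"
proof (induction m)
  case (Suc m)
  have R: "R \<ge> 0" using assms(1) norm_ge_zero order_trans by blast
  have "z ^ Suc (Suc m) - w ^ Suc (Suc m) = z ^ Suc m * (z - w) + (z ^ Suc m - w ^ Suc m) * w" by (simp add: algebra_simps)
  also have "norm \<dots> \<le> norm z ^ Suc m * norm (z - w) + norm (z ^ Suc m - w ^ Suc m) * norm w"
    by (rule order_trans[OF norm_triangle_ineq]) (simp add: norm_mult norm_power)
  also have "\<dots> \<le> R ^ Suc m * norm (z - w) + (real (Suc m) * norm (z - w) * R ^ m) * R"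
    using assms R by (intro add_mono mult_mono power_mono Suc) auto
  also have "\<dots> = real (Suc (Suc m)) * norm (z - w) * R ^ Suc m" by (simp add: algebra_simps)
  finally show ?case .
qed simp

lemma powr_small:
  fixes e D b :: real assumes "e > 0" "D \<ge> 0" "b > 0"
  shows "\<exists>s0>0. \<forall>a. 0 \<le> a \<longrightarrow> a \<le> s0 \<longrightarrow> D * a powr b \<le> e"
proof (intro exI conjI allI impI)
  show "(e / (D + 1)) powr (1 / b) > 0" using assms by simp
  fix a assume a: "0 \<le> a" "a \<le> (e / (D + 1)) powr (1 / b)"
  have "a powr b \<le> ((e / (D + 1)) powr (1 / b)) powr b" using a assms by (intro powr_mono2) auto
  also have "\<dots> = e / (D + 1)" using assms by (simp add: powr_powr)
  finally have "D * a powr b \<le> D * (e / (D + 1))" using assms by (intro mult_left_mono) auto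
  also have "\<dots> \<le> e" using assms by (simp add: field_simps)
  finally show "D * a powr b \<le> e" .
qed

context stp begin

text \<open>\<open>Zf\<close> is the logarithm of the centered characteristic function up to \<open>O(\<bar>s\<bar>\<^bsup>kp\<^esup>)\<close>, since
  \<open>f s - 1 = Y s + \<i> s \<mu>\<^sub>1 - Ym s\<close> and \<open>Ym s = \<mu>\<^sub>2 s\<^sup>2 / 2 + O(\<bar>s\<bar>\<^sup>3)\<close>.\<close>
definition "sig = mu1\<^sup>2 - mu2"
definition "kp = min 3 (2 * \<alpha>)"
definition "Zf s = Y s + sig * s\<^sup>2 / 2 - \<i> * s * mu1 * Y s"
definition "Zd s = Y' s + sig * s - \<i> * mu1 * Y s - \<i> * s * mu1 * Y' s"

lemma sig: "sig > 0" using mu2(2) zero_le_power2[of mu1] unfolding sig_def by linarith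
text \<open>The strict inequality \<open>kp > \<alpha> + 1\<close> uses both bounds on \<alpha>. It
  makes the error of the expansion, \<open>n powr (1 - kp / \<alpha>)\<close>, of smaller order than
  \<open>n powr (- 1 / \<alpha>)\<close>.\<close>

lemma kp: "2 \<le> kp" "kp \<le> 3" "kp \<le> 2 * \<alpha>" "kp > \<alpha> + 1" using \<alpha> by (auto simp: kp_def)

lemma of_real_deriv: "(complex_of_real has_vector_derivative 1) (at s)"
  by (auto intro!: derivative_eq_intros simp: has_vector_derivative_def scaleR_conv_of_real)

lemma Zf_deriv: "(Zf has_vector_derivative Zd s) (at s)"
proof -
  have 1: "((\<lambda>s. complex_of_real (sig * s\<^sup>2 / 2)) has_vector_derivative complex_of_real (sig * s)) (at s)"
    by (rule has_vector_derivative_of_real) (auto intro!: derivative_eq_intros)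
  have 2: "((\<lambda>s. \<i> * complex_of_real s * mu1 * Y s) has_vector_derivative \<i> * complex_of_real s * mu1 * Y' s + \<i> * 1 * mu1 * Y s) (at s)"
    by (intro has_vector_derivative_mult Y_deriv has_vector_derivative_mult_left has_vector_derivative_mult_right of_real_deriv)
  show ?thesis unfolding Zf_def[abs_def] Zd_def
    using has_vector_derivative_diff[OF has_vector_derivative_add[OF Y_deriv 1] 2] by (simp add: algebra_simps)
qed

lemma powr_le_1: "0 \<le> a \<Longrightarrow> a \<le> 1 \<Longrightarrow> 0 \<le> b \<Longrightarrow> a powr b \<le> (1::real)"
  using powr_mono2[of b a 1] by simp

lemma powr_le_self: "0 \<le> a \<Longrightarrow> a \<le> 1 \<Longrightarrow> 1 \<le> b \<Longrightarrow> a powr b \<le> (a::real)"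
  using powr_mono'[of 1 b a] by simp

text \<open>The comparison is made for derivatives, since the bound for \<open>f\<close> itself then
  follows by integration from 0. The order \<open>kp - 1 = min 2 (2 * \<alpha> - 1)\<close> has two
  sources: the Taylor remainder of \<open>Ym1\<close> and similar terms are quadratic in
  \<open>s\<close>, and the product \<open>Y' s * Y s\<close> has order
  \<open>2 * \<alpha> - 1\<close>.\<close>

lemma f_taylor_deriv:
  obtains C where "C \<ge> 0" "\<And>s. \<bar>s\<bar> \<le> 1 \<Longrightarrow> norm (f' s - (\<i> * mu1 + Zd s) * exp (\<i> * s * mu1 + Zf s)) \<le> C * \<bar>s\<bar> powr (kp - 1)"
proof -
  define S3 where "S3 = (\<Sum>k. (kap ^ k) ^ 3 * Wm k)"
  define K1 where "K1 = mu1 + CY + sig / 2 + mu1 * CY"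
  define K2 where "K2 = mu1 + CY + sig + mu1 * CY + mu1 * CY"
  define K3 where "K3 = sig / 2 + mu1 * CY"
  define K4 where "K4 = sig + 2 * mu1 * CY"
  define C0 where "C0 = S3 / 2 + K2 * K3 + K4 * (mu1 + CY) + K2 * (exp K1 * K1\<^sup>2)"
  define C where "C = C0 + CY\<^sup>2"
  have m: "mu1 > 0" "CY > 0" "sig > 0" by (rule mu1 CY sig)+
  have Kpos: "K1 > 0" "K2 > 0" "K3 > 0" "K4 > 0" unfolding K1_def K2_def K3_def K4_def using m by (auto intro!: add_pos_pos)
  have S3: "S3 \<ge> 0" unfolding S3_def using kap Wm by (intro suminf_nonneg kap_Wm_summable) (auto simp: less_imp_le)
  have C0: "C0 \<ge> 0" unfolding C0_def using Kpos m S3 by (intro add_nonneg_nonneg mult_nonneg_nonneg) auto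
  show ?thesis
  proof (rule that[of C])
    show "C \<ge> 0" unfolding C_def using C0 by simp
    fix s :: real assume s1: "\<bar>s\<bar> \<le> 1"
    define a where "a = \<bar>s\<bar>"
    have a: "0 \<le> a" "a \<le> 1" using s1 by (auto simp: a_def)
    have aa: "a\<^sup>2 = s\<^sup>2" "a\<^sup>2 \<le> a" using a mult_left_mono[of a 1 a] by (auto simp: a_def power2_eq_square)
    define v where "v = sig * s\<^sup>2 / 2 - \<i> * s * mu1 * Y s"
    define u where "u = sig * s - \<i> * mu1 * Y s - \<i> * s * mu1 * Y' s"
    define W where "W = \<i> * s * mu1 + Zf s"
    have W: "W = \<i> * s * mu1 + Y s + v" by (simp add: W_def Zf_def v_def)
    have Zd: "Zd s = Y' s + u" by (simp add: Zd_def u_def)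
    have Ya: "norm (Y s) \<le> CY * a" "norm (Y' s) \<le> CY" "norm (Y s) \<le> CY"
    proof -
      have "a powr \<alpha> \<le> a" "a powr (\<alpha> - 1) \<le> 1" using a \<alpha> by (auto intro: powr_le_self powr_le_1)
      then have "CY * a powr \<alpha> \<le> CY * a" "CY * a powr (\<alpha> - 1) \<le> CY * 1" using m by (auto intro!: mult_left_mono)
      moreover have "CY * a \<le> CY * 1" using m a by (intro mult_left_mono) auto
      ultimately show "norm (Y s) \<le> CY * a" "norm (Y' s) \<le> CY" "norm (Y s) \<le> CY"
        using norm_Y[of s] norm_Y'[of s] unfolding a_def by linarith+
    qed
    have sY: "norm (\<i> * s * mu1 * Y s) \<le> a * mu1 * (CY * a)" 
      unfolding norm_mult using m a by (simp add: a_def) (intro mult_left_mono Ya[unfolded a_def], auto)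
    have nv: "norm v \<le> K3 * a\<^sup>2"
    proof -
      have "norm v \<le> norm (complex_of_real (sig * s\<^sup>2 / 2)) + norm (\<i> * s * mu1 * Y s)" unfolding v_def by (simp only: of_real_divide of_real_numeral norm_triangle_ineq4)
      also have "norm (complex_of_real (sig * s\<^sup>2 / 2)) = sig / 2 * a\<^sup>2" unfolding norm_of_real using m by (simp add: aa)
      finally show ?thesis using sY by (simp add: K3_def power2_eq_square algebra_simps)
    qed
    have nu: "norm u \<le> K4 * a"
    proof -
      have "norm u \<le> norm (complex_of_real (sig * s)) + norm (\<i> * mu1 * Y s) + norm (\<i> * s * mu1 * Y' s)"
        unfolding u_def by (rule order_trans[OF norm_triangle_ineq4] add_right_mono norm_triangle_ineq4)+
      also have "\<dots> \<le> sig * a + mu1 * (CY * a) + a * mu1 * CY"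
        unfolding norm_mult norm_of_real using m Ya a by (intro add_mono) (auto simp: a_def abs_mult intro!: mult_left_mono mult_mono)
      finally show ?thesis by (simp add: K4_def algebra_simps)
    qed
    have nY: "norm (\<i> * s * mu1 + Y s) \<le> (mu1 + CY) * a"
      using norm_triangle_ineq[of "\<i> * s * mu1" "Y s"] Ya m by (simp add: norm_mult a_def algebra_simps)
    have nW: "norm W \<le> K1 * a"
    proof -
      have "norm W \<le> (mu1 + CY) * a + K3 * a\<^sup>2" unfolding W using norm_triangle_ineq[of "\<i> * s * mu1 + Y s" v] nY nv by linarith
      also have "\<dots> \<le> (mu1 + CY) * a + K3 * a" using aa Kpos by (intro add_left_mono mult_left_mono) auto
      finally show ?thesis by (simp add: K1_def K3_def algebra_simps)
    qed
    have nW': "norm (\<i> * mu1 + Zd s) \<le> K2"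
    proof -
      have "norm (\<i> * mu1 + Zd s) \<le> mu1 + norm (Y' s) + norm u"
        unfolding Zd using norm_triangle_ineq[of "\<i> * mu1" "Y' s + u"] norm_triangle_ineq[of "Y' s" u] m by (simp add: norm_mult)
      also have "\<dots> \<le> mu1 + CY + K4 * 1"
        by (intro add_mono order_refl Ya order_trans[OF nu] mult_left_mono) (use a Kpos in auto)
      finally show ?thesis by (simp add: K2_def K4_def algebra_simps)
    qed
    have nE: "norm (exp W - 1 - W) \<le> exp K1 * K1\<^sup>2 * a\<^sup>2"
    proof -
      have "norm (exp W - 1 - W) \<le> exp (norm W) * norm W ^ 2" using exp_minus_expT[of W 2] by (simp add: expT_2 diff_diff_eq)
      also have "\<dots> \<le> exp K1 * (K1 * a) ^ 2"
      proof (intro mult_mono power_mono nW)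
        have "K1 * a \<le> K1 * 1" using a Kpos by (intro mult_left_mono) auto
        then show "exp (norm W) \<le> exp K1" using nW by simp
      qed auto
      finally show ?thesis by (simp add: power_mult_distrib mult_ac)
    qed
    \<comment> \<open>This cancellation determines \<open>Zf\<close>. In the product
      \<open>(\<i> * mu1 + Zd s) * (1 + W)\<close> the linear term is
      \<open>(sig - mu1\<^sup>2) * s = - mu2 * s\<close>, matching \<open>Ym1\<close>, and the terms
      \<open>mu1 * Y\<close> and \<open>s * mu1 * Y'\<close> drop out against the derivative of the
      last summand of \<open>Zf\<close>.\<close>
    have eq: "f' s - (\<i> * mu1 + Zd s) * exp W = - (Ym1 s - mu2 * s) - Y' s * Y s - (\<i> * mu1 + Zd s) * v - u * (\<i> * s * mu1 + Y s) - (\<i> * mu1 + Zd s) * (exp W - 1 - W)"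
    proof -
      have f's: "f' s = \<i> * mu1 + Y' s - Ym1 s" by (simp add: Y'_def)
      have sg: "complex_of_real mu2 = complex_of_real mu1 * complex_of_real mu1 - complex_of_real sig"
        by (simp add: sig_def power2_eq_square)
      have "(\<i> * mu1 + Zd s) * (1 + W) = \<i> * mu1 + Y' s - mu2 * s + Y' s * Y s + (\<i> * mu1 + Zd s) * v + u * (\<i> * s * mu1 + Y s)"
        unfolding W Zd unfolding u_def by (simp add: sg algebra_simps)
      then show ?thesis unfolding f's by (simp add: algebra_simps)
    qed
    have "norm (f' s - (\<i> * mu1 + Zd s) * exp W) \<le> norm (Ym1 s - mu2 * s) + norm (Y' s * Y s) + norm ((\<i> * mu1 + Zd s) * v) + norm (u * (\<i> * s * mu1 + Y s)) + norm ((\<i> * mu1 + Zd s) * (exp W - 1 - W))"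
    proof -
      have "norm (- a - b - c - d - e) \<le> norm a + norm b + norm c + norm d + norm e" for a b c d e :: complex
        using norm_triangle_ineq4[of "- a" b] norm_triangle_ineq4[of "- a - b" c] norm_triangle_ineq4[of "- a - b - c" d] norm_triangle_ineq4[of "- a - b - c - d" e]
        by simp
      then show ?thesis unfolding eq .
    qed
    also have "\<dots> \<le> S3 / 2 * a\<^sup>2 + CY\<^sup>2 * a powr (2 * \<alpha> - 1) + K2 * (K3 * a\<^sup>2) + (K4 * a) * ((mu1 + CY) * a) + K2 * (exp K1 * K1\<^sup>2 * a\<^sup>2)"
    proof (intro add_mono)
      show "norm (Ym1 s - mu2 * s) \<le> S3 / 2 * a\<^sup>2" using Ym1_taylor[of s] by (simp add: S3_def aa mult.commute)
      have "norm (Y' s * Y s) \<le> (CY * a powr (\<alpha> - 1)) * (CY * a powr \<alpha>)"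
        unfolding norm_mult a_def using m by (intro mult_mono norm_Y norm_Y') auto
      also have "\<dots> = CY\<^sup>2 * (a powr (\<alpha> - 1) * a powr \<alpha>)" by (simp add: power2_eq_square)
      also have "a powr (\<alpha> - 1) * a powr \<alpha> = a powr (2 * \<alpha> - 1)" by (simp flip: powr_add)
      finally show "norm (Y' s * Y s) \<le> CY\<^sup>2 * a powr (2 * \<alpha> - 1)" .
    qed (unfold norm_mult, (intro mult_mono nW' nv nu nY nE; use Kpos a m in auto)+)
    also have "\<dots> = C0 * a\<^sup>2 + CY\<^sup>2 * a powr (2 * \<alpha> - 1)" by (simp add: C0_def power2_eq_square algebra_simps)
    also have "\<dots> \<le> C0 * a powr (kp - 1) + CY\<^sup>2 * a powr (kp - 1)"
    proof (intro add_mono mult_left_mono C0)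
      have "a\<^sup>2 = a powr 2" using a by simp
      then show "a\<^sup>2 \<le> a powr (kp - 1)" using kp a powr_mono'[of "kp - 1" 2 a] by simp
      show "a powr (2 * \<alpha> - 1) \<le> a powr (kp - 1)" using kp a by (intro powr_mono') auto
    qed simp
    also have "\<dots> = C * \<bar>s\<bar> powr (kp - 1)" by (simp add: C_def a_def algebra_simps)
    finally show "norm (f' s - (\<i> * mu1 + Zd s) * exp (\<i> * s * mu1 + Zf s)) \<le> C * \<bar>s\<bar> powr (kp - 1)" unfolding W_def .
  qed
qed

text \<open>The characteristic function of \<open>X - mu1\<close>; \<open>gd\<close> is its
  derivative.\<close>

definition "gs s = f s * iexp (- (s * mu1))"
definition "gd s = (f' s - \<i> * mu1 * f s) * iexp (- (s * mu1))"

lemma gs_deriv: "(gs has_vector_derivative gd s) (at s)"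
  using has_vector_derivative_mult[OF f_deriv iexp_has_vector_derivative[of mu1 s]]
  unfolding gs_def[abs_def] gd_def by (simp add: algebra_simps)

lemma norm_gs: "norm (gs s) = norm (f s)" by (simp add: gs_def norm_mult)

lemma norm_gd: "norm (gd s) \<le> 2 * mu1"
proof -
  have "norm (gd s) \<le> norm (f' s) + norm (\<i> * mu1 * f s)" unfolding gd_def norm_mult norm_iexp using norm_triangle_ineq4[of "f' s" "\<i> * mu1 * f s"] by (simp add: norm_mult)
  also have "\<dots> \<le> mu1 + mu1 * 1" using norm_f' norm_f mu1(2) by (intro add_mono) (auto simp: norm_mult)
  finally show ?thesis by simp
qed

text \<open>The derivative bound is integrated along the segment from 0, where both functions equal
  1; this gains one power of \<open>\<bar>s\<bar>\<close>. The centering factor has modulus 1, and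
  its derivative contributes a term of the higher order \<open>kp\<close>.\<close>

lemma taylor_gs:
  obtains C where "C \<ge> 0" "\<And>s. \<bar>s\<bar> \<le> 1 \<Longrightarrow> norm (gs s - exp (Zf s)) \<le> C * \<bar>s\<bar> powr kp"
    "\<And>s. \<bar>s\<bar> \<le> 1 \<Longrightarrow> norm (gd s - Zd s * exp (Zf s)) \<le> C * \<bar>s\<bar> powr (kp - 1)"
proof -
  obtain C where C: "C \<ge> 0" "\<And>s. \<bar>s\<bar> \<le> 1 \<Longrightarrow> norm (f' s - (\<i> * mu1 + Zd s) * exp (\<i> * s * mu1 + Zf s)) \<le> C * \<bar>s\<bar> powr (kp - 1)"
    using f_taylor_deriv by blast
  let ?e = "\<lambda>s. exp (\<i> * complex_of_real s * mu1 + Zf s)"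
  have dD: "((\<lambda>s. f s - ?e s) has_vector_derivative f' s - (\<i> * mu1 + Zd s) * ?e s) (at s)" for s
  proof -
    have "((\<lambda>s. \<i> * complex_of_real s * mu1 + Zf s) has_vector_derivative \<i> * 1 * mu1 + Zd s) (at s)"
      by (intro has_vector_derivative_add Zf_deriv has_vector_derivative_mult_left has_vector_derivative_mult_right of_real_deriv)
    from field_vector_diff_chain_at[OF this DERIV_exp] f_deriv
    show ?thesis by (intro has_vector_derivative_diff) (auto simp: comp_def)
  qed
  have D: "norm (f s - ?e s) \<le> C * \<bar>s\<bar> powr kp" if s: "\<bar>s\<bar> \<le> 1" for s
  proof -
    have "norm ((f s - ?e s) - (f 0 - ?e 0)) \<le> C * \<bar>s\<bar> powr (kp - 1) * norm (s - 0)"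
    proof (rule differentiable_bound[where S = "closed_segment 0 s" and f' = "\<lambda>x h. h *\<^sub>R (f' x - (\<i> * mu1 + Zd x) * ?e x)"])
      fix x assume "x \<in> closed_segment 0 s"
      then have x: "\<bar>x\<bar> \<le> \<bar>s\<bar>" by (auto simp: closed_segment_eq_real_ivl split: if_splits)
      show "((\<lambda>s. f s - ?e s) has_derivative (\<lambda>h. h *\<^sub>R (f' x - (\<i> * mu1 + Zd x) * ?e x))) (at x within closed_segment 0 s)"
        using dD[of x] unfolding has_vector_derivative_def by (rule has_derivative_at_withinI)
      have "norm (f' x - (\<i> * mu1 + Zd x) * ?e x) \<le> C * \<bar>x\<bar> powr (kp - 1)" using C(2)[of x] x s by simp
      also have "\<dots> \<le> C * \<bar>s\<bar> powr (kp - 1)" using x C kp by (intro mult_left_mono powr_mono2) auto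
      finally show "onorm (\<lambda>h. h *\<^sub>R (f' x - (\<i> * mu1 + Zd x) * ?e x)) \<le> C * \<bar>s\<bar> powr (kp - 1)"
        by (intro onorm_le) (simp add: mult.commute[of "\<bar>_\<bar>"] mult_right_mono)
    qed auto
    also have "\<dots> = C * (\<bar>s\<bar> powr (kp - 1) * \<bar>s\<bar> powr 1)" by simp
    also have "\<bar>s\<bar> powr (kp - 1) * \<bar>s\<bar> powr 1 = \<bar>s\<bar> powr kp" unfolding powr_add[symmetric] by simp
    finally show ?thesis by (simp add: f_0 Zf_def Y_0)
  qed
  have e: "exp (Zf s) = ?e s * iexp (- (s * mu1))" for s by (simp add: exp_add[symmetric] algebra_simps)
  show ?thesis
  proof (rule that[of "C + mu1 * C"])
    show "C + mu1 * C \<ge> 0" using C(1) mu1(2) by simp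
    fix s :: real assume s: "\<bar>s\<bar> \<le> 1"
    have "gs s - exp (Zf s) = (f s - ?e s) * iexp (- (s * mu1))" unfolding gs_def e by (simp only: left_diff_distrib)
    then have "norm (gs s - exp (Zf s)) \<le> C * \<bar>s\<bar> powr kp" using D[OF s] by (simp only: norm_mult norm_iexp mult_1_right)
    moreover have "0 \<le> mu1 * C * \<bar>s\<bar> powr kp" using C(1) mu1(2) by simp
    ultimately show "norm (gs s - exp (Zf s)) \<le> (C + mu1 * C) * \<bar>s\<bar> powr kp" unfolding distrib_right by linarith
    have "gd s - Zd s * exp (Zf s) = ((f' s - (\<i> * mu1 + Zd s) * ?e s) - \<i> * mu1 * (f s - ?e s)) * iexp (- (s * mu1))"
      unfolding gd_def e by (simp only: algebra_simps)
    then have "norm (gd s - Zd s * exp (Zf s)) \<le> norm (f' s - (\<i> * mu1 + Zd s) * ?e s) + mu1 * norm (f s - ?e s)"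
      using norm_triangle_ineq4[of "f' s - (\<i> * mu1 + Zd s) * ?e s" "\<i> * mu1 * (f s - ?e s)"] mu1(2) by (simp only: norm_mult norm_iexp mult_1_right norm_ii norm_of_real abs_of_pos mult_1)
    also have "\<dots> \<le> C * \<bar>s\<bar> powr (kp - 1) + mu1 * (C * \<bar>s\<bar> powr (kp - 1))"
    proof (intro add_mono mult_left_mono C s)
      have "\<bar>s\<bar> powr kp \<le> \<bar>s\<bar> powr (kp - 1)" using s by (intro powr_mono') auto
      then show "norm (f s - ?e s) \<le> C * \<bar>s\<bar> powr (kp - 1)" using D[OF s] mult_left_mono[of "\<bar>s\<bar> powr kp" "\<bar>s\<bar> powr (kp - 1)" C] C by linarith
    qed (use mu1 in auto)
    finally show "norm (gd s - Zd s * exp (Zf s)) \<le> (C + mu1 * C) * \<bar>s\<bar> powr (kp - 1)" by (simp add: algebra_simps)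
  qed
qed

text \<open>A rate that survives all losses: the real part of \<open>Zf\<close> keeps
  \<open>5/8 * cY\<close>, the inequality for \<open>exp (- x)\<close> halves this, and the
  difference between \<open>gs\<close> and \<open>exp Zf\<close> costs at most
  \<open>cY / 8\<close>.\<close>

definition "c0 = cY / 8"
lemma c0: "c0 > 0" using cY by (simp add: c0_def)

text \<open>For \<alpha> < 2 the corrections \<open>sig * s\<^sup>2 / 2\<close> and
  \<open>s * mu1 * Y s\<close> are small compared with \<open>\<bar>s\<bar> powr \<alpha>\<close>
  near 0, so the decay of \<open>exp Y\<close> passes to \<open>exp Zf\<close> and then to
  \<open>gs\<close>. The two inequalities on the corrections are part of the result because they
  later absorb the growth of \<open>exp (v1 + v2)\<close>.\<close>

lemma Zf_small:
  obtains s0 C K where "0 < s0" "s0 \<le> 1" "C \<ge> 0" "K \<ge> 0"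
    "\<And>s. \<bar>s\<bar> \<le> s0 \<Longrightarrow> sig * s\<^sup>2 / 2 \<le> cY / 4 * \<bar>s\<bar> powr \<alpha>"
    "\<And>s. \<bar>s\<bar> \<le> s0 \<Longrightarrow> mu1 * CY * \<bar>s\<bar> * \<bar>s\<bar> powr \<alpha> \<le> cY / 8 * \<bar>s\<bar> powr \<alpha>"
    "\<And>s. \<bar>s\<bar> \<le> s0 \<Longrightarrow> norm (gs s) \<le> exp (- c0 * \<bar>s\<bar> powr \<alpha>)"
    "\<And>s. \<bar>s\<bar> \<le> s0 \<Longrightarrow> norm (exp (Zf s)) \<le> exp (- c0 * \<bar>s\<bar> powr \<alpha>)"
    "\<And>s. \<bar>s\<bar> \<le> s0 \<Longrightarrow> norm (gs s - exp (Zf s)) \<le> C * \<bar>s\<bar> powr kp"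
    "\<And>s. \<bar>s\<bar> \<le> s0 \<Longrightarrow> norm (gd s - Zd s * exp (Zf s)) \<le> C * \<bar>s\<bar> powr (kp - 1)"
    "\<And>s. \<bar>s\<bar> \<le> s0 \<Longrightarrow> norm (Zd s) \<le> K * \<bar>s\<bar> powr (\<alpha> - 1)"
proof -
  obtain C where C: "C \<ge> 0" "\<And>s. \<bar>s\<bar> \<le> 1 \<Longrightarrow> norm (gs s - exp (Zf s)) \<le> C * \<bar>s\<bar> powr kp"
    "\<And>s. \<bar>s\<bar> \<le> 1 \<Longrightarrow> norm (gd s - Zd s * exp (Zf s)) \<le> C * \<bar>s\<bar> powr (kp - 1)"
    using taylor_gs by blast
  have m: "mu1 > 0" "CY > 0" "sig > 0" "cY > 0" by (rule mu1 CY sig cY)+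
  obtain s1 where s1: "s1 > 0" "\<And>a. 0 \<le> a \<Longrightarrow> a \<le> s1 \<Longrightarrow> sig / 2 * a powr (2 - \<alpha>) \<le> cY / 4"
    using powr_small[of "cY/4" "sig/2" "2 - \<alpha>"] m \<alpha> by auto
  obtain s2 where s2: "s2 > 0" "\<And>a. 0 \<le> a \<Longrightarrow> a \<le> s2 \<Longrightarrow> mu1 * CY * a powr 1 \<le> cY / 8"
    using powr_small[of "cY/8" "mu1 * CY" 1] m by auto
  obtain s3 where s3: "s3 > 0" "\<And>a. 0 \<le> a \<Longrightarrow> a \<le> s3 \<Longrightarrow> C * a powr (kp - \<alpha>) \<le> cY / 8"
    using powr_small[of "cY/8" C "kp - \<alpha>"] m C kp by auto
  \<comment> \<open>Forces \<open>x \<le> 1\<close> below, the range in which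
    \<open>exp (- x) \<le> 1 - x / 2\<close> is derived.\<close>
  obtain s4 where s4: "s4 > 0" "\<And>a. 0 \<le> a \<Longrightarrow> a \<le> s4 \<Longrightarrow> (5/8 * cY) * a powr \<alpha> \<le> 1"
    using powr_small[of 1 "5/8 * cY" \<alpha>] m \<alpha> by auto
  define s0 where "s0 = Min {1, s1, s2, s3, s4}"
  have s0: "0 < s0" "s0 \<le> 1" "s0 \<le> s1" "s0 \<le> s2" "s0 \<le> s3" "s0 \<le> s4" using s1 s2 s3 s4 unfolding s0_def by auto
  have A1: "sig * s\<^sup>2 / 2 \<le> cY / 4 * \<bar>s\<bar> powr \<alpha>" if s: "\<bar>s\<bar> \<le> s0" for s
  proof -
    have "s\<^sup>2 = \<bar>s\<bar> powr (2 - \<alpha>) * \<bar>s\<bar> powr \<alpha>" unfolding powr_add[symmetric] by simp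
    then have "sig * s\<^sup>2 / 2 = (sig / 2 * \<bar>s\<bar> powr (2 - \<alpha>)) * \<bar>s\<bar> powr \<alpha>" by simp
    also have "\<dots> \<le> cY / 4 * \<bar>s\<bar> powr \<alpha>" using s1(2)[of "\<bar>s\<bar>"] s s0 by (intro mult_right_mono) auto
    finally show ?thesis .
  qed
  have A2: "mu1 * CY * \<bar>s\<bar> * \<bar>s\<bar> powr \<alpha> \<le> cY / 8 * \<bar>s\<bar> powr \<alpha>" if s: "\<bar>s\<bar> \<le> s0" for s
    using s2(2)[of "\<bar>s\<bar>"] s s0 by (intro mult_right_mono) auto
  have A3: "C * \<bar>s\<bar> powr kp \<le> cY / 8 * \<bar>s\<bar> powr \<alpha>" if s: "\<bar>s\<bar> \<le> s0" for s
  proof -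
    have "C * \<bar>s\<bar> powr kp = (C * \<bar>s\<bar> powr (kp - \<alpha>)) * \<bar>s\<bar> powr \<alpha>" by (simp add: mult.assoc flip: powr_add)
    also have "\<dots> \<le> cY / 8 * \<bar>s\<bar> powr \<alpha>" using s3(2)[of "\<bar>s\<bar>"] s s0 by (intro mult_right_mono) auto
    finally show ?thesis .
  qed
  have ReZ: "Re (Zf s) \<le> - (5/8 * cY) * \<bar>s\<bar> powr \<alpha>" if s: "\<bar>s\<bar> \<le> s0" for s
  proof -
    have "\<bar>Re (\<i> * s * mu1 * Y s)\<bar> \<le> norm (\<i> * s * mu1 * Y s)" by (rule abs_Re_le_cmod)
    also have "\<dots> \<le> \<bar>s\<bar> * mu1 * (CY * \<bar>s\<bar> powr \<alpha>)" unfolding norm_mult using m norm_Y[of s] by (auto intro!: mult_left_mono)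
    also have "\<dots> \<le> cY / 8 * \<bar>s\<bar> powr \<alpha>" using A2[OF s] by (simp add: mult_ac)
    finally have "\<bar>Re (\<i> * s * mu1 * Y s)\<bar> \<le> cY / 8 * \<bar>s\<bar> powr \<alpha>" .
    moreover have "Re (Zf s) = Re (Y s) + sig * s\<^sup>2 / 2 - Re (\<i> * s * mu1 * Y s)"
    proof -
      have "complex_of_real sig * (complex_of_real s)\<^sup>2 / 2 = complex_of_real (sig * s\<^sup>2 / 2)" by simp
      then show ?thesis unfolding Zf_def by (simp only: minus_complex.sel plus_complex.sel Re_complex_of_real)
    qed
    ultimately show ?thesis using Re_Y[of s] A1[OF s] by (simp add: algebra_simps)
  qed
  have B2: "norm (exp (Zf s)) \<le> exp (- (5/8 * cY) * \<bar>s\<bar> powr \<alpha>)" if "\<bar>s\<bar> \<le> s0" for s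
    using ReZ[OF that] by simp
  show ?thesis
  proof (rule that[OF s0(1,2) C(1) _ A1 A2])
    fix s assume s: "\<bar>s\<bar> \<le> s0"
    let ?\<tau> = "\<bar>s\<bar> powr \<alpha>"
    have "(- (5/8 * cY)) * ?\<tau> \<le> (- c0) * ?\<tau>" using cY by (intro mult_right_mono) (auto simp: c0_def)
    then show "norm (exp (Zf s)) \<le> exp (- c0 * ?\<tau>)" using B2[OF s] by (meson exp_le_cancel_iff order_trans)
    define x where "x = 5/8 * cY * ?\<tau>"
    have x: "0 \<le> x" "x \<le> 1" using s4(2)[of "\<bar>s\<bar>"] s s0 cY by (auto simp: x_def)
    have "exp (- x) \<le> 1 - x / 2"
    proof -
      have "exp (- x) = 1 / exp x" by (simp add: exp_minus divide_inverse)
      also have "\<dots> \<le> 1 / (1 + x)" using x exp_ge_add_one_self[of x] by (intro divide_left_mono) auto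
      also have "\<dots> \<le> 1 - x / 2"
      proof -
        have "x * x \<le> x * 1" using x by (intro mult_left_mono) auto
        then have "1 \<le> (1 - x / 2) * (1 + x)" by (simp add: algebra_simps)
        then show ?thesis using x by (simp add: pos_divide_le_eq)
      qed
      finally show ?thesis .
    qed
    moreover have "norm (gs s) \<le> norm (exp (Zf s)) + norm (gs s - exp (Zf s))"
      using norm_triangle_ineq[of "exp (Zf s)" "gs s - exp (Zf s)"] by simp
    moreover have "norm (exp (Zf s)) \<le> exp (- x)" using B2[OF s] by (simp add: x_def)
    moreover have "norm (gs s - exp (Zf s)) \<le> cY / 8 * ?\<tau>" using C(2)[of s] A3[OF s] s s0 by linarith
    ultimately have "norm (gs s) \<le> 1 - x / 2 + cY / 8 * ?\<tau>" by linarith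
    also have "\<dots> \<le> 1 + (- c0 * ?\<tau>)"
    proof -
      have "0 \<le> cY * ?\<tau>" using cY by simp
      then show ?thesis by (simp add: x_def c0_def)
    qed
    also have "\<dots> \<le> exp (- c0 * ?\<tau>)" by (rule exp_ge_add_one_self)
    finally show "norm (gs s) \<le> exp (- c0 * ?\<tau>)" .
    show "norm (gs s - exp (Zf s)) \<le> C * \<bar>s\<bar> powr kp" "norm (gd s - Zd s * exp (Zf s)) \<le> C * \<bar>s\<bar> powr (kp - 1)"
      using C s s0 by auto
    have s1': "\<bar>s\<bar> \<le> 1" using s s0 by simp
    have "norm (Zd s) \<le> norm (Y' s) + sig * \<bar>s\<bar> + mu1 * norm (Y s) + \<bar>s\<bar> * mu1 * norm (Y' s)"
    proof -
      have "norm (a + b - c - d) \<le> norm a + norm b + norm c + norm d" for a b c d :: complex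
        using norm_triangle_ineq[of a b] norm_triangle_ineq4[of "a + b" c] norm_triangle_ineq4[of "a + b - c" d] by linarith
      from this[of "Y' s" "complex_of_real sig * s" "\<i> * mu1 * Y s" "\<i> * s * mu1 * Y' s"] show ?thesis
        unfolding Zd_def using m by (simp add: norm_mult)
    qed
    also have "\<dots> \<le> CY * \<bar>s\<bar> powr (\<alpha> - 1) + sig * \<bar>s\<bar> powr (\<alpha> - 1) + mu1 * (CY * \<bar>s\<bar> powr (\<alpha> - 1)) + 1 * mu1 * (CY * \<bar>s\<bar> powr (\<alpha> - 1))"
    proof -
      have "\<bar>s\<bar> powr 1 \<le> \<bar>s\<bar> powr (\<alpha> - 1)" by (rule powr_mono') (use s1' \<alpha> in auto)
      moreover have "\<bar>s\<bar> powr \<alpha> \<le> \<bar>s\<bar> powr (\<alpha> - 1)" by (rule powr_mono') (use s1' in auto)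
      ultimately have "sig * \<bar>s\<bar> \<le> sig * \<bar>s\<bar> powr (\<alpha> - 1)" "CY * \<bar>s\<bar> powr \<alpha> \<le> CY * \<bar>s\<bar> powr (\<alpha> - 1)"
        using m by (auto intro!: mult_left_mono)
      moreover from this(2) have "norm (Y s) \<le> CY * \<bar>s\<bar> powr (\<alpha> - 1)" using norm_Y[of s] by linarith
      ultimately show ?thesis using m s1' by (intro add_mono norm_Y' mult_left_mono mult_mono) auto
    qed
    also have "\<dots> = (CY + sig + 2 * mu1 * CY) * \<bar>s\<bar> powr (\<alpha> - 1)" by (simp add: algebra_simps)
    finally show "norm (Zd s) \<le> (CY + sig + 2 * mu1 * CY) * \<bar>s\<bar> powr (\<alpha> - 1)" .
  qed (use m in auto)
qed

text \<open>\<open>Phi\<close> is the transform of the approximating function: \<open>th = 0\<close> gives part (i), \<open>th = 1\<close> adds the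
  \<open>G\<^bsup>(1,1)\<^esup>\<close> term of part (ii). \<open>L\<close> stands for the \<open>\<ell> - 1\<close> of the statement.\<close>
definition "dn n = real n powr (- 1 / \<alpha>)"
definition "yn n t = of_nat n * Y (t * dn n)"
definition "yn' n t = of_nat n * dn n * Y' (t * dn n)"
definition "v1 n t = complex_of_real (real n * (sig * (t * dn n)\<^sup>2 / 2))"
definition "v1' n t = complex_of_real (real n * (sig * (t * dn n) * dn n))"
definition "v2 n t = - \<i> * t * dn n * mu1 * yn n t"
definition "v2' n t = - \<i> * dn n * mu1 * (yn n t + t * yn' n t)"
definition "Phi th L n t = exp (yn n t) * (expT (Suc L) (v1 n t) + th * v2 n t)"
definition "Phi' th L n t = yn' n t * Phi th L n t + exp (yn n t) * (expT L (v1 n t) * v1' n t + th * v2' n t)"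
definition "hn th L n t = gs (t * dn n) ^ n - Phi th L n t"
definition "hn' th L n t = of_nat n * dn n * gs (t * dn n) ^ (n - 1) * gd (t * dn n) - Phi' th L n t"

lemma dilate_deriv: assumes "\<And>s. (u has_vector_derivative u' s) (at s)"
  shows "((\<lambda>t. u (t * d)) has_vector_derivative complex_of_real d * u' (t * d)) (at t)"
proof -
  have "((\<lambda>t. t * d) has_vector_derivative d) (at t)"
    by (auto intro!: derivative_eq_intros simp: has_vector_derivative_def)
  from vector_diff_chain_at[OF this assms] show ?thesis by (simp add: comp_def scaleR_conv_of_real)
qed

lemma yn_deriv: "(yn n has_vector_derivative yn' n t) (at t)"
  using has_vector_derivative_mult_right[OF dilate_deriv[OF Y_deriv, of "dn n" t], of "of_nat n"]
  unfolding yn_def[abs_def] yn'_def by (simp add: mult.assoc)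

lemma v1_deriv: "(v1 n has_vector_derivative v1' n t) (at t)"
  unfolding v1_def[abs_def] v1'_def by (rule has_vector_derivative_of_real) (auto intro!: derivative_eq_intros)

lemma v2_deriv: "(v2 n has_vector_derivative v2' n t) (at t)"
proof -
  have "((\<lambda>t. (- \<i> * dn n * mu1) * (complex_of_real t * yn n t)) has_vector_derivative (- \<i> * dn n * mu1) * (complex_of_real t * yn' n t + 1 * yn n t)) (at t)"
    by (intro has_vector_derivative_mult_right has_vector_derivative_mult of_real_deriv yn_deriv)
  then show ?thesis unfolding v2_def[abs_def] v2'_def by (simp add: mult_ac add.commute)
qed

lemma Phi_deriv: "(Phi th L n has_vector_derivative Phi' th L n t) (at t)"
proof -
  have 1: "((\<lambda>t. exp (yn n t)) has_vector_derivative yn' n t * exp (yn n t)) (at t)"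
    using field_vector_diff_chain_at[OF yn_deriv DERIV_exp] by (simp add: comp_def)
  have "((\<lambda>t. expT (Suc L) (v1 n t) + th * v2 n t) has_vector_derivative expT L (v1 n t) * v1' n t + th * v2' n t) (at t)"
    by (intro has_vector_derivative_add expT_deriv v1_deriv has_vector_derivative_mult_right v2_deriv)
  from has_vector_derivative_mult[OF 1 this] show ?thesis
    unfolding Phi_def[abs_def] Phi'_def by (simp add: algebra_simps)
qed

lemma gs_pow_deriv: "((\<lambda>t. gs (t * dn n) ^ n) has_vector_derivative of_nat n * dn n * gs (t * dn n) ^ (n - 1) * gd (t * dn n)) (at t)"
proof -
  have "((\<lambda>z. z ^ n) has_field_derivative of_nat n * gs (t * dn n) ^ (n - 1)) (at (gs (t * dn n)))"
    by (auto intro!: derivative_eq_intros)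
  from field_vector_diff_chain_at[OF dilate_deriv[OF gs_deriv, of "dn n" t] this]
  show ?thesis by (simp add: comp_def mult_ac)
qed

lemma hn_deriv: "(hn th L n has_vector_derivative hn' th L n t) (at t)"
  unfolding hn_def[abs_def] hn'_def by (intro has_vector_derivative_diff gs_pow_deriv Phi_deriv)

lemma mult_swap_eq: "N * S = A * B \<Longrightarrow> d * A = c \<Longrightarrow> N * d * S = c * (B :: real)"
proof -
  assume "N * S = A * B" "d * A = c"
  then have "d * (N * S) = c * B" by (simp add: mult.assoc[symmetric])
  then show ?thesis by (simp add: mult_ac)
qed

lemma powr_le_poly: "0 \<le> T \<Longrightarrow> 0 \<le> b \<Longrightarrow> b \<le> real k \<Longrightarrow> T powr b \<le> (1 + T) ^ k"
proof -
  assume a: "0 \<le> T" "0 \<le> b" "b \<le> real k"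
  have "T powr b \<le> (1 + T) powr b" using a by (intro powr_mono2) auto
  also have "\<dots> \<le> (1 + T) powr real k" using a by (intro powr_mono) auto
  also have "\<dots> = (1 + T) ^ k" using a by (simp add: powr_realpow)
  finally show ?thesis .
qed

text \<open>Equal to \<open>n * (dn n)\<^sup>2\<close>, the size of \<open>v1\<close>; its power
  \<open>j\<close> is the factor \<open>1 / n powr (j * (2 - \<alpha>) / \<alpha>)\<close> of the
  approximating function.\<close>

definition "del n = real n powr (1 - 2 / \<alpha>)"
text \<open>The first summand is \<open>n\<close> times the expansion error of one factor at
  \<open>s = t * dn n\<close>; the others are the error of \<open>remainder_bounds\<close> with
  \<open>del n\<close> and \<open>dn n\<close> as small parameters.\<close>

definition "eps th L n = real n powr (1 - kp / \<alpha>) + del n ^ Suc L + dn n ^ 2 + del n * dn n + (1 - th) * dn n"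

lemma del_le_1: "n \<ge> 1 \<Longrightarrow> 0 \<le> del n" "n \<ge> 1 \<Longrightarrow> del n \<le> 1" and dn_le_1: "n \<ge> 1 \<Longrightarrow> 0 < dn n" "n \<ge> 1 \<Longrightarrow> dn n \<le> 1"
proof -
  assume n: "n \<ge> 1"
  show "0 \<le> del n" "0 < dn n" using n by (auto simp: del_def dn_def)
  have "1 \<le> real n" using n by simp
  then have "real n powr b \<le> 1" if "b \<le> 0" for b using powr_mono[of b 0 "real n"] that by simp
  then show "del n \<le> 1" "dn n \<le> 1" using \<alpha> by (auto simp: del_def dn_def field_simps)
qed

lemma dn_pow: "n \<ge> 1 \<Longrightarrow> real n * (\<bar>t * dn n\<bar> powr b) = real n powr (1 - b / \<alpha>) * \<bar>t\<bar> powr b"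
proof -
  assume n: "n \<ge> 1"
  have "\<bar>t * dn n\<bar> powr b = \<bar>t\<bar> powr b * dn n powr b" using dn_le_1[OF n] by (simp add: abs_mult powr_mult)
  moreover have "dn n powr b = real n powr (- b / \<alpha>)" by (simp add: dn_def powr_powr)
  moreover have "real n * real n powr (- b / \<alpha>) = real n powr (1 + (- b / \<alpha>))" using n by (simp only: powr_add) simp
  ultimately show ?thesis by (simp add: mult_ac)
qed

text \<open>The difference of \<open>n\<close>-th powers is \<open>n\<close> times the difference of
  the factors times the remaining powers. Since \<open>n * \<bar>t * dn n\<bar> powr \<alpha> =
  \<bar>t\<bar> powr \<alpha>\<close>, those powers decay in \<open>t\<close> independently of
  \<open>n\<close>, and \<open>n\<close> times the error of one factor is
  \<open>n powr (1 - kp / \<alpha>)\<close> times a power of \<open>\<bar>t\<bar>\<close>.\<close>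

lemma gs_power_est:
  assumes n: "n \<ge> 4" and C: "C \<ge> 0" "K \<ge> 0" and s: "\<bar>t * dn n\<bar> \<le> 1"
    and g: "norm (gs (t * dn n)) \<le> exp (- c0 * \<bar>t * dn n\<bar> powr \<alpha>)"
    and b: "norm (exp (Zf (t * dn n))) \<le> exp (- c0 * \<bar>t * dn n\<bar> powr \<alpha>)"
    and gb: "norm (gs (t * dn n) - exp (Zf (t * dn n))) \<le> C * \<bar>t * dn n\<bar> powr kp"
    and gb': "norm (gd (t * dn n) - Zd (t * dn n) * exp (Zf (t * dn n))) \<le> C * \<bar>t * dn n\<bar> powr (kp - 1)"
    and Z: "norm (Zd (t * dn n)) \<le> K * \<bar>t * dn n\<bar> powr (\<alpha> - 1)"
  defines "E \<equiv> exp (- (c0 / 2) * \<bar>t\<bar> powr \<alpha>)" and "P \<equiv> 1 + \<bar>t\<bar>"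
  shows "norm (gs (t * dn n) ^ n - exp (Zf (t * dn n)) ^ n) \<le> (C + K * C) * real n powr (1 - kp / \<alpha>) * (t\<^sup>2 * P ^ 4 * E)"
    and "norm (of_nat n * dn n * gs (t * dn n) ^ (n - 1) * gd (t * dn n) - of_nat n * dn n * (Zd (t * dn n) * exp (Zf (t * dn n)) ^ n))
       \<le> (C + K * C) * real n powr (1 - kp / \<alpha>) * (\<bar>t\<bar> * P ^ 4 * E)"
proof -
  define s where "s = t * dn n"
  define d where "d = dn n"
  define \<eta> where "\<eta> = real n powr (1 - kp / \<alpha>)"
  define R where "R = exp (- c0 * \<bar>s\<bar> powr \<alpha>)"
  have n1: "n \<ge> 1" using n by simp
  have d: "0 < d" "d \<le> 1" using dn_le_1[OF n1] by (auto simp: d_def)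
  have P: "P \<ge> 1" "0 \<le> \<bar>t\<bar>" "\<bar>t\<bar> \<le> P" by (auto simp: P_def)
  have E0: "E \<ge> 0" by (simp add: E_def)
  have na: "real n * \<bar>s\<bar> powr \<alpha> = \<bar>t\<bar> powr \<alpha>" using dn_pow[OF n1, of t \<alpha>] \<alpha> n1 by (simp add: s_def)
  have nk: "real n * \<bar>s\<bar> powr kp = \<eta> * \<bar>t\<bar> powr kp" using dn_pow[OF n1, of t kp] by (simp add: s_def \<eta>_def)
  have R: "R ^ k \<le> E" if k: "real n / 2 \<le> real k" for k
  proof -
    have "R ^ k = exp (real k * (- c0 * \<bar>s\<bar> powr \<alpha>))" unfolding R_def by (simp only: exp_of_nat_mult)
    moreover have "(real n / 2) * \<bar>s\<bar> powr \<alpha> \<le> real k * \<bar>s\<bar> powr \<alpha>" using k by (intro mult_right_mono) auto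
    then have "c0 * ((real n / 2) * \<bar>s\<bar> powr \<alpha>) \<le> c0 * (real k * \<bar>s\<bar> powr \<alpha>)" using c0 by (intro mult_left_mono) auto
    then have "real k * (- c0 * \<bar>s\<bar> powr \<alpha>) \<le> - (c0 / 2) * \<bar>t\<bar> powr \<alpha>" unfolding na[symmetric] by (simp add: mult_ac)
    ultimately show ?thesis unfolding E_def by simp
  qed
  have gR: "norm (gs s) \<le> R" "norm (exp (Zf s)) \<le> R" using g b by (auto simp: s_def R_def)
  \<comment> \<open>The bound for the powers uses the exponent \<open>n - 1\<close>, the one for
    derivatives also \<open>n - 2\<close>. For \<open>n >= 4\<close> both are at least
    \<open>n / 2\<close>, which accounts for the rate \<open>c0 / 2\<close>.\<close>
  define m where "m = n - 2"
  have m: "n = Suc (Suc m)" using n by (simp add: m_def)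
  have Rm: "R ^ Suc m \<le> E" "R ^ m \<le> E" by (rule R; use n m in linarith)+
  have kp2: "\<bar>t\<bar> powr kp \<le> t\<^sup>2 * P"
  proof -
    have "\<bar>t\<bar> powr kp = \<bar>t\<bar> powr 2 * \<bar>t\<bar> powr (kp - 2)" unfolding powr_add[symmetric] by simp
    also have "\<dots> \<le> t\<^sup>2 * P" using powr_le_poly[of "\<bar>t\<bar>" "kp - 2" 1] kp by (intro mult_mono) (auto simp: P_def)
    finally show ?thesis .
  qed
  have kp1: "\<bar>t\<bar> powr (kp - 1) \<le> \<bar>t\<bar> * P"
  proof -
    have "\<bar>t\<bar> powr (kp - 1) = \<bar>t\<bar> powr 1 * \<bar>t\<bar> powr (kp - 2)" unfolding powr_add[symmetric] by simp
    also have "\<dots> \<le> \<bar>t\<bar> * P" using powr_le_poly[of "\<bar>t\<bar>" "kp - 2" 1] kp by (intro mult_mono) (auto simp: P_def)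
    finally show ?thesis .
  qed
  have al2: "\<bar>t\<bar> powr \<alpha> \<le> P ^ 2" using powr_le_poly[of "\<bar>t\<bar>" \<alpha> 2] \<alpha> by (simp add: P_def)
  have CK: "0 \<le> C" "0 \<le> K * C" "0 \<le> \<eta>" using C by (auto simp: \<eta>_def)
  have P4: "P \<le> P ^ 4" "P ^ 3 \<le> P ^ 4" using P power_increasing[of 1 4 P] power_increasing[of 3 4 P] by auto
  have "norm (gs s ^ n - exp (Zf s) ^ n) \<le> real n * norm (gs s - exp (Zf s)) * R ^ Suc m"
    using power_diff_le[OF gR, of "Suc m"] by (simp add: m)
  also have "\<dots> \<le> real n * (C * \<bar>s\<bar> powr kp) * E"
    using gb C Rm by (intro mult_mono mult_left_mono) (auto simp: s_def R_def)
  also have "\<dots> = C * \<eta> * (\<bar>t\<bar> powr kp * E)" using nk by (simp add: mult_ac) 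
  also have "\<dots> \<le> (C + K * C) * \<eta> * (t\<^sup>2 * P ^ 4 * E)"
  proof (intro mult_mono mult_right_mono)
    have "t\<^sup>2 * P \<le> t\<^sup>2 * P ^ 4" using P4 by (intro mult_left_mono) auto
    then show "\<bar>t\<bar> powr kp \<le> t\<^sup>2 * P ^ 4" using kp2 by linarith
  qed (use CK E0 P in auto)
  finally show "norm (gs (t * dn n) ^ n - exp (Zf (t * dn n)) ^ n) \<le> (C + K * C) * real n powr (1 - kp / \<alpha>) * (t\<^sup>2 * P ^ 4 * E)"
    unfolding s_def \<eta>_def .
  \<comment> \<open>Exchanges the factor with its derivative first and the remaining powers
    afterwards, so that each error of \<open>taylor_gs\<close> appears exactly once.\<close>
  have eq: "of_nat n * dn n * gs s ^ (n - 1) * gd s - of_nat n * dn n * (Zd s * exp (Zf s) ^ n)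
    = of_nat n * dn n * (gs s ^ Suc m * (gd s - Zd s * exp (Zf s)) + Zd s * exp (Zf s) * (gs s ^ Suc m - exp (Zf s) ^ Suc m))"
    by (simp add: m algebra_simps)
  have "norm (gs s ^ Suc m * (gd s - Zd s * exp (Zf s)) + Zd s * exp (Zf s) * (gs s ^ Suc m - exp (Zf s) ^ Suc m))
    \<le> norm (gs s) ^ Suc m * norm (gd s - Zd s * exp (Zf s)) + norm (Zd s) * norm (exp (Zf s)) * norm (gs s ^ Suc m - exp (Zf s) ^ Suc m)"
    by (rule order_trans[OF norm_triangle_ineq]) (simp only: norm_mult norm_power order_refl)
  also have "\<dots> \<le> E * (C * \<bar>s\<bar> powr (kp - 1)) + (K * \<bar>s\<bar> powr (\<alpha> - 1)) * 1 * (real n * (C * \<bar>s\<bar> powr kp) * E)"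
  proof (intro add_mono mult_mono)
    show "norm (gs s) ^ Suc m \<le> E" using power_mono[OF gR(1), of "Suc m"] Rm(1) by simp
    show "norm (gd s - Zd s * exp (Zf s)) \<le> C * \<bar>s\<bar> powr (kp - 1)" using gb' by (simp add: s_def)
    show "norm (Zd s) \<le> K * \<bar>s\<bar> powr (\<alpha> - 1)" using Z by (simp add: s_def)
    have "R \<le> 1" using c0 by (simp add: R_def)
    then show "norm (exp (Zf s)) \<le> 1" using gR by linarith
    have "norm (gs s ^ Suc m - exp (Zf s) ^ Suc m) \<le> real (Suc m) * norm (gs s - exp (Zf s)) * R ^ m" by (rule power_diff_le[OF gR])
    also have "\<dots> \<le> real n * (C * \<bar>s\<bar> powr kp) * E"
      using gb C Rm by (intro mult_mono) (auto simp: s_def R_def m)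
    finally show "norm (gs s ^ Suc m - exp (Zf s) ^ Suc m) \<le> real n * (C * \<bar>s\<bar> powr kp) * E" .
  qed (use C E0 in auto)
  finally have le: "norm (gs s ^ Suc m * (gd s - Zd s * exp (Zf s)) + Zd s * exp (Zf s) * (gs s ^ Suc m - exp (Zf s) ^ Suc m))
    \<le> E * (C * \<bar>s\<bar> powr (kp - 1)) + (K * \<bar>s\<bar> powr (\<alpha> - 1)) * 1 * (real n * (C * \<bar>s\<bar> powr kp) * E)" .
  have nd1: "real n * d * \<bar>s\<bar> powr (kp - 1) = \<eta> * \<bar>t\<bar> powr (kp - 1)"
  proof -
    have "real n * \<bar>s\<bar> powr (kp - 1) = real n powr (1 - (kp - 1) / \<alpha>) * \<bar>t\<bar> powr (kp - 1)" using dn_pow[OF n1, of t "kp - 1"] by (simp add: s_def)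
    moreover have "d * real n powr (1 - (kp - 1) / \<alpha>) = \<eta>" unfolding d_def dn_def \<eta>_def powr_add[symmetric] by (simp add: diff_divide_distrib)
    ultimately show ?thesis by (rule mult_swap_eq)
  qed
  have nd2: "real n * d * \<bar>s\<bar> powr (\<alpha> - 1) = \<bar>t\<bar> powr (\<alpha> - 1)"
  proof -
    have "real n * \<bar>s\<bar> powr (\<alpha> - 1) = real n powr (1 - (\<alpha> - 1) / \<alpha>) * \<bar>t\<bar> powr (\<alpha> - 1)" using dn_pow[OF n1, of t "\<alpha> - 1"] by (simp add: s_def)
    moreover have "d * real n powr (1 - (\<alpha> - 1) / \<alpha>) = 1" unfolding d_def dn_def powr_add[symmetric] using \<alpha> n1 by (simp add: diff_divide_distrib)
    ultimately have "real n * d * \<bar>s\<bar> powr (\<alpha> - 1) = 1 * \<bar>t\<bar> powr (\<alpha> - 1)" by (rule mult_swap_eq)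
    then show ?thesis by simp
  qed
  have "norm (of_nat n * dn n * gs s ^ (n - 1) * gd s - of_nat n * dn n * (Zd s * exp (Zf s) ^ n)) = real n * d * norm (gs s ^ Suc m * (gd s - Zd s * exp (Zf s)) + Zd s * exp (Zf s) * (gs s ^ Suc m - exp (Zf s) ^ Suc m))"
    unfolding eq norm_mult[of "of_nat n * complex_of_real (dn n)"] using d by (simp add: norm_mult d_def)
  also have "\<dots> \<le> real n * d * (E * (C * \<bar>s\<bar> powr (kp - 1)) + (K * \<bar>s\<bar> powr (\<alpha> - 1)) * 1 * (real n * (C * \<bar>s\<bar> powr kp) * E))"
    using d by (intro mult_left_mono le) auto
  also have "\<dots> = C * (real n * d * \<bar>s\<bar> powr (kp - 1)) * E + K * C * (real n * d * \<bar>s\<bar> powr (\<alpha> - 1)) * (real n * \<bar>s\<bar> powr kp) * E"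
    by (simp add: algebra_simps)
  also have "\<dots> = C * \<eta> * (\<bar>t\<bar> powr (kp - 1) * E) + K * C * \<eta> * (\<bar>t\<bar> powr (\<alpha> - 1) * \<bar>t\<bar> powr kp * E)"
    unfolding nd1 nd2 nk by (simp add: mult_ac)
  also have "\<dots> \<le> C * \<eta> * (\<bar>t\<bar> * P ^ 4 * E) + K * C * \<eta> * (\<bar>t\<bar> * P ^ 4 * E)"
  proof (intro add_mono mult_left_mono mult_right_mono)
    have "\<bar>t\<bar> * P \<le> \<bar>t\<bar> * P ^ 4" using P4 by (intro mult_left_mono) auto
    then show "\<bar>t\<bar> powr (kp - 1) \<le> \<bar>t\<bar> * P ^ 4" using kp1 by linarith
    have "\<bar>t\<bar> powr (\<alpha> - 1) * \<bar>t\<bar> powr kp = \<bar>t\<bar> powr \<alpha> * \<bar>t\<bar> powr (kp - 1)" unfolding powr_add[symmetric] by (rule arg_cong2[where f = "(powr)"]) simp_all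
    also have "\<dots> \<le> P ^ 2 * (\<bar>t\<bar> * P)" using al2 kp1 by (intro mult_mono) auto
    also have "\<dots> = \<bar>t\<bar> * P ^ 3" by (simp add: power2_eq_square power3_eq_cube)
    also have "\<dots> \<le> \<bar>t\<bar> * P ^ 4" using P4 by (intro mult_left_mono) auto
    finally show "\<bar>t\<bar> powr (\<alpha> - 1) * \<bar>t\<bar> powr kp \<le> \<bar>t\<bar> * P ^ 4" .
  qed (use CK E0 in auto)
  also have "\<dots> = (C + K * C) * \<eta> * (\<bar>t\<bar> * P ^ 4 * E)" by (simp add: algebra_simps)
  finally show "norm (of_nat n * dn n * gs (t * dn n) ^ (n - 1) * gd (t * dn n) - of_nat n * dn n * (Zd (t * dn n) * exp (Zf (t * dn n)) ^ n))
       \<le> (C + K * C) * real n powr (1 - kp / \<alpha>) * (\<bar>t\<bar> * P ^ 4 * E)" unfolding s_def \<eta>_def .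
qed

text \<open>By the scaling of \<open>Y\<close> the main exponent \<open>yn\<close> is bounded and
  decays uniformly in \<open>n\<close>, while \<open>v1\<close> carries the small factor
  \<open>del n\<close> and \<open>v2\<close> the small factor \<open>dn n\<close>.\<close>

lemma vn_bounds:
  fixes t :: real and n :: nat
  assumes n: "n \<ge> 1"
  defines "P \<equiv> 1 + \<bar>t\<bar>" and "K \<equiv> 1 + sig + 2 * (mu1 * CY)"
  shows "norm (v1 n t) \<le> K * del n * \<bar>t\<bar>\<^sup>2" "norm (v1' n t) \<le> K * del n * \<bar>t\<bar>"
    "norm (v2 n t) \<le> K * dn n * \<bar>t\<bar>\<^sup>2 * P" "norm (v2' n t) \<le> K * dn n * \<bar>t\<bar> * P"
    "norm (yn n t) \<le> CY * \<bar>t\<bar> powr \<alpha>" "norm (yn' n t) \<le> CY * \<bar>t\<bar> powr (\<alpha> - 1)" "norm (yn' n t) \<le> CY * P"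
    "norm (exp (yn n t)) \<le> exp (- cY * \<bar>t\<bar> powr \<alpha>)"
proof -
  have m: "mu1 > 0" "CY > 0" "sig > 0" by (rule mu1 CY sig)+
  have d: "0 < dn n" using dn_le_1[OF n] by simp
  have P: "P \<ge> 1" by (simp add: P_def)
  have nd: "real n * dn n * dn n = del n"
    using n unfolding dn_def del_def mult.assoc powr_add[symmetric]
    by (simp add: powr_diff powr_minus_divide)
  have K: "sig / 2 \<le> K" "sig \<le> K" "mu1 * CY \<le> K" "2 * (mu1 * CY) \<le> K" "0 \<le> K" using m by (auto simp: K_def)
  have "norm (v1 n t) = sig / 2 * del n * \<bar>t\<bar>\<^sup>2"
    unfolding v1_def norm_of_real nd[symmetric] using m d by (simp add: abs_mult power_mult_distrib power2_eq_square)
  also have "\<dots> \<le> K * del n * \<bar>t\<bar>\<^sup>2" using K del_le_1[OF n] by (intro mult_right_mono) auto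
  finally show "norm (v1 n t) \<le> K * del n * \<bar>t\<bar>\<^sup>2" .
  have "norm (v1' n t) = sig * del n * \<bar>t\<bar>"
    unfolding v1'_def norm_of_real nd[symmetric] using m d by (simp add: abs_mult)
  also have "\<dots> \<le> K * del n * \<bar>t\<bar>" using K del_le_1[OF n] by (intro mult_right_mono) auto
  finally show "norm (v1' n t) \<le> K * del n * \<bar>t\<bar>" .
  have na: "real n * \<bar>t * dn n\<bar> powr \<alpha> = \<bar>t\<bar> powr \<alpha>" using dn_pow[OF n, of t \<alpha>] \<alpha> n by simp
  have nd2: "real n * dn n * \<bar>t * dn n\<bar> powr (\<alpha> - 1) = \<bar>t\<bar> powr (\<alpha> - 1)"
  proof -
    have "real n * \<bar>t * dn n\<bar> powr (\<alpha> - 1) = real n powr (1 - (\<alpha> - 1) / \<alpha>) * \<bar>t\<bar> powr (\<alpha> - 1)" by (rule dn_pow[OF n])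
    moreover have "dn n * real n powr (1 - (\<alpha> - 1) / \<alpha>) = 1" unfolding dn_def powr_add[symmetric] using \<alpha> n by (simp add: diff_divide_distrib)
    ultimately have "real n * dn n * \<bar>t * dn n\<bar> powr (\<alpha> - 1) = 1 * \<bar>t\<bar> powr (\<alpha> - 1)" by (rule mult_swap_eq)
    then show ?thesis by simp
  qed
  have "norm (yn n t) = real n * norm (Y (t * dn n))" by (simp add: yn_def norm_mult)
  also have "\<dots> \<le> real n * (CY * \<bar>t * dn n\<bar> powr \<alpha>)" by (intro mult_left_mono norm_Y) auto
  also have "\<dots> = CY * \<bar>t\<bar> powr \<alpha>" unfolding na[symmetric] by simp
  finally show y: "norm (yn n t) \<le> CY * \<bar>t\<bar> powr \<alpha>" .
  have "norm (yn' n t) = real n * dn n * norm (Y' (t * dn n))" using d by (simp add: yn'_def norm_mult)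
  also have "\<dots> \<le> real n * dn n * (CY * \<bar>t * dn n\<bar> powr (\<alpha> - 1))" using d by (intro mult_left_mono norm_Y') auto
  also have "\<dots> = CY * \<bar>t\<bar> powr (\<alpha> - 1)" unfolding nd2[symmetric] by simp
  finally show y': "norm (yn' n t) \<le> CY * \<bar>t\<bar> powr (\<alpha> - 1)" .
  have al1: "\<bar>t\<bar> powr (\<alpha> - 1) \<le> P" using powr_le_poly[of "\<bar>t\<bar>" "\<alpha> - 1" 1] \<alpha> by (simp add: P_def)
  then show "norm (yn' n t) \<le> CY * P" using y' mult_left_mono[OF al1, of CY] m by linarith
  have al: "\<bar>t\<bar> powr \<alpha> \<le> \<bar>t\<bar> * P"
  proof -
    have "\<bar>t\<bar> powr \<alpha> = \<bar>t\<bar> powr 1 * \<bar>t\<bar> powr (\<alpha> - 1)" unfolding powr_add[symmetric] by simp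
    also have "\<dots> \<le> \<bar>t\<bar> * P" using al1 by (intro mult_mono) auto
    finally show ?thesis .
  qed
  have tt: "\<bar>t\<bar> * \<bar>t\<bar> powr (\<alpha> - 1) = \<bar>t\<bar> powr \<alpha>"
  proof -
    have "\<bar>t\<bar> powr \<alpha> = \<bar>t\<bar> powr 1 * \<bar>t\<bar> powr (\<alpha> - 1)" unfolding powr_add[symmetric] by simp
    then show ?thesis by simp
  qed
  have "norm (v2 n t) = (\<bar>t\<bar> * dn n * mu1) * norm (yn n t)" unfolding v2_def using d m by (simp add: norm_mult)
  also have "\<dots> \<le> (\<bar>t\<bar> * dn n * mu1) * (CY * (\<bar>t\<bar> * P))"
    by (intro mult_left_mono order_trans[OF y] al) (use m d in auto)
  also have "\<dots> = (mu1 * CY) * (dn n * \<bar>t\<bar>\<^sup>2 * P)" by (simp add: power2_eq_square)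
  also have "\<dots> \<le> K * (dn n * \<bar>t\<bar>\<^sup>2 * P)" using K d P by (intro mult_right_mono) auto
  finally show "norm (v2 n t) \<le> K * dn n * \<bar>t\<bar>\<^sup>2 * P" by (simp only: mult.assoc)
  have "norm (v2' n t) = (dn n * mu1) * norm (yn n t + t * yn' n t)" unfolding v2'_def using d m by (simp add: norm_mult)
  also have "\<dots> \<le> (dn n * mu1) * (CY * \<bar>t\<bar> powr \<alpha> + CY * \<bar>t\<bar> powr \<alpha>)"
  proof (intro mult_left_mono order_trans[OF norm_triangle_ineq] add_mono y)
    have "norm (t * yn' n t) \<le> \<bar>t\<bar> * (CY * \<bar>t\<bar> powr (\<alpha> - 1))" using y' by (simp add: norm_mult mult_left_mono)
    then show "norm (t * yn' n t) \<le> CY * \<bar>t\<bar> powr \<alpha>" unfolding tt[symmetric] by (simp add: mult_ac)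
  qed (use d m in auto)
  also have "\<dots> = 2 * (mu1 * CY) * (dn n * \<bar>t\<bar> powr \<alpha>)" by simp
  also have "\<dots> \<le> K * (dn n * (\<bar>t\<bar> * P))" using K d P al m by (intro mult_mono mult_left_mono) auto
  finally show "norm (v2' n t) \<le> K * dn n * \<bar>t\<bar> * P" by (simp only: mult.assoc)
  have "Re (yn n t) = real n * Re (Y (t * dn n))" by (simp add: yn_def)
  also have "\<dots> \<le> real n * (- cY * \<bar>t * dn n\<bar> powr \<alpha>)" by (intro mult_left_mono Re_Y) auto
  also have "\<dots> = - cY * \<bar>t\<bar> powr \<alpha>" unfolding na[symmetric] by simp
  finally show "norm (exp (yn n t)) \<le> exp (- cY * \<bar>t\<bar> powr \<alpha>)" by simp
qed

text \<open>The difference splits into replacing \<open>gs ^ n\<close> by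
  \<open>exp (n * Zf)\<close>, and expanding \<open>exp (n * Zf)\<close> around
  \<open>exp yn\<close> in powers of \<open>v1\<close> and \<open>v2\<close>.\<close>

lemma hn_est:
  assumes th: "0 \<le> th" "th \<le> 1"
  obtains s0 C where "s0 > 0" "C \<ge> 0"
    "\<And>n t. n \<ge> 4 \<Longrightarrow> \<bar>t * dn n\<bar> \<le> s0 \<Longrightarrow> norm (hn th L n t) \<le> C * eps th L n * (t\<^sup>2 * (1 + \<bar>t\<bar>) ^ (2 * L + 8) * exp (- (c0 / 2) * \<bar>t\<bar> powr \<alpha>))"
    "\<And>n t. n \<ge> 4 \<Longrightarrow> \<bar>t * dn n\<bar> \<le> s0 \<Longrightarrow> norm (hn' th L n t) \<le> C * eps th L n * (\<bar>t\<bar> * (1 + \<bar>t\<bar>) ^ (2 * L + 8) * exp (- (c0 / 2) * \<bar>t\<bar> powr \<alpha>))"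
proof -
  obtain s0 C K where S: "0 < s0" "s0 \<le> 1" "C \<ge> 0" "K \<ge> 0"
    "\<And>s. \<bar>s\<bar> \<le> s0 \<Longrightarrow> sig * s\<^sup>2 / 2 \<le> cY / 4 * \<bar>s\<bar> powr \<alpha>"
    "\<And>s. \<bar>s\<bar> \<le> s0 \<Longrightarrow> mu1 * CY * \<bar>s\<bar> * \<bar>s\<bar> powr \<alpha> \<le> cY / 8 * \<bar>s\<bar> powr \<alpha>"
    "\<And>s. \<bar>s\<bar> \<le> s0 \<Longrightarrow> norm (gs s) \<le> exp (- c0 * \<bar>s\<bar> powr \<alpha>)"
    "\<And>s. \<bar>s\<bar> \<le> s0 \<Longrightarrow> norm (exp (Zf s)) \<le> exp (- c0 * \<bar>s\<bar> powr \<alpha>)"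
    "\<And>s. \<bar>s\<bar> \<le> s0 \<Longrightarrow> norm (gs s - exp (Zf s)) \<le> C * \<bar>s\<bar> powr kp"
    "\<And>s. \<bar>s\<bar> \<le> s0 \<Longrightarrow> norm (gd s - Zd s * exp (Zf s)) \<le> C * \<bar>s\<bar> powr (kp - 1)"
    "\<And>s. \<bar>s\<bar> \<le> s0 \<Longrightarrow> norm (Zd s) \<le> K * \<bar>s\<bar> powr (\<alpha> - 1)"
    using Zf_small by blast
  define KK where "KK = 1 + sig + 2 * (mu1 * CY)"
  define N where "N = KK ^ Suc L + 2 * KK ^ 3"
  have m: "mu1 > 0" "CY > 0" "sig > 0" by (rule mu1 CY sig)+
  have KK: "KK \<ge> 1" using m by (simp add: KK_def)
  have N0: "N \<ge> 0" using KK by (simp add: N_def)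
  show ?thesis
  proof (rule that[OF S(1), of "(C + K * C) + (CY + 1) * N"])
    show "(C + K * C) + (CY + 1) * N \<ge> 0" using S N0 m by simp
    fix n :: nat and t :: real assume n: "n \<ge> 4" and s: "\<bar>t * dn n\<bar> \<le> s0"
    define P where "P = 1 + \<bar>t\<bar>"
    define E where "E = exp (- (c0 / 2) * \<bar>t\<bar> powr \<alpha>)"
    define Q where "Q = P ^ (2 * L + 8)"
    have n1: "n \<ge> 1" using n by simp
    have P: "P \<ge> 1" "\<bar>t\<bar> \<le> P" by (auto simp: P_def)
    have E0: "E \<ge> 0" by (simp add: E_def)
    have s1: "\<bar>t * dn n\<bar> \<le> 1" using s S by linarith
    note G = gs_power_est[OF n S(3,4) s1 S(7)[OF s] S(8)[OF s] S(9)[OF s] S(10)[OF s] S(11)[OF s], folded P_def E_def]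
    note V = vn_bounds[OF n1, of t, folded P_def KK_def]
    note D = del_le_1[OF n1] less_imp_le[OF dn_le_1(1)[OF n1]] dn_le_1(2)[OF n1]
    note R = remainder_bounds[OF KK D th, of "\<bar>t\<bar>" "v1 n t" "v1' n t" "v2 n t" "v2' n t" L, folded P_def N_def, OF abs_ge_zero V(1-4)]
    define e2 where "e2 = del n ^ Suc L + (dn n)\<^sup>2 + del n * dn n + (1 - th) * dn n"
    have e2: "e2 \<ge> 0" unfolding e2_def using D th by (intro add_nonneg_nonneg mult_nonneg_nonneg) auto
    define Gx where "Gx = exp (norm (v1 n t) + norm (v2 n t))"
    let ?\<eta> = "real n powr (1 - kp / \<alpha>)"
    have eps: "eps th L n = ?\<eta> + e2" by (simp add: eps_def e2_def)
    have na: "real n * \<bar>t * dn n\<bar> powr \<alpha> = \<bar>t\<bar> powr \<alpha>" using dn_pow[OF n1, of t \<alpha>] \<alpha> n1 by simp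
    \<comment> \<open>The growth of the expansion is bounded by \<open>exp\<close> of
      \<open>3/8 * cY * \<bar>t\<bar> powr \<alpha>\<close>, and the decay of \<open>exp yn\<close>
      at rate \<open>cY\<close> leaves more than the rate \<open>c0 / 2 = cY / 16\<close>.\<close>
    have GE: "norm (exp (yn n t)) * Gx \<le> E"
    proof -
      have "norm (v1 n t) \<le> cY / 4 * \<bar>t\<bar> powr \<alpha>"
      proof -
        have "norm (v1 n t) = real n * (sig * (t * dn n)\<^sup>2 / 2)" unfolding v1_def norm_of_real using m by simp
        also have "\<dots> \<le> real n * (cY / 4 * \<bar>t * dn n\<bar> powr \<alpha>)" by (intro mult_left_mono S(5) s) auto
        finally show ?thesis unfolding na[symmetric] by (simp add: mult_ac)
      qed
      moreover have "norm (v2 n t) \<le> cY / 8 * \<bar>t\<bar> powr \<alpha>"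
      proof -
        have "norm (v2 n t) = (\<bar>t * dn n\<bar> * mu1) * norm (yn n t)" unfolding v2_def using m D by (simp add: norm_mult abs_mult)
        also have "\<dots> \<le> (\<bar>t * dn n\<bar> * mu1) * (CY * \<bar>t\<bar> powr \<alpha>)" using m by (intro mult_left_mono V) auto
        also have "\<dots> = real n * (mu1 * CY * \<bar>t * dn n\<bar> * \<bar>t * dn n\<bar> powr \<alpha>)" unfolding na[symmetric] by (simp add: mult_ac)
        also have "\<dots> \<le> real n * (cY / 8 * \<bar>t * dn n\<bar> powr \<alpha>)" by (intro mult_left_mono S(6) s) auto
        finally show ?thesis unfolding na[symmetric] by (simp add: mult_ac)
      qed
      moreover have "0 \<le> cY * \<bar>t\<bar> powr \<alpha>" using cY by simp
      ultimately have "- cY * \<bar>t\<bar> powr \<alpha> + (norm (v1 n t) + norm (v2 n t)) \<le> - (c0 / 2) * \<bar>t\<bar> powr \<alpha>" by (simp add: c0_def)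
      then have "exp (- cY * \<bar>t\<bar> powr \<alpha>) * Gx \<le> E" unfolding E_def Gx_def exp_add[symmetric] by simp
      moreover have "norm (exp (yn n t)) * Gx \<le> exp (- cY * \<bar>t\<bar> powr \<alpha>) * Gx" by (intro mult_right_mono V) (simp add: Gx_def)
      ultimately show ?thesis by linarith
    qed
    have PQ: "P ^ 4 \<le> Q" "P ^ (2 * L + 6) \<le> Q" "P * (\<bar>t\<bar> * P ^ (2 * L + 6)) \<le> Q" "0 \<le> Q"
    proof -
      show "P ^ 4 \<le> Q" "P ^ (2 * L + 6) \<le> Q" unfolding Q_def using P by (auto intro: power_increasing)
      have "P * (\<bar>t\<bar> * P ^ (2 * L + 6)) \<le> P * (P * P ^ (2 * L + 6))" using P by (intro mult_left_mono mult_right_mono) auto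
      also have "\<dots> = Q"
      proof -
        have "2 * L + 8 = Suc (Suc (2 * L + 6))" by simp
        then show ?thesis unfolding Q_def by (simp only: power_Suc)
      qed
      finally show "P * (\<bar>t\<bar> * P ^ (2 * L + 6)) \<le> Q" .
      show "0 \<le> Q" using P by (simp add: Q_def)
    qed
    let ?B = "exp (v1 n t + v2 n t) - expT (Suc L) (v1 n t) - th * v2 n t"
    let ?B' = "exp (v1 n t + v2 n t) * (v1' n t + v2' n t) - expT L (v1 n t) * v1' n t - th * v2' n t"
    have RB: "norm ?B \<le> N * e2 * Gx * (\<bar>t\<bar>\<^sup>2 * P ^ (2 * L + 6))" "norm ?B' \<le> N * e2 * Gx * (\<bar>t\<bar> * P ^ (2 * L + 6))"
      using R unfolding e2_def Gx_def by auto
    \<comment> \<open>The three summands of \<open>Zf\<close>, multiplied by \<open>n\<close> and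
      taken at \<open>t * dn n\<close>, are \<open>yn\<close>, \<open>v1\<close> and
      \<open>v2\<close>.\<close>
    have nZ: "of_nat n * Zf (t * dn n) = yn n t + v1 n t + v2 n t"
      unfolding Zf_def yn_def v1_def v2_def by (simp add: algebra_simps)
    have bn: "exp (Zf (t * dn n)) ^ n = exp (yn n t) * exp (v1 n t + v2 n t)"
      unfolding exp_of_nat_mult[symmetric] nZ by (simp add: exp_add mult.assoc)
    have nZd: "of_nat n * dn n * Zd (t * dn n) = yn' n t + v1' n t + v2' n t"
      unfolding Zd_def yn_def yn'_def v1'_def v2'_def by (simp add: algebra_simps)
    have h: "hn th L n t = (gs (t * dn n) ^ n - exp (Zf (t * dn n)) ^ n) + exp (yn n t) * ?B"
      unfolding hn_def Phi_def bn by (simp add: algebra_simps)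
    have h': "hn' th L n t = (of_nat n * dn n * gs (t * dn n) ^ (n - 1) * gd (t * dn n) - of_nat n * dn n * (Zd (t * dn n) * exp (Zf (t * dn n)) ^ n)) + (yn' n t * (exp (yn n t) * ?B) + exp (yn n t) * ?B')"
    proof -
      have "of_nat n * dn n * (Zd (t * dn n) * exp (Zf (t * dn n)) ^ n) = (yn' n t + v1' n t + v2' n t) * (exp (yn n t) * exp (v1 n t + v2 n t))"
        unfolding bn nZd[symmetric] by (simp only: mult.assoc)
      then show ?thesis unfolding hn'_def Phi'_def Phi_def by (simp add: algebra_simps)
    qed
    have e1: "norm (exp (yn n t) * ?B) \<le> N * e2 * (\<bar>t\<bar>\<^sup>2 * P ^ (2 * L + 6)) * E"
    proof -
      have "norm (exp (yn n t) * ?B) \<le> norm (exp (yn n t)) * (N * e2 * Gx * (\<bar>t\<bar>\<^sup>2 * P ^ (2 * L + 6)))" unfolding norm_mult by (intro mult_left_mono RB) auto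
      also have "\<dots> = N * e2 * (\<bar>t\<bar>\<^sup>2 * P ^ (2 * L + 6)) * (norm (exp (yn n t)) * Gx)" by (simp only: mult_ac)
      also have "\<dots> \<le> N * e2 * (\<bar>t\<bar>\<^sup>2 * P ^ (2 * L + 6)) * E" using N0 e2 P by (intro mult_left_mono GE mult_nonneg_nonneg) auto
      finally show ?thesis .
    qed
    have e1': "norm (exp (yn n t) * ?B') \<le> N * e2 * (\<bar>t\<bar> * P ^ (2 * L + 6)) * E"
    proof -
      have "norm (exp (yn n t) * ?B') \<le> norm (exp (yn n t)) * (N * e2 * Gx * (\<bar>t\<bar> * P ^ (2 * L + 6)))" unfolding norm_mult by (intro mult_left_mono RB) auto
      also have "\<dots> = N * e2 * (\<bar>t\<bar> * P ^ (2 * L + 6)) * (norm (exp (yn n t)) * Gx)" by (simp only: mult_ac)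
      also have "\<dots> \<le> N * e2 * (\<bar>t\<bar> * P ^ (2 * L + 6)) * E" using N0 e2 P by (intro mult_left_mono GE mult_nonneg_nonneg) auto
      finally show ?thesis .
    qed
    have comb: "(C + K * C) * ?\<eta> * X + (CY + 1) * N * e2 * X \<le> ((C + K * C) + (CY + 1) * N) * eps th L n * X" if "X \<ge> 0" for X
    proof -
      have "0 \<le> (C + K * C) * e2 * X" "0 \<le> (CY + 1) * N * ?\<eta> * X" using S N0 m e2 that by auto
      then show ?thesis unfolding eps by (simp add: algebra_simps)
    qed
    have "norm (hn th L n t) \<le> (C + K * C) * ?\<eta> * (t\<^sup>2 * P ^ 4 * E) + N * e2 * (\<bar>t\<bar>\<^sup>2 * P ^ (2 * L + 6)) * E"
      unfolding h by (rule order_trans[OF norm_triangle_ineq add_mono[OF G(1) e1]])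
    also have "\<dots> \<le> (C + K * C) * ?\<eta> * (t\<^sup>2 * Q * E) + (CY + 1) * N * e2 * (t\<^sup>2 * Q * E)"
    proof (intro add_mono)
      show "(C + K * C) * ?\<eta> * (t\<^sup>2 * P ^ 4 * E) \<le> (C + K * C) * ?\<eta> * (t\<^sup>2 * Q * E)"
        using S E0 PQ by (intro mult_left_mono mult_right_mono) auto
      have "N * e2 * (t\<^sup>2 * P ^ (2 * L + 6) * E) \<le> ((CY + 1) * N) * e2 * (t\<^sup>2 * Q * E)"
        using N0 e2 E0 PQ P m by (intro mult_mono mult_left_mono mult_right_mono) (auto simp: algebra_simps)
      then show "N * e2 * (\<bar>t\<bar>\<^sup>2 * P ^ (2 * L + 6)) * E \<le> (CY + 1) * N * e2 * (t\<^sup>2 * Q * E)" by (simp add: mult.assoc)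
    qed
    also have "\<dots> \<le> ((C + K * C) + (CY + 1) * N) * eps th L n * (t\<^sup>2 * Q * E)" by (intro comb mult_nonneg_nonneg PQ E0) auto
    finally show "norm (hn th L n t) \<le> ((C + K * C) + (CY + 1) * N) * eps th L n * (t\<^sup>2 * (1 + \<bar>t\<bar>) ^ (2 * L + 8) * exp (- (c0 / 2) * \<bar>t\<bar> powr \<alpha>))"
      unfolding Q_def P_def E_def .
    have "norm (yn' n t * (exp (yn n t) * ?B)) \<le> CY * N * e2 * (\<bar>t\<bar> * Q * E)"
    proof -
      have "norm (yn' n t * (exp (yn n t) * ?B)) \<le> (CY * P) * (N * e2 * (\<bar>t\<bar>\<^sup>2 * P ^ (2 * L + 6)) * E)"
        unfolding norm_mult[of "yn' n t"] using m P by (intro mult_mono V e1) auto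
      also have "\<dots> = CY * N * e2 * (\<bar>t\<bar> * (P * (\<bar>t\<bar> * P ^ (2 * L + 6))) * E)" by (simp only: power2_eq_square mult_ac)
      also have "\<dots> \<le> CY * N * e2 * (\<bar>t\<bar> * Q * E)" using m N0 e2 E0 PQ by (intro mult_left_mono mult_right_mono) auto
      finally show ?thesis .
    qed
    moreover have "norm (exp (yn n t) * ?B') \<le> N * e2 * (\<bar>t\<bar> * Q * E)"
    proof -
      have "N * e2 * (\<bar>t\<bar> * P ^ (2 * L + 6) * E) \<le> N * e2 * (\<bar>t\<bar> * Q * E)"
        using N0 e2 E0 PQ by (intro mult_left_mono mult_right_mono) auto
      then show ?thesis using e1' by (simp add: mult.assoc)
    qed
    moreover have "(C + K * C) * ?\<eta> * (\<bar>t\<bar> * P ^ 4 * E) \<le> (C + K * C) * ?\<eta> * (\<bar>t\<bar> * Q * E)"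
      using S E0 PQ by (intro mult_left_mono mult_right_mono) auto
    ultimately have "norm (hn' th L n t) \<le> (C + K * C) * ?\<eta> * (\<bar>t\<bar> * Q * E) + (CY * N * e2 * (\<bar>t\<bar> * Q * E) + N * e2 * (\<bar>t\<bar> * Q * E))"
      unfolding h' using G(2) by (intro order_trans[OF norm_triangle_ineq] add_mono) linarith+
    also have "\<dots> = (C + K * C) * ?\<eta> * (\<bar>t\<bar> * Q * E) + (CY + 1) * N * e2 * (\<bar>t\<bar> * Q * E)" by (simp add: algebra_simps)
    also have "\<dots> \<le> ((C + K * C) + (CY + 1) * N) * eps th L n * (\<bar>t\<bar> * Q * E)" by (intro comb mult_nonneg_nonneg PQ E0) auto
    finally show "norm (hn' th L n t) \<le> ((C + K * C) + (CY + 1) * N) * eps th L n * (\<bar>t\<bar> * (1 + \<bar>t\<bar>) ^ (2 * L + 8) * exp (- (c0 / 2) * \<bar>t\<bar> powr \<alpha>))"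
      unfolding Q_def P_def E_def .
  qed
qed

end

section \<open>The approximating functions as Fourier inverses\<close>

definition fourier_real :: "(real \<Rightarrow> complex) \<Rightarrow> bool" where
  "fourier_real \<phi> \<longleftrightarrow> fourier_good \<phi> \<and> (\<forall>t. \<phi> (- t) = cnj (\<phi> t))"

definition cdfF :: "(real \<Rightarrow> complex) \<Rightarrow> real \<Rightarrow> real" where
  "cdfF \<phi> x = (\<integral>z. indicator {..x} z * Re (invF \<phi> z) \<partial>lborel)"

lemma fourier_real_density: "fourier_real \<phi> \<Longrightarrow> fourier_density (\<lambda>x. Re (invF \<phi> x)) \<phi>"
  unfolding fourier_real_def by (intro fourier_density_invF) auto

lemma fourier_real_add: "fourier_real \<phi> \<Longrightarrow> fourier_real \<psi> \<Longrightarrow> fourier_real (\<lambda>t. \<phi> t + \<psi> t)"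
  unfolding fourier_real_def by (auto intro: fourier_good_add)

lemma fourier_real_cmult: "fourier_real \<phi> \<Longrightarrow> fourier_real (\<lambda>t. complex_of_real c * \<phi> t)"
  unfolding fourier_real_def by (auto intro: fourier_good_cmult)

lemma fourier_real_integrable:
  "fourier_real \<phi> \<Longrightarrow> integrable lborel \<phi>" "fourier_real \<phi> \<Longrightarrow> integrable lborel (\<lambda>z. indicator {..x} z * Re (invF \<phi> z))"
proof -
  assume "fourier_real \<phi>"
  then have i: "integrable lborel \<phi>" "integrable lborel (invF \<phi>)" by (auto simp: fourier_real_def fourier_good_def)
  show "integrable lborel \<phi>" by fact
  show "integrable lborel (\<lambda>z. indicator {..x} z * Re (invF \<phi> z))"
    by (rule Bochner_Integration.integrable_bound[OF integrable_Re[OF i(2)]]) (use i in \<open>auto simp: indicator_def\<close>)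
qed

lemma cdfF_add: "fourier_real \<phi> \<Longrightarrow> fourier_real \<psi> \<Longrightarrow> cdfF (\<lambda>t. \<phi> t + \<psi> t) x = cdfF \<phi> x + cdfF \<psi> x"
  unfolding cdfF_def by (simp add: invF_add fourier_real_integrable distrib_left)

lemma cdfF_cmult: "fourier_real \<phi> \<Longrightarrow> cdfF (\<lambda>t. complex_of_real c * \<phi> t) x = c * cdfF \<phi> x"
  unfolding cdfF_def by (simp add: invF_cmult mult.left_commute)

lemma fourier_real_sum:
  assumes "finite A" "A \<noteq> {}" "\<And>j. j \<in> A \<Longrightarrow> fourier_real (\<phi> j)"
  shows "fourier_real (\<lambda>t. \<Sum>j\<in>A. \<phi> j t) \<and> cdfF (\<lambda>t. \<Sum>j\<in>A. \<phi> j t) x = (\<Sum>j\<in>A. cdfF (\<phi> j) x)"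
  using assms by (induction rule: finite_ne_induct) (simp_all add: fourier_real_add cdfF_add)

context stp begin

text \<open>For \<open>lam = n\<close> and \<open>c = dn n\<close> this is the transform prescribed
  for \<open>Gkj k j\<close>.\<close>

definition "phiY lam c k j t = (- \<i> * complex_of_real t) ^ k * (complex_of_real lam * Y (c * t)) ^ j * exp (complex_of_real lam * Y (c * t))"

lemma fourier_real_Y:
  assumes lam: "lam > 0" and c: "c > 0"
  shows "fourier_real (phiY lam c k j)"
proof -
  have u: "poly_bounded m (\<lambda>t. (- \<i> * complex_of_real t) ^ k)" for m
    by (intro poly_bounded_power poly_bounded_mult poly_bounded_const poly_bounded_ident)
  have eq: "exp (lam * Ym (c * t)) * chp (compound lam c) t = exp (lam * Y (c * t))" for t
    unfolding chp_compound[OF lam] Y_def by (simp add: algebra_simps flip: exp_add)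
  have "fourier_good (phiY lam c k j)"
    using fourier_good_jumps[OF lam c u compound_integrable[OF lam less_imp_le[OF c]], of j]
    unfolding mult.assoc eq phiY_def[abs_def] .
  moreover have "phiY lam c k j (- t) = cnj (phiY lam c k j t)" for t
    using Y_cnj[of "c * t"] by (simp add: exp_cnj phiY_def)
  ultimately show ?thesis by (simp add: fourier_real_def)
qed

abbreviation "phn n k j \<equiv> phiY (real n) (dn n) k j"

lemma fourier_real_phn: "n \<ge> 1 \<Longrightarrow> fourier_real (phn n k j)"
  using dn_le_1 by (intro fourier_real_Y) auto

lemma yfun_yn: assumes n: "n \<ge> 1" shows "yfun \<alpha> p (gam p n) t = yn n t"
  using yfun_gam(1)[OF n, of t] yfun_Y[of "real n" t] n by (simp add: yn_def dn_def)

lemma Gkj_cdfF: assumes n: "n \<ge> 1" shows "Gkj k j \<alpha> p (gam p n) x = cdfF (phn n k j) x"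
proof -
  have "(\<lambda>t. (- \<i> * complex_of_real t) ^ k * (yfun \<alpha> p (gam p n) t) ^ j * exp (yfun \<alpha> p (gam p n) t)) = phn n k j"
    unfolding yfun_yn[OF n] yn_def phiY_def[abs_def] by (simp add: mult.commute)
  with Gkj_eq[of "\<lambda>x. Re (invF (phn n k j) x)" k \<alpha> p "gam p n" j] fourier_real_density[OF fourier_real_phn[OF n, of k j]]
  show ?thesis by (simp add: cdfF_def)
qed

lemma Gdf_cdfF: assumes n: "n \<ge> 1" shows "Gdf \<alpha> p (gam p n) x = cdfF (phn n 0 0) x"
proof -
  have 1: "(\<lambda>t. exp (yfun \<alpha> p (gam p n) t)) = phn n 0 0"
    unfolding yfun_yn[OF n] yn_def phiY_def[abs_def] by (simp add: mult.commute)
  have 2: "yfun \<alpha> p (gam p n) 0 = 0" unfolding yfun_yn[OF n] by (simp add: yn_def Y_0)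
  have 3: "Re (invF (phn n 0 0) z) \<ge> 0" for z
    using gY_nonneg[of "real n" "dn n" z] dn_le_1[OF n] n by (simp add: gY_def phiY_def[abs_def])
  show ?thesis
    using Gdf_eq[of "\<lambda>x. Re (invF (phn n 0 0) x)" \<alpha> p "gam p n"] 2 3 fourier_real_density[OF fourier_real_phn[OF n, of 0 0]] unfolding 1
    by (simp add: cdfF_def)
qed

definition "cfn n j = (-1) ^ j * sig ^ j * del n ^ j / (fact j * 2 ^ j)"

text \<open>Each power of \<open>v1\<close> is a real multiple of an even power of \<open>t\<close>,
  and \<open>(- \<i> * t) ^ (2 * j)\<close> is \<open>(-1) ^ j * t ^ (2 * j)\<close>; this produces
  the alternating signs in the coefficients. The term \<open>v2\<close> contributes
  \<open>- \<i> * t * yn\<close>, which is the pattern of the pair \<open>(1, 1)\<close>.\<close>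

lemma Phi_decomp:
  assumes n: "n \<ge> 1"
  shows "Phi th L n = (\<lambda>t. (\<Sum>j\<in>{..L}. complex_of_real (cfn n j) * phn n (2*j) 0 t) + complex_of_real (th * mu1 * dn n) * phn n 1 1 t)"
proof
  fix t
  have yy: "complex_of_real (real n) * Y (dn n * t) = yn n t" by (simp add: yn_def mult.commute)
  have nd: "real n * (dn n * dn n) = del n"
    using n unfolding dn_def del_def mult.assoc powr_add[symmetric]
    by (simp add: powr_diff powr_minus_divide)
  have v: "v1 n t = complex_of_real (sig * del n / 2) * of_real t ^ 2" 
    unfolding v1_def nd[symmetric] of_real_power[symmetric] of_real_mult[symmetric] of_real_eq_iff by (simp add: power2_eq_square)
  have i2: "(- \<i> * complex_of_real t) ^ (2 * j) = (-1) ^ j * (of_real t ^ 2) ^ j" for j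
  proof -
    have "(- \<i> * complex_of_real t) ^ 2 = (-1) * of_real t ^ 2" by (simp add: power_mult_distrib)
    then show ?thesis unfolding power_mult by (simp only: power_mult_distrib)
  qed
  have "v1 n t ^ j / fact j * exp (yn n t) = complex_of_real (cfn n j) * phn n (2*j) 0 t" for j
  proof -
    have "v1 n t ^ j / fact j = complex_of_real (sig ^ j * del n ^ j / (fact j * 2 ^ j)) * (of_real t ^ 2) ^ j"
      unfolding v power_mult_distrib by (simp add: power_mult_distrib power_divide)
    moreover have "(-1) ^ j * ((-1) ^ j * z) = z" for z :: complex by (simp flip: mult.assoc power_mult_distrib)
    ultimately show ?thesis unfolding cfn_def phiY_def yy i2 by (simp add: mult_ac)
  qed
  then have "expT (Suc L) (v1 n t) * exp (yn n t) = (\<Sum>j\<in>{..L}. complex_of_real (cfn n j) * phn n (2*j) 0 t)"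
    unfolding expT_def sum_distrib_right lessThan_Suc_atMost by simp
  moreover have "th * v2 n t * exp (yn n t) = complex_of_real (th * mu1 * dn n) * phn n 1 1 t"
    unfolding phiY_def yy by (simp add: v2_def mult_ac)
  ultimately show "Phi th L n t = (\<Sum>j\<in>{..L}. complex_of_real (cfn n j) * phn n (2*j) 0 t) + complex_of_real (th * mu1 * dn n) * phn n 1 1 t"
    by (simp add: Phi_def algebra_simps)
qed

lemma Phi_fourier:
  assumes n: "n \<ge> 1"
  shows "fourier_real (Phi th L n)"
    "cdfF (Phi th L n) x = (\<Sum>j\<in>{..L}. cfn n j * cdfF (phn n (2*j) 0) x) + th * mu1 * dn n * cdfF (phn n 1 1) x"
proof -
  note R = fourier_real_cmult[OF fourier_real_phn[OF n]]
  have S: "fourier_real (\<lambda>t. \<Sum>j\<in>{..L}. complex_of_real (cfn n j) * phn n (2*j) 0 t) \<and>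
     cdfF (\<lambda>t. \<Sum>j\<in>{..L}. complex_of_real (cfn n j) * phn n (2*j) 0 t) x = (\<Sum>j\<in>{..L}. cdfF (\<lambda>t. complex_of_real (cfn n j) * phn n (2*j) 0 t) x)"
    by (rule fourier_real_sum) (auto intro: R)
  show "fourier_real (Phi th L n)" unfolding Phi_decomp[OF n] by (rule fourier_real_add[OF conjunct1[OF S] R])
  show "cdfF (Phi th L n) x = (\<Sum>j\<in>{..L}. cfn n j * cdfF (phn n (2*j) 0) x) + th * mu1 * dn n * cdfF (phn n 1 1) x"
    unfolding Phi_decomp[OF n] cdfF_add[OF conjunct1[OF S] R] conjunct2[OF S] cdfF_cmult[OF fourier_real_phn[OF n]] ..
qed

text \<open>The summand \<open>j = 0\<close> is the distribution function \<open>Gdf\<close> itself,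
  whose density is nonnegative; the others are the functions \<open>Gkj\<close>. Both are inverse
  transforms, so linearity of \<open>cdfF\<close> assembles them into one.\<close>

lemma Gtilde_eq:
  assumes n: "n \<ge> 1"
  shows "Gtilde \<alpha> p (Suc L) n x = cdfF (Phi 0 L n) x" "Gtt \<alpha> p (Suc L) n x = cdfF (Phi 1 L n) x"
proof -
  have d: "1 / real n powr (real j * (2 - \<alpha>) / \<alpha>) = del n ^ j" for j
  proof -
    have "del n ^ j = real n powr (- (real j * (2 - \<alpha>) / \<alpha>))"
    proof -
      have "real j * (1 - 2 / \<alpha>) = - (real j * (2 - \<alpha>) / \<alpha>)" using \<alpha> by (simp add: field_simps)
      then show ?thesis using n unfolding del_def by (subst powr_power) auto
    qed
    then show ?thesis by (simp add: powr_minus_divide)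
  qed
  have "{..L} = insert 0 {1..L}" by auto
  then have s: "(\<Sum>j\<in>{..L}. cfn n j * cdfF (phn n (2*j) 0) x) = cdfF (phn n 0 0) x + (\<Sum>j\<in>{1..L}. cfn n j * cdfF (phn n (2*j) 0) x)"
    by (simp add: cfn_def)
  have "(-1) ^ j * (mu1\<^sup>2 - mu2) ^ j * Gkj (2*j) 0 \<alpha> p (gam p n) x / (fact j * 2 ^ j * real n powr (real j * (2 - \<alpha>) / \<alpha>)) = cfn n j * cdfF (phn n (2*j) 0) x" for j
    unfolding Gkj_cdfF[OF n] cfn_def d[symmetric] sig_def by simp
  then have 1: "Gtilde \<alpha> p (Suc L) n x = (\<Sum>j\<in>{..L}. cfn n j * cdfF (phn n (2*j) 0) x)"
    unfolding Gtilde_def s Gdf_cdfF[OF n] mu1_def[symmetric] mu2_def[symmetric] by simp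
  then show "Gtilde \<alpha> p (Suc L) n x = cdfF (Phi 0 L n) x" using Phi_fourier(2)[OF n, of 0 L x] by simp
  have "dn n = 1 / real n powr (1 / \<alpha>)" by (simp add: dn_def powr_minus_divide)
  then show "Gtt \<alpha> p (Suc L) n x = cdfF (Phi 1 L n) x"
    unfolding Gtt_def 1 Gkj_cdfF[OF n] mu1_def[symmetric] using Phi_fourier(2)[OF n, of 1 L x] by simp
qed

section \<open>Bounds for the approximating transform and its density, uniform in
  \<open>n\<close>\<close>

lemma powr_alpha_ge: "\<bar>t\<bar> powr \<alpha> \<ge> \<bar>t\<bar> - 1"
proof (cases "\<bar>t\<bar> \<le> 1")
  case True
  then show ?thesis using powr_ge_zero[of "\<bar>t\<bar>" \<alpha>] by linarith
next
  case False
  then have "\<bar>t\<bar> powr 1 \<le> \<bar>t\<bar> powr \<alpha>" using \<alpha> by (intro powr_mono) auto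
  then show ?thesis using False by simp
qed

lemma poly_exp_powr_decay:
  assumes c: "c > 0"
  obtains C where "C \<ge> 0" "\<And>t. (1 + \<bar>t\<bar>) ^ m * exp (- c * \<bar>t\<bar> powr \<alpha>) \<le> C / (1 + t\<^sup>2)"
proof -
  have "\<exists>C. \<forall>t. norm (complex_of_real ((1 + \<bar>t\<bar>) ^ m) * exp (complex_of_real (- c * \<bar>t\<bar> powr \<alpha>))) \<le> C / (1 + t^2)"
  proof (rule poly_exp_decay[where b = c and c = c])
    show "Re (complex_of_real (- c * \<bar>t\<bar> powr \<alpha>)) \<le> c - c * \<bar>t\<bar>" for t
      using mult_left_mono[OF powr_alpha_ge[of t], of c] c by (simp add: algebra_simps)
    show "\<exists>C n. \<forall>t. norm (complex_of_real ((1 + \<bar>t\<bar>) ^ m)) \<le> C * (1 + \<bar>t\<bar>) ^ n"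
      unfolding norm_of_real by (intro exI[of _ 1] exI[of _ m]) simp
  qed fact
  then obtain C where C: "norm (complex_of_real ((1 + \<bar>t\<bar>) ^ m) * exp (complex_of_real (- c * \<bar>t\<bar> powr \<alpha>))) \<le> C / (1 + t^2)" for t by blast
  have "norm (complex_of_real ((1 + \<bar>t\<bar>) ^ m) * exp (complex_of_real (- c * \<bar>t\<bar> powr \<alpha>))) = (1 + \<bar>t\<bar>) ^ m * exp (- c * \<bar>t\<bar> powr \<alpha>)" for t
    unfolding norm_mult norm_of_real exp_of_real by simp
  with C have *: "(1 + \<bar>t\<bar>) ^ m * exp (- c * \<bar>t\<bar> powr \<alpha>) \<le> C / (1 + t\<^sup>2)" for t by simp
  show ?thesis
  proof
    show "C \<ge> 0" using order_trans[OF _ *[of 0], of 0] by simp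
  qed (rule *)
qed

lemma norm_expT_le: assumes "1 \<le> W" "norm z \<le> W" "k \<le> Suc L" shows "norm (expT k z) \<le> real k * W ^ L"
proof -
  have "norm (z ^ j / fact j) \<le> W ^ L" if "j \<in> {..<k}" for j
  proof -
    have "norm (z ^ j / fact j) = norm z ^ j / fact j" by (simp add: norm_divide norm_power)
    also have "\<dots> \<le> norm z ^ j / 1" by (intro divide_left_mono) (auto simp: fact_ge_1)
    also have "\<dots> \<le> W ^ j" using assms by (simp add: power_mono)
    also have "\<dots> \<le> W ^ L" using assms that by (intro power_increasing) auto
    finally show ?thesis .
  qed
  then have "norm (expT k z) \<le> (\<Sum>j<k. W ^ L)" unfolding expT_def by (intro sum_norm_le) auto
  then show ?thesis by simp
qed

text \<open>Uniformity in \<open>n\<close> holds because \<open>del n\<close> and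
  \<open>dn n\<close> are at most 1 and the decay of \<open>exp yn\<close> does not depend on
  \<open>n\<close>.\<close>

lemma Phi_bounds:
  fixes th :: real
  assumes th: "0 \<le> th" "th \<le> 1"
  obtains C where "C \<ge> 0" 
    "\<And>n t. n \<ge> 1 \<Longrightarrow> norm (Phi th L n t) \<le> C * (1 + \<bar>t\<bar>) ^ (2 * L + 6) * exp (- cY * \<bar>t\<bar> powr \<alpha>)"
    "\<And>n t. n \<ge> 1 \<Longrightarrow> norm (Phi' th L n t) \<le> C * (1 + \<bar>t\<bar>) ^ (2 * L + 6) * exp (- cY * \<bar>t\<bar> powr \<alpha>)"
proof -
  define K where "K = 1 + sig + 2 * (mu1 * CY)"
  define C where "C = (CY + 1) * (real L + 2) * K ^ (L + 3)"
  have pos: "mu1 > 0" "CY > 0" "sig > 0" by (rule mu1 CY sig)+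
  then have K1: "K \<ge> 1" by (simp add: K_def)
  have main: "norm (Phi th L n t) \<le> C * (1 + \<bar>t\<bar>) ^ (2 * L + 6) * exp (- cY * \<bar>t\<bar> powr \<alpha>) \<and>
      norm (Phi' th L n t) \<le> C * (1 + \<bar>t\<bar>) ^ (2 * L + 6) * exp (- cY * \<bar>t\<bar> powr \<alpha>)" if n: "n \<ge> 1" for n t
  proof -
    define P where "P = 1 + \<bar>t\<bar>"
    define E where "E = exp (- cY * \<bar>t\<bar> powr \<alpha>)"
    \<comment> \<open>One quantity dominating everything: \<open>v1\<close>, \<open>v1'\<close> and
      \<open>v2'\<close> are at most \<open>W\<close>, and \<open>v2\<close> is at most its square.
      The largest power used is \<open>W ^ (L + 3)\<close>, hence the exponent
      \<open>2 * L + 6\<close> of \<open>P\<close>.\<close>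
    define W where "W = K * P\<^sup>2"
    have P: "P \<ge> 1" "\<bar>t\<bar> \<le> P" by (auto simp: P_def)
    have PP: "P \<le> P\<^sup>2" "1 \<le> P\<^sup>2" using P by (auto intro: self_le_power)
    have W1: "1 \<le> W" unfolding W_def using mult_mono[OF K1 PP(2)] K1 by simp
    have KP: "K * P \<le> W" "P \<le> W" unfolding W_def using PP K1 P mult_mono[of 1 K P "P\<^sup>2"] by auto
    have W2: "W \<le> W\<^sup>2" using W1 by (auto intro: self_le_power)
    note vb = vn_bounds[OF n, of t, folded K_def P_def E_def]
    note dl = del_le_1[OF n] dn_le_1[OF n]
    have t2: "\<bar>t\<bar>\<^sup>2 \<le> P\<^sup>2" using P by (intro power_mono) auto
    have "norm (v1 n t) \<le> K * 1 * P\<^sup>2"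
      by (rule order_trans[OF vb(1)]) (use K1 dl t2 in \<open>intro mult_mono; auto\<close>)
    then have b1: "norm (v1 n t) \<le> W" by (simp add: W_def)
    have "norm (v1' n t) \<le> K * 1 * P"
      by (rule order_trans[OF vb(2)]) (use K1 dl P in \<open>intro mult_mono; auto\<close>)
    then have b1': "norm (v1' n t) \<le> W" using KP by simp
    have "norm (v2 n t) \<le> K * 1 * P\<^sup>2 * P"
      by (rule order_trans[OF vb(3)]) (use K1 dl P t2 in \<open>intro mult_mono; auto\<close>)
    also have "\<dots> \<le> W * W" unfolding mult_1_right W_def[symmetric] using KP W1 by (intro mult_left_mono) auto
    finally have b2: "norm (v2 n t) \<le> W\<^sup>2" by (simp add: power2_eq_square)
    have "norm (v2' n t) \<le> K * 1 * P * P"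
      by (rule order_trans[OF vb(4)]) (use K1 dl P in \<open>intro mult_mono; auto\<close>)
    then have b2': "norm (v2' n t) \<le> W" by (simp add: W_def power2_eq_square mult.assoc)
    have y': "norm (yn' n t) \<le> CY * W" by (rule order_trans[OF vb(7)]) (use pos KP in auto)
    have E: "norm (exp (yn n t)) \<le> E" "0 \<le> E" using vb(8) by (auto simp: E_def)
    have tv: "norm (complex_of_real th * z) \<le> norm z" for z
      using th mult_right_mono[of th 1 "norm z"] by (simp add: norm_mult)
    have pw: "W ^ a \<le> W ^ b" if "a \<le> b" for a b using W1 that by (rule power_increasing[rotated])
    have "norm (expT (Suc L) (v1 n t) + th * v2 n t) \<le> real (Suc L) * W ^ L + W\<^sup>2"
      by (rule order_trans[OF norm_triangle_ineq]) (intro add_mono norm_expT_le W1 b1 order_refl order_trans[OF tv] b2)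
    also have "\<dots> \<le> real (Suc L) * W ^ (L + 2) + W ^ (L + 2)" by (intro add_mono mult_left_mono pw) auto
    finally have i: "norm (expT (Suc L) (v1 n t) + th * v2 n t) \<le> (real L + 2) * W ^ (L + 2)" by (simp add: algebra_simps)
    have Ph: "norm (Phi th L n t) \<le> (real L + 2) * W ^ (L + 2) * E"
      unfolding Phi_def norm_mult using mult_mono[OF E(1) i] E by (simp add: mult.commute)
    have "norm (expT L (v1 n t) * v1' n t + th * v2' n t) \<le> (real L * W ^ L) * W + W"
      by (rule order_trans[OF norm_triangle_ineq], unfold norm_mult[of "expT L (v1 n t)"])
         (use W1 in \<open>intro add_mono mult_mono norm_expT_le W1 b1 b1' order_trans[OF tv] b2'; auto\<close>)
    also have "\<dots> = real L * W ^ (L + 1) + W ^ 1" by simp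
    also have "\<dots> \<le> real L * W ^ (L + 3) + W ^ (L + 3)" by (intro add_mono mult_left_mono pw) auto
    also have "\<dots> \<le> (real L + 2) * W ^ (L + 3)" using W1 by (simp add: algebra_simps)
    finally have j: "norm (expT L (v1 n t) * v1' n t + th * v2' n t) \<le> (real L + 2) * W ^ (L + 3)" .
    have "norm (Phi' th L n t) \<le> (CY * W) * ((real L + 2) * W ^ (L + 2) * E) + E * ((real L + 2) * W ^ (L + 3))"
      unfolding Phi'_def by (rule order_trans[OF norm_triangle_ineq], unfold norm_mult)
        (use pos W1 E in \<open>intro add_mono mult_mono y' Ph j; auto\<close>)
    also have "\<dots> = (CY + 1) * (real L + 2) * W ^ (L + 3) * E" by (simp add: algebra_simps power_add eval_nat_numeral)
    also have WC: "\<dots> = C * P ^ (2 * L + 6) * E"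
      unfolding C_def W_def power_mult_distrib power_mult[symmetric] by (simp add: algebra_simps)
    finally have Ph': "norm (Phi' th L n t) \<le> C * P ^ (2 * L + 6) * E" .
    have "(real L + 2) * W ^ (L + 2) * E \<le> ((CY + 1) * (real L + 2)) * W ^ (L + 3) * E"
      using pos E W1 by (intro mult_right_mono mult_mono pw) (auto simp: mult_le_cancel_right1)
    with Ph have "norm (Phi th L n t) \<le> C * P ^ (2 * L + 6) * E" unfolding WC by (rule order_trans)
    with Ph' show ?thesis unfolding P_def E_def by blast
  qed
  show ?thesis by (rule that[of C]) (use main pos K1 in \<open>auto simp: C_def\<close>)
qed

text \<open>Supplies the continuous derivative for the integration by parts in the density bound; it
  rests on the continuity of \<open>Y'\<close>.\<close>

lemma Phi'_cont: "continuous_on UNIV (Phi' th L n)"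
proof -
  have cd: "continuous_on UNIV u" if "\<And>t::real. (u has_vector_derivative u' t) (at t)" for u u' :: "real \<Rightarrow> complex"
    using has_vector_derivative_continuous[OF that] by (auto simp: continuous_on_eq_continuous_at)
  have "continuous_on UNIV Y'" using Y'_cont by (auto simp: continuous_on_eq_continuous_at)
  then have "continuous_on UNIV (\<lambda>t. Y' (t * dn n))" by (rule continuous_on_compose2) (auto intro!: continuous_intros)
  then have y': "continuous_on UNIV (yn' n)" unfolding yn'_def by (intro continuous_intros)
  have v2: "continuous_on UNIV (v2' n)" unfolding v2'_def[abs_def] using cd[OF yn_deriv, of n] y' by (intro continuous_intros)
  have v1: "continuous_on UNIV (v1' n)" unfolding v1'_def[abs_def] by (intro continuous_intros)
  have e: "continuous_on UNIV (\<lambda>t. expT L (v1 n t))" unfolding expT_def using cd[OF v1_deriv, of n] by (intro continuous_intros) auto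
  show ?thesis unfolding Phi'_def[abs_def]
    using cd[OF Phi_deriv, of th L n] y' v1 v2 e cd[OF yn_deriv, of n] by (intro continuous_intros)
qed

text \<open>The norm of \<open>Phi\<close> bounds the density and the norm of \<open>Phi'\<close>
  bounds \<open>x\<close> times the density. The weight \<open>1 + \<bar>x\<bar>\<close> thus costs
  one derivative, which is all that \<open>Y\<close> has. The constant \<open>K\<close> of the
  smoothing inequality is therefore independent of \<open>n\<close>.\<close>

lemma Phi_density_bound:
  fixes th :: real
  assumes th: "0 \<le> th" "th \<le> 1"
  obtains K where "K \<ge> 0" "\<And>n x. n \<ge> 1 \<Longrightarrow> (1 + \<bar>x\<bar>) * \<bar>Re (invF (Phi th L n) x)\<bar> \<le> K"
proof -
  obtain C where C: "C \<ge> 0" 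
    and b: "\<And>n t. n \<ge> 1 \<Longrightarrow> norm (Phi th L n t) \<le> C * (1 + \<bar>t\<bar>) ^ (2 * L + 6) * exp (- cY * \<bar>t\<bar> powr \<alpha>)"
    "\<And>n t. n \<ge> 1 \<Longrightarrow> norm (Phi' th L n t) \<le> C * (1 + \<bar>t\<bar>) ^ (2 * L + 6) * exp (- cY * \<bar>t\<bar> powr \<alpha>)" using Phi_bounds[OF th, of L] by blast
  obtain D where D: "D \<ge> 0" "\<And>t. (1 + \<bar>t\<bar>) ^ (2 * L + 6) * exp (- cY * \<bar>t\<bar> powr \<alpha>) \<le> D / (1 + t\<^sup>2)"
    using poly_exp_powr_decay[OF cY, of "2 * L + 6"] by blast
  define M where "M = C * D"
  have le: "C * (1 + \<bar>t\<bar>) ^ (2 * L + 6) * exp (- cY * \<bar>t\<bar> powr \<alpha>) \<le> M / (1 + t\<^sup>2)" for t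
    using mult_left_mono[OF D(2)[of t] C] by (simp add: M_def mult.assoc)
  have b': "norm (Phi th L n t) \<le> M / (1 + t\<^sup>2)" "norm (Phi' th L n t) \<le> M / (1 + t\<^sup>2)" if "n \<ge> 1" for n t
    using b[OF that, of t] le[of t] by linarith+
  have i: "integrable lborel (\<lambda>t. M / (1 + t\<^sup>2))"
    using integrable_mult_right[OF integrable_inverse_square_lborel, of M] by simp
  define I where "I = 1 / (2 * pi) * (\<integral>t. M / (1 + t\<^sup>2) \<partial>lborel)"
  have I: "norm (invF (Phi th L n) x) \<le> I" "norm (invF (Phi' th L n) x) \<le> I" if "n \<ge> 1" for n x
    unfolding I_def by (intro norm_invF_le[OF i] b' that)+
  have fin: "(1 + \<bar>x\<bar>) * \<bar>Re (invF (Phi th L n) x)\<bar> \<le> 2 * I" if n: "n \<ge> 1" for n x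
  proof -
    have "invF (Phi' th L n) x = \<i> * x * invF (Phi th L n) x"
      by (rule invF_deriv[OF Phi_deriv Phi'_cont b'[OF n]])
    then have "\<bar>x\<bar> * norm (invF (Phi th L n) x) \<le> I" using I(2)[OF n, of x] by (simp add: norm_mult)
    then have "(1 + \<bar>x\<bar>) * norm (invF (Phi th L n) x) \<le> 2 * I" using I(1)[OF n, of x] by (simp add: distrib_right)
    moreover have "(1 + \<bar>x\<bar>) * \<bar>Re (invF (Phi th L n) x)\<bar> \<le> (1 + \<bar>x\<bar>) * norm (invF (Phi th L n) x)"
      by (intro mult_left_mono abs_Re_le_cmod) auto
    ultimately show ?thesis by linarith
  qed
  have "I \<ge> 0" using order_trans[OF norm_ge_zero I(1)[of 1]] by simp
  then show ?thesis by (intro that[of "2 * I"] fin) auto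
qed

end

section \<open>The law of the normalized sum\<close>

lemma arctan_integral:
  fixes c T :: real assumes "T \<ge> 0"
  shows "(\<lambda>t. c / (1 + t\<^sup>2)) integrable_on {-T..T}" "c \<ge> 0 \<Longrightarrow> integral {-T..T} (\<lambda>t. c / (1 + t\<^sup>2)) \<le> c * pi"
proof -
  have "((\<lambda>t. c * (1 / (1 + t\<^sup>2))) has_integral c * (arctan T - arctan (-T))) {-T..T}"
    using assms by (intro has_integral_mult_right fundamental_theorem_of_calculus)
      (auto intro!: derivative_eq_intros simp: has_real_derivative_iff_has_vector_derivative[symmetric] divide_inverse)
  then have *: "((\<lambda>t. c / (1 + t\<^sup>2)) has_integral c * (arctan T - arctan (-T))) {-T..T}" by simp
  then show "(\<lambda>t. c / (1 + t\<^sup>2)) integrable_on {-T..T}" by blast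
  assume "c \<ge> 0"
  then have "c * (arctan T - arctan (-T)) \<le> c * pi"
    using arctan_ubound[of T] by (intro mult_left_mono) (auto simp: arctan_minus)
  then show "integral {-T..T} (\<lambda>t. c / (1 + t\<^sup>2)) \<le> c * pi" using integral_unique[OF *] by simp
qed

text \<open>Equality on atoms extends to subsets of \<open>S\<close> by countable additivity; in
  particular \<open>S\<close> has full mass under \<open>D\<close> as well, so the complement of
  \<open>S\<close> is null for both measures.\<close>

lemma measure_eqI_countable_support:
  fixes D N :: "real measure"
  assumes D: "prob_space D" "sets D = sets borel" and N: "prob_space N" "sets N = sets borel"
    and S: "countable S" and eq: "\<And>x. x \<in> S \<Longrightarrow> emeasure D {x} = emeasure N {x}" and N1: "emeasure N S = 1"
  shows "D = N"
proof (rule measure_eqI)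
  show "sets D = sets N" using D N by simp
  fix A assume "A \<in> sets D"
  then have A: "A \<in> sets borel" using D by simp
  have S': "S \<in> sets borel" using S by (rule sets.countable[rotated]) simp
  have cut: "emeasure D (A' \<inter> S) = emeasure N (A' \<inter> S)" for A'
  proof -
    have c: "countable (A' \<inter> S)" using S by blast
    have "emeasure D (A' \<inter> S) = (\<integral>\<^sup>+x. emeasure D {x} \<partial>count_space (A' \<inter> S))"
      by (rule emeasure_countable_singleton) (use D c in auto)
    also have "\<dots> = (\<integral>\<^sup>+x. emeasure N {x} \<partial>count_space (A' \<inter> S))" by (intro nn_integral_cong) (use eq in auto)
    also have "\<dots> = emeasure N (A' \<inter> S)" by (rule emeasure_countable_singleton[symmetric]) (use N c in auto)
    finally show ?thesis .
  qed
  have D1: "emeasure D S = 1" using cut[of UNIV] N1 by simp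
  have *: "emeasure Q A = emeasure Q (A \<inter> S)" if Q: "prob_space Q" "sets Q = sets borel" "emeasure Q S = 1" for Q
  proof -
    interpret prob_space Q by fact
    have "AE x in Q. x \<in> S" using Q(3) S' Q(2) by (intro AE_prob_1) (simp add: measure_def)
    then show ?thesis using A S' Q(2) by (intro emeasure_eq_AE) auto
  qed
  show "emeasure D A = emeasure N A" using *[OF D D1] *[OF N N1] cut[of A] by simp
qed

context stp begin

lemma Xpmf_integrable: "integrable (measure_pmf Xpmf) (\<lambda>x. x)"
  unfolding integrable_pmf_nn Xpmf_mean by simp

text \<open>Only the masses of the atoms are given. They add up to 1, so they determine the
  law.\<close>

lemma X_law:
  fixes M :: "'a measure" and X :: "'a \<Rightarrow> real"
  assumes M: "prob_space M" and rv [measurable]: "X \<in> borel_measurable M"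
    and d: "\<And>k. k \<ge> 1 \<Longrightarrow> measure M {\<omega> \<in> space M. X \<omega> = rr p powr (real k / \<alpha>)} = qq p ^ (k - 1) * p"
  shows "distr M borel X = distr (measure_pmf Xpmf) borel (\<lambda>x. x)"
proof (rule measure_eqI_countable_support[where S = "range (\<lambda>k. rho ^ Suc k)"])
  interpret prob_space M by fact
  show "prob_space (distr M borel X)" by (rule prob_space_distr) simp
  show "prob_space (distr (measure_pmf Xpmf) borel (\<lambda>x. x))" by (rule measure_pmf.prob_space_distr) simp
  show "countable (range (\<lambda>k. rho ^ Suc k))" by simp
  show "emeasure (distr (measure_pmf Xpmf) borel (\<lambda>x. x)) (range (\<lambda>k. rho ^ Suc k)) = 1"
  proof -
    define S where "S = range (\<lambda>k. rho ^ Suc k)"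
    have c: "S \<in> sets borel" unfolding S_def by (rule sets.countable) auto
    have "set_pmf Xpmf \<subseteq> S" unfolding Xpmf_def set_map_pmf S_def by (rule image_mono) simp
    then have "AE x in measure_pmf Xpmf. x \<in> S" unfolding AE_measure_pmf_iff by blast
    then have "emeasure (measure_pmf Xpmf) S = 1" by (intro measure_pmf.emeasure_eq_1_AE) auto
    then show ?thesis using c unfolding S_def[symmetric] by (simp add: emeasure_distr)
  qed
  fix x assume "x \<in> range (\<lambda>k. rho ^ Suc k)"
  then obtain k where x: "x = rho ^ Suc k" by blast
  have "inj (\<lambda>k. rho ^ Suc k)" using rho by (auto simp: inj_on_def)
  then have "pmf Xpmf x = Wf k" unfolding Xpmf_def x using p by (subst pmf_map_inj') (auto simp: Wf_def q_def)
  moreover have "measure M {\<omega> \<in> space M. X \<omega> = x} = Wf k" 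
    using d[of "Suc k"] unfolding x rho_pow r q Wf_def by simp
  moreover have "X -` {x} \<inter> space M = {\<omega> \<in> space M. X \<omega> = x}" by auto
  ultimately show "emeasure (distr M borel X) {x} = emeasure (distr (measure_pmf Xpmf) borel (\<lambda>x. x)) {x}"
    by (simp add: emeasure_distr emeasure_eq_measure emeasure_pmf_single)
qed auto

definition "std_sum M X n = distr M borel (\<lambda>\<omega>. ((\<Sum>i<n. X i \<omega>) - mu \<alpha> p 1 * real n) / real n powr (1 / \<alpha>))"

text \<open>Independence turns the characteristic function of the sum into a power of
  \<open>f\<close>; the centering contributes one phase factor per summand, which turns
  \<open>f\<close> into \<open>gs\<close>.\<close>

lemma std_sum_law:
  fixes M :: "'a measure" and X :: "nat \<Rightarrow> 'a \<Rightarrow> real"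
  assumes M: "prob_space M" and rv [measurable]: "\<And>i. X i \<in> borel_measurable M"
    and indep: "prob_space.indep_vars M (\<lambda>_. borel) X UNIV"
    and d: "\<And>i k. k \<ge> 1 \<Longrightarrow> measure M {\<omega> \<in> space M. X i \<omega> = rr p powr (real k / \<alpha>)} = qq p ^ (k - 1) * p"
  shows "real_distribution (std_sum M X n)" "integrable (std_sum M X n) (\<lambda>x. x)"
    "char (std_sum M X n) t = gs (t * dn n) ^ n"
    "cdf (std_sum M X n) x = measure M {\<omega> \<in> space M. ((\<Sum>i<n. X i \<omega>) - mu \<alpha> p 1 * real n) / real n powr (1 / \<alpha>) \<le> x}"
proof -
  interpret prob_space M by fact
  let ?Z = "\<lambda>\<omega>. ((\<Sum>i<n. X i \<omega>) - mu \<alpha> p 1 * real n) / real n powr (1 / \<alpha>)"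
  have Zm [measurable]: "?Z \<in> borel_measurable M" by measurable
  have L: "distr M borel (X i) = distr (measure_pmf Xpmf) borel (\<lambda>x. x)" for i
    by (rule X_law[OF M rv d])
  show "real_distribution (std_sum M X n)" unfolding std_sum_def by (rule real_distribution_distr[OF Zm])
  have "integrable (distr M borel (X i)) (\<lambda>x. x)" for i
    unfolding L by (rule iffD2[OF integrable_distr_eq Xpmf_integrable]) simp_all
  then have Xi: "integrable M (X i)" for i by (rule iffD1[OF integrable_distr_eq[OF rv, where f = "\<lambda>x. x"], rotated]) (rule measurable_ident_sets[OF refl])
  have "integrable M ?Z"
    by (intro integrable_divide Bochner_Integration.integrable_diff Bochner_Integration.integrable_sum Xi integrable_const)
  then show "integrable (std_sum M X n) (\<lambda>x. x)" unfolding std_sum_def by (rule iffD2[OF integrable_distr_eq[where f = "\<lambda>x::real. x", OF Zm], rotated]) (rule measurable_ident_sets[OF refl])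
  show "cdf (std_sum M X n) x = measure M {\<omega> \<in> space M. ?Z \<omega> \<le> x}"
    unfolding std_sum_def cdf_def by (subst measure_distr) (auto intro!: arg_cong[where f = "measure M"])
  have ch: "char (distr M borel (X i)) s = f s" for i s
    unfolding L char_def chp_X[symmetric] by (rule integral_distr) simp_all
  have indn: "indep_vars (\<lambda>_. borel) X {..<n}" by (rule indep_vars_subset[OF indep]) simp
  have chS: "(\<integral>\<omega>. iexp (s * (\<Sum>i<n. X i \<omega>)) \<partial>M) = f s ^ n" for s
  proof -
    have "(\<integral>\<omega>. iexp (s * (\<Sum>i<n. X i \<omega>)) \<partial>M) = char (distr M borel (\<lambda>\<omega>. \<Sum>i<n. X i \<omega>)) s"
      unfolding char_def by (rule integral_distr[symmetric]) simp_all
    also have "\<dots> = f s ^ n" unfolding char_distr_sum[OF indn] ch by simp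
    finally show ?thesis .
  qed
  define s where "s = t * dn n"
  have tZ: "t * ?Z \<omega> = s * (\<Sum>i<n. X i \<omega>) + real n * (- (s * mu1))" for \<omega>
    unfolding s_def dn_def mu1_def[symmetric] by (simp add: powr_minus_divide algebra_simps diff_divide_distrib)
  have e: "iexp (real n * (- (s * mu1))) = iexp (- (s * mu1)) ^ n"
    using exp_of_nat_mult[of n "\<i> * complex_of_real (- (s * mu1))"] by (simp add: mult_ac)
  have "iexp (t * ?Z \<omega>) = iexp (s * (\<Sum>i<n. X i \<omega>)) * iexp (- (s * mu1)) ^ n" for \<omega>
    unfolding tZ e[symmetric] of_real_add distrib_left exp_add ..
  then have "char (std_sum M X n) t = (\<integral>\<omega>. iexp (s * (\<Sum>i<n. X i \<omega>)) * iexp (- (s * mu1)) ^ n \<partial>M)"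
    unfolding std_sum_def char_def by (subst integral_distr) simp_all
  also have "\<dots> = f s ^ n * iexp (- (s * mu1)) ^ n" unfolding chS[symmetric] by simp
  finally show "char (std_sum M X n) t = gs (t * dn n) ^ n" unfolding gs_def power_mult_distrib s_def .
qed

lemma Phi_0: "Phi th L n 0 = 1"
proof -
  have "expT (Suc L) 0 = 1" unfolding expT_def sum.lessThan_Suc_shift by simp
  then show ?thesis by (simp add: Phi_def yn_def Y_0 v1_def v2_def)
qed

lemma smoothing_application:
  fixes th :: real
  assumes P: "real_distribution P" "integrable P (\<lambda>x. x)" and ch: "\<And>t. char P t = gs (t * dn n) ^ n" and n: "n \<ge> 1"
    and K: "\<And>x. (1 + \<bar>x\<bar>) * \<bar>Re (invF (Phi th L n) x)\<bar> \<le> K"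
    and T: "T \<ge> 1" and B: "B integrable_on {-T..T}"
    and hB: "\<And>t. \<bar>t\<bar> \<le> T \<Longrightarrow> norm (hn th L n t / t) \<le> B t"
    and h'B: "\<And>t. \<bar>t\<bar> \<le> T \<Longrightarrow> norm (hn' th L n t / t - hn th L n t / t\<^sup>2) \<le> B t"
  shows "(1 + \<bar>x\<bar>) * \<bar>cdf P x - cdfF (Phi th L n) x\<bar> \<le> smooth_const * (integral {-T..T} B + K / T)"
proof -
  let ?g = "\<lambda>x. Re (invF (Phi th L n) x)"
  have fd: "fourier_density ?g (Phi th L n)" by (rule fourier_real_density[OF Phi_fourier(1)[OF n]])
  then have F: "(\<integral>x. iexp (t * x) * ?g x \<partial>lborel) = Phi th L n t" for t by (auto simp: fourier_density_def)
  have "complex_of_real (integral\<^sup>L lborel ?g) = complex_of_real 1" using F[of 0] by (simp add: Phi_0)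
  then have g1: "integral\<^sup>L lborel ?g = 1" unfolding of_real_eq_iff .
  have gi: "integrable lborel ?g" "integrable lborel (\<lambda>x. x * ?g x)" using fd by (auto simp: fourier_density_def)
  have hc: "hn (complex_of_real th) L n t = char P t - (\<integral>x. iexp (t * x) * ?g x \<partial>lborel)" for t unfolding F ch hn_def ..
  have h0: "hn (complex_of_real th) L n 0 = 0" by (simp add: hn_def Phi_0 gs_def f_0)
  interpret S: smoothing_setup P ?g "hn th L n" "hn' th L n" B T K
    by (rule smoothing_setup.intro) (rule P gi g1 K hc T hn_deriv B hB h'B h0 | assumption)+
  show ?thesis using S.smoothing_bound[of x] unfolding S.H_def S.G_def cdfF_def .
qed

text \<open>The factors \<open>t\<^sup>2\<close> and \<open>\<bar>t\<bar>\<close> of the preceding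
  estimates cancel the divisions by \<open>t\<close>, so no singularity at 0 remains, and the
  exponential pays for the polynomial and for the integrable majorant.\<close>

lemma hn_near:
  fixes th :: real
  assumes th: "0 \<le> th" "th \<le> 1"
  obtains s0 D where "s0 > 0" "D \<ge> 0"
    "\<And>n t. n \<ge> 4 \<Longrightarrow> \<bar>t * dn n\<bar> \<le> s0 \<Longrightarrow> norm (hn th L n t / t) \<le> D * eps th L n / (1 + t\<^sup>2)"
    "\<And>n t. n \<ge> 4 \<Longrightarrow> \<bar>t * dn n\<bar> \<le> s0 \<Longrightarrow> norm (hn' th L n t / t - hn th L n t / t\<^sup>2) \<le> D * eps th L n / (1 + t\<^sup>2)"
proof -
  obtain s0 C where S: "s0 > 0" "C \<ge> 0"
    and b: "\<And>n t. n \<ge> 4 \<Longrightarrow> \<bar>t * dn n\<bar> \<le> s0 \<Longrightarrow> norm (hn th L n t) \<le> C * eps th L n * (t\<^sup>2 * (1 + \<bar>t\<bar>) ^ (2 * L + 8) * exp (- (c0 / 2) * \<bar>t\<bar> powr \<alpha>))"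
    and b': "\<And>n t. n \<ge> 4 \<Longrightarrow> \<bar>t * dn n\<bar> \<le> s0 \<Longrightarrow> norm (hn' th L n t) \<le> C * eps th L n * (\<bar>t\<bar> * (1 + \<bar>t\<bar>) ^ (2 * L + 8) * exp (- (c0 / 2) * \<bar>t\<bar> powr \<alpha>))"
    using hn_est[OF th, of L] by blast
  have "c0 / 2 > 0" using c0 by simp
  then obtain D where D: "D \<ge> 0" "\<And>t. (1 + \<bar>t\<bar>) ^ Suc (2 * L + 8) * exp (- (c0 / 2) * \<bar>t\<bar> powr \<alpha>) \<le> D / (1 + t\<^sup>2)"
    using poly_exp_powr_decay[of "c0 / 2" "Suc (2 * L + 8)"] by blast
  have main: "norm (hn th L n t / t) \<le> 2 * C * D * eps th L n / (1 + t\<^sup>2) \<and> norm (hn' th L n t / t - hn th L n t / t\<^sup>2) \<le> 2 * C * D * eps th L n / (1 + t\<^sup>2)"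
    if n: "n \<ge> 4" and t: "\<bar>t * dn n\<bar> \<le> s0" for n t
  proof -
    have e0: "eps th L n \<ge> 0" unfolding eps_def using del_le_1[of n] dn_le_1[of n] n th by (intro add_nonneg_nonneg) auto
    show ?thesis
    proof (cases "t = 0")
      \<comment> \<open>Division by 0 gives 0, so both left sides vanish.\<close>
      case True
      then show ?thesis using S D e0 by simp
    next
      case False
      define Q where "Q = (1 + \<bar>t\<bar>) ^ (2 * L + 8) * exp (- (c0 / 2) * \<bar>t\<bar> powr \<alpha>)"
      define U where "U = C * eps th L n"
      have U: "U \<ge> 0" "Q \<ge> 0" using S e0 by (auto simp: U_def Q_def)
      have "norm (hn th L n t) \<le> U * (t\<^sup>2 * Q)" "norm (hn' th L n t) \<le> U * (\<bar>t\<bar> * Q)"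
        using b[OF n t] b'[OF n t] by (auto simp: U_def Q_def mult.assoc)
      then have 1: "norm (hn th L n t) / t\<^sup>2 \<le> U * Q" "norm (hn' th L n t) / \<bar>t\<bar> \<le> U * Q"
        using False by (auto simp: field_simps)
      have "norm (hn th L n t / t) = \<bar>t\<bar> * (norm (hn th L n t) / t\<^sup>2)"
        using False by (simp add: norm_divide power2_eq_square abs_if)
      also have "\<dots> \<le> \<bar>t\<bar> * (U * Q)" by (intro mult_left_mono 1) simp
      finally have 2: "norm (hn th L n t / t) \<le> \<bar>t\<bar> * (U * Q)" .
      have "norm (hn' th L n t / t - hn th L n t / t\<^sup>2) \<le> norm (hn' th L n t / t) + norm (hn th L n t / t\<^sup>2)" by (rule norm_triangle_ineq4)
      also have "\<dots> = norm (hn' th L n t) / \<bar>t\<bar> + norm (hn th L n t) / t\<^sup>2" by (simp add: norm_divide norm_power)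
      also have "\<dots> \<le> 2 * (U * Q)" using 1 by linarith
      finally have 3: "norm (hn' th L n t / t - hn th L n t / t\<^sup>2) \<le> 2 * (U * Q)" .
      have "2 * (U * ((1 + \<bar>t\<bar>) * Q)) \<le> 2 * (U * (D / (1 + t\<^sup>2)))"
      proof -
        have "(1 + \<bar>t\<bar>) * Q \<le> D / (1 + t\<^sup>2)" using D(2)[of t] unfolding Q_def power_Suc by (simp only: mult.assoc)
        then show ?thesis using U(1) by (intro mult_left_mono) auto
      qed
      moreover have "\<bar>t\<bar> * (U * Q) \<le> 2 * (U * ((1 + \<bar>t\<bar>) * Q))" "2 * (U * Q) \<le> 2 * (U * ((1 + \<bar>t\<bar>) * Q))"
      proof -
        have "\<bar>t\<bar> * (U * Q) = U * (\<bar>t\<bar> * Q)" by simp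
        also have "\<dots> \<le> U * ((1 + \<bar>t\<bar>) * Q)" using U by (intro mult_left_mono mult_right_mono) auto
        also have "\<dots> \<le> 2 * \<dots>" using U by (simp add: mult_nonneg_nonneg)
        finally show "\<bar>t\<bar> * (U * Q) \<le> 2 * (U * ((1 + \<bar>t\<bar>) * Q))" .
        have "1 * Q \<le> (1 + \<bar>t\<bar>) * Q" using U by (intro mult_right_mono) auto
        then show "2 * (U * Q) \<le> 2 * (U * ((1 + \<bar>t\<bar>) * Q))" using U by (intro mult_left_mono) auto
      qed
      moreover have "2 * (U * (D / (1 + t\<^sup>2))) = 2 * C * D * eps th L n / (1 + t\<^sup>2)" by (simp add: U_def)
      ultimately show ?thesis using 2 3 by linarith
    qed
  qed
  show ?thesis by (rule that[of s0 "2 * C * D"]) (use S D main in auto)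
qed

text \<open>Each of the five summands is at most \<open>dn n\<close>. With \<open>L = l - 1\<close>
  the hypothesis is \<open>l * (2 - \<alpha>) >= 1\<close>, that is
  \<open>\<alpha> \<le> 2 - 1 / l\<close>; it is used for the power of \<open>del n\<close>.\<close>

lemma eps_0_le:
  assumes n: "n \<ge> 1" and L: "real (Suc L) * (2 - \<alpha>) \<ge> 1"
  shows "eps 0 L n \<le> 5 * dn n"
proof -
  note d = del_le_1[OF n] dn_le_1[OF n]
  have "(\<alpha> + 1) / \<alpha> \<le> kp / \<alpha>" using kp \<alpha> by (intro divide_right_mono) auto
  then have "1 - kp / \<alpha> \<le> - 1 / \<alpha>" using \<alpha> by (simp add: add_divide_distrib)
  then have 1: "real n powr (1 - kp / \<alpha>) \<le> dn n" unfolding dn_def using n by (intro powr_mono) auto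
  have "del n ^ Suc L = real n powr (real (Suc L) * (1 - 2 / \<alpha>))" using n unfolding del_def by (subst powr_power) auto
  moreover have "real (Suc L) * (1 - 2 / \<alpha>) \<le> - 1 / \<alpha>"
  proof -
    have "real (Suc L) * (1 - 2 / \<alpha>) = - (real (Suc L) * (2 - \<alpha>)) / \<alpha>" using \<alpha> by (simp add: field_simps)
    also have "\<dots> \<le> - 1 / \<alpha>" using L \<alpha> by (intro divide_right_mono) auto
    finally show ?thesis .
  qed
  ultimately have 2: "del n ^ Suc L \<le> dn n" unfolding dn_def using n by (auto intro!: powr_mono)
  have "dn n ^ 2 \<le> dn n" using power_decreasing[of 1 2 "dn n"] d by auto
  moreover have "del n * dn n \<le> dn n" using d mult_right_mono[of "del n" 1 "dn n"] by auto
  moreover have "(1 - 0) * dn n = dn n" by simp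
  ultimately show ?thesis unfolding eps_def using 1 2 by linarith
qed

lemma dn_tendsto: "dn \<longlonglongrightarrow> 0"
  unfolding dn_def[abs_def] using \<alpha> by (intro tendsto_neg_powr filterlim_real_sequentially) auto

lemma T_eventually: "A > 0 \<Longrightarrow> \<forall>\<^sub>F n in sequentially. 1 \<le> A / dn n"
  using order_tendstoD(2)[OF dn_tendsto, of A] eventually_ge_at_top[of 1]
  by (rule eventually_elim2) (use dn_le_1 in \<open>auto simp: field_simps\<close>)

end

section \<open>Rates of convergence\<close>

lemma power3_exp_tendsto_0: "c > 0 \<Longrightarrow> (\<lambda>n. real n ^ 3 * exp (- c * real n)) \<longlonglongrightarrow> 0"
  by real_asymp

text \<open>The ratio is rational, say \<open>a / b\<close> in lowest terms. Then
  \<open>b ^ k\<close> divides \<open>m 0 * a ^ k\<close>, hence \<open>m 0\<close>, for every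
  \<open>k\<close>; as a nonzero integer has only boundedly large divisors,
  \<open>b = 1\<close>.\<close>

lemma geometric_integers_ratio:
  fixes x :: real and m :: "nat \<Rightarrow> int"
  assumes x: "x > 0" and m: "\<And>k. real_of_int (m k) = real_of_int (m 0) * x ^ k" and m0: "m 0 \<noteq> 0"
  shows "x \<in> \<nat>"
proof -
  have "x = real_of_int (m 1) / real_of_int (m 0)" using m[of 1] m0 by simp
  then have "x \<in> \<rat>" by simp
  then obtain a b where ab: "b > 0" "coprime a b" "x = real_of_int a / real_of_int b" by (rule Rats_cases') blast
  have "b ^ k dvd m 0" for k
  proof -
    have "real_of_int (m k) * real_of_int b ^ k = real_of_int (m 0) * real_of_int a ^ k"
      using ab(1) unfolding m[of k] ab(3) by (simp add: power_divide)
    then have "real_of_int (m k * b ^ k) = real_of_int (m 0 * a ^ k)" by simp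
    then have "m k * b ^ k = m 0 * a ^ k" unfolding of_int_eq_iff .
    then have "b ^ k dvd m 0 * a ^ k" by (metis dvd_triv_right)
    moreover have "coprime (b ^ k) (a ^ k)" using ab(2) by (simp add: coprime_commute)
    ultimately show ?thesis by (simp add: coprime_dvd_mult_left_iff)
  qed
  then have le: "b ^ k \<le> \<bar>m 0\<bar>" for k using m0 by (intro zdvd_imp_le) auto
  have "b = 1"
  proof (rule ccontr)
    assume "b \<noteq> 1"
    then have "(2::int) ^ nat \<bar>m 0\<bar> \<le> b ^ nat \<bar>m 0\<bar>" using ab(1) by (intro power_mono) auto
    also have "\<dots> \<le> int (nat \<bar>m 0\<bar>)" using le[of "nat \<bar>m 0\<bar>"] by simp
    finally have "(2::nat) ^ nat \<bar>m 0\<bar> \<le> nat \<bar>m 0\<bar>" by (metis of_nat_le_iff of_nat_numeral of_nat_power)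
    then show False using less_exp[of "nat \<bar>m 0\<bar>"] by linarith
  qed
  then have "x = real_of_int a" using ab by simp
  moreover then have "a \<ge> 0" using x by simp
  ultimately show ?thesis by (metis nonneg_int_cases of_int_of_nat_eq of_nat_in_Nats)
qed

context stp begin

text \<open>If \<open>norm (f s) = 1\<close>, all \<open>iexp (s * rho ^ k)\<close> agree, so \<open>s rho\<^sup>k (rho - 1)\<close> is a multiple of \<open>2 pi\<close> for all
  \<open>k \<ge> 1\<close>: a geometric progression of integers.\<close>
lemma norm_f_less_1:
  assumes nl: "rho \<notin> \<nat>" and s: "s \<noteq> 0"
  shows "norm (f s) < 1"
proof (rule ccontr)
  assume "\<not> norm (f s) < 1"
  then have n1: "norm (f s) = 1" using norm_f[of s] by linarith
  define z where "z k = cnj (f s) * iexp (s * rho ^ Suc k)" for k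
  have nz: "norm (z k) = 1" for k unfolding z_def norm_mult norm_iexp using n1 by simp
  have fs: "f s * cnj (f s) = 1" using n1 complex_norm_square[of "f s"] by simp
  have sf: "(\<lambda>k. iexp (s * rho ^ Suc k) * Wf k) sums f s"
    unfolding f_def by (rule summable_sums[OF summable_norm_cancel[OF f_summable]])
  \<comment> \<open>The average of \<open>Re (z k)\<close> with the weights \<open>Wf k\<close>
    equals 1, while every term is at most 1; hence all terms are 1.\<close>
  have "(\<lambda>k. Re (cnj (f s) * (iexp (s * rho ^ Suc k) * Wf k))) sums Re (cnj (f s) * f s)"
    by (intro sums_Re sums_mult sf)
  then have "(\<lambda>k. Re (z k) * Wf k) sums 1" using fs unfolding z_def mult.assoc[symmetric] by (simp add: mult.commute)
  from sums_diff[OF Wf(2) this] have "(\<lambda>k. Wf k * (1 - Re (z k))) sums 0" by (simp add: algebra_simps)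
  then have sm: "summable (\<lambda>k. Wf k * (1 - Re (z k)))" "(\<Sum>k. Wf k * (1 - Re (z k))) = 0" by (auto simp: sums_iff)
  have nn: "0 \<le> Wf k * (1 - Re (z k))" for k
    using Wf(1)[of k] complex_Re_le_cmod[of "z k"] nz[of k] by simp
  have "Wf k * (1 - Re (z k)) = 0" for k
    using suminf_eq_zero_iff[OF sm(1)] nn sm(2) by auto
  then have Rz: "Re (z k) = 1" for k using Wf(1)[of k] by (metis mult_eq_0_iff less_irrefl eq_iff_diff_eq_0)
  have z1: "z k = 1" for k
  proof -
    have "(Re (z k))\<^sup>2 + (Im (z k))\<^sup>2 = 1" using nz[of k] cmod_power2[of "z k"] by simp
    then show ?thesis using Rz[of k] by (simp add: complex_eq_iff)
  qed
  have e: "iexp (s * rho ^ Suc k) = f s" for k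
  proof -
    have "f s * (cnj (f s) * iexp (s * rho ^ Suc k)) = f s" using z1[of k] by (simp add: z_def)
    then show ?thesis unfolding mult.assoc[symmetric] fs by simp
  qed
  have "\<exists>m::int. s * (rho * (rho - 1)) * rho ^ k = real_of_int m * (2 * pi)" for k
  proof -
    have "s * rho ^ Suc (Suc k) = s * (rho * (rho - 1)) * rho ^ k + s * rho ^ Suc k" by (simp add: algebra_simps)
    then have "iexp (s * rho ^ Suc (Suc k)) = iexp (s * (rho * (rho - 1)) * rho ^ k) * iexp (s * rho ^ Suc k)"
      by (simp only: of_real_add distrib_left exp_add)
    then have "f s = iexp (s * (rho * (rho - 1)) * rho ^ k) * f s" unfolding e .
    then have "iexp (s * (rho * (rho - 1)) * rho ^ k) = 1" using n1 by auto
    then obtain m :: int where "Im (\<i> * complex_of_real (s * (rho * (rho - 1)) * rho ^ k)) = of_int (2 * m) * pi"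
      unfolding exp_eq_1 by blast
    then show ?thesis by (intro exI[of _ m]) (simp only: Im_i_times Re_complex_of_real of_int_mult of_int_numeral mult_ac)
  qed
  then obtain m :: "nat \<Rightarrow> int" where m: "s * (rho * (rho - 1)) * rho ^ k = real_of_int (m k) * (2 * pi)" for k by metis
  have mk: "real_of_int (m k) = real_of_int (m 0) * rho ^ k" for k
  proof -
    have "real_of_int (m k) * (2 * pi) = (real_of_int (m 0) * rho ^ k) * (2 * pi)"
      using m[of k] m[of 0] by simp
    then show ?thesis by (subst (asm) mult_right_cancel) auto
  qed
  have "m 0 \<noteq> 0" using m[of 0] s rho by auto
  with nl show False using geometric_integers_ratio[OF rho(2), of m, OF mk] by blast
qed

text \<open>Compactness turns the strict inequality away from 0 into a uniform gap. The interval up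
  to \<open>A\<close> is what allows an arbitrarily large multiple of \<open>1 / dn n\<close> as
  cut-off.\<close>

lemma norm_f_bound_annulus:
  assumes nl: "rho \<notin> \<nat>" and s0: "s0 > 0"
  obtains \<eta> where "0 < \<eta>" "\<eta> < 1" "\<And>s. s0 \<le> \<bar>s\<bar> \<Longrightarrow> \<bar>s\<bar> \<le> A \<Longrightarrow> norm (f s) \<le> \<eta>"
proof -
  \<comment> \<open>The maximum keeps the set nonempty when \<open>A < s0\<close>.\<close>
  define S where "S = {s0..max s0 A} \<union> {- max s0 A..- s0}"
  have "compact S" "S \<noteq> {}" by (auto simp: S_def)
  moreover have "continuous_on S (\<lambda>s. norm (f s))"
    using has_vector_derivative_continuous[OF f_deriv] by (intro continuous_on_norm) (auto simp: continuous_at_imp_continuous_on)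
  ultimately obtain u where u: "u \<in> S" "\<And>s. s \<in> S \<Longrightarrow> norm (f s) \<le> norm (f u)" using continuous_attains_sup by meson
  have "u \<noteq> 0" using u(1) s0 by (auto simp: S_def)
  with norm_f_less_1[OF nl] have "norm (f u) < 1" by blast
  then show ?thesis
    \<comment> \<open>The lower limit \<open>1/2\<close> keeps the bound positive, since its
      logarithm is taken later.\<close>
    by (intro that[of "max (1/2) (norm (f u))"]) (auto intro!: max.coboundedI2 u(2) simp: S_def abs_if split: if_splits)
qed

text \<open>Cut-off \<open>T = s0 / dn n\<close>: the whole interval lies in the range of the
  expansion, and the smoothing error \<open>K / T\<close> is already of the order
  \<open>dn n\<close>.\<close>

lemma rate_O:
  assumes L: "real (Suc L) * (2 - \<alpha>) \<ge> 1"
    and P: "\<And>n. real_distribution (P n)" "\<And>n. integrable (P n) (\<lambda>x. x)" and ch: "\<And>n t. char (P n) t = gs (t * dn n) ^ n"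
  shows "\<exists>C. \<forall>\<^sub>F n in sequentially. \<forall>x. (1 + \<bar>x\<bar>) * \<bar>cdf (P n) x - cdfF (Phi (complex_of_real 0) L n) x\<bar> \<le> C * dn n"
proof -
  have th: "(0::real) \<le> 0" "(0::real) \<le> 1" by auto
  obtain s0 D where S: "s0 > 0" "D \<ge> 0"
    and b: "\<And>n t. n \<ge> 4 \<Longrightarrow> \<bar>t * dn n\<bar> \<le> s0 \<Longrightarrow> norm (hn (complex_of_real 0) L n t / t) \<le> D * eps 0 L n / (1 + t\<^sup>2)"
    "\<And>n t. n \<ge> 4 \<Longrightarrow> \<bar>t * dn n\<bar> \<le> s0 \<Longrightarrow> norm (hn' (complex_of_real 0) L n t / t - hn (complex_of_real 0) L n t / t\<^sup>2) \<le> D * eps 0 L n / (1 + t\<^sup>2)"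
    using hn_near[OF th, of L] by blast
  obtain K where K: "K \<ge> 0" "\<And>n x. n \<ge> 1 \<Longrightarrow> (1 + \<bar>x\<bar>) * \<bar>Re (invF (Phi (complex_of_real 0) L n) x)\<bar> \<le> K"
    using Phi_density_bound[OF th, of L] by blast
  \<comment> \<open>The 5 comes from \<open>eps_0_le\<close>, \<open>pi\<close> from integrating
    \<open>1 / (1 + t\<^sup>2)\<close>, and \<open>K / s0\<close> from the cut-off.\<close>
  define C where "C = smooth_const * (D * 5 * pi + K / s0)"
  have "\<forall>\<^sub>F n in sequentially. 4 \<le> n \<and> 1 \<le> s0 / dn n" using T_eventually[OF S(1)] eventually_ge_at_top[of 4] by eventually_elim auto
  then have "\<forall>\<^sub>F n in sequentially. \<forall>x. (1 + \<bar>x\<bar>) * \<bar>cdf (P n) x - cdfF (Phi (complex_of_real 0) L n) x\<bar> \<le> C * dn n"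
  proof (rule eventually_mono, intro allI)
    fix n x assume n: "4 \<le> n \<and> 1 \<le> s0 / dn n"
    then have n1: "n \<ge> 1" by simp
    note d = dn_le_1[OF n1]
    have e: "0 \<le> eps 0 L n" unfolding eps_def using d del_le_1[OF n1] by (intro add_nonneg_nonneg) auto
    have T: "\<bar>t * dn n\<bar> \<le> s0" if "\<bar>t\<bar> \<le> s0 / dn n" for t using that d by (simp add: abs_mult pos_le_divide_eq)
    have T0: "0 \<le> s0 / dn n" using S d by simp
    have DE: "0 \<le> D * eps 0 L n" using S e by simp
    let ?B = "\<lambda>t. D * eps 0 L n / (1 + t\<^sup>2)"
    have "(1 + \<bar>x\<bar>) * \<bar>cdf (P n) x - cdfF (Phi (complex_of_real 0) L n) x\<bar> \<le> smooth_const * (integral {- (s0 / dn n)..s0 / dn n} ?B + K / (s0 / dn n))"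
      by (rule smoothing_application[OF P ch n1 K(2)[OF n1] conjunct2[OF n] arctan_integral(1)[OF T0] b[OF conjunct1[OF n] T]])
    also have "\<dots> \<le> smooth_const * (D * eps 0 L n * pi + K / s0 * dn n)"
      using arctan_integral(2)[OF T0 DE] by (intro mult_left_mono smooth_const_nonneg add_mono) auto
    also have "\<dots> \<le> smooth_const * (D * (5 * dn n) * pi + K / s0 * dn n)"
      using eps_0_le[OF n1 L] S K(1) by (intro mult_left_mono smooth_const_nonneg add_mono mult_right_mono) auto
    finally show "(1 + \<bar>x\<bar>) * \<bar>cdf (P n) x - cdfF (Phi (complex_of_real 0) L n) x\<bar> \<le> C * dn n" by (simp add: C_def algebra_simps)
  qed
  then show ?thesis by blast
qed

text \<open>For \<open>th = 1\<close> the last summand of \<open>eps\<close> vanishes. The power of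
  \<open>del n\<close> is of smaller order than \<open>dn n\<close> because the inequality for
  \<open>L\<close> is strict.\<close>

lemma eps_1_tendsto:
  assumes L: "real (Suc L) * (2 - \<alpha>) > 1"
  shows "(\<lambda>n. eps 1 L n / dn n) \<longlonglongrightarrow> 0"
proof -
  define b1 where "b1 = 1 - kp / \<alpha> + 1 / \<alpha>"
  define b2 where "b2 = real (Suc L) * (1 - 2 / \<alpha>) + 1 / \<alpha>"
  have "(\<alpha> + 1) / \<alpha> < kp / \<alpha>" using kp \<alpha> by (intro divide_strict_right_mono) auto
  then have b1: "b1 < 0" using \<alpha> by (simp add: b1_def add_divide_distrib)
  have "b2 = (1 - real (Suc L) * (2 - \<alpha>)) / \<alpha>" using \<alpha> by (simp add: b2_def field_simps)
  then have b2: "b2 < 0" using L \<alpha> by (simp add: divide_neg_pos)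
  have "1 - 2 / \<alpha> < 0" using \<alpha> by (simp add: field_simps)
  then have del: "del \<longlonglongrightarrow> 0" unfolding del_def[abs_def] by (intro tendsto_neg_powr filterlim_real_sequentially)
  have "(\<lambda>n. real n powr b1 + real n powr b2 + dn n + del n) \<longlonglongrightarrow> 0 + 0 + 0 + 0"
    using b1 b2 by (intro tendsto_add tendsto_neg_powr filterlim_real_sequentially dn_tendsto del)
  moreover have "\<forall>\<^sub>F n in sequentially. real n powr b1 + real n powr b2 + dn n + del n = eps 1 L n / dn n"
    using eventually_ge_at_top[of 1]
  proof eventually_elim
    case (elim n)
    note d = dn_le_1[OF elim]
    have i: "1 / dn n = real n powr (1 / \<alpha>)" unfolding dn_def by (simp add: powr_minus_divide)
    have "real n powr b1 = real n powr (1 - kp / \<alpha>) * (1 / dn n)" unfolding i b1_def powr_add ..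
    moreover have "real n powr b2 = del n ^ Suc L * (1 / dn n)"
      using elim unfolding i b2_def powr_add del_def by (subst powr_power) auto
    ultimately show ?case using d by (simp add: eps_def add_divide_distrib power2_eq_square)
  qed
  ultimately show ?thesis by (simp add: filterlim_cong[OF refl refl])
qed

text \<open>Between \<open>s0\<close> and \<open>A\<close> the expansion is no longer available, but
  both terms of the difference are exponentially small in \<open>n\<close>: the power of
  \<open>gs\<close> by the gap below 1, and \<open>Phi\<close> by its decay in \<open>t\<close>,
  which is large there.\<close>

lemma hn_far:
  fixes th :: real
  assumes th: "0 \<le> th" "th \<le> 1" and nl: "rho \<notin> \<nat>" and s0: "s0 > 0"
  obtains c D W where "c > 0" "D \<ge> 0" "W \<ge> 0"
    "\<And>n t. n \<ge> 1 \<Longrightarrow> 1 \<le> s0 / dn n \<Longrightarrow> s0 \<le> \<bar>t * dn n\<bar> \<Longrightarrow> \<bar>t * dn n\<bar> \<le> A \<Longrightarrow>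
       norm (hn th L n t / t) \<le> D * exp (- c * real n) / (1 + t\<^sup>2) + W * real n * exp (- c * real n) \<and>
       norm (hn' th L n t / t - hn th L n t / t\<^sup>2) \<le> D * exp (- c * real n) / (1 + t\<^sup>2) + W * real n * exp (- c * real n)"
proof -
  obtain \<eta> where e: "0 < \<eta>" "\<eta> < 1" "\<And>s. s0 \<le> \<bar>s\<bar> \<Longrightarrow> \<bar>s\<bar> \<le> A \<Longrightarrow> norm (f s) \<le> \<eta>"
    using norm_f_bound_annulus[OF nl s0, of A] by blast
  obtain C where C: "C \<ge> 0" 
    and b: "\<And>n t. n \<ge> 1 \<Longrightarrow> norm (Phi th L n t) \<le> C * (1 + \<bar>t\<bar>) ^ (2 * L + 6) * exp (- cY * \<bar>t\<bar> powr \<alpha>)"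
    "\<And>n t. n \<ge> 1 \<Longrightarrow> norm (Phi' th L n t) \<le> C * (1 + \<bar>t\<bar>) ^ (2 * L + 6) * exp (- cY * \<bar>t\<bar> powr \<alpha>)"
    using Phi_bounds[OF th, of L] by blast
  have cY2: "cY / 2 > 0" using cY by simp
  obtain D where D: "D \<ge> 0" "\<And>t. (1 + \<bar>t\<bar>) ^ (2 * L + 6) * exp (- (cY / 2) * \<bar>t\<bar> powr \<alpha>) \<le> D / (1 + t\<^sup>2)"
    using poly_exp_powr_decay[OF cY2, of "2 * L + 6"] by blast
  \<comment> \<open>First entry: \<open>\<bar>t\<bar> powr \<alpha>\<close> is at least
    \<open>n * s0 powr \<alpha>\<close>, and half of the rate \<open>cY\<close> is reserved for the
    integrable factor. Second entry: \<open>\<eta> ^ n\<close> written as an exponential.\<close>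
  define c where "c = min (cY / 2 * s0 powr \<alpha>) (- ln \<eta>)"
  \<comment> \<open>The 1 stands for the power of \<open>gs\<close>; the other summand for its
    derivative, with \<open>norm (gd s) \<le> 2 * mu1\<close> and one power of \<open>\<eta>\<close>
    missing.\<close>
  define W where "W = 1 + 2 * mu1 / \<eta>"
  have c: "c > 0" using cY s0 e by (simp add: c_def)
  have W: "W \<ge> 0" using mu1(2) e by (simp add: W_def)
  have main: "norm (hn th L n t / t) \<le> 2 * C * D * exp (- c * real n) / (1 + t\<^sup>2) + W * real n * exp (- c * real n) \<and>
       norm (hn' th L n t / t - hn th L n t / t\<^sup>2) \<le> 2 * C * D * exp (- c * real n) / (1 + t\<^sup>2) + W * real n * exp (- c * real n)"
    if n: "n \<ge> 1" and d1: "1 \<le> s0 / dn n" and t: "s0 \<le> \<bar>t * dn n\<bar>" "\<bar>t * dn n\<bar> \<le> A" for n t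
  proof -
    define E where "E = exp (- c * real n)"
    note d = dn_le_1[OF n]
    have E0: "E \<ge> 0" by (simp add: E_def)
    have "s0 \<le> \<bar>t\<bar> * dn n" using t(1) d by (simp add: abs_mult)
    then have "s0 / dn n \<le> \<bar>t\<bar>" using d by (simp add: pos_divide_le_eq)
    then have t1: "1 \<le> \<bar>t\<bar>" using d1 by linarith
    have ta: "\<bar>t\<bar> powr \<alpha> = real n * \<bar>t * dn n\<bar> powr \<alpha>" using dn_pow[OF n, of t \<alpha>] \<alpha> n by simp
    have "s0 powr \<alpha> \<le> \<bar>t * dn n\<bar> powr \<alpha>" using t s0 \<alpha> by (intro powr_mono2) auto
    then have "cY / 2 * (real n * s0 powr \<alpha>) \<le> cY / 2 * \<bar>t\<bar> powr \<alpha>" unfolding ta using cY by (intro mult_left_mono) auto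
    moreover have "c * real n \<le> cY / 2 * s0 powr \<alpha> * real n" by (intro mult_right_mono) (auto simp: c_def)
    ultimately have ce: "exp (- (cY / 2) * \<bar>t\<bar> powr \<alpha>) \<le> E" unfolding E_def by (simp add: mult_ac)
    define Q where "Q = (1 + \<bar>t\<bar>) ^ (2 * L + 6) * exp (- (cY / 2) * \<bar>t\<bar> powr \<alpha>)"
    have "exp (- cY * \<bar>t\<bar> powr \<alpha>) = exp (- (cY / 2) * \<bar>t\<bar> powr \<alpha>) * exp (- (cY / 2) * \<bar>t\<bar> powr \<alpha>)"
      unfolding exp_add[symmetric] by simp
    then have "C * (1 + \<bar>t\<bar>) ^ (2 * L + 6) * exp (- cY * \<bar>t\<bar> powr \<alpha>) = C * (Q * exp (- (cY / 2) * \<bar>t\<bar> powr \<alpha>))"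
      unfolding Q_def by (simp only: mult_ac)
    also have "\<dots> \<le> C * (D / (1 + t\<^sup>2) * E)" using D(2)[of t] ce C D(1) unfolding Q_def by (intro mult_left_mono mult_mono) auto
    also have "\<dots> = C * D * E / (1 + t\<^sup>2)" by simp
    finally have PQ: "norm (Phi th L n t) \<le> C * D * E / (1 + t\<^sup>2)" "norm (Phi' th L n t) \<le> C * D * E / (1 + t\<^sup>2)"
      using b[OF n, of t] by linarith+
    have g: "norm (gs (t * dn n)) \<le> \<eta>" using e(3)[OF t] norm_gs by simp
    have "\<eta> ^ n = exp (real n * ln \<eta>)" using e(1) by (simp add: exp_of_nat_mult)
    also have "\<dots> \<le> E" unfolding E_def using mult_left_mono[of c "- ln \<eta>" "real n"] by (simp add: c_def mult.commute)
    finally have eE: "\<eta> ^ n \<le> E" .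
    have G: "norm (gs (t * dn n) ^ n) \<le> E"
      unfolding norm_power using power_mono[OF g, of n] eE by simp
    have "\<eta> ^ (n - 1) = \<eta> ^ n / \<eta>" using e(1) n by (simp add: power_diff)
    then have eE': "\<eta> ^ (n - 1) \<le> E / \<eta>" using eE e(1) by (simp add: divide_right_mono)
    have "norm (of_nat n * dn n * gs (t * dn n) ^ (n - 1) * gd (t * dn n)) = real n * dn n * norm (gs (t * dn n)) ^ (n - 1) * norm (gd (t * dn n))"
      using d by (simp add: norm_mult norm_power)
    also have "\<dots> \<le> real n * 1 * (E / \<eta>) * (2 * mu1)"
      using d norm_gd[of "t * dn n"] power_mono[OF g, of "n - 1"] eE' E0 e(1)
      by (intro mult_mono mult_nonneg_nonneg) auto
    finally have G': "norm (of_nat n * dn n * gs (t * dn n) ^ (n - 1) * gd (t * dn n)) \<le> real n * E * (2 * mu1 / \<eta>)" by (simp add: mult_ac)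
    have n1: "E \<le> real n * E" using n E0 mult_right_mono[of 1 "real n" E] by simp
    have We: "W * real n * E = real n * E + real n * E * (2 * mu1 / \<eta>)" by (simp add: W_def algebra_simps)
    have h: "norm (hn th L n t) \<le> real n * E + C * D * E / (1 + t\<^sup>2)"
      unfolding hn_def using norm_triangle_ineq4[of "gs (t * dn n) ^ n" "Phi th L n t"] G PQ n1 by linarith
    have h': "norm (hn' th L n t) \<le> real n * E * (2 * mu1 / \<eta>) + C * D * E / (1 + t\<^sup>2)"
      unfolding hn'_def using norm_triangle_ineq4[of "of_nat n * dn n * gs (t * dn n) ^ (n - 1) * gd (t * dn n)" "Phi' th L n t"] G' PQ by linarith
    have dv: "norm (z / complex_of_real t) \<le> norm z" "norm (z / (complex_of_real (t\<^sup>2))) \<le> norm z" for z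
    proof -
      have "1 \<le> \<bar>t\<bar> ^ 2" using t1 by (rule one_le_power)
      then have "1 \<le> t\<^sup>2" by simp
      then show "norm (z / complex_of_real t) \<le> norm z" "norm (z / (complex_of_real (t\<^sup>2))) \<le> norm z"
        using t1 divide_left_mono[of 1 "\<bar>t\<bar>" "norm z"] divide_left_mono[of 1 "t\<^sup>2" "norm z"]
        unfolding norm_divide norm_of_real by auto
    qed
    have X: "C * D * E / (1 + t\<^sup>2) + C * D * E / (1 + t\<^sup>2) = 2 * C * D * E / (1 + t\<^sup>2)" by simp
    have pos: "0 \<le> C * D * E / (1 + t\<^sup>2)" "0 \<le> real n * E * (2 * mu1 / \<eta>)" using C D(1) E0 e(1) mu1(2) by auto
    have "norm (hn th L n t / t) \<le> 2 * C * D * E / (1 + t\<^sup>2) + W * real n * E"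
      using dv(1)[of "hn th L n t"] h pos X We by linarith
    moreover have "norm (hn' th L n t / t - hn th L n t / t\<^sup>2) \<le> 2 * C * D * E / (1 + t\<^sup>2) + W * real n * E"
      using norm_triangle_ineq4[of "hn' th L n t / t" "hn th L n t / t\<^sup>2"] dv(1)[of "hn' th L n t"] dv(2)[of "hn th L n t"] h h' X We by linarith
    ultimately show ?thesis unfolding E_def by blast
  qed
  have CD: "0 \<le> 2 * C * D" using C D(1) by simp
  show ?thesis by (rule that[OF c CD W main])
qed

text \<open>Cut-off \<open>T = A / dn n\<close> with \<open>A\<close> depending on \<open>e\<close>,
  so that the smoothing error \<open>K / T\<close> becomes an arbitrarily small multiple of
  \<open>dn n\<close>. The interval is divided at \<open>s0\<close>: the expansion applies inside,
  the exponential bound outside.\<close>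

lemma rate_o:
  assumes L: "real (Suc L) * (2 - \<alpha>) > 1" and nl: "rho \<notin> \<nat>" and ep: "e > 0"
    and P: "\<And>n. real_distribution (P n)" "\<And>n. integrable (P n) (\<lambda>x. x)" and ch: "\<And>n t. char (P n) t = gs (t * dn n) ^ n"
  shows "\<forall>\<^sub>F n in sequentially. \<forall>x. (1 + \<bar>x\<bar>) * \<bar>cdf (P n) x - cdfF (Phi (complex_of_real 1) L n) x\<bar> \<le> e * dn n"
proof -
  have th: "(0::real) \<le> 1" "(1::real) \<le> 1" by auto
  let ?h = "hn (complex_of_real 1) L" and ?h' = "hn' (complex_of_real 1) L"
  obtain s0 D where S: "s0 > 0" "D \<ge> 0"
    and b: "\<And>n t. n \<ge> 4 \<Longrightarrow> \<bar>t * dn n\<bar> \<le> s0 \<Longrightarrow> norm (?h n t / t) \<le> D * eps 1 L n / (1 + t\<^sup>2)"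
    "\<And>n t. n \<ge> 4 \<Longrightarrow> \<bar>t * dn n\<bar> \<le> s0 \<Longrightarrow> norm (?h' n t / t - ?h n t / t\<^sup>2) \<le> D * eps 1 L n / (1 + t\<^sup>2)"
    using hn_near[OF th, of L] by blast
  obtain K where K: "K \<ge> 0" "\<And>n x. n \<ge> 1 \<Longrightarrow> (1 + \<bar>x\<bar>) * \<bar>Re (invF (Phi (complex_of_real 1) L n) x)\<bar> \<le> K"
    using Phi_density_bound[OF th, of L] by blast
  \<comment> \<open>Chosen so that the smoothing error uses up at most half of \<open>e\<close>; the
    added 1 makes it positive even if \<open>K\<close> is 0.\<close>
  define A where "A = 1 + 2 * smooth_const * K / e"
  have A: "A > 0" "smooth_const * (K / A) \<le> e / 2"
  proof -
    have "0 \<le> 2 * smooth_const * K / e" using smooth_const_nonneg K(1) ep by simp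
    then show "A > 0" by (simp add: A_def)
    moreover have "2 * smooth_const * K \<le> e * A" using ep by (simp add: A_def distrib_left)
    ultimately show "smooth_const * (K / A) \<le> e / 2" by (simp add: field_simps)
  qed
  obtain c D' W where c: "c > 0" "D' \<ge> 0" "W \<ge> 0"
    and far: "\<And>n t. n \<ge> 1 \<Longrightarrow> 1 \<le> s0 / dn n \<Longrightarrow> s0 \<le> \<bar>t * dn n\<bar> \<Longrightarrow> \<bar>t * dn n\<bar> \<le> A \<Longrightarrow>
       norm (?h n t / t) \<le> D' * exp (- c * real n) / (1 + t\<^sup>2) + W * real n * exp (- c * real n) \<and>
       norm (?h' n t / t - ?h n t / t\<^sup>2) \<le> D' * exp (- c * real n) / (1 + t\<^sup>2) + W * real n * exp (- c * real n)"
    using hn_far[OF th nl S(1), of A L] by blast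
  \<comment> \<open>The integral part of the bound divided by \<open>dn n\<close>. The cube of
    \<open>n\<close> absorbs the length of the interval, the factor \<open>n\<close> of the
    derivative and the division by \<open>dn n\<close>, using
    \<open>1 / dn n \<le> n\<close>.\<close>
  define R where "R n = smooth_const * (D * pi * (eps 1 L n / dn n) + (D' * pi + 2 * A * W) * (real n ^ 3 * exp (- c * real n)))" for n
  have "R \<longlonglongrightarrow> smooth_const * (D * pi * 0 + (D' * pi + 2 * A * W) * 0)"
    unfolding R_def[abs_def] by (intro tendsto_intros eps_1_tendsto[OF L] power3_exp_tendsto_0[OF c(1)])
  then have "\<forall>\<^sub>F n in sequentially. R n < e / 2" using ep by (intro order_tendstoD) auto
  then have "\<forall>\<^sub>F n in sequentially. (4 \<le> n \<and> R n < e / 2) \<and> 1 \<le> s0 / dn n \<and> 1 \<le> A / dn n"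
    using T_eventually[OF S(1)] T_eventually[OF A(1)] eventually_ge_at_top[of 4] by eventually_elim auto
  then show ?thesis
  proof (rule eventually_mono, intro allI)
    fix n x assume N: "(4 \<le> n \<and> R n < e / 2) \<and> 1 \<le> s0 / dn n \<and> 1 \<le> A / dn n"
    then have n4: "4 \<le> n" and n1: "n \<ge> 1" and T1: "1 \<le> A / dn n" and s1: "1 \<le> s0 / dn n" and Rn: "R n < e / 2" by auto
    note d = dn_le_1[OF n1]
    define E where "E = exp (- c * real n)"
    define V where "V = D * eps 1 L n + D' * E"
    define U where "U = W * real n * E"
    have e0: "0 \<le> eps 1 L n" unfolding eps_def using d del_le_1[OF n1] by (intro add_nonneg_nonneg) auto
    have VU: "0 \<le> D * eps 1 L n" "0 \<le> D' * E" "0 \<le> V" "0 \<le> U" using S c e0 by (auto simp: V_def U_def E_def)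
    have T0: "0 \<le> A / dn n" using T1 by simp
    define B where "B t = V / (1 + t\<^sup>2) + U" for t :: real
    have BI: "B integrable_on {-(A / dn n)..A / dn n}" unfolding B_def
      by (intro integrable_add arctan_integral(1)[OF T0] integrable_const_ivl)
    have "integral {-(A / dn n)..A / dn n} B = integral {-(A / dn n)..A / dn n} (\<lambda>t. V / (1 + t\<^sup>2)) + integral {-(A / dn n)..A / dn n} (\<lambda>t. U)"
      unfolding B_def by (intro Henstock_Kurzweil_Integration.integral_add arctan_integral(1)[OF T0] integrable_const_ivl)
    also have "\<dots> \<le> V * pi + 2 * (A / dn n) * U" using arctan_integral(2)[OF T0 VU(3)] T0 by simp
    finally have IB: "integral {-(A / dn n)..A / dn n} B \<le> V * pi + 2 * (A / dn n) * U" .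
    have bd: "norm (?h n t / t) \<le> B t \<and> norm (?h' n t / t - ?h n t / t\<^sup>2) \<le> B t" if t: "\<bar>t\<bar> \<le> A / dn n" for t
    proof (cases "\<bar>t * dn n\<bar> \<le> s0")
      case True
      have "D * eps 1 L n / (1 + t\<^sup>2) \<le> V / (1 + t\<^sup>2)" using VU by (intro divide_right_mono) (auto simp: V_def)
      then have "D * eps 1 L n / (1 + t\<^sup>2) \<le> B t" using VU(4) unfolding B_def by linarith
      then show ?thesis using b[OF n4 True] by linarith
    next
      case False
      have "D' * E / (1 + t\<^sup>2) \<le> V / (1 + t\<^sup>2)" using VU by (intro divide_right_mono) (auto simp: V_def)
      then have "D' * E / (1 + t\<^sup>2) + U \<le> B t" unfolding B_def by linarith
      moreover have "\<bar>t * dn n\<bar> \<le> A" using t d by (simp add: abs_mult pos_le_divide_eq)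
      then have "norm (?h n t / t) \<le> D' * E / (1 + t\<^sup>2) + U \<and> norm (?h' n t / t - ?h n t / t\<^sup>2) \<le> D' * E / (1 + t\<^sup>2) + U"
        using far[OF n1 s1, of t] False unfolding E_def U_def by simp
      ultimately show ?thesis by linarith
    qed
    have "(1 + \<bar>x\<bar>) * \<bar>cdf (P n) x - cdfF (Phi (complex_of_real 1) L n) x\<bar> \<le> smooth_const * (integral {-(A / dn n)..A / dn n} B + K / (A / dn n))"
      by (rule smoothing_application[OF P ch n1 K(2)[OF n1] T1 BI conjunct1[OF bd] conjunct2[OF bd]])
    also have "\<dots> \<le> smooth_const * (V * pi + 2 * (A / dn n) * U + K / (A / dn n))"
      using IB by (intro mult_left_mono smooth_const_nonneg) auto
    also have "\<dots> \<le> R n * dn n + e / 2 * dn n"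
    proof -
      have "1 / dn n = real n powr (1 / \<alpha>)" unfolding dn_def by (simp add: powr_minus_divide)
      also have "\<dots> \<le> real n powr 1" using \<alpha> n1 by (intro powr_mono) auto
      finally have nd: "1 / dn n \<le> real n" using n1 by simp
      then have nd1: "1 \<le> real n * dn n" using d by (simp add: pos_divide_le_eq)
      have E0: "0 \<le> E" by (simp add: E_def)
      have n2: "real n \<le> real n ^ 3" "real n ^ 2 \<le> real n ^ 3" using power_increasing[of 1 3 "real n"] power_increasing[of 2 3 "real n"] n1 by auto
      have "E * 1 \<le> E * (real n * dn n)" using nd1 E0 by (intro mult_left_mono)
      also have "\<dots> \<le> E * (real n ^ 3 * dn n)" using n2 d E0 by (intro mult_left_mono mult_right_mono) auto
      finally have e1: "E \<le> E * (real n ^ 3 * dn n)" by simp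
      have "1 / dn n * real n * E \<le> real n * real n * E" using nd E0 by (intro mult_right_mono) auto
      also have "\<dots> = real n ^ 2 * (E * 1)" by (simp add: power2_eq_square)
      also have "\<dots> \<le> real n ^ 2 * (E * (real n * dn n))" using nd1 E0 by (intro mult_left_mono) auto
      also have "\<dots> = E * (real n ^ 3 * dn n)" by (simp add: power2_eq_square power3_eq_cube)
      finally have e2: "1 / dn n * real n * E \<le> E * (real n ^ 3 * dn n)" .
      have "V * pi + 2 * (A / dn n) * U = D * pi * (eps 1 L n / dn n) * dn n + D' * pi * E + 2 * A * W * (1 / dn n * real n * E)"
        using d by (simp add: V_def U_def algebra_simps)
      also have "\<dots> \<le> D * pi * (eps 1 L n / dn n) * dn n + D' * pi * (E * (real n ^ 3 * dn n)) + 2 * A * W * (E * (real n ^ 3 * dn n))"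
        using e1 e2 c A by (intro add_mono mult_left_mono order_refl) auto
      also have "\<dots> = (D * pi * (eps 1 L n / dn n) + (D' * pi + 2 * A * W) * (real n ^ 3 * E)) * dn n"
        by (simp only: distrib_right distrib_left mult_ac)
      finally have "smooth_const * (V * pi + 2 * (A / dn n) * U) \<le> R n * dn n"
        unfolding R_def E_def[symmetric] mult.assoc[of smooth_const] by (intro mult_left_mono smooth_const_nonneg)
      moreover have "smooth_const * (K / (A / dn n)) = smooth_const * (K / A) * dn n" by simp
      moreover have "smooth_const * (K / A) * dn n \<le> e / 2 * dn n" using A d by (intro mult_right_mono) auto
      ultimately show ?thesis by (simp only: distrib_left)
    qed
    also have "\<dots> \<le> e / 2 * dn n + e / 2 * dn n" using Rn d by (intro add_mono mult_right_mono) auto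
    finally show "(1 + \<bar>x\<bar>) * \<bar>cdf (P n) x - cdfF (Phi (complex_of_real 1) L n) x\<bar> \<le> e * dn n" by simp
  qed
qed

end

theorem theorem2:
  fixes p \<alpha> :: real and l :: nat and M :: "'a measure" and X :: "nat \<Rightarrow> 'a \<Rightarrow> real"
  assumes p: "0 < p" "p < 1"
    and \<alpha>: "1 < \<alpha>" "\<alpha> < 2"
    and M: "prob_space M"
    and rv: "\<And>i. X i \<in> borel_measurable M"
    and indep: "prob_space.indep_vars M (\<lambda>_. borel) X UNIV"
    and distr: "\<And>i k. k \<ge> 1 \<Longrightarrow>
        measure M {\<omega> \<in> space M. X i \<omega> = rr p powr (real k / \<alpha>)} = qq p ^ (k - 1) * p"
  shows
    "(l \<ge> 2 \<and> 2 - 1 / (real l - 1) < \<alpha> \<and> \<alpha> \<le> 2 - 1 / real l \<longrightarrow>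
       (\<exists>C. \<forall>\<^sub>F n in at_top. \<forall>x::real.
          (1 + \<bar>x\<bar>) * \<bar>measure M {\<omega> \<in> space M.
              ((\<Sum>i<n. X i \<omega>) - mu \<alpha> p 1 * real n) / real n powr (1 / \<alpha>) \<le> x}
            - Gtilde \<alpha> p l n x\<bar> \<le> C * real n powr (- 1 / \<alpha>)))
   \<and>
    ((l = 2 \<and> \<alpha> < 3 / 2 \<or> l \<ge> 3 \<and> 2 - 1 / (real l - 1) \<le> \<alpha> \<and> \<alpha> < 2 - 1 / real l) \<and>
      rr p powr (1 / \<alpha>) \<notin> \<nat> \<longrightarrow>
       (\<forall>\<epsilon>>0. \<forall>\<^sub>F n in at_top. \<forall>x::real.
          (1 + \<bar>x\<bar>) * \<bar>measure M {\<omega> \<in> space M.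
              ((\<Sum>i<n. X i \<omega>) - mu \<alpha> p 1 * real n) / real n powr (1 / \<alpha>) \<le> x}
            - Gtt \<alpha> p l n x\<bar> \<le> \<epsilon> * real n powr (- 1 / \<alpha>)))"
proof -
  interpret stp p \<alpha> by unfold_locales (use p \<alpha> in auto)
  let ?P = "std_sum M X"
  note P = std_sum_law[OF M rv indep distr]
  have P1: "real_distribution (?P n)" "integrable (?P n) (\<lambda>x. x)" "char (?P n) t = gs (t * dn n) ^ n" for n t
    by (rule P; assumption)+
  have cdf: "measure M {\<omega> \<in> space M. ((\<Sum>i<n. X i \<omega>) - mu \<alpha> p 1 * real n) / real n powr (1 / \<alpha>) \<le> x} = cdf (?P n) x" for n x
    by (rule P(4)[symmetric]; assumption)
  \<comment> \<open>The number of correction terms is \<open>L = l - 1\<close>, so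
    \<open>Suc L\<close> is \<open>l\<close> and the conditions on \<open>L\<close> become
    conditions on \<open>l * (2 - \<alpha>)\<close>.\<close>
  have Ll: "real (Suc (l - 1)) * (2 - \<alpha>) = real l * (2 - \<alpha>)" "Suc (l - 1) = l" if "l \<ge> 2" using that by auto
  show ?thesis
  proof (intro conjI impI allI)
    assume a: "l \<ge> 2 \<and> 2 - 1 / (real l - 1) < \<alpha> \<and> \<alpha> \<le> 2 - 1 / real l"
    then have "1 / real l \<le> 2 - \<alpha>" by simp
    then have "1 \<le> real (Suc (l - 1)) * (2 - \<alpha>)" using a Ll(1) by (simp add: field_simps)
    from rate_O[OF this P1] obtain C
      where C: "\<forall>\<^sub>F n in sequentially. \<forall>x. (1 + \<bar>x\<bar>) * \<bar>cdf (?P n) x - cdfF (Phi (complex_of_real 0) (l - 1) n) x\<bar> \<le> C * dn n" by blast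
    then have "\<forall>\<^sub>F n in sequentially. \<forall>x. (1 + \<bar>x\<bar>) * \<bar>cdf (?P n) x - Gtilde \<alpha> p l n x\<bar> \<le> C * dn n"
      using eventually_ge_at_top[of 1] by eventually_elim (use Gtilde_eq(1)[of _ "l - 1"] Ll a in simp)
    then show "\<exists>C. \<forall>\<^sub>F n in at_top. \<forall>x::real.
          (1 + \<bar>x\<bar>) * \<bar>measure M {\<omega> \<in> space M. ((\<Sum>i<n. X i \<omega>) - mu \<alpha> p 1 * real n) / real n powr (1 / \<alpha>) \<le> x}
            - Gtilde \<alpha> p l n x\<bar> \<le> C * real n powr (- 1 / \<alpha>)"
      unfolding cdf dn_def by blast
  next
    fix \<epsilon> :: real
    assume a: "(l = 2 \<and> \<alpha> < 3 / 2 \<or> l \<ge> 3 \<and> 2 - 1 / (real l - 1) \<le> \<alpha> \<and> \<alpha> < 2 - 1 / real l) \<and> rr p powr (1 / \<alpha>) \<notin> \<nat>"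
      and e: "0 < \<epsilon>"
    have l2: "l \<ge> 2" using a by auto
    \<comment> \<open>For \<open>l = 2\<close> the limit \<open>3 / 2\<close> is
      \<open>2 - 1 / l\<close>, so both alternatives give the same strict inequality.\<close>
    have "1 / real l < 2 - \<alpha>" using a by auto
    then have "1 < real (Suc (l - 1)) * (2 - \<alpha>)" using l2 Ll(1) by (simp add: field_simps)
    moreover have "rho \<notin> \<nat>" using a by (simp add: rho_def r)
    ultimately have "\<forall>\<^sub>F n in sequentially. \<forall>x. (1 + \<bar>x\<bar>) * \<bar>cdf (?P n) x - cdfF (Phi (complex_of_real 1) (l - 1) n) x\<bar> \<le> \<epsilon> * dn n"
      by (rule rate_o[OF _ _ e P1])
    then have "\<forall>\<^sub>F n in sequentially. \<forall>x. (1 + \<bar>x\<bar>) * \<bar>cdf (?P n) x - Gtt \<alpha> p l n x\<bar> \<le> \<epsilon> * dn n"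
      using eventually_ge_at_top[of 1] by eventually_elim (use Gtilde_eq(2)[of _ "l - 1"] Ll l2 in simp)
    then show "\<forall>\<^sub>F n in at_top. \<forall>x::real.
          (1 + \<bar>x\<bar>) * \<bar>measure M {\<omega> \<in> space M. ((\<Sum>i<n. X i \<omega>) - mu \<alpha> p 1 * real n) / real n powr (1 / \<alpha>) \<le> x}
            - Gtt \<alpha> p l n x\<bar> \<le> \<epsilon> * real n powr (- 1 / \<alpha>)"
      unfolding cdf dn_def .
  qed
qed

end
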